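(* Let $k>1$ be an integer and let $d$ be a fundamental discriminant with $\operatorname{sign}(d)=(-1)^k$. Then, as an identity of $q$-series, \[ \frac{\zeta(1-2k)}{H(k,|d|)}\left(\frac{1}{2}H(k,|d|)+\sum_{(-1)^kD>0}\left(\int_0^1 F_{k,D,d}(x)\,dx\right) q^{|D|}\right)=\frac{1}{2}\mathcal{H}_k(\tau), \] where the sum runs over all discriminants $D$ with $(-1)^kD>0$.
   Context: A discriminant is an integer $D\equiv 0,1 \pmod 4$ (here always nonzero). A fundamental discriminant is $1$ or the discriminant of a quadratic field; every nonzero discriminant is uniquely $D=D_0f^2$ with $D_0$ a fundamental discriminant and $f\ge 1$. $\left(\frac{\cdot}{\cdot}\right)$ denotes the Kronecker symbol (in particular $\left(\frac{d}{-1}\right)=\operatorname{sign}(d)$). Quadratic functions: $[a,b,c]$ denotes $Q(x)=ax^2+bx+c$ with $a,b,c\in\mathbb{Z}$. For an integer $\Delta>0$, $\mathfrak{Q}_\Delta$ is the set of all such $Q$ with $b^2-4ac=\Delta$. Genus character: let $d$ be a fundamental discriminant and $D$ a discriminant with $Dd>0$. For $Q=[a,b,c]\in\mathfrak{Q}_{Dd}$ put $\chi_d(Q)=0$ if $\gcd(a,b,c,d)>1$, and $\chi_d(Q)=\left(\frac{d}{r}\right)$ if $\gcd(a,b,c,d)=1$, where $r$ is any integer coprime to $d$ represented by the binary form $aX^2+bXY+cY^2$ with $X,Y\in\mathbb{Z}$ (the value does not depend on the choice of $r$). The function $F_{k,D,d}$: for an integer $k>1$ and $\operatorname{sign}(d)=\operatorname{sign}(D)=(-1)^k$,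 define for $x\in\mathbb{R}$ \[ F_{k,D,d}(x)=\sum_{\substack{Q=[a,b,c]\in\mathfrak{Q}_{Dd}\\ a<0<Q(x)}}\chi_d(Q)\,Q(x)^{k-1}. \] It is $1$-periodic in $x$. Cohen's numbers: $H(k,0)=\zeta(1-2k)$; for $N>0$ such that $(-1)^kN$ is a discriminant, write $(-1)^kN=D_0f^2$ with $D_0$ a fundamental discriminant and $f\ge1$, and set \[ H(k,N)=L_{D_0}(1-k)\sum_{r\mid f}\mu(r)\left(\frac{D_0}{r}\right)r^{k-1}\sigma_{2k-1}(f/r), \] where $L_{D_0}(s)$ is the (analytically continued) Dirichlet $L$-function of the character $\left(\frac{D_0}{\cdot}\right)$ (so $L_1=\zeta$), $\mu$ is the Möbius function, and $\sigma_m(n)=\sum_{t\mid n}t^m$. Cohen's Eisenstein series of weight $k+1/2$ on $\Gamma_0(4)$ is \[ \mathcal{H}_k(\tau)=\zeta(1-2k)+\sum_{(-1)^kD>0}H(k,|D|)\,q^{|D|},\qquad q=\exp(2\pi i\tau),\ \Im(\tau)>0, \] the sum being over discriminants $D$ with $(-1)^kD>0$. *)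

theory Defs
  imports
    "HOL-Complex_Analysis.Complex_Analysis"
    "HOL-Number_Theory.Number_Theory"
    "HOL-Computational_Algebra.Squarefree"
begin

section \<open>Discriminants\<close>

definition is_discriminant :: "int \<Rightarrow> bool" where
  "is_discriminant D \<longleftrightarrow> D \<noteq> 0 \<and> (D mod 4 = 0 \<or> D mod 4 = 1)"

text \<open>
  Every quadratic field is the subfield of the complex numbers generated by a square root of some
  non-square integer \<open>m\<close>; its elements are \<open>quad_elem m x y\<close> with rational \<open>x\<close> and \<open>y\<close>, and its
  nontrivial automorphism sends \<open>quad_elem m x y\<close> to \<open>quad_elem m x (- y)\<close>.
\<close>

definition quad_elem :: "int \<Rightarrow> rat \<Rightarrow> rat \<Rightarrow> complex" where
  "quad_elem m x y = of_rat x + of_rat y * csqrt (of_int m)"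

definition quad_ring_of_integers :: "int \<Rightarrow> complex set" where
  "quad_ring_of_integers m = {z. algebraic_int z \<and> (\<exists>x y. z = quad_elem m x y)}"

text \<open>
  The discriminant is the square of the determinant formed by the conjugates of an integral basis.
  The ring of integers has rank 2, so any two elements that span it over the integers form a basis.
\<close>

definition is_quadratic_field_discriminant :: "int \<Rightarrow> bool" where
  "is_quadratic_field_discriminant D \<longleftrightarrow>
     (\<exists>m x\<^sub>1 y\<^sub>1 x\<^sub>2 y\<^sub>2. (\<nexists>n. m = n\<^sup>2) \<and>
        quad_ring_of_integers m =
          {of_int u * quad_elem m x\<^sub>1 y\<^sub>1 + of_int v * quad_elem m x\<^sub>2 y\<^sub>2 | u v. True} \<and>
        of_int D = (quad_elem m x\<^sub>1 y\<^sub>1 * quad_elem m x\<^sub>2 (- y\<^sub>2)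
                    - quad_elem m x\<^sub>2 y\<^sub>2 * quad_elem m x\<^sub>1 (- y\<^sub>1))\<^sup>2)"

definition fundamental_discriminant :: "int \<Rightarrow> bool" where
  "fundamental_discriminant D \<longleftrightarrow> D = 1 \<or> is_quadratic_field_discriminant D"

definition disc_decomp :: "int \<Rightarrow> int \<times> nat" where
  "disc_decomp D =
     (THE (D\<^sub>0, f). fundamental_discriminant D\<^sub>0 \<and> 1 \<le> f \<and> D = D\<^sub>0 * (int f)\<^sup>2)"


section \<open>Kronecker symbol\<close>

definition kronecker_prime :: "int \<Rightarrow> int \<Rightarrow> int" where
  "kronecker_prime a p =
     (if p = 2 then if even a then 0 else if a mod 8 = 1 \<or> a mod 8 = 7 then 1 else - 1
      else Legendre a p)"

text \<open>
  The first factor for nonzero \<open>n\<close> is the value at the unit \<open>sgn n\<close>. The prime factors of an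
  integer are taken to be positive.
\<close>

definition kronecker :: "int \<Rightarrow> int \<Rightarrow> int" where
  "kronecker a n =
     (if n = 0 then if \<bar>a\<bar> = 1 then 1 else 0
      else (if n < 0 \<and> a < 0 then - 1 else 1) *
           (\<Prod>p\<in>prime_factors n. kronecker_prime a p ^ multiplicity p n))"


section \<open>Quadratic functions and the genus character\<close>

type_synonym quad = "int \<times> int \<times> int"

fun quad_eval :: "quad \<Rightarrow> real \<Rightarrow> real" where
  "quad_eval (a, b, c) x = of_int a * x\<^sup>2 + of_int b * x + of_int c"

definition quads :: "int \<Rightarrow> quad set" where
  "quads \<Delta> = {(a, b, c). b\<^sup>2 - 4 * a * c = \<Delta>}"

fun genus_character :: "int \<Rightarrow> quad \<Rightarrow> int" where
  "genus_character d (a, b, c) =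
     (if gcd (gcd a b) (gcd c d) > 1 then 0
      else kronecker d
             (SOME r. coprime r d \<and> (\<exists>X Y. r = a * X\<^sup>2 + b * X * Y + c * Y\<^sup>2)))"

definition F :: "nat \<Rightarrow> int \<Rightarrow> int \<Rightarrow> real \<Rightarrow> real" where
  "F k D d x =
     (\<Sum>\<^sub>\<infinity>Q\<in>{Q \<in> quads (D * d). fst Q < 0 \<and> 0 < quad_eval Q x}.
        of_int (genus_character d Q) * quad_eval Q x ^ (k - 1))"


section \<open>Zeta and L-functions\<close>

text \<open>
  The value at \<open>s\<close> of the analytic continuation to the complex plane minus 1 of the Dirichlet
  series with coefficients \<open>a 1, a 2, \<dots>\<close>, which is assumed to converge for real part greater
  than 1. By the identity theorem the value is unique for \<open>s \<noteq> 1\<close>.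
\<close>

definition dirichlet_continuation :: "(nat \<Rightarrow> complex) \<Rightarrow> complex \<Rightarrow> complex" where
  "dirichlet_continuation a s =
     (THE z. \<exists>f. f holomorphic_on (- {1}) \<and>
        (\<forall>w. Re w > 1 \<longrightarrow> (\<lambda>n. a (Suc n) / of_nat (Suc n) powr w) sums f w) \<and>
        z = f s)"

definition zeta :: "complex \<Rightarrow> complex" where
  "zeta = dirichlet_continuation (\<lambda>_. 1)"

definition dirichlet_L :: "int \<Rightarrow> complex \<Rightarrow> complex" where
  "dirichlet_L D = dirichlet_continuation (\<lambda>n. of_int (kronecker D (int n)))"


section \<open>Cohen's numbers and Eisenstein series\<close>

definition moebius_mu :: "nat \<Rightarrow> int" where
  "moebius_mu n = (if squarefree n then (- 1) ^ card (prime_factors n) else 0)"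

definition divisor_sigma :: "nat \<Rightarrow> nat \<Rightarrow> nat" where
  "divisor_sigma m n = (\<Sum>t | t dvd n. t ^ m)"

text \<open>Only meaningful if \<open>N = 0\<close> or \<open>(- 1) ^ k * int N\<close> is a discriminant.\<close>

definition cohen_H :: "nat \<Rightarrow> nat \<Rightarrow> complex" where
  "cohen_H k N =
     (if N = 0 then zeta (1 - 2 * of_nat k)
      else let (D\<^sub>0, f) = disc_decomp ((- 1) ^ k * int N) in
        dirichlet_L D\<^sub>0 (1 - of_nat k) *
        (\<Sum>r | r dvd f.
           of_int (moebius_mu r * kronecker D\<^sub>0 (int r)) * of_nat (r ^ (k - 1)) *
           of_nat (divisor_sigma (2 * k - 1) (f div r))))"

definition discs_of_sign :: "nat \<Rightarrow> int set" where
  "discs_of_sign k = {D. is_discriminant D \<and> (- 1) ^ k * D > 0}"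

definition nome :: "complex \<Rightarrow> complex" where
  "nome \<tau> = exp (2 * of_real pi * \<i> * \<tau>)"

definition cohen_eisenstein :: "nat \<Rightarrow> complex \<Rightarrow> complex" where
  "cohen_eisenstein k \<tau> =
     zeta (1 - 2 * of_nat k) +
     (\<Sum>\<^sub>\<infinity>D\<in>discs_of_sign k. cohen_H k (nat \<bar>D\<bar>) * nome \<tau> ^ nat \<bar>D\<bar>)"

end

theory Submission
  imports Defs "HOL-Real_Asymp.Real_Asymp"
begin

text \<open>
  Write \<open>\<Delta> = D d\<close>. The functions with \<open>a < 0\<close> fall into classes under integer translation, so the
  integral of \<open>F\<close> over the unit interval unfolds into Beta integrals over the real line and equals
  \<open>(-1)^k \<Delta>^(k-1/2) B(k,k) (\<Sum>a\<ge>1. N a / a^k)\<close>, where \<open>N a\<close> counts the solutions \<open>x\<close> modulo \<open>a\<close> of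
  \<open>x\<^sup>2 + \<delta> x - (\<Delta> - \<delta>)/4 = 0\<close> with \<open>\<delta> = \<Delta> mod 2\<close>, weighted by the genus character. By quadratic
  reciprocity the Kronecker symbol of \<open>d\<close> and the genus character split into factors belonging to
  the prime discriminants that divide \<open>d\<close>. Hence \<open>N\<close> is multiplicative, and its
  generating function at a prime \<open>p\<close> obeys a recursion under \<open>D \<mapsto> D/p\<^sup>2\<close>. The Euler product then
  gives \<open>\<Sum> N a / a^k = L_d(k) L_D0(k) T(f) / \<zeta>(2k)\<close> for \<open>D = D0 f\<^sup>2\<close>, with \<open>T(f)\<close> the rescaled finite sum in
  Cohen's number. The functional equations of these \<open>L\<close>-functions, whose root numbers are Gauss
  sums, turn this into \<open>H(k,|d|) H(k,|D|) = 2 \<zeta>(1-2k) \<integral> F\<close>, which is the identity coefficient by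
  coefficient.
\<close>

text \<open>A fundamental discriminant is carried along as a finite set \<open>S\<close> of prime
  discriminants with product \<open>d\<close>. The definition of \<open>kronecker\<close> factors
  the second argument and shows neither periodicity nor parity; \<open>psi\<close> shows both, and
  the genus character of \<open>[a,b,c]\<close> becomes a product over \<open>S\<close> whose
  factors look only at whichever of \<open>a\<close>, \<open>c\<close> is prime to them. The
  L-values are definite descriptions over functions holomorphic on the punctured plane, so a
  continuation has to be exhibited. It is assembled from Lerch series at roots of unity: their
  values at \<open>1 - k\<close> are elementary, and differentiating the reflection formula of Gamma
  turns these into Hurwitz sums. The sign of the Gauss sums cannot be left open: the root numbers of
  \<open>d\<close> and \<open>D0\<close> belong to different characters, and their product has to
  produce the sign \<open>(-1)^k\<close> that the condition \<open>a < 0\<close> puts on the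
  integral. In the recursion under \<open>D \<mapsto> p^2 D\<close> the exponent moves by two and
  root counts are multiplied by \<open>p\<close>; only the smallest exponents deviate, which is
  where the finite factor of Cohen's number comes from.\<close>

no_notation Infinite_Set_Sum.abs_summable_on (infix \<open>abs'_summable'_on\<close> 50)

section \<open>Prime discriminants and the Kronecker symbol\<close>

text \<open>The congruence \<open>q mod 4 = 1\<close> fixes the sign of an odd \<open>q\<close> in
  terms of its prime. Every fundamental discriminant is a product of such \<open>q\<close> with
  distinct underlying primes (\<open>min_disc_disc_set\<close>).\<close>

definition prime_disc :: "int \<Rightarrow> bool" where
  "prime_disc q \<longleftrightarrow> q = -4 \<or> q = 8 \<or> q = -8 \<or> (prime \<bar>q\<bar> \<and> q mod 4 = 1)"

definition base_prime :: "int \<Rightarrow> int" where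
  "base_prime q = (if even q then 2 else \<bar>q\<bar>)"

text \<open>The Kronecker symbol of \<open>q\<close> at \<open>n\<close> with reciprocity already
  applied (\<open>kronecker_prime_disc\<close>), so that periodicity in \<open>n\<close> can be read
  off a residue table or a Legendre symbol.\<close>

definition psi :: "int \<Rightarrow> int \<Rightarrow> int" where
  "psi q n =
     (if even q then
        if even n then 0
        else if q = -4 then (if n mod 4 = 1 then 1 else -1)
        else if q = 8 then (if n mod 8 = 1 \<or> n mod 8 = 7 then 1 else -1)
        else (if n mod 8 = 1 \<or> n mod 8 = 3 then 1 else -1)
      else Legendre n \<bar>q\<bar>)"

section \<open>Legendre symbols: Euler's criterion and the supplementary laws\<close>

lemma Legendre_values: "Legendre a p = 1 \<or> Legendre a p = 0 \<or> Legendre a p = -1"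
  by (simp add: Legendre_def)

lemma Legendre_eq_0_iff: "Legendre a p = 0 \<longleftrightarrow> p dvd a"
  by (auto simp: Legendre_def cong_0_iff)

lemma Legendre_cong: "[a = b] (mod p) \<Longrightarrow> Legendre a p = Legendre b p"
  unfolding Legendre_def QuadRes_def by (simp add: cong_def)

lemma Legendre_square: "\<not> p dvd x \<Longrightarrow> prime p \<Longrightarrow> Legendre (x\<^sup>2) p = 1"
  by (auto simp: Legendre_def QuadRes_def cong_0_iff prime_dvd_power_iff intro: exI[of _ x])

lemma small_cong_eq:
  fixes x y p :: int
  assumes "[x = y] (mod p)" "p > 2" "x = 1 \<or> x = 0 \<or> x = -1" "y = 1 \<or> y = 0 \<or> y = -1"
  shows "x = y"
proof -
  have d: "p dvd x - y" using assms(1) by (simp add: cong_iff_dvd_diff)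
  have "\<bar>x - y\<bar> < p" using assms by auto
  with d have "x - y = 0" using dvd_imp_le_int[of "x - y" p] by force
  thus ?thesis by simp
qed

lemma euler_criterion_int:
  fixes p :: int
  assumes "prime p" "p > 2"
  shows "[Legendre a p = a ^ (nat ((p - 1) div 2))] (mod p)"
proof -
  have "prime (nat p)" "2 < nat p" using assms by (auto simp: prime_nat_iff_prime)
  from euler_criterion[OF this, of a]
  have "[Legendre a (int (nat p)) = a ^ ((nat p - 1) div 2)] (mod int (nat p))" by simp
  moreover have "(nat p - 1) div 2 = nat ((p - 1) div 2)" using assms by (simp add: nat_div_distrib nat_diff_distrib')
  ultimately show ?thesis using assms by simp
qed

lemma Legendre_mult:
  fixes p :: int
  assumes "prime p" "p > 2"
  shows "Legendre (a * b) p = Legendre a p * Legendre b p"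
proof (rule small_cong_eq[OF _ \<open>p > 2\<close>])
  have "[Legendre (a * b) p = (a * b) ^ (nat ((p - 1) div 2))] (mod p)"
    by (rule euler_criterion_int[OF assms])
  moreover have "[Legendre a p * Legendre b p = a ^ (nat ((p - 1) div 2)) * b ^ (nat ((p - 1) div 2))] (mod p)"
    by (intro cong_mult euler_criterion_int[OF assms])
  ultimately show "[Legendre (a * b) p = Legendre a p * Legendre b p] (mod p)"
    by (metis cong_sym cong_trans power_mult_distrib)
qed (use Legendre_values[of a p] Legendre_values[of b p] Legendre_values[of "a*b" p] in auto)

lemma odd_prime_gt_2: "prime (p::int) \<Longrightarrow> odd p \<Longrightarrow> p > 2"
  using prime_ge_2_int[of p] by (cases "p = 2") auto

lemma Legendre_minus_one:
  fixes p :: int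
  assumes "prime p" "p > 2"
  shows "Legendre (-1) p = (if p mod 4 = 1 then 1 else -1)"
proof (rule small_cong_eq[OF _ \<open>p > 2\<close>])
  have "odd p" using assms prime_odd_int by auto
  hence m: "p mod 4 = 1 \<or> p mod 4 = 3" by presburger
  have "(-1::int) ^ (nat ((p - 1) div 2)) = (if p mod 4 = 1 then 1 else -1)"
  proof (cases "p mod 4 = 1")
    case True
    hence "even ((p - 1) div 2)" by presburger
    hence "even (nat ((p - 1) div 2))" using assms by (simp add: even_nat_iff)
    thus ?thesis using True by simp
  next
    case False
    hence "odd ((p - 1) div 2)" using m by presburger
    hence "odd (nat ((p - 1) div 2))" using assms by (simp add: even_nat_iff)
    thus ?thesis using False by simp
  qed
  with euler_criterion_int[OF assms, of "-1"]
  show "[Legendre (-1) p = (if p mod 4 = 1 then 1 else -1)] (mod p)" by simp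
qed (auto simp: Legendre_values)

lemma Legendre_two:
  fixes p :: int
  assumes "prime p" "p > 2"
  shows "Legendre 2 p = (if p mod 8 = 1 \<or> p mod 8 = 7 then 1 else -1)"
proof -
  have odd: "odd p" using assms prime_odd_int by auto
  interpret GAUSS "nat p" 2
  proof
    show "prime (nat p)" "2 < nat p" using assms by (auto simp: prime_nat_iff_prime)
    show "[2 \<noteq> 0] (mod int (nat p))" using assms by (auto simp: cong_0_iff dest: zdvd_imp_le)
  qed auto
  have pp: "int (nat p) = p" using assms by simp
  define h where "h = (p - 1) div 2"
  have h: "p = 2 * h + 1" using odd by (auto simp: h_def elim: oddE)
  \<comment> \<open>\<open>E\<close> collects the least residues of \<open>2 x\<close>,
    \<open>0 < x \<le> h\<close>, that exceed \<open>h\<close>. Since \<open>2 x < p\<close> no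
    reduction takes place, so the condition is \<open>x > h div 2\<close>.\<close>
  have "E = (\<lambda>x. 2 * x) ` {h div 2 <.. h}"
  proof -
    have C: "C = (\<lambda>x. 2 * x) ` {0 <.. h}"
      unfolding C_def B_def A_def pp image_image h_def[symmetric]
      by (intro image_cong) (auto simp: h mult.commute)
    show ?thesis unfolding E_def C pp h_def[symmetric] using h assms by auto
  qed
  hence "card E = card {h div 2 <.. h}" by (simp add: card_image inj_on_def)
  also have "\<dots> = nat (h - h div 2)" by simp
  finally have c: "card E = nat (h - h div 2)" .
  have ev: "even (h - h div 2) \<longleftrightarrow> (p mod 8 = 1 \<or> p mod 8 = 7)"
    unfolding h by presburger
  have "h - h div 2 \<ge> 0" using assms h by linarith
  hence "even (nat (h - h div 2)) \<longleftrightarrow> (p mod 8 = 1 \<or> p mod 8 = 7)" using ev by (simp add: even_nat_iff)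
  thus ?thesis using gauss_lemma c pp by auto
qed

lemma prime_disc_even_cases: "prime_disc q \<Longrightarrow> even q \<Longrightarrow> q = -4 \<or> q = 8 \<or> q = -8"
proof -
  assume q: "prime_disc q" "even q"
  have "q mod 4 = 1 \<Longrightarrow> odd q" by presburger
  thus ?thesis using q by (auto simp: prime_disc_def)
qed

lemma prime_disc_odd:
  assumes "prime_disc q" "odd q"
  shows "prime \<bar>q\<bar>" "q mod 4 = 1" "\<bar>q\<bar> > 2"
  using assms odd_prime_gt_2[of "\<bar>q\<bar>"] by (auto simp: prime_disc_def)

lemma prime_disc_nz: "prime_disc q \<Longrightarrow> q \<noteq> 0"
  by (auto simp: prime_disc_def)

lemma prime_disc_abs_gt: "prime_disc q \<Longrightarrow> \<bar>q\<bar> > 2"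
  by (cases "even q") (auto dest: prime_disc_even_cases prime_disc_odd)

lemma prime_base_prime: "prime_disc q \<Longrightarrow> prime (base_prime q)"
  by (auto simp: base_prime_def dest: prime_disc_odd)

text \<open>Modulus 8 is used for \<open>q = -4\<close> as well, so that the three even prime
  discriminants share one residue table.\<close>

lemma psi_mod8: "prime_disc q \<Longrightarrow> even q \<Longrightarrow> psi q n = psi q (n mod 8)"
proof -
  assume "prime_disc q" "even q"
  have "even n \<longleftrightarrow> even (n mod 8)" "n mod 4 = (n mod 8) mod 4"
    by (simp_all add: dvd_mod_iff mod_mod_cancel)
  thus ?thesis using \<open>even q\<close> by (simp add: psi_def)
qed

lemma psi_eq_0_iff: "psi q n = 0 \<longleftrightarrow> base_prime q dvd n"
  by (simp add: psi_def base_prime_def Legendre_eq_0_iff)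

lemma psi_mult:
  assumes "prime_disc q"
  shows "psi q (m * n) = psi q m * psi q n"
proof (cases "even q")
  case True
  show ?thesis
  proof (cases "even m \<or> even n")
    case ev: True
    hence "psi q (m * n) = 0" "psi q m = 0 \<or> psi q n = 0"
      using True by (auto simp: psi_eq_0_iff base_prime_def)
    thus ?thesis by auto
  next
    case False
    hence "odd m" "odd n" by auto
    hence m: "m mod 8 = 1 \<or> m mod 8 = 3 \<or> m mod 8 = 5 \<or> m mod 8 = 7"
      and n: "n mod 8 = 1 \<or> n mod 8 = 3 \<or> n mod 8 = 5 \<or> n mod 8 = 7" by presburger+
    have p: "psi q (m * n) = psi q ((m mod 8) * (n mod 8))"
      unfolding psi_mod8[OF assms True, of "m * n"] psi_mod8[OF assms True, of "(m mod 8) * (n mod 8)"]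
      by (simp add: mod_mult_eq)
    show ?thesis
      unfolding p psi_mod8[OF assms True, of m] psi_mod8[OF assms True, of n]
      using m n prime_disc_even_cases[OF assms True]
      by (elim disjE) (simp_all only: psi_def, simp_all)
  qed
next
  case False
  with prime_disc_odd[OF assms] show ?thesis by (simp add: psi_def Legendre_mult)
qed

lemma psi_cong:
  assumes "prime_disc q" "[m = n] (mod q)"
  shows "psi q m = psi q n"
proof (cases "even q")
  case True
  from prime_disc_even_cases[OF assms(1) True] consider "q = -4" | "q = 8" | "q = -8" by blast
  thus ?thesis
  proof cases
    case 1
    hence "[m = n] (mod 4)" using assms(2) by (simp add: cong_iff_dvd_diff)
    hence "m mod 4 = n mod 4" by (simp add: cong_def)
    moreover from this have "even m \<longleftrightarrow> even n" by presburger
    ultimately show ?thesis using 1 by (simp add: psi_def)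
  next
    case 2
    hence "m mod 8 = n mod 8" using assms(2) by (simp add: cong_def)
    thus ?thesis using psi_mod8[OF assms(1) True] by metis
  next
    case 3
    hence "[m = n] (mod 8)" using assms(2) by (simp add: cong_iff_dvd_diff)
    hence "m mod 8 = n mod 8" by (simp add: cong_def)
    thus ?thesis using psi_mod8[OF assms(1) True] by metis
  qed
next
  case False
  have "[m = n] (mod \<bar>q\<bar>)" using assms(2) by (simp add: cong_iff_dvd_diff)
  thus ?thesis using False by (simp add: psi_def Legendre_cong)
qed

lemma psi_values: "psi q n = 1 \<or> psi q n = 0 \<or> psi q n = -1"
  using Legendre_values by (auto simp: psi_def)

lemma psi_abs_le: "\<bar>psi q n\<bar> \<le> 1"
  using psi_values[of q n] by auto

lemma psi_square: "\<not> base_prime q dvd n \<Longrightarrow> psi q n * psi q n = 1"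
  using psi_values[of q n] psi_eq_0_iff[of q n] by auto

lemma psi_one: "prime_disc q \<Longrightarrow> psi q 1 = 1"
  using Legendre_square[of "\<bar>q\<bar>" 1] prime_disc_odd[of q] by (auto simp: psi_def prime_int_iff)

lemma psi_minus_one: "prime_disc q \<Longrightarrow> psi q (-1) = sgn q"
proof -
  assume q: "prime_disc q"
  show ?thesis
  proof (cases "even q")
    case True
    from prime_disc_even_cases[OF q True] show ?thesis by (auto simp: psi_def)
  next
    case False
    note o = prime_disc_odd[OF q False]
    have "Legendre (-1) \<bar>q\<bar> = (if \<bar>q\<bar> mod 4 = 1 then 1 else -1)"
      using o by (intro Legendre_minus_one) auto
    also have "\<dots> = sgn q"
    proof (cases "q > 0")
      case True thus ?thesis using o by simp
    next
      case False
      hence "q < 0" using prime_disc_nz[OF q] by simp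
      moreover from this have "\<bar>q\<bar> mod 4 \<noteq> 1" using o(2) by simp presburger
      ultimately show ?thesis by simp
    qed
    finally show ?thesis using False by (simp add: psi_def)
  qed
qed

lemma psi_power: "prime_disc q \<Longrightarrow> psi q (n ^ k) = psi q n ^ k"
  by (induction k) (auto simp: psi_one psi_mult)

lemma psi_prod: "prime_disc q \<Longrightarrow> psi q (\<Prod>x\<in>A. f x) = (\<Prod>x\<in>A. psi q (f x))"
  by (induction A rule: infinite_finite_induct) (auto simp: psi_one psi_mult)

section \<open>Kronecker symbols of products of prime discriminants\<close>

lemma kronecker_prime_mult:
  assumes "prime p"
  shows "kronecker_prime (a * b) p = kronecker_prime a p * kronecker_prime b p"
proof (cases "p = 2")
  case True
  \<comment> \<open>At 2 the symbol of \<open>x\<close> agrees with the character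
    \<open>psi 8\<close>, so multiplicativity there is an instance of
    \<open>psi_mult\<close>.\<close>
  have e: "(kronecker_prime x 2) = psi 8 x" for x by (auto simp: kronecker_prime_def psi_def)
  show ?thesis unfolding True e by (rule psi_mult) (simp add: prime_disc_def)
next
  case False
  hence "p > 2" using assms prime_ge_2_int[of p] by simp
  thus ?thesis using False assms by (simp add: kronecker_prime_def Legendre_mult)
qed

lemma kronecker_prime_eq_0_iff: "kronecker_prime a p = 0 \<longleftrightarrow> p dvd a"
  by (auto simp: kronecker_prime_def Legendre_eq_0_iff)

lemma kronecker_prime_values:
  "kronecker_prime a p = 1 \<or> kronecker_prime a p = 0 \<or> kronecker_prime a p = -1"
  by (auto simp: kronecker_prime_def Legendre_def)

lemma kronecker_prime_square:
  assumes "prime p" "\<not> p dvd f" shows "kronecker_prime (a * f\<^sup>2) p = kronecker_prime a p"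
  using kronecker_prime_mult[OF assms(1)] kronecker_prime_values[of f p] kronecker_prime_eq_0_iff[of f p] assms(2)
  by (auto simp: power2_eq_square)

lemma Legendre_reciprocity:
  fixes p l :: int
  assumes "prime p" "p > 2" "prime l" "l > 2" "p \<noteq> l"
  shows "Legendre p l = (if p mod 4 = 3 \<and> l mod 4 = 3 then - Legendre l p else Legendre l p)"
proof -
  have o: "odd p" "odd l" using assms prime_odd_int by auto
  have rec: "Legendre p l * Legendre l p = (-1) ^ nat ((p - 1) div 2 * ((l - 1) div 2))"
    using assms by (intro Quadratic_Reciprocity_int) (auto simp: prime_nat_iff_prime)
  have nn: "(p - 1) div 2 * ((l - 1) div 2) \<ge> 0" using assms by (intro mult_nonneg_nonneg) auto
  have od: "odd ((p - 1) div 2 * ((l - 1) div 2)) \<longleftrightarrow> p mod 4 = 3 \<and> l mod 4 = 3"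
  proof -
    have "odd ((p - 1) div 2) \<longleftrightarrow> p mod 4 = 3" "odd ((l - 1) div 2) \<longleftrightarrow> l mod 4 = 3"
      using o by presburger+
    thus ?thesis by simp
  qed
  have e: "(-1::int) ^ nat ((p - 1) div 2 * ((l - 1) div 2)) = (if p mod 4 = 3 \<and> l mod 4 = 3 then -1 else 1)"
    using od nn by (auto simp: even_nat_iff)
  have nz: "Legendre l p \<noteq> 0" using assms primes_dvd_imp_eq[of p l] by (auto simp: Legendre_eq_0_iff)
  show ?thesis using rec e nz Legendre_values[of l p] by auto
qed

text \<open>Quadratic reciprocity together with both supplementary laws. The normalisation
  \<open>q mod 4 = 1\<close> absorbs the usual sign: for \<open>q < 0\<close> the factor
  \<open>Legendre (-1) p\<close> compensates the sign in
  \<open>Legendre_reciprocity\<close>.\<close>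

lemma kronecker_prime_prime_disc:
  assumes q: "prime_disc q" and p: "prime p"
  shows "kronecker_prime q p = psi q p"
proof (cases "p dvd q")
  case True
  have "base_prime q dvd p"
  proof (cases "even q")
    case ev: True
    from prime_disc_even_cases[OF q this] have "\<bar>q\<bar> = 2 ^ 2 \<or> \<bar>q\<bar> = 2 ^ 3" by auto
    hence "p dvd 2 ^ 2 \<or> p dvd 2 ^ 3" using True by (metis dvd_abs_iff)
    hence "p dvd 2" using p prime_dvd_power by blast
    hence "p = 2" using p by (simp add: primes_dvd_imp_eq)
    thus ?thesis using ev by (simp add: base_prime_def)
  next
    case False
    have "p dvd \<bar>q\<bar>" using True by simp
    hence "p = \<bar>q\<bar>" using primes_dvd_imp_eq[OF p prime_disc_odd(1)[OF q False]] by simp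
    thus ?thesis using False by (simp add: base_prime_def)
  qed
  hence "psi q p = 0" by (simp add: psi_eq_0_iff)
  moreover have "kronecker_prime q p = 0" using True by (simp add: kronecker_prime_eq_0_iff)
  ultimately show ?thesis by simp
next
  case ndvd: False
  show ?thesis
  proof (cases "even q")
    case True
    hence "p \<noteq> 2" using ndvd by auto
    hence p2: "p > 2" using prime_ge_2_int[OF p] by simp
    have odd: "odd p" using p p2 prime_odd_int by auto
    have L: "kronecker_prime q p = Legendre q p" using \<open>p \<noteq> 2\<close> by (simp add: kronecker_prime_def)
    have p22: "\<not> p dvd 2" using p2 zdvd_imp_le[of p 2] by auto
    have l4: "Legendre 4 p = 1" using Legendre_square[OF p22 p] by simp
    have l8: "Legendre 8 p = Legendre 2 p" using Legendre_mult[OF p p2, of 4 2] l4 by simp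
    have m4: "Legendre (-4) p = Legendre (-1) p" using Legendre_mult[OF p p2, of 4 "-1"] l4 by simp
    have m8: "Legendre (-8) p = Legendre (-1) p * Legendre 2 p" using Legendre_mult[OF p p2, of 8 "-1"] l8 by simp
    note vals = Legendre_minus_one[OF p p2] Legendre_two[OF p p2]
    have pm: "p mod 8 = 1 \<or> p mod 8 = 3 \<or> p mod 8 = 5 \<or> p mod 8 = 7" using odd by presburger
    have p4: "p mod 4 = (p mod 8) mod 4" by (simp add: mod_mod_cancel)
    from prime_disc_even_cases[OF q True] show ?thesis
    proof (elim disjE)
      assume "q = -4" thus ?thesis using L m4 vals odd by (simp add: psi_def)
    next
      assume "q = 8" thus ?thesis using L l8 vals odd by (simp add: psi_def)
    next
      assume q8: "q = -8"
      show ?thesis using pm unfolding L unfolding q8 m8 vals p4 psi_def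
        by (elim disjE) (simp_all add: odd)
    qed
  next
    case False
    note o = prime_disc_odd[OF q False]
    show ?thesis
    proof (cases "p = 2")
      case True
      have "Legendre 2 \<bar>q\<bar> = (if \<bar>q\<bar> mod 8 = 1 \<or> \<bar>q\<bar> mod 8 = 7 then 1 else -1)"
        using o by (intro Legendre_two) auto
      moreover have "(\<bar>q\<bar> mod 8 = 1 \<or> \<bar>q\<bar> mod 8 = 7) \<longleftrightarrow> (q mod 8 = 1 \<or> q mod 8 = 7)"
      proof (cases "q < 0")
        case True
        have "((-q) mod 8 = 1 \<or> (-q) mod 8 = 7) \<longleftrightarrow> (q mod 8 = 1 \<or> q mod 8 = 7)" by presburger
        thus ?thesis using True by simp
      qed simp
      ultimately show ?thesis using True False by (simp add: psi_def kronecker_prime_def)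
    next
      case False2: False
      hence p2: "p > 2" using prime_ge_2_int[OF p] by simp
      have odd: "odd p" using p p2 prime_odd_int by auto
      have ne: "\<bar>q\<bar> \<noteq> p" using ndvd by auto
      have rec: "Legendre \<bar>q\<bar> p = (if \<bar>q\<bar> mod 4 = 3 \<and> p mod 4 = 3 then - Legendre p \<bar>q\<bar> else Legendre p \<bar>q\<bar>)"
        using o p p2 ne by (intro Legendre_reciprocity) auto
      have pm: "p mod 4 = 1 \<or> p mod 4 = 3" using odd by presburger
      have "Legendre q p = Legendre p \<bar>q\<bar>"
      proof (cases "q > 0")
        case True thus ?thesis using rec o(2) by simp
      next
        case False
        hence qq: "q = (-1) * \<bar>q\<bar>" by simp
        have qm: "\<bar>q\<bar> mod 4 = 3" using o(2) False by simp presburger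
        have "Legendre q p = Legendre (-1) p * Legendre \<bar>q\<bar> p"
          by (subst qq) (rule Legendre_mult[OF p p2])
        thus ?thesis using rec qm pm Legendre_minus_one[OF p p2] by auto
      qed
      thus ?thesis using False False2 by (simp add: psi_def kronecker_prime_def)
    qed
  qed
qed

text \<open>Both sides are multiplicative in \<open>n\<close>, so primes suffice. The factor that
  \<open>kronecker\<close> attaches to negative \<open>n\<close> is
  \<open>psi q (-1) = sgn q\<close>, and at \<open>n = 0\<close> both sides vanish because
  \<open>|q| > 2\<close>.\<close>

lemma kronecker_prime_disc:
  assumes q: "prime_disc q"
  shows "kronecker q n = psi q n"
proof (cases "n = 0")
  case True
  have "psi q 0 = 0" by (simp add: psi_eq_0_iff)
  thus ?thesis using True prime_disc_abs_gt[OF q] by (simp add: kronecker_def)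
next
  case False
  have "(\<Prod>p\<in>prime_factors n. kronecker_prime q p ^ multiplicity p n) =
        (\<Prod>p\<in>prime_factors n. psi q (p ^ multiplicity p n))"
    by (intro prod.cong refl) (simp add: kronecker_prime_prime_disc[OF q] psi_power[OF q] in_prime_factors_imp_prime)
  also have "\<dots> = psi q (\<Prod>p\<in>prime_factors n. p ^ multiplicity p n)" by (simp add: psi_prod[OF q])
  also have "(\<Prod>p\<in>prime_factors n. p ^ multiplicity p n) = \<bar>n\<bar>"
    using prod_prime_factors[OF False] by simp
  finally have e: "(\<Prod>p\<in>prime_factors n. kronecker_prime q p ^ multiplicity p n) = psi q \<bar>n\<bar>" .
  have "kronecker q n = (if n < 0 \<and> q < 0 then - 1 else 1) * psi q \<bar>n\<bar>"
    using False e by (simp add: kronecker_def)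
  also have "\<dots> = psi q n"
  proof (cases "n < 0")
    case True
    hence "psi q n = psi q (-1) * psi q \<bar>n\<bar>" using psi_mult[OF q, of "-1" "\<bar>n\<bar>"] by simp
    thus ?thesis using True psi_minus_one[OF q] prime_disc_nz[OF q] by (auto simp: sgn_if)
  qed simp
  finally show ?thesis .
qed

lemma kronecker_mult_left:
  assumes "a \<noteq> 0" "b \<noteq> 0" "n \<noteq> 0"
  shows "kronecker (a * b) n = kronecker a n * kronecker b n"
proof -
  have "(\<Prod>p\<in>prime_factors n. kronecker_prime (a * b) p ^ multiplicity p n) =
     (\<Prod>p\<in>prime_factors n. kronecker_prime a p ^ multiplicity p n) *
     (\<Prod>p\<in>prime_factors n. kronecker_prime b p ^ multiplicity p n)"
    unfolding prod.distrib[symmetric]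
    by (intro prod.cong refl) (auto simp: kronecker_prime_mult power_mult_distrib in_prime_factors_iff)
  moreover have "(a * b < 0) \<longleftrightarrow> (a < 0) \<noteq> (b < 0)"
    using assms by (auto simp: mult_less_0_iff)
  ultimately show ?thesis using assms by (simp add: kronecker_def)
qed

lemma kronecker_1: "kronecker 1 n = 1"
proof -
  have "kronecker_prime 1 p = 1" if "prime p" for p
    using that Legendre_square[of p 1] by (auto simp: kronecker_prime_def dest: not_prime_unit)
  thus ?thesis by (simp add: kronecker_def in_prime_factors_iff)
qed

text \<open>The source of complete multiplicativity and periodicity of the symbol of a fundamental
  discriminant. At \<open>n = 0\<close> the two cases in the definition of \<open>kronecker\<close>
  match the empty and the nonempty product.\<close>

lemma kronecker_prod:
  assumes "finite S" "\<And>q. q \<in> S \<Longrightarrow> prime_disc q"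
  shows "kronecker (\<Prod>S) n = (\<Prod>q\<in>S. psi q n)"
proof (cases "n = 0")
  case True
  show ?thesis
  proof (cases "S = {}")
    case False
    then obtain q where q: "q \<in> S" by blast
    have "psi q 0 = 0" by (simp add: psi_eq_0_iff)
    hence 1: "(\<Prod>q\<in>S. psi q 0) = 0" using q assms(1) by (auto intro!: prod_zero)
    have "q dvd \<Prod>S" using q assms(1) by (rule dvd_prodI[of S q "\<lambda>x. x", rotated])
    hence "\<bar>q\<bar> dvd \<bar>\<Prod>S\<bar>" by simp
    moreover have "\<not> \<bar>q\<bar> dvd 1" using prime_disc_abs_gt[OF assms(2)[OF q]] by (auto dest: zdvd_imp_le)
    ultimately have "\<bar>\<Prod>S\<bar> \<noteq> 1" by metis
    thus ?thesis using True 1 by (simp add: kronecker_def)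
  qed (simp add: kronecker_1)
next
  case False
  from assms show ?thesis
  proof (induction S rule: finite_induct)
    case (insert q S)
    have "\<Prod>S \<noteq> 0" using insert prime_disc_nz by (simp add: prod_zero_iff)
    thus ?case using insert False
      by (simp add: kronecker_mult_left prime_disc_nz kronecker_prime_disc)
  qed (simp add: kronecker_1)
qed

lemma kronecker_prime_eq: "prime p \<Longrightarrow> kronecker d p = kronecker_prime d p"
  using prime_gt_0_int[of p] by (auto simp: kronecker_def prime_prime_factors)

section \<open>Sums over residue classes\<close>

lemma periodic_mod:
  fixes f :: "int \<Rightarrow> 'a"
  assumes "\<And>x. f (x + n) = f x" shows "f (x mod n) = f x"
proof -
  have up: "f (x + int k * n) = f x" for x k
    by (induction k) (use assms[of "x + int _ * n"] in \<open>auto simp: algebra_simps\<close>)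
  have "f (x + j * n) = f x" for x j
  proof (cases "j \<ge> 0")
    case True thus ?thesis using up[of x "nat j"] by simp
  next
    case False thus ?thesis using up[of "x + j * n" "nat (-j)"] by (simp add: algebra_simps)
  qed
  from this[of "x mod n" "x div n"] show ?thesis by (simp add: mod_mult_div_eq mult.commute)
qed

lemma periodic_cong:
  fixes f :: "int \<Rightarrow> 'a"
  assumes "\<And>x. f (x + n) = f x" "[x = y] (mod n)" shows "f x = f y"
  using periodic_mod[of f n, OF assms(1)] assms(2) unfolding cong_def by metis

lemma sum_residue_affine:
  fixes f :: "int \<Rightarrow> 'a :: comm_monoid_add"
  assumes per: "\<And>x. f (x + n) = f x" and n: "n > 0" and u: "coprime u n"
  shows "(\<Sum>x\<in>{0..<n}. f (u * x + v)) = (\<Sum>x\<in>{0..<n}. f x)"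
proof -
  define h where "h x = (u * x + v) mod n" for x
  have inj: "inj_on h {0..<n}"
  proof (rule inj_onI)
    fix x y assume xy: "x \<in> {0..<n}" "y \<in> {0..<n}" "h x = h y"
    hence "[u * x + v = u * y + v] (mod n)" by (simp add: h_def cong_def)
    hence "[u * x = u * y] (mod n)" by (simp add: cong_add_rcancel)
    hence "[x = y] (mod n)" using u by (simp add: cong_mult_lcancel coprime_commute)
    thus "x = y" using xy by (simp add: cong_def)
  qed
  have "h ` {0..<n} \<subseteq> {0..<n}" using n by (auto simp: h_def)
  hence "h ` {0..<n} = {0..<n}" by (intro endo_inj_surj inj) auto
  hence "bij_betw h {0..<n} {0..<n}" using inj by (simp add: bij_betw_def)
  hence "(\<Sum>x\<in>{0..<n}. f x) = (\<Sum>x\<in>{0..<n}. f (h x))" by (rule sum.reindex_bij_betw[symmetric])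
  also have "\<dots> = (\<Sum>x\<in>{0..<n}. f (u * x + v))"
    by (simp add: h_def periodic_mod[of f n, OF per])
  finally show ?thesis ..
qed

lemma sum_residue_crt:
  fixes f g :: "int \<Rightarrow> 'a :: comm_semiring_1"
  assumes f: "\<And>x. f (x + a) = f x" and g: "\<And>x. g (x + b) = g x"
    and a: "a > 0" and b: "b > 0" and co: "coprime a b"
  shows "(\<Sum>x\<in>{0..<a*b}. f x * g x) = (\<Sum>x\<in>{0..<a}. f x) * (\<Sum>x\<in>{0..<b}. g x)"
proof -
  define h where "h x = (x mod a, x mod b)" for x
  have inj: "inj_on h {0..<a*b}"
  proof (rule inj_onI)
    fix x y assume xy: "x \<in> {0..<a*b}" "y \<in> {0..<a*b}" "h x = h y"
    hence "[x = y] (mod a)" "[x = y] (mod b)" by (auto simp: h_def cong_def)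
    hence "[x = y] (mod a * b)" using co by (simp add: coprime_cong_mult)
    thus "x = y" using xy by (simp add: cong_def)
  qed
  have sub: "h ` {0..<a*b} \<subseteq> {0..<a} \<times> {0..<b}" using a b by (auto simp: h_def)
  have "h ` {0..<a*b} = {0..<a} \<times> {0..<b}"
    using a b by (intro card_subset_eq sub) (auto simp: card_image[OF inj] card_cartesian_product nat_mult_distrib)
  hence "bij_betw h {0..<a*b} ({0..<a} \<times> {0..<b})" using inj by (simp add: bij_betw_def)
  hence "(\<Sum>(x,y)\<in>{0..<a} \<times> {0..<b}. f x * g y) = (\<Sum>x\<in>{0..<a*b}. case h x of (x, y) \<Rightarrow> f x * g y)"
    by (rule sum.reindex_bij_betw[symmetric])
  also have "\<dots> = (\<Sum>x\<in>{0..<a*b}. f x * g x)"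
    by (simp add: h_def periodic_mod[of f a, OF f] periodic_mod[of g b, OF g])
  finally show ?thesis by (simp add: sum_product sum.cartesian_product)
qed

lemma sum_residue_mult:
  fixes f :: "int \<Rightarrow> 'a :: comm_semiring_1"
  assumes f: "\<And>x. f (x + n) = f x" and n: "n > 0"
  shows "(\<Sum>x\<in>{0..<n * int m}. f x) = of_nat m * (\<Sum>x\<in>{0..<n}. f x)"
proof (induction m)
  case (Suc m)
  have "(\<Sum>x\<in>{n * int m..<n * int m + n}. f x) = (\<Sum>x\<in>{0..<n}. f (x + n * int m))"
    by (rule sum.reindex_bij_witness[of _ "\<lambda>x. x + n * int m" "\<lambda>x. x - n * int m"]) auto
  also have "\<dots> = (\<Sum>x\<in>{0..<n}. f x)"
    by (intro sum.cong refl periodic_cong[of f n, OF f]) (simp add: cong_def)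
  finally have "(\<Sum>x\<in>{n * int m..<n * int m + n}. f x) = (\<Sum>x\<in>{0..<n}. f x)" .
  moreover have "{0..<n * int (Suc m)} = {0..<n * int m} \<union> {n * int m..<n * int m + n}"
    using n by (simp add: algebra_simps) (simp add: ivl_disj_un)
  moreover have "{0..<n * int m} \<inter> {n * int m..<n * int m + n} = {}" by auto
  ultimately show ?case using Suc by (simp add: sum.union_disjoint algebra_simps)
qed auto

section \<open>Functional equations of Dirichlet series\<close>

text \<open>The negated forward difference; summation by parts against \<open>w^n\<close> produces
  differences with this sign.\<close>

definition dif :: "(complex \<Rightarrow> complex) \<Rightarrow> complex \<Rightarrow> complex" where
  "dif f z = f z - f (z + 1)"

lemma dif_pow_Suc: "(dif ^^ Suc j) f z = (dif ^^ j) f z - (dif ^^ j) f (z + 1)"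
  by (simp add: dif_def)

lemma dif_pow_cong:
  assumes "\<And>z. Re z > 0 \<Longrightarrow> f z = g z" "Re z > 0"
  shows "(dif ^^ j) f z = (dif ^^ j) g z"
  using assms(2) by (induction j arbitrary: z) (simp_all add: assms(1) dif_pow_Suc del: funpow.simps)

text \<open>A difference of order \<open>M\<close> is controlled by the derivative of order
  \<open>M\<close> on \<open>[y, y + M]\<close>. \<open>H j\<close> plays the role of the
  \<open>j\<close>-th derivative; the induction replaces the whole family by its first differences
  and applies the mean value inequality once.\<close>

lemma dif_bound:
  fixes H :: "nat \<Rightarrow> complex \<Rightarrow> complex"
  assumes "\<And>j z. Re z > 0 \<Longrightarrow> (H j has_field_derivative H (Suc j) z) (at z)"
    and "y > 0" "\<And>x. y \<le> x \<Longrightarrow> x \<le> y + real M \<Longrightarrow> norm (H M (of_real x)) \<le> B"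
  shows "norm ((dif ^^ M) (H 0) (of_real y)) \<le> B"
  using assms
proof (induction M arbitrary: H y)
  case (Suc M)
  define H' where "H' j z = H j z - H j (z + 1)" for j z
  have H0: "dif (H 0) = H' 0" by (auto simp: dif_def H'_def)
  have "norm ((dif ^^ M) (H' 0) (of_real y)) \<le> B"
  proof (rule Suc.IH)
    fix j and z :: complex assume z: "Re z > 0"
    show "(H' j has_field_derivative H' (Suc j) z) (at z)"
      unfolding H'_def
      by (rule DERIV_diff Suc.prems(1) z DERIV_chain2[where f = "H j" and g = "\<lambda>z. z + 1" and Db = 1, simplified])+
        (auto intro!: derivative_eq_intros Suc.prems(1) simp: z add_pos_pos)
  next
    show "y > 0" by fact
  next
    fix x assume x: "y \<le> x" "x \<le> y + real M"
    have "norm (H M (of_real (x + 1)) - H M (of_real x)) \<le> B * norm (complex_of_real (x + 1) - of_real x)"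
    proof (rule field_differentiable_bound[where S = "closed_segment (complex_of_real x) (of_real (x + 1))"])
      fix z assume "z \<in> closed_segment (complex_of_real x) (of_real (x + 1))"
      then obtain t where t: "z = of_real t" "x \<le> t" "t \<le> x + 1"
        unfolding closed_segment_of_real closed_segment_eq_real_ivl by (auto split: if_splits)
      show "(H M has_field_derivative H (Suc M) z) (at z within closed_segment (complex_of_real x) (of_real (x + 1)))"
        by (rule has_field_derivative_at_within, rule Suc.prems(1)) (use t x \<open>y > 0\<close> in auto)
      show "norm (H (Suc M) z) \<le> B"
        unfolding t by (rule Suc.prems(3)) (use t x in auto)
    qed auto
    thus "norm (H' M (of_real x)) \<le> B" by (simp add: H'_def norm_minus_commute)
  qed
  thus ?case unfolding funpow_Suc_right comp_apply H0 .
qed auto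

section \<open>Lerch series and their continuation\<close>

definition npow :: "complex \<Rightarrow> complex \<Rightarrow> complex" where
  "npow s z = z powr (- s)"

lemma norm_pochhammer_le: "norm (pochhammer (s::complex) M) \<le> (norm s + real M) ^ M"
proof -
  have "norm (pochhammer s M) = (\<Prod>i<M. norm (s + of_nat i))"
    by (simp add: pochhammer_prod prod_norm atLeast0LessThan)
  also have "\<dots> \<le> (\<Prod>i<M. norm s + real M)"
    by (intro prod_mono) (auto intro!: order_trans[OF norm_triangle_ineq])
  finally show ?thesis by simp
qed

lemma dif_npow_bound:
  assumes "y > 0" "Re s + real M \<ge> 0"
  shows "norm ((dif ^^ M) (npow s) (of_real y)) \<le> norm (pochhammer s M) * y powr (- Re s - real M)"
proof -
  define H where "H j z = (-1) ^ j * pochhammer s j * z powr (- s - of_nat j)" for j z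
  have "norm ((dif ^^ M) (H 0) (of_real y)) \<le> norm (pochhammer s M) * y powr (- Re s - real M)"
  proof (rule dif_bound)
    fix j and z :: complex assume z: "Re z > 0"
    have "((\<lambda>z. z powr (- s - of_nat j)) has_field_derivative (- s - of_nat j) * z powr (- s - of_nat j - 1)) (at z)"
      by (rule has_field_derivative_powr) (use z in \<open>auto simp: complex_nonpos_Reals_iff\<close>)
    hence "(H j has_field_derivative (-1) ^ j * pochhammer s j * ((- s - of_nat j) * z powr (- s - of_nat j - 1))) (at z)"
      unfolding H_def by (intro DERIV_cmult)
    also have "(-1) ^ j * pochhammer s j * ((- s - of_nat j) * z powr (- s - of_nat j - 1)) = H (Suc j) z"
      by (simp add: H_def pochhammer_rec' algebra_simps)
    finally show "(H j has_field_derivative H (Suc j) z) (at z)" .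
  next
    fix x assume x: "y \<le> x"
    have "norm (H M (of_real x)) = norm (pochhammer s M) * x powr (- Re s - real M)"
      using x assms by (simp add: H_def norm_mult norm_power norm_powr_real_powr)
    also have "\<dots> \<le> norm (pochhammer s M) * y powr (- Re s - real M)"
      using x assms by (intro mult_left_mono powr_mono2') auto
    finally show "norm (H M (of_real x)) \<le> norm (pochhammer s M) * y powr (- Re s - real M)" .
  qed fact
  moreover have "H 0 = npow s" by (auto simp: H_def npow_def)
  ultimately show ?thesis by simp
qed

lemma dif_npow_bound_nat:
  assumes "Re s + real M \<ge> 0"
  shows "norm ((dif ^^ M) (npow s) (of_nat (Suc n))) \<le> norm (pochhammer s M) * real (Suc n) powr (- Re s - real M)"
  using dif_npow_bound[OF _ assms, of "real (Suc n)"] by simp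

lemma summable_Suc_powr: "a < -1 \<Longrightarrow> summable (\<lambda>n. real (Suc n) powr a)"
  by (subst summable_Suc_iff, subst summable_real_powr_iff)

text \<open>
  \<open>M\<close> summations by parts transform \<open>\<Sum>n\<ge>1. w^n n^(-s)\<close> into \<open>lerch_trunc w M s\<close>, whose series
  converges for \<open>Re s > 1 - M\<close> because \<open>M\<close> differences of \<open>n^(-s)\<close> are of order \<open>n^(-s-M)\<close>.
\<close>

definition lerch_tail :: "complex \<Rightarrow> nat \<Rightarrow> complex \<Rightarrow> complex" where
  "lerch_tail w M s = (\<Sum>n. w ^ Suc n * (dif ^^ M) (npow s) (of_nat (Suc n)))"

definition lerch_trunc :: "complex \<Rightarrow> nat \<Rightarrow> complex \<Rightarrow> complex" where
  "lerch_trunc w M s =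
     - (\<Sum>j<M. (w / (w - 1)) ^ Suc j * (dif ^^ j) (npow s) 1) + (w / (w - 1)) ^ M * lerch_tail w M s"

text \<open>This number of summations by parts pushes \<open>Re s + M\<close> beyond 1. By
  \<open>lerch_eq_trunc\<close> every sufficiently large number gives the same value, so near a
  given \<open>s\<close> a fixed one may be used.\<close>

definition lerch :: "complex \<Rightarrow> complex \<Rightarrow> complex" where
  "lerch w s = lerch_trunc w (nat \<lceil>2 - Re s\<rceil>) s"

lemma lerch_tail_summable:
  assumes "norm w = 1" "Re s + real M > 1"
  shows "summable (\<lambda>n. w ^ Suc n * (dif ^^ M) (npow s) (of_nat (Suc n)))"
proof (rule summable_comparison_test'[where N = 0])
  show "summable (\<lambda>n. norm (pochhammer s M) * real (Suc n) powr (- Re s - real M))"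
    by (intro summable_mult summable_Suc_powr) (use assms in auto)
  show "norm (w ^ Suc n * (dif ^^ M) (npow s) (of_nat (Suc n))) \<le>
    norm (pochhammer s M) * real (Suc n) powr (- Re s - real M)" for n
    using dif_npow_bound_nat[of s M n] assms by (simp add: norm_mult norm_power del: funpow.simps power_Suc of_nat_Suc)
qed

text \<open>One summation by parts. The shifted series is \<open>1/w\<close> times the old tail
  without its first term, so the new tail is \<open>(1 - 1/w)\<close> times the old one plus
  \<open>u 1\<close>; since \<open>w \<noteq> 1\<close> this can be solved for the old tail, and
  \<open>u 1\<close> joins the boundary sum.\<close>

lemma lerch_trunc_Suc:
  assumes w: "norm w = 1" "w \<noteq> 1" and s: "Re s + real M > 1"
  shows "lerch_trunc w (Suc M) s = lerch_trunc w M s"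
proof -
  define c where "c = w / (w - 1)"
  define u where "u n = (dif ^^ M) (npow s) (of_nat n)" for n :: nat
  have w0: "w \<noteq> 0" using w by auto
  have cw: "c * (w - 1) = w" using w by (simp add: c_def)
  have S: "(\<lambda>n. w ^ Suc n * u (Suc n)) sums lerch_tail w M s"
    unfolding u_def lerch_tail_def by (rule summable_sums[OF lerch_tail_summable[OF w(1) s]])
  have S1: "(\<lambda>n. w ^ Suc (Suc n) * u (Suc (Suc n))) sums (lerch_tail w M s - w * u 1)"
    using S by (subst sums_Suc_iff[where f = "\<lambda>n. w ^ Suc n * u (Suc n)"]) simp
  have "(\<lambda>n. w ^ Suc n * u (Suc n) - (1 / w) * (w ^ Suc (Suc n) * u (Suc (Suc n)))) sums
     (lerch_tail w M s - (1 / w) * (lerch_tail w M s - w * u 1))"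
    by (intro sums_diff sums_mult S S1)
  also have "(\<lambda>n. w ^ Suc n * u (Suc n) - (1 / w) * (w ^ Suc (Suc n) * u (Suc (Suc n)))) =
       (\<lambda>n. w ^ Suc n * (dif ^^ Suc M) (npow s) (of_nat (Suc n)))"
  proof
    fix n
    have "(of_nat (Suc (Suc n)) :: complex) = of_nat (Suc n) + 1" by simp
    thus "w ^ Suc n * u (Suc n) - (1 / w) * (w ^ Suc (Suc n) * u (Suc (Suc n))) =
       w ^ Suc n * (dif ^^ Suc M) (npow s) (of_nat (Suc n))"
      using w0 unfolding dif_pow_Suc u_def by (simp add: field_simps)
  qed
  finally have T: "lerch_tail w (Suc M) s = lerch_tail w M s - (1 / w) * (lerch_tail w M s - w * u 1)"
    unfolding lerch_tail_def by (rule sums_unique[symmetric])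
  have "c * lerch_tail w (Suc M) s = (c * (w - 1)) / w * lerch_tail w M s + c * u 1"
    unfolding T using w0 by (simp add: field_simps)
  hence "c * lerch_tail w (Suc M) s = lerch_tail w M s + c * u 1" using w0 cw by simp
  hence "c ^ M * (c * lerch_tail w (Suc M) s) = c ^ M * (lerch_tail w M s + c * u 1)" by simp
  hence "c ^ Suc M * lerch_tail w (Suc M) s = c ^ M * lerch_tail w M s + c ^ Suc M * u 1"
    by (simp add: algebra_simps)
  thus ?thesis unfolding lerch_trunc_def c_def[symmetric] by (simp add: u_def del: funpow.simps power_Suc)
qed

lemma lerch_eq_trunc:
  assumes w: "norm w = 1" "w \<noteq> 1" and s: "Re s + real M > 1"
  shows "lerch w s = lerch_trunc w M s"
proof -
  define K where "K = nat \<lceil>2 - Re s\<rceil>"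
  have K: "Re s + real K > 1" unfolding K_def by linarith
  have *: "lerch_trunc w (A + j) s = lerch_trunc w A s" if "Re s + real A > 1" for A j
    using that by (induction j) (auto simp: lerch_trunc_Suc[OF w])
  have "lerch_trunc w K s = lerch_trunc w (K + M) s" using *[OF K] by simp
  also have "\<dots> = lerch_trunc w M s" using *[OF s, of K] by (simp add: add.commute)
  finally show ?thesis by (simp add: lerch_def K_def)
qed

lemma holomorphic_dif_npow: "z \<noteq> 0 \<or> Re z > 0 \<Longrightarrow> (\<lambda>s. (dif ^^ j) (npow s) z) holomorphic_on A" if "Re z > 0"
  using that
proof (induction j arbitrary: z)
  case 0
  thus ?case by (auto simp: npow_def intro!: holomorphic_intros)
next
  case (Suc j)
  thus ?case unfolding dif_pow_Suc by (intro holomorphic_intros Suc) auto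
qed

lemma holomorphic_lerch_trunc:
  assumes w: "norm w = 1"
  shows "lerch_trunc w M holomorphic_on {s. Re s > 1 - real M}"
proof -
  define S where "S = {s. Re s > 1 - real M}"
  have S: "open S" unfolding S_def by (simp add: open_halfspace_Re_gt)
  define f where "f n s = w ^ Suc n * (dif ^^ M) (npow s) (of_nat (Suc n))" for n s
  have hol: "f n holomorphic_on A" for n A
    unfolding f_def by (intro holomorphic_intros holomorphic_dif_npow) auto
  have "\<exists>g g'. \<forall>x\<in>S. ((\<lambda>n. f n x) sums g x) \<and> ((\<lambda>n. deriv (f n) x) sums g' x) \<and> (g has_field_derivative g' x) (at x)"
  proof (rule series_and_derivative_comparison_local[OF S])
    fix n x assume "x \<in> S"
    show "(f n has_field_derivative deriv (f n) x) (at x)"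
      by (rule holomorphic_derivI[OF hol[of n UNIV]]) auto
  next
    fix x assume x: "x \<in> S"
    \<comment> \<open>Half the distance of \<open>x\<close> from the line
      \<open>Re s = 1 - M\<close>. On the ball of this radius the exponents stay at most
      \<open>-1 - d\<close>, which yields one summable majorant.\<close>
    define d where "d = (Re x + real M - 1) / 2"
    have d: "d > 0" using x by (auto simp: d_def S_def)
    define h where "h n = (norm x + d + real M) ^ M * real (Suc n) powr (- (Re x - d) - real M)" for n
    have "summable h" unfolding h_def
      by (intro summable_mult summable_Suc_powr) (use d in \<open>auto simp: d_def field_simps\<close>)
    moreover have "norm (f n y) \<le> h n" if y: "y \<in> ball x d" for n y
    proof -
      have 1: "norm (y - x) < d" using y by (simp add: dist_norm norm_minus_commute)
      have 2: "norm y \<le> norm x + d" using 1 norm_triangle_sub[of y x] by linarith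
      have 3: "Re y \<ge> Re x - d" using 1 abs_Re_le_cmod[of "y - x"] by (simp add: abs_le_iff)
      have ge: "Re y + real M \<ge> 0" using 3 d by (simp add: d_def field_simps)
      have "norm (f n y) = norm ((dif ^^ M) (npow y) (of_nat (Suc n)))"
        using w by (simp add: f_def norm_mult norm_power del: funpow.simps power_Suc of_nat_Suc)
      also have "\<dots> \<le> norm (pochhammer y M) * real (Suc n) powr (- Re y - real M)"
        by (rule dif_npow_bound_nat[OF ge])
      also have "\<dots> \<le> (norm y + real M) ^ M * real (Suc n) powr (- (Re x - d) - real M)"
        using 3 by (intro mult_mono norm_pochhammer_le powr_mono) auto
      also have "\<dots> \<le> h n" unfolding h_def
        using 2 by (intro mult_right_mono power_mono) auto
      finally show ?thesis .
    qed
    ultimately show "\<exists>d h. 0 < d \<and> summable h \<and> (\<forall>\<^sub>F n in sequentially. \<forall>y\<in>ball x d \<inter> S. norm (f n y) \<le> h n)"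
      using d by (intro exI[of _ d] exI[of _ h]) (auto intro!: always_eventually)
  qed
  then obtain g g' where g: "\<And>x. x \<in> S \<Longrightarrow> (\<lambda>n. f n x) sums g x"
    "\<And>x. x \<in> S \<Longrightarrow> (g has_field_derivative g' x) (at x)" by blast
  have "g holomorphic_on S" using g(2) S by (auto simp: holomorphic_on_open)
  hence t: "lerch_tail w M holomorphic_on S"
    by (rule holomorphic_transform) (use g(1) in \<open>auto simp: lerch_tail_def f_def sums_iff\<close>)
  show ?thesis unfolding S_def[symmetric] lerch_trunc_def
    by (intro holomorphic_intros t holomorphic_dif_npow) auto
qed

lemma holomorphic_lerch:
  assumes w: "norm w = 1" "w \<noteq> 1"
  shows "lerch w holomorphic_on A"
proof -
  have "lerch w field_differentiable (at s)" for s
  proof -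
    define M where "M = nat \<lceil>2 - Re s\<rceil>"
    have s: "s \<in> {s. Re s > 1 - real M}" unfolding M_def by (simp; linarith)
    have "lerch w holomorphic_on {s. Re s > 1 - real M}"
      by (rule holomorphic_transform[OF holomorphic_lerch_trunc[OF w(1), of M]])
        (auto simp: lerch_eq_trunc[OF w, symmetric])
    thus ?thesis using s open_halfspace_Re_gt[of "1 - real M"] holomorphic_on_imp_differentiable_at by blast
  qed
  thus ?thesis by (auto simp: holomorphic_on_def intro: field_differentiable_at_within)
qed

lemma lerch_sums:
  assumes w: "norm w = 1" "w \<noteq> 1" and s: "Re s > 1"
  shows "(\<lambda>n. w ^ Suc n / of_nat (Suc n) powr s) sums lerch w s"
proof -
  have "summable (\<lambda>n. w ^ Suc n * (dif ^^ 0) (npow s) (of_nat (Suc n)))"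
    by (rule lerch_tail_summable) (use assms in auto)
  moreover have "lerch w s = lerch_tail w 0 s"
    using lerch_eq_trunc[OF w, of s 0] s by (simp add: lerch_trunc_def)
  ultimately have "(\<lambda>n. w ^ Suc n * (dif ^^ 0) (npow s) (of_nat (Suc n))) sums lerch w s"
    unfolding lerch_tail_def by (simp add: sums_iff)
  thus ?thesis by (simp add: npow_def powr_minus field_simps)
qed

text \<open>The Leibniz rule for differences with a factor \<open>z\<close>. It serves twice:
  differences of order above \<open>m\<close> annihilate \<open>z^m\<close>, and the numbers
  \<open>polylog_coeff\<close> obey their recursion.\<close>

lemma dif_mult_id:
  "(dif ^^ Suc j) (\<lambda>z. z * h z) z = (z + of_nat (Suc j)) * (dif ^^ Suc j) h z - of_nat (Suc j) * (dif ^^ j) h z"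
proof (induction j arbitrary: z)
  case 0
  show ?case by (simp add: dif_def algebra_simps)
next
  case (Suc j)
  have alg: "((z + J) * A - J * C) - ((z + 1 + J) * B - J * C') = (z + (J + 1)) * (A - B) - (J + 1) * A"
    if "A = C - C'" for A B C C' J :: complex
    unfolding that by (simp add: algebra_simps)
  have J: "(of_nat (Suc (Suc j)) :: complex) = of_nat (Suc j) + 1" by simp
  have "(dif ^^ Suc (Suc j)) (\<lambda>z. z * h z) z =
      ((z + of_nat (Suc j)) * (dif ^^ Suc j) h z - of_nat (Suc j) * (dif ^^ j) h z) -
      ((z + 1 + of_nat (Suc j)) * (dif ^^ Suc j) h (z + 1) - of_nat (Suc j) * (dif ^^ j) h (z + 1))"
    unfolding dif_pow_Suc[of "Suc j" "\<lambda>z. z * h z"] Suc.IH ..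
  also have "\<dots> = (z + (of_nat (Suc j) + 1)) * ((dif ^^ Suc j) h z - (dif ^^ Suc j) h (z + 1)) -
      (of_nat (Suc j) + 1) * (dif ^^ Suc j) h z"
    by (rule alg) (rule dif_pow_Suc)
  finally show ?case unfolding J dif_pow_Suc[of "Suc j" h, symmetric] .
qed

lemma dif_zero: "(dif ^^ i) (\<lambda>_. 0) z = 0"
  by (induction i arbitrary: z) (simp_all only: dif_pow_Suc funpow_0 diff_self)

lemma dif_power_eq_0: "j > m \<Longrightarrow> (dif ^^ j) (\<lambda>z. z ^ m) z = 0"
proof (induction m arbitrary: j z)
  case 0
  then obtain i where "j = Suc i" by (cases j) auto
  moreover have "dif (\<lambda>z. z ^ 0) = (\<lambda>_. 0)" by (auto simp: dif_def)
  ultimately show ?case unfolding funpow_Suc_right comp_apply by (simp only: dif_zero funpow_Suc_right comp_apply)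
next
  case (Suc m)
  then obtain i where i: "j = Suc i" "i > m" by (cases j) auto
  have "(dif ^^ Suc i) (\<lambda>z. z * z ^ m) z = 0"
    unfolding dif_mult_id using Suc.IH[of "Suc i"] Suc.IH[of i] i by simp
  thus ?case using i by simp
qed

text \<open>Up to the sign \<open>(-1)^j\<close> this is \<open>j!\<close> times the Stirling number
  of the second kind \<open>S(m+1, j+1)\<close>.\<close>

definition polylog_coeff :: "nat \<Rightarrow> nat \<Rightarrow> complex" where
  "polylog_coeff m j = (dif ^^ j) (\<lambda>z. z ^ m) 1"

lemma polylog_coeff_0: "polylog_coeff m 0 = 1"
  by (simp add: polylog_coeff_def)

lemma polylog_coeff_Suc:
  "polylog_coeff (Suc m) (Suc j) = (of_nat j + 2) * polylog_coeff m (Suc j) - (of_nat j + 1) * polylog_coeff m j"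
  unfolding polylog_coeff_def using dif_mult_id[of j "\<lambda>z. z ^ m" 1]
  by (simp add: algebra_simps del: funpow.simps)

lemma polylog_coeff_eq_0: "j > m \<Longrightarrow> polylog_coeff m j = 0"
  by (simp add: polylog_coeff_def dif_power_eq_0)

text \<open>At \<open>c = w / (w - 1)\<close> this is the polylogarithm of order \<open>-m\<close>
  at \<open>w\<close>: only the boundary terms of the summations by parts remain.\<close>

definition polylog_poly :: "nat \<Rightarrow> complex \<Rightarrow> complex" where
  "polylog_poly m c = - (\<Sum>j\<le>m. c ^ Suc j * polylog_coeff m j)"

lemma lerch_neg:
  assumes w: "norm w = 1" "w \<noteq> 1"
  shows "lerch w (- of_nat m) = polylog_poly m (w / (w - 1))"
proof -
  have eq: "(dif ^^ j) (npow (- of_nat m)) z = (dif ^^ j) (\<lambda>z. z ^ m) z" if "Re z > 0" for j z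
    by (rule dif_pow_cong[OF _ that]) (auto simp: npow_def powr_nat)
  have t: "lerch_tail w (m + 2) (- of_nat m) = 0"
    unfolding lerch_tail_def by (simp add: eq dif_power_eq_0 del: funpow.simps)
  \<comment> \<open>\<open>m + 2\<close> is the least order covered by \<open>lerch_eq_trunc\<close>
    at \<open>s = -m\<close>, and differences of that order annihilate \<open>z^m\<close>.\<close>
  have "lerch w (- of_nat m) = lerch_trunc w (m + 2) (- of_nat m)"
    by (rule lerch_eq_trunc[OF w]) auto
  also have "\<dots> = - (\<Sum>j<m+2. (w / (w - 1)) ^ Suc j * polylog_coeff m j)"
    unfolding lerch_trunc_def t by (simp add: eq polylog_coeff_def del: funpow.simps)
  also have "(\<Sum>j<m+2. (w / (w - 1)) ^ Suc j * polylog_coeff m j) = (\<Sum>j\<le>m. (w / (w - 1)) ^ Suc j * polylog_coeff m j)"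
    by (rule sum.mono_neutral_right) (auto simp: polylog_coeff_eq_0)
  finally show ?thesis by (simp add: polylog_poly_def)
qed

text \<open>The counterpart of \<open>w d/dw Li(-m) = Li(-m-1)\<close>. For
  \<open>w = exp (K z)\<close> the quantity \<open>c = w / (w - 1)\<close> satisfies precisely the
  differential equation in the hypothesis, and the coefficients match by
  \<open>polylog_coeff_Suc\<close>.\<close>

lemma polylog_poly_deriv:
  assumes "(c has_field_derivative K * (c z - c z ^ 2)) (at z)"
  shows "((\<lambda>z. polylog_poly m (c z)) has_field_derivative K * polylog_poly (Suc m) (c z)) (at z)"
proof -
  define D where "D = polylog_coeff m"
  define x where "x = c z"
  have "((\<lambda>z. polylog_poly m (c z)) has_field_derivative
      - (\<Sum>j\<le>m. (of_nat (Suc j) * c z ^ j * (K * (c z - c z ^ 2))) * polylog_coeff m j)) (at z)"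
    unfolding polylog_poly_def
    by (rule DERIV_minus DERIV_sum DERIV_cmult_right)+ (auto intro!: derivative_eq_intros assms simp del: power_Suc of_nat_Suc)
  also have "- (\<Sum>j\<le>m. (of_nat (Suc j) * c z ^ j * (K * (c z - c z ^ 2))) * polylog_coeff m j)
     = K * polylog_poly (Suc m) (c z)"
  proof -
    have "(\<Sum>j\<le>Suc m. x ^ Suc j * polylog_coeff (Suc m) j) =
       x + (\<Sum>j\<le>m. x ^ Suc (Suc j) * polylog_coeff (Suc m) (Suc j))"
      by (subst sum.atMost_Suc_shift) (simp add: polylog_coeff_0)
    also have "\<dots> = x + (\<Sum>j\<le>m. x ^ Suc (Suc j) * ((of_nat j + 2) * D (Suc j)))
                      - (\<Sum>j\<le>m. x ^ Suc (Suc j) * ((of_nat j + 1) * D j))"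
      by (simp add: polylog_coeff_Suc D_def right_diff_distrib sum_subtractf)
    also have "x + (\<Sum>j\<le>m. x ^ Suc (Suc j) * ((of_nat j + 2) * D (Suc j))) =
        (\<Sum>j\<le>Suc m. x ^ Suc j * ((of_nat j + 1) * D j))"
      by (subst sum.atMost_Suc_shift) (simp add: D_def polylog_coeff_0 add_ac)
    also have "\<dots> = (\<Sum>j\<le>m. x ^ Suc j * ((of_nat j + 1) * D j))"
      by (simp add: D_def polylog_coeff_eq_0)
    finally have "(\<Sum>j\<le>Suc m. x ^ Suc j * polylog_coeff (Suc m) j) =
       (\<Sum>j\<le>m. (of_nat (Suc j) * x ^ j * (x - x ^ 2)) * D j)"
      by (simp add: sum_subtractf[symmetric] algebra_simps power2_eq_square)
    thus ?thesis unfolding polylog_poly_def x_def[symmetric] D_def[symmetric]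
      by (simp add: sum_distrib_left mult_ac)
  qed
  finally show ?thesis .
qed

text \<open>Obtained by differentiating \<open>rGamma z * rGamma (1 - z)\<close>; keeping the sine
  as a factor avoids a division.\<close>

lemma Digamma_reflection:
  fixes z :: complex
  assumes z: "z \<notin> \<int>"
  shows "(Digamma (1 - z) - Digamma z) * sin (of_real pi * z) = of_real pi * cos (of_real pi * z)"
proof -
  have z1: "z \<notin> \<int>\<^sub>\<le>\<^sub>0" using z by auto
  have z2: "1 - z \<notin> \<int>\<^sub>\<le>\<^sub>0"
  proof
    assume "1 - z \<in> \<int>\<^sub>\<le>\<^sub>0"
    hence "1 - (1 - z) \<in> \<int>" by (intro Ints_diff) auto
    thus False using z by simp
  qed
  have "((\<lambda>z. rGamma z * rGamma (1 - z)) has_field_derivative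
      (- rGamma z * Digamma z) * rGamma (1 - z) + rGamma z * (rGamma (1 - z) * Digamma (1 - z))) (at z)"
    using z1 z2 by (auto intro!: derivative_eq_intros has_field_derivative_rGamma_no_nonpos_int simp: algebra_simps)
  moreover have "((\<lambda>z. rGamma z * rGamma (1 - z)) has_field_derivative cos (of_real pi * z)) (at z)"
    unfolding rGamma_reflection_complex by (auto intro!: derivative_eq_intros)
  ultimately have "(- rGamma z * Digamma z) * rGamma (1 - z) + rGamma z * (rGamma (1 - z) * Digamma (1 - z))
     = cos (of_real pi * z)" by (rule DERIV_unique)
  hence "(rGamma z * rGamma (1 - z)) * (Digamma (1 - z) - Digamma z) = cos (of_real pi * z)"
    by (simp add: algebra_simps)
  thus ?thesis unfolding rGamma_reflection_complex by (simp add: field_simps)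
qed

text \<open>Equal to \<open>w / (w - 1)\<close> at \<open>w = exp (2 pi i z)\<close>, hence to
  \<open>1/2 - (i/2) cot (pi z)\<close>; the cotangent links it to Digamma.\<close>

definition ecoef :: "complex \<Rightarrow> complex" where
  "ecoef z = 1 / (1 - exp (- (2 * of_real pi * \<i> * z)))"

definition unit_strip :: "complex set" where
  "unit_strip = {z. 0 < Re z \<and> Re z < 1}"

lemma unit_strip_not_Int: "z \<in> unit_strip \<Longrightarrow> z \<notin> \<int>"
  by (auto simp: unit_strip_def elim!: Ints_cases)

lemma exp_2pi_i_ne_1: "z \<notin> \<int> \<Longrightarrow> exp (- (2 * of_real pi * \<i> * z)) \<noteq> 1"
proof
  assume z: "z \<notin> \<int>" and "exp (- (2 * of_real pi * \<i> * z)) = 1"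
  then obtain n :: int where n: "Re (- (2 * of_real pi * \<i> * z)) = 0"
      "Im (- (2 * of_real pi * \<i> * z)) = of_int (2 * n) * pi"
    unfolding exp_eq_1 by blast
  from n(2) have "pi * (- Re z) = pi * of_int n" by simp
  hence "- Re z = of_int n" by (subst (asm) mult_left_cancel) auto
  hence "z = of_int (- n)" using n(1) by (intro complex_eqI) auto
  thus False using z by (metis Ints_of_int)
qed

lemma ecoef_deriv:
  assumes "z \<notin> \<int>"
  shows "(ecoef has_field_derivative (2 * of_real pi * \<i>) * (ecoef z - ecoef z ^ 2)) (at z)"
proof -
  have ne: "1 - exp (- (2 * of_real pi * \<i> * z)) \<noteq> 0" using exp_2pi_i_ne_1[OF assms] by auto
  define E where "E = exp (- (2 * of_real pi * \<i> * z))"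
  have E: "1 - E \<noteq> 0" using ne by (simp add: E_def)
  have "((\<lambda>z. 1 - exp (- (2 * of_real pi * \<i> * z))) has_field_derivative 2 * of_real pi * \<i> * E) (at z)"
    unfolding E_def by (auto intro!: derivative_eq_intros)
  from DERIV_inverse_fun[OF this ne]
  have "(ecoef has_field_derivative - (2 * of_real pi * \<i> * E * inverse ((1 - E) ^ 2))) (at z)"
    by (simp add: ecoef_def[abs_def] E_def inverse_eq_divide numeral_2_eq_2)
  moreover have "- (2 * of_real pi * \<i> * E * inverse ((1 - E) ^ 2)) =
     2 * of_real pi * \<i> * (1 / (1 - E) - (1 / (1 - E)) ^ 2)"
  proof -
    have "1 / (1 - E) - (1 / (1 - E)) ^ 2 = - E * inverse ((1 - E) ^ 2)"
      using E by (simp add: divide_simps power2_eq_square)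
    thus ?thesis by simp
  qed
  ultimately have "(ecoef has_field_derivative 2 * of_real pi * \<i> * (1 / (1 - E) - (1 / (1 - E)) ^ 2)) (at z)"
    by (simp only:)
  thus ?thesis by (simp only: ecoef_def E_def)
qed

lemma ecoef_cot:
  assumes z: "z \<notin> \<int>"
  shows "- ecoef z = - (1 / 2) + \<i> / (2 * of_real pi) * (Digamma (1 - z) - Digamma z)"
proof -
  define E where "E = exp (\<i> * (of_real pi * z))"
  have E0: "E \<noteq> 0" by (simp add: E_def)
  have e: "exp (- (2 * of_real pi * \<i> * z)) = inverse E * inverse E"
    unfolding E_def exp_minus[symmetric] exp_add[symmetric] by (simp add: algebra_simps)
  have ne: "inverse E * inverse E \<noteq> 1" using exp_2pi_i_ne_1[OF z] e by simp
  have ne2: "E * E \<noteq> 1" using ne E0 by (auto simp: field_simps)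
  have s: "sin (of_real pi * z) = (E - inverse E) / (2 * \<i>)"
    unfolding sin_exp_eq E_def exp_minus[symmetric] by simp
  have c: "cos (of_real pi * z) = (E + inverse E) / 2"
    unfolding cos_exp_eq E_def exp_minus[symmetric] by simp
  have s0: "sin (of_real pi * z) \<noteq> 0" unfolding s using ne2 E0 by (auto simp: field_simps)
  have "Digamma (1 - z) - Digamma z = of_real pi * cos (of_real pi * z) / sin (of_real pi * z)"
    using Digamma_reflection[OF z] s0 by (simp add: field_simps)
  also have "\<dots> = of_real pi * \<i> * (E * E + 1) / (E * E - 1)"
    unfolding s c using E0 ne2 by (simp add: field_simps)
  finally have D: "Digamma (1 - z) - Digamma z = of_real pi * \<i> * (E * E + 1) / (E * E - 1)" .
  have "ecoef z = E * E / (E * E - 1)"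
    unfolding ecoef_def e using E0 ne ne2 by (simp add: field_simps)
  moreover have "- (1 / 2) + \<i> / (2 * of_real pi) * (of_real pi * \<i> * (E * E + 1) / (E * E - 1)) = - (E * E / (E * E - 1))"
    using ne2 by (simp add: field_simps)
  ultimately show ?thesis unfolding D by simp
qed

text \<open>On the strip this is the \<open>m\<close>-th derivative of \<open>- ecoef\<close>,
  expressed by Polygamma values at \<open>z\<close> and \<open>1 - z\<close>. The constant
  \<open>1/2\<close> of \<open>ecoef_cot\<close> survives only for \<open>m = 0\<close>.\<close>

definition refl_poly :: "nat \<Rightarrow> complex \<Rightarrow> complex" where
  "refl_poly m z = \<i> / (2 * of_real pi) * ((-1) ^ m * Polygamma m (1 - z) - Polygamma m z)
      - (if m = 0 then 1 / 2 else 0)"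

lemma refl_poly_deriv:
  assumes z: "z \<in> unit_strip"
  shows "(refl_poly m has_field_derivative refl_poly (Suc m) z) (at z)"
proof -
  have z1: "z \<notin> \<int>\<^sub>\<le>\<^sub>0" using unit_strip_not_Int[OF z] by auto
  have "1 - z \<in> unit_strip" using z by (auto simp: unit_strip_def)
  hence z2: "1 - z \<notin> \<int>\<^sub>\<le>\<^sub>0" using unit_strip_not_Int by auto
  have 1: "(Polygamma m has_field_derivative Polygamma (Suc m) z) (at z)"
    by (rule has_field_derivative_Polygamma[OF z1])
  have 2: "((\<lambda>z. Polygamma m (1 - z)) has_field_derivative Polygamma (Suc m) (1 - z) * (-1)) (at z)"
    by (rule DERIV_chain2[where f = "Polygamma m" and g = "\<lambda>z. 1 - z", OF has_field_derivative_Polygamma[OF z2]]) (auto intro!: derivative_eq_intros)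
  show ?thesis unfolding refl_poly_def[abs_def]
    by (rule derivative_eq_intros 1 2 refl)+ (simp add: algebra_simps)
qed

text \<open>\<open>ecoef_cot\<close> is differentiated repeatedly: \<open>polylog_poly_deriv\<close>
  with \<open>K = 2 pi i\<close> raises \<open>m\<close> on the left, \<open>refl_poly_deriv\<close>
  on the right. For \<open>m > 0\<close> this is Lipschitz's formula.\<close>

lemma polylog_refl:
  assumes "z \<in> unit_strip"
  shows "(2 * of_real pi * \<i>) ^ m * polylog_poly m (ecoef z) = refl_poly m z"
  using assms
proof (induction m arbitrary: z)
  case 0
  show ?case using ecoef_cot[OF unit_strip_not_Int[OF 0]]
    by (simp add: polylog_poly_def polylog_coeff_0 refl_poly_def)
next
  case (Suc m)
  have op: "open unit_strip"
    unfolding unit_strip_def by (intro open_Collect_conj open_Collect_less continuous_intros)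
  have "((\<lambda>z. (2 * of_real pi * \<i>) ^ m * polylog_poly m (ecoef z)) has_field_derivative
     (2 * of_real pi * \<i>) ^ m * ((2 * of_real pi * \<i>) * polylog_poly (Suc m) (ecoef z))) (at z)"
    by (intro DERIV_cmult polylog_poly_deriv ecoef_deriv unit_strip_not_Int Suc.prems)
  hence "(refl_poly m has_field_derivative
     (2 * of_real pi * \<i>) ^ m * ((2 * of_real pi * \<i>) * polylog_poly (Suc m) (ecoef z))) (at z)"
    by (rule has_field_derivative_transform_within_open[OF _ op Suc.prems]) (use Suc.IH in auto)
  from DERIV_unique[OF this refl_poly_deriv[OF Suc.prems]] show ?case by (simp add: mult_ac)
qed

section \<open>Hurwitz sums and the functional equation of periodic Dirichlet series\<close>

definition hsum :: "nat \<Rightarrow> complex \<Rightarrow> complex" where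
  "hsum k z = (\<Sum>n. inverse ((z + of_nat n) ^ k))"

definition rt :: "nat \<Rightarrow> nat \<Rightarrow> complex" where
  "rt N m = exp (2 * of_real pi * \<i> * (of_nat m / of_nat N))"

lemma norm_rt [simp]: "norm (rt N m) = 1"
  by (simp add: rt_def)

lemma rt_eq_1_iff: "N > 0 \<Longrightarrow> rt N m = 1 \<longleftrightarrow> N dvd m"
proof -
  assume N: "N > 0"
  have "(Im (2 * of_real pi * \<i> * (of_nat m / of_nat N)) = of_int (2 * n) * pi) \<longleftrightarrow>
     of_nat m / real N = of_int n" for n :: int
  proof -
    have "Im (2 * of_real pi * \<i> * (of_nat m / of_nat N)) = (2 * pi) * (real m / real N)" by simp
    moreover have "of_int (2 * n) * pi = (2 * pi) * of_int n" by simp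
    moreover have "(2 * pi) * (real m / real N) = (2 * pi) * of_int n \<longleftrightarrow> real m / real N = of_int n"
      by (subst mult_left_cancel) auto
    ultimately show ?thesis by metis
  qed
  hence "rt N m = 1 \<longleftrightarrow> (\<exists>n::int. of_nat m / real N = of_int n)"
    unfolding rt_def exp_eq_1 by simp
  also have "\<dots> \<longleftrightarrow> (\<exists>n::int. int m = int N * n)"
  proof -
    have "real m / real N = of_int n \<longleftrightarrow> int m = int N * n" for n :: int
    proof -
      have "real m / real N = of_int n \<longleftrightarrow> real m = real N * of_int n"
        using N by (simp add: nonzero_divide_eq_eq mult.commute)
      also have "\<dots> \<longleftrightarrow> real_of_int (int m) = real_of_int (int N * n)" by simp
      finally show ?thesis unfolding of_int_eq_iff .
    qed
    thus ?thesis by simp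
  qed
  also have "\<dots> \<longleftrightarrow> N dvd m" by (metis dvd_def int_dvd_int_iff)
  finally show ?thesis .
qed

lemma rt_power: "rt N m ^ n = rt N (m * n)"
  unfolding rt_def exp_of_nat_mult[symmetric] by (simp add: mult_ac)

lemma rt_sum:
  assumes "N > 0"
  shows "(\<Sum>m\<in>{1..<N}. rt N m ^ n) = (if N dvd n then of_nat N else 0) - 1"
proof -
  have "(\<Sum>m<N. rt N n ^ m) = (if N dvd n then of_nat N else 0)"
  proof (cases "N dvd n")
    case True
    thus ?thesis using rt_eq_1_iff[OF assms, of n] by simp
  next
    case False
    have "rt N n ^ N = 1" unfolding rt_power using rt_eq_1_iff[OF assms, of "n * N"] by simp
    thus ?thesis using False rt_eq_1_iff[OF assms, of n] by (simp add: geometric_sum)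
  qed
  moreover have "(\<Sum>m<N. rt N n ^ m) = 1 + (\<Sum>m\<in>{1..<N}. rt N n ^ m)"
    using assms by (subst lessThan_atLeast0, subst sum.atLeast_Suc_lessThan) auto
  moreover have "(\<Sum>m\<in>{1..<N}. rt N m ^ n) = (\<Sum>m\<in>{1..<N}. rt N n ^ m)"
    by (simp add: rt_power mult.commute)
  ultimately show ?thesis by (simp add: algebra_simps split: if_splits)
qed

text \<open>Hurwitz's formula at the integer \<open>1 - k\<close>: \<open>lerch_neg\<close> gives a
  polynomial in \<open>ecoef\<close>, \<open>polylog_refl\<close> converts it into Polygamma values
  of order \<open>k - 1\<close>, and these are Hurwitz sums of exponent \<open>k\<close>.\<close>

lemma lerch_at_neg:
  assumes x: "0 < x" "x < 1" and k: "k \<ge> 2"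
  shows "lerch (exp (2 * of_real pi * \<i> * of_real x)) (1 - of_nat k) =
    fact (k - 1) / (2 * of_real pi * \<i>) ^ k * (hsum k (1 - of_real x) + (-1) ^ k * hsum k (of_real x))"
proof -
  define w where "w = exp (2 * of_real pi * \<i> * of_real x)"
  define m where "m = k - 1"
  have m: "k = Suc m" "m > 0" using k by (auto simp: m_def)
  have xs: "complex_of_real x \<in> unit_strip" using x by (simp add: unit_strip_def)
  have e: "exp (- (2 * of_real pi * \<i> * of_real x)) = 1 / w" by (simp add: w_def exp_minus field_simps)
  have w1: "w \<noteq> 1" "w \<noteq> 0" using exp_2pi_i_ne_1[OF unit_strip_not_Int[OF xs]] e by (auto simp: w_def)
  have "w / (w - 1) = ecoef (of_real x)" unfolding ecoef_def e using w1 by (simp add: field_simps)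
  moreover have "norm w = 1" by (simp add: w_def)
  ultimately have "lerch w (- of_nat m) = polylog_poly m (ecoef (of_real x))"
    using lerch_neg[of w m] w1 by simp
  also have "\<dots> = refl_poly m (of_real x) / (2 * of_real pi * \<i>) ^ m"
    unfolding polylog_refl[OF xs, symmetric] by simp
  also have "refl_poly m (of_real x) = fact m / (2 * of_real pi * \<i>) * (hsum k (1 - of_real x) + (-1) ^ k * hsum k (of_real x))"
    using m by (simp add: refl_poly_def Polygamma_def hsum_def field_simps)
  finally have "lerch w (- of_nat m) = fact m / (2 * of_real pi * \<i>) * (hsum k (1 - of_real x) + (-1) ^ k * hsum k (of_real x)) / (2 * of_real pi * \<i>) ^ m" .
  moreover have "1 - of_nat k = - (of_nat m :: complex)" using m by simp
  ultimately show ?thesis unfolding w_def[symmetric] m_def[symmetric] using m by (simp only: power_Suc) (simp add: mult_ac)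
qed

text \<open>The punctured plane is connected, so the identity theorem makes the definite description
  unambiguous, and any holomorphic extension computes it.\<close>

lemma dirichlet_continuation_eqI:
  assumes g: "g holomorphic_on (- {1})" and s: "s \<noteq> 1"
    and sums: "\<And>w. Re w > 1 \<Longrightarrow> (\<lambda>n. a (Suc n) / of_nat (Suc n) powr w) sums g w"
  shows "dirichlet_continuation a s = g s"
  unfolding dirichlet_continuation_def
proof (rule the_equality)
  show "\<exists>f. f holomorphic_on - {1} \<and> (\<forall>w. 1 < Re w \<longrightarrow> (\<lambda>n. a (Suc n) / of_nat (Suc n) powr w) sums f w) \<and> g s = f s"
    using g sums by blast
  fix z assume "\<exists>f. f holomorphic_on - {1} \<and> (\<forall>w. 1 < Re w \<longrightarrow> (\<lambda>n. a (Suc n) / of_nat (Suc n) powr w) sums f w) \<and> z = f s"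
  then obtain f where f: "f holomorphic_on - {1}" "z = f s"
    "\<And>w. 1 < Re w \<Longrightarrow> (\<lambda>n. a (Suc n) / of_nat (Suc n) powr w) sums f w" by blast
  have "f s = g s"
  proof (rule analytic_continuation_open[of "{w. Re w > 1}" "- {1}" f g s])
    show "open {w. Re w > 1}" by (rule open_halfspace_Re_gt)
    show "{w. Re w > 1} \<noteq> {}" by (auto intro: exI[of _ 2])
    show "connected (- {1::complex})" by (intro connected_punctured_universe) auto
    show "f z = g z" if "z \<in> {w. Re w > 1}" for z
      using f(3)[of z] sums[of z] that by (simp add: sums_unique2)
  qed (use f g s in auto)
  thus "z = g s" using f by simp
qed

text \<open>The mode \<open>m = 0\<close>, which would bring in the pole of zeta, is absent from the
  Fourier expansion; what remains is a finite sum of entire Lerch functions.\<close>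

lemma dirichlet_continuation_fourier:
  assumes N: "N \<ge> 2" and a: "\<And>n. a (Suc n) = (\<Sum>m\<in>{1..<N}. A m * rt N m ^ Suc n)" and s: "s \<noteq> 1"
  shows "dirichlet_continuation a s = (\<Sum>m\<in>{1..<N}. A m * lerch (rt N m) s)"
proof (rule dirichlet_continuation_eqI)
  have ne: "rt N m \<noteq> 1" if "m \<in> {1..<N}" for m
    using that rt_eq_1_iff[of N m] nat_dvd_not_less[of m N] by auto
  show "(\<lambda>s. \<Sum>m\<in>{1..<N}. A m * lerch (rt N m) s) holomorphic_on - {1}"
    by (intro holomorphic_intros holomorphic_lerch ne) auto
  fix w :: complex assume w: "Re w > 1"
  have "(\<lambda>n. \<Sum>m\<in>{1..<N}. A m * (rt N m ^ Suc n / of_nat (Suc n) powr w)) sums (\<Sum>m\<in>{1..<N}. A m * lerch (rt N m) w)"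
    by (intro sums_sum sums_mult lerch_sums ne w) auto
  thus "(\<lambda>n. a (Suc n) / of_nat (Suc n) powr w) sums (\<Sum>m\<in>{1..<N}. A m * lerch (rt N m) w)"
    unfolding a by (simp add: sum_divide_distrib del: power_Suc of_nat_Suc)
qed fact

definition lval :: "(nat \<Rightarrow> complex) \<Rightarrow> nat \<Rightarrow> complex" where
  "lval a k = (\<Sum>n. a (Suc n) / of_nat (Suc n) ^ k)"

lemma summable_hsum:
  assumes "z \<noteq> 0" "k \<ge> 2" shows "summable (\<lambda>n. inverse (((z::complex) + of_nat n) ^ k))"
  using Polygamma_converges'[OF assms] .

lemma summable_lval:
  assumes "\<And>n. norm (a n) \<le> 1" "k \<ge> 2"
  shows "summable (\<lambda>n. a (Suc n) / of_nat (Suc n) ^ k :: complex)"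
proof (rule summable_comparison_test'[where N = 0])
  have "summable (\<lambda>n. inverse (real n ^ k))" by (rule inverse_power_summable) (use assms in auto)
  thus "summable (\<lambda>n. inverse (real (Suc n) ^ k))" by (subst summable_Suc_iff)
  show "norm (a (Suc n) / of_nat (Suc n) ^ k) \<le> inverse (real (Suc n) ^ k)" for n
    using assms(1)[of "Suc n"] by (simp add: norm_divide norm_power field_simps del: of_nat_Suc)
qed

text \<open>The series is grouped by residues modulo \<open>N\<close>:
  \<open>n N + m = N (m/N + n)\<close>, and the residue 0 drops out because
  \<open>chi 0 = 0\<close>.\<close>

lemma hsum_distribution:
  assumes N: "N > 0" and k: "k \<ge> 2"
    and per: "\<And>n m. chi (n * N + m) = chi m" and chi0: "chi 0 = 0" and bd: "\<And>n. norm (chi n) \<le> 1"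
  shows "(\<Sum>m\<in>{1..<N}. chi m * hsum k (of_real (real m / real N))) = of_nat N ^ k * lval chi k"
proof -
  have "(\<lambda>n. chi (Suc n) / of_nat (Suc n) ^ k) sums lval chi k"
    unfolding lval_def by (rule summable_sums[OF summable_lval[OF bd k]])
  hence "(\<lambda>n. chi n / of_nat n ^ k) sums lval chi k"
    using chi0 by (subst (asm) sums_Suc_iff) simp
  from sums_group[OF this N]
  have "(\<lambda>n. \<Sum>i = n * N..<n * N + N. chi i / of_nat i ^ k) sums lval chi k" .
  also have "(\<lambda>n. \<Sum>i = n * N..<n * N + N. chi i / of_nat i ^ k) =
     (\<lambda>n. \<Sum>m\<in>{1..<N}. chi m * (inverse (of_nat N ^ k) * inverse ((of_real (real m / real N) + of_nat n) ^ k)))"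
  proof
    fix n
    have "(\<Sum>i = n * N..<n * N + N. chi i / of_nat i ^ k) = (\<Sum>m=0..<N. chi (m + n * N) / of_nat (m + n * N) ^ k)"
      by (subst sum.shift_bounds_nat_ivl[symmetric]) (simp add: add.commute)
    also have "\<dots> = (\<Sum>m=0..<N. chi m / of_nat (m + n * N) ^ k)"
      using per[of n] by (simp add: add.commute)
    also have "\<dots> = (\<Sum>m\<in>{1..<N}. chi m / of_nat (m + n * N) ^ k)"
      using N chi0 by (subst sum.atLeast_Suc_lessThan) auto
    also have "\<dots> = (\<Sum>m\<in>{1..<N}. chi m * (inverse (of_nat N ^ k) * inverse ((of_real (real m / real N) + of_nat n) ^ k)))"
    proof (intro sum.cong refl)
      fix m
      have "(of_nat (m + n * N) :: complex) = of_nat N * (of_real (real m / real N) + of_nat n)"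
        using N by (simp add: field_simps)
      thus "chi m / of_nat (m + n * N) ^ k = chi m * (inverse (of_nat N ^ k) * inverse ((of_real (real m / real N) + of_nat n) ^ k))"
        by (simp only: power_mult_distrib divide_inverse inverse_mult_distrib)
    qed
    finally show "(\<Sum>i = n * N..<n * N + N. chi i / of_nat i ^ k) =
      (\<Sum>m\<in>{1..<N}. chi m * (inverse (of_nat N ^ k) * inverse ((of_real (real m / real N) + of_nat n) ^ k)))" .
  qed
  finally have 1: "(\<lambda>n. \<Sum>m\<in>{1..<N}. chi m * (inverse (of_nat N ^ k) * inverse ((of_real (real m / real N) + of_nat n) ^ k))) sums lval chi k" .
  have 2: "(\<lambda>n. \<Sum>m\<in>{1..<N}. chi m * (inverse (of_nat N ^ k) * inverse ((of_real (real m / real N) + of_nat n) ^ k))) sums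
     (\<Sum>m\<in>{1..<N}. chi m * (inverse (of_nat N ^ k) * hsum k (of_real (real m / real N))))"
  proof (intro sums_sum sums_mult)
    fix m assume "m \<in> {1..<N}"
    hence "complex_of_real (real m / real N) \<noteq> 0" by simp
    from summable_sums[OF summable_hsum[OF this k]]
    show "(\<lambda>n. inverse ((of_real (real m / real N) + of_nat n) ^ k)) sums hsum k (of_real (real m / real N))"
      by (simp add: hsum_def)
  qed
  have "lval chi k = (\<Sum>m\<in>{1..<N}. chi m * (inverse (of_nat N ^ k) * hsum k (of_real (real m / real N))))"
    by (rule sums_unique2[OF 1 2])
  also have "\<dots> = inverse (of_nat N ^ k) * (\<Sum>m\<in>{1..<N}. chi m * hsum k (of_real (real m / real N)))"
    by (simp add: sum_distrib_left mult_ac)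
  finally show ?thesis using N by simp
qed

text \<open>The hypothesis \<open>gauss\<close>, divided by \<open>\<tau>\<close>, is the Fourier
  expansion of \<open>chi\<close> in terms of \<open>chi\<close> itself, and
  \<open>lerch_at_neg\<close> evaluates each mode.\<close>

theorem dirichlet_continuation_functional:
  assumes N: "N \<ge> 2" and k: "k \<ge> 2" and tau: "\<tau> \<noteq> 0"
    and per: "\<And>n m. chi (n * N + m) = chi m" and chi0: "chi 0 = 0" and bd: "\<And>n. norm (chi n) \<le> 1"
    and gauss: "\<And>n. (\<Sum>m\<in>{1..<N}. chi m * rt N m ^ n) = chi n * \<tau>"
    and parity: "\<And>m. m \<in> {1..<N} \<Longrightarrow> chi (N - m) = (-1) ^ k * chi m"
  shows "dirichlet_continuation chi (1 - of_nat k) =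
    2 * (-1) ^ k * fact (k - 1) * of_nat N ^ k / (\<tau> * (2 * of_real pi * \<i>) ^ k) * lval chi k"
proof -
  have s: "(1 - of_nat k :: complex) \<noteq> 1" using k by simp
  define h where "h m = hsum k (of_real (real m / real N))" for m
  define K where "K = fact (k - 1) / (2 * of_real pi * \<i>) ^ k"
  have "dirichlet_continuation chi (1 - of_nat k) = (\<Sum>m\<in>{1..<N}. chi m / \<tau> * lerch (rt N m) (1 - of_nat k))"
  proof (rule dirichlet_continuation_fourier[OF N _ s])
    fix n show "chi (Suc n) = (\<Sum>m\<in>{1..<N}. chi m / \<tau> * rt N m ^ Suc n)"
      using gauss[of "Suc n"] tau by (simp add: sum_divide_distrib[symmetric] del: power_Suc)
  qed
  also have "\<dots> = (\<Sum>m\<in>{1..<N}. chi m / \<tau> * (K * (h (N - m) + (-1) ^ k * h m)))"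
  proof (intro sum.cong refl)
    fix m assume m: "m \<in> {1..<N}"
    hence "rt N m = exp (2 * of_real pi * \<i> * of_real (real m / real N))" by (simp add: rt_def)
    moreover have "0 < real m / real N" "real m / real N < 1" using m by auto
    ultimately have "lerch (rt N m) (1 - of_nat k) = K * (hsum k (1 - of_real (real m / real N)) + (-1) ^ k * h m)"
      unfolding h_def K_def using lerch_at_neg[OF _ _ k] by metis
    also have "1 - of_real (real m / real N) = complex_of_real (real (N - m) / real N)"
      using m by (simp add: of_nat_diff field_simps)
    finally show "chi m / \<tau> * lerch (rt N m) (1 - of_nat k) = chi m / \<tau> * (K * (h (N - m) + (-1) ^ k * h m))"
      by (simp add: h_def)
  qed
  also have "\<dots> = K / \<tau> * ((\<Sum>m\<in>{1..<N}. chi m * h (N - m)) + (-1) ^ k * (\<Sum>m\<in>{1..<N}. chi m * h m))"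
    by (simp add: sum_distrib_left algebra_simps sum.distrib add_divide_distrib)
  \<comment> \<open>The reflection \<open>m \<mapsto> N - m\<close> and the parity of
    \<open>chi\<close> make this sum a copy of the other one; hence the factor 2.\<close>
  also have "(\<Sum>m\<in>{1..<N}. chi m * h (N - m)) = (\<Sum>m\<in>{1..<N}. chi (N - m) * h m)"
    by (rule sum.reindex_bij_witness[of _ "\<lambda>m. N - m" "\<lambda>m. N - m"]) auto
  also have "\<dots> = (-1) ^ k * (\<Sum>m\<in>{1..<N}. chi m * h m)"
    by (simp add: parity sum_distrib_left mult_ac)
  also have "(\<Sum>m\<in>{1..<N}. chi m * h m) = of_nat N ^ k * lval chi k"
    unfolding h_def by (rule hsum_distribution) (use N k per chi0 bd in auto)
  finally show ?thesis by (simp add: K_def field_simps)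
qed

text \<open>
  Multiplying the zeta series by \<open>N^(1-s) - 1\<close> gives the sum of the Lerch series over the nontrivial
  \<open>N\<close>-th roots of unity. The factors for \<open>N = 2\<close> and \<open>N = 3\<close> have only the zero \<open>s = 1\<close> in common.
\<close>

definition bz :: "nat \<Rightarrow> complex \<Rightarrow> complex" where
  "bz N s = (\<Sum>m\<in>{1..<N}. lerch (rt N m) s)"

definition qz :: "nat \<Rightarrow> complex \<Rightarrow> complex" where
  "qz N s = of_nat N powr (1 - s) - 1"

lemma summable_Suc_powr_complex: "Re s > 1 \<Longrightarrow> summable (\<lambda>n. 1 / of_nat (Suc n) powr s :: complex)"
proof (rule summable_comparison_test'[where N = 0])
  assume s: "Re s > 1"
  show "summable (\<lambda>n. real (Suc n) powr - Re s)" by (rule summable_Suc_powr) (use s in auto)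
  show "norm (1 / of_nat (Suc n) powr s) \<le> real (Suc n) powr - Re s" for n
    using norm_powr_real_powr[of "of_nat (Suc n)" s]
    by (simp add: norm_divide powr_minus field_simps del: of_nat_Suc)
qed

lemma rt_ne_1: "m \<in> {1..<N} \<Longrightarrow> rt N m \<noteq> 1"
  using rt_eq_1_iff[of N m] nat_dvd_not_less[of m N] by auto

lemma holomorphic_bz: "bz N holomorphic_on A"
  unfolding bz_def by (intro holomorphic_intros holomorphic_lerch rt_ne_1) auto

text \<open>The nontrivial \<open>N\<close>-th roots of unity have \<open>n\<close>-th powers
  summing to \<open>N - 1\<close> if \<open>N\<close> divides \<open>n\<close> and to
  \<open>-1\<close> otherwise; the multiples of \<open>N\<close> reproduce the whole series with the
  factor \<open>N^(1-s)\<close>.\<close>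

lemma bz_eq:
  assumes N: "N \<ge> 2" and s: "Re s > 1" and z: "(\<lambda>n. 1 / of_nat (Suc n) powr s) sums z"
  shows "bz N s = qz N s * z"
proof -
  have "(\<lambda>n. \<Sum>m\<in>{1..<N}. rt N m ^ Suc n / of_nat (Suc n) powr s) sums bz N s"
    unfolding bz_def by (intro sums_sum lerch_sums rt_ne_1 s) auto
  also have "(\<lambda>n. \<Sum>m\<in>{1..<N}. rt N m ^ Suc n / of_nat (Suc n) powr s) =
    (\<lambda>n. (if N dvd Suc n then of_nat N / of_nat (Suc n) powr s else 0) - 1 / of_nat (Suc n) powr s)"
    unfolding sum_divide_distrib[symmetric] using N
    by (subst rt_sum) (auto simp: diff_divide_distrib simp del: power_Suc of_nat_Suc)
  finally have "(\<lambda>n. ((if N dvd Suc n then of_nat N / of_nat (Suc n) powr s else 0) - 1 / of_nat (Suc n) powr s) +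
      1 / of_nat (Suc n) powr s) sums (bz N s + z)"
    by (rule sums_add[OF _ z])
  hence 1: "(\<lambda>n. if N dvd Suc n then of_nat N / of_nat (Suc n) powr s else 0) sums (bz N s + z)" by simp
  define g where "g n = N * Suc n - 1" for n
  have Sg: "Suc (g n) = N * Suc n" for n using N by (simp add: g_def)
  have "strict_mono g" unfolding strict_mono_def g_def using N
    by (metis Suc_mono Suc_pred diff_less_mono le_eq_less_or_eq mult_less_cancel1 mult_pos_pos not_less_eq_eq numeral_2_eq_2 zero_less_Suc less_le_trans One_nat_def Suc_leI)
  moreover have "(if N dvd Suc n then of_nat N / of_nat (Suc n) powr s else 0) = 0" if "n \<notin> range g" for n
  proof -
    have "\<not> N dvd Suc n"
    proof
      assume "N dvd Suc n"
      then obtain j where j: "Suc n = N * j" by (elim dvdE)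
      hence "j > 0" by (intro Nat.gr0I) auto
      then obtain i where "j = Suc i" by (cases j) auto
      hence "n = g i" using j by (simp add: g_def)
      thus False using that by auto
    qed
    thus ?thesis by simp
  qed
  ultimately have "(\<lambda>n. if N dvd Suc (g n) then of_nat N / of_nat (Suc (g n)) powr s else 0) sums (bz N s + z)"
    using 1 sums_mono_reindex[of g "\<lambda>n. if N dvd Suc n then of_nat N / of_nat (Suc n) powr s else 0"] by blast
  also have "(\<lambda>n. if N dvd Suc (g n) then of_nat N / of_nat (Suc (g n)) powr s else 0) =
     (\<lambda>n. of_nat N powr (1 - s) * (1 / of_nat (Suc n) powr s))"
  proof
    fix n
    have "of_nat (N * Suc n) powr s = of_nat N powr s * (of_nat (Suc n) :: complex) powr s"
      unfolding of_nat_mult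
      by (metis of_nat_0_le_iff of_real_of_nat_eq powr_times_real_left powr_times_real powr_of_real of_real_mult Reals_of_nat Re_complex_of_real)
    thus "(if N dvd Suc (g n) then of_nat N / of_nat (Suc (g n)) powr s else 0) =
      of_nat N powr (1 - s) * (1 / of_nat (Suc n) powr s)"
      unfolding Sg using N by (simp add: powr_diff del: of_nat_Suc of_nat_mult)
  qed
  finally have "bz N s + z = of_nat N powr (1 - s) * z"
    using sums_mult[OF z, of "of_nat N powr (1 - s)"] by (rule sums_unique2)
  thus ?thesis by (simp add: qz_def algebra_simps)
qed

lemma holomorphic_qz: "N > 0 \<Longrightarrow> qz N holomorphic_on A"
  unfolding qz_def by (intro holomorphic_intros) auto

text \<open>A common zero other than 1 would make \<open>ln 2\<close> and \<open>ln 3\<close>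
  commensurable, so that some positive power of 2 would equal a positive power of 3.\<close>

lemma qz_zero_imp: "qz 2 s = 0 \<Longrightarrow> qz 3 s = 0 \<Longrightarrow> s = 1"
proof (rule ccontr)
  assume q: "qz 2 s = 0" "qz 3 s = 0" and s: "s \<noteq> 1"
  have "exp ((1 - s) * of_real (ln 2)) = 1" "exp ((1 - s) * of_real (ln 3)) = 1"
    using q Ln_of_real[of 2] Ln_of_real[of 3] by (simp_all add: qz_def powr_def)
  then obtain n m :: int where nm: "Re (1 - s) * ln 2 = 0" "Im (1 - s) * ln 2 = of_int (2 * n) * pi"
     "Im (1 - s) * ln 3 = of_int (2 * m) * pi"
    unfolding exp_eq_1 by auto
  define t where "t = Im (1 - s)"
  have t: "t \<noteq> 0" using s nm(1) by (auto simp: t_def complex_eq_iff)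
  have n0: "n \<noteq> 0" "m \<noteq> 0" using nm t by (auto simp: t_def)
  have "t * (of_int m * ln 2) = of_int m * (t * ln 2)" by simp
  also have "\<dots> = of_int n * (t * ln 3)"
    unfolding t_def nm(2) nm(3) by simp
  finally have "t * (of_int m * ln 2) = t * (of_int n * ln 3)" by simp
  hence "of_int m * ln 2 = of_int n * ln (3::real)" using t by simp
  hence "\<bar>of_int m * ln 2\<bar> = \<bar>of_int n * ln (3::real)\<bar>" by simp
  hence "real (nat \<bar>m\<bar>) * ln 2 = real (nat \<bar>n\<bar>) * ln 3" by (simp add: abs_mult)
  hence "ln ((2::real) ^ nat \<bar>m\<bar>) = ln (3 ^ nat \<bar>n\<bar>)" by (simp add: ln_realpow)
  hence "(2::real) ^ nat \<bar>m\<bar> = 3 ^ nat \<bar>n\<bar>" by simp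
  hence "(2::nat) ^ nat \<bar>m\<bar> = 3 ^ nat \<bar>n\<bar>"
    by (metis of_nat_eq_iff of_nat_numeral of_nat_power)
  moreover have "even ((2::nat) ^ nat \<bar>m\<bar>)" using n0 by simp
  moreover have "odd ((3::nat) ^ nat \<bar>n\<bar>)" by simp
  ultimately show False by metis
qed

definition zf :: "complex \<Rightarrow> complex" where
  "zf s = (if qz 2 s \<noteq> 0 then bz 2 s / qz 2 s else bz 3 s / qz 3 s)"

text \<open>For \<open>Re w > 1\<close> both sides are \<open>qz 2 w * qz 3 w\<close> times zeta;
  continuation extends this to the plane, so the two quotients in \<open>zf\<close> agree where both
  make sense.\<close>

lemma bz_qz_cross: "bz 2 s * qz 3 s = bz 3 s * qz 2 s"
proof (rule analytic_continuation_open[of "{w. Re w > 1}" UNIV "\<lambda>s. bz 2 s * qz 3 s" "\<lambda>s. bz 3 s * qz 2 s" s])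
  show "open {w. Re w > 1}" by (rule open_halfspace_Re_gt)
  show "{w. Re w > 1} \<noteq> {}" by (auto intro: exI[of _ 2])
  fix z assume "z \<in> {w. Re w > 1}"
  hence z: "Re z > 1" by simp
  note S = summable_sums[OF summable_Suc_powr_complex[OF z]]
  show "bz 2 z * qz 3 z = bz 3 z * qz 2 z"
    using bz_eq[of 2, OF _ z S] bz_eq[of 3, OF _ z S] by simp
qed (auto intro!: holomorphic_intros holomorphic_bz holomorphic_qz)

lemma holomorphic_zf: "zf holomorphic_on (- {1})"
proof -
  have op: "open {s. qz N s \<noteq> 0}" if "N > 0" for N
    using open_Collect_neq[of "qz N" "\<lambda>_. 0"] holomorphic_on_imp_continuous_on[OF holomorphic_qz[OF that]] by auto
  have "zf field_differentiable at s" if "s \<noteq> 1" for s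
  proof (cases "qz 2 s = 0")
    case False
    have "zf holomorphic_on {s. qz 2 s \<noteq> 0}"
      by (rule holomorphic_transform[of "\<lambda>s. bz 2 s / qz 2 s"])
        (auto intro!: holomorphic_intros holomorphic_bz holomorphic_qz simp: zf_def)
    thus ?thesis using False op[of 2] holomorphic_on_imp_differentiable_at by auto
  next
    case True
    hence 3: "qz 3 s \<noteq> 0" using qz_zero_imp that by blast
    have "zf holomorphic_on {s. qz 3 s \<noteq> 0}"
      by (rule holomorphic_transform[of "\<lambda>s. bz 3 s / qz 3 s"])
        (auto intro!: holomorphic_intros holomorphic_bz holomorphic_qz simp: zf_def field_simps bz_qz_cross)
    thus ?thesis using 3 op[of 3] holomorphic_on_imp_differentiable_at by auto
  qed
  thus ?thesis by (auto simp: holomorphic_on_def intro: field_differentiable_at_within)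
qed

lemma zeta_eq_zf: "s \<noteq> 1 \<Longrightarrow> zeta s = zf s"
  unfolding zeta_def
proof (rule dirichlet_continuation_eqI[OF holomorphic_zf])
  fix w :: complex assume w: "Re w > 1"
  note S = summable_sums[OF summable_Suc_powr_complex[OF w]]
  have "w \<noteq> 1" using w by auto
  hence "zf w = (\<Sum>n. 1 / of_nat (Suc n) powr w)"
    using bz_eq[of 2, OF _ w S] bz_eq[of 3, OF _ w S] qz_zero_imp[of w] by (auto simp: zf_def)
  thus "(\<lambda>n. 1 / of_nat (Suc n) powr w) sums zf w" using S by simp
qed

text \<open>For \<open>N = 2\<close> the only nontrivial root of unity is \<open>-1\<close>, that is
  \<open>x = 1/2\<close>. Evenness of \<open>K\<close> merges the two Hurwitz terms, and the factor
  \<open>2^K - 1\<close> from \<open>qz 2\<close> cancels the one in the Hurwitz sum at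
  \<open>1/2\<close>.\<close>

theorem zeta_functional:
  assumes K: "even K" "K \<ge> 2"
  shows "zeta (1 - of_nat K) = 2 * fact (K - 1) / (2 * of_real pi * \<i>) ^ K * lval (\<lambda>_. 1) K"
proof -
  define Z where "Z = lval (\<lambda>_. 1) K"
  have q: "qz 2 (1 - of_nat K) = 2 ^ K - 1" by (simp add: qz_def powr_nat)
  have "(2::complex) ^ K \<noteq> 1"
  proof
    assume "(2::complex) ^ K = 1"
    hence "norm ((2::complex) ^ K) = 1" by simp
    hence "(2::real) ^ K = 1" by (simp add: norm_power)
    thus False using K one_less_power[of "2::real" K] by simp
  qed
  hence q0: "(2 ^ K - 1 :: complex) \<noteq> 0" by simp
  have "zeta (1 - of_nat K) = bz 2 (1 - of_nat K) / (2 ^ K - 1)"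
    using K q q0 by (subst zeta_eq_zf) (auto simp: zf_def)
  also have "bz 2 (1 - of_nat K) = lerch (rt 2 1) (1 - of_nat K)"
  proof -
    have "{1..<2::nat} = {1}" by auto
    thus ?thesis by (simp add: bz_def)
  qed
  also have "rt 2 1 = exp (2 * of_real pi * \<i> * of_real (1/2))" by (simp add: rt_def)
  also have "lerch \<dots> (1 - of_nat K) = fact (K - 1) / (2 * of_real pi * \<i>) ^ K * (2 * hsum K (1/2))"
    using lerch_at_neg[of "1/2" K] K by simp
  also have "hsum K (1/2) = (2 ^ K - 1) * Z"
  proof -
    have S: "(\<lambda>n. 1 / of_nat (Suc n) ^ K) sums Z"
      unfolding Z_def lval_def using summable_sums[OF summable_lval[of "\<lambda>_. 1" K]] K by simp
    from sums_group[OF this, of 2]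
    have "(\<lambda>n. \<Sum>i\<in>{n * 2..<n * 2 + 2}. 1 / of_nat (Suc i) ^ K) sums Z" by simp
    hence 1: "(\<lambda>n. 1 / of_nat (2 * n + 1) ^ K + 1 / of_nat (2 * Suc n) ^ K) sums Z"
      by (simp add: atLeastLessThanSuc numeral_2_eq_2 mult.commute add_ac del: of_nat_Suc of_nat_mult)
    have 2: "(\<lambda>n. 1 / of_nat (2 * Suc n) ^ K) sums (1 / 2 ^ K * Z)"
      using sums_mult[OF S, of "1 / 2 ^ K"] by (simp add: power_mult_distrib del: of_nat_Suc mult_Suc_right)
    have 3: "(\<lambda>n. 1 / of_nat (2 * n + 1) ^ K) sums (Z - 1 / 2 ^ K * Z)"
      using sums_diff[OF 1 2] by simp
    have "(\<lambda>n. 2 ^ K * (1 / of_nat (2 * n + 1) ^ K)) sums (2 ^ K * (Z - 1 / 2 ^ K * Z))"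
      by (rule sums_mult[OF 3])
    moreover have "2 ^ K * (1 / of_nat (2 * n + 1) ^ K) = inverse ((1/2 + of_nat n :: complex) ^ K)" for n
    proof -
      have "(of_nat (2 * n + 1) :: complex) = 2 * (1/2 + of_nat n)" by (simp add: field_simps)
      thus ?thesis by (simp only: power_mult_distrib) (simp add: field_simps)
    qed
    ultimately have "hsum K (1/2) = 2 ^ K * (Z - 1 / 2 ^ K * Z)"
      unfolding hsum_def by (simp add: sums_iff)
    thus ?thesis by (simp add: algebra_simps)
  qed
  finally show ?thesis using q0 by (simp add: Z_def)
qed

section \<open>Quadratic Gauss sums\<close>

definition ee :: "real \<Rightarrow> complex" where
  "ee r = exp (2 * of_real pi * \<i> * of_real r)"

lemma ee_add: "ee (r + s) = ee r * ee s"
  by (simp add: ee_def exp_add[symmetric] algebra_simps)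

lemma ee_of_int [simp]: "ee (of_int n) = 1"
  unfolding ee_def exp_eq_1 by (auto intro: exI[of _ n])

lemma ee_0 [simp]: "ee 0 = 1"
  by (simp add: ee_def)

lemma norm_ee [simp]: "norm (ee r) = 1"
  by (simp add: ee_def)

lemma ee_neq_0 [simp]: "ee r \<noteq> 0"
  by (simp add: ee_def)

lemma ee_cis: "ee r = cis (2 * pi * r)"
  by (simp add: ee_def cis_conv_exp mult_ac)

lemma ee_periodic: "ee (r + of_int n) = ee r"
  by (simp add: ee_add)

lemma ee_frac_cong:
  fixes N :: int
  assumes "N > 0" "[x = y] (mod N)" shows "ee (of_int x / of_int N) = ee (of_int y / of_int N)"
proof -
  from assms obtain k where "x = y + N * k" by (metis cong_iff_lin cong_sym)
  hence "real_of_int x / of_int N = of_int y / of_int N + of_int k" using assms by (simp add: field_simps)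
  thus ?thesis by (simp only: ee_periodic)
qed

lemma ee_power: "ee r ^ n = ee (of_nat n * r)"
  unfolding ee_def exp_of_nat_mult[symmetric] by (simp add: mult_ac)

lemma sum_ee:
  fixes N n :: int
  assumes "N > 0"
  shows "(\<Sum>x\<in>{0..<N}. ee (of_int (x * n) / of_int N)) = (if N dvd n then of_int N else 0)"
proof (cases "N dvd n")
  case True
  hence "ee (of_int (x * n) / of_int N) = 1" for x
    using ee_frac_cong[OF assms, of "x * n" 0] by (simp add: cong_0_iff)
  thus ?thesis using True assms by simp
next
  case False
  define f where "f x = ee (of_int (x * n) / of_int N)" for x
  have per: "f (x + N) = f x" for x
    unfolding f_def by (rule ee_frac_cong[OF assms]) (simp add: cong_def ring_distribs)
  have "(\<Sum>x\<in>{0..<N}. f (1 * x + 1)) = (\<Sum>x\<in>{0..<N}. f x)"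
    by (rule sum_residue_affine[where f = f and n = N, OF per assms]) auto
  moreover have "f (1 * x + 1) = f x * ee (of_int n / of_int N)" for x
    unfolding f_def ee_add[symmetric] by (simp add: ring_distribs add_divide_distrib)
  ultimately have "(\<Sum>x\<in>{0..<N}. f x) * ee (of_int n / of_int N) = (\<Sum>x\<in>{0..<N}. f x)"
    by (simp add: sum_distrib_right)
  moreover have "ee (of_int n / of_int N) \<noteq> 1"
  proof
    assume "ee (of_int n / of_int N) = 1"
    then obtain k where "Im (2 * of_real pi * \<i> * of_real (of_int n / of_int N)) = of_int (2 * k) * pi"
      unfolding ee_def exp_eq_1 by blast
    hence "(2 * pi) * (of_int n / of_int N) = (2 * pi) * of_int k" by simp
    hence "real_of_int n / of_int N = of_int k" by (subst (asm) mult_left_cancel) auto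
    hence "real_of_int n = of_int (k * N)" using assms by (simp add: field_simps)
    hence "n = k * N" by linarith
    thus False using False by simp
  qed
  ultimately have "(\<Sum>x\<in>{0..<N}. f x) = 0" by (metis mult_cancel_left1 mult.commute)
  thus ?thesis using False by (simp add: f_def)
qed

lemma coprime_primesI:
  fixes a b :: int
  assumes "b \<noteq> 0" "\<And>p. prime p \<Longrightarrow> p dvd a \<Longrightarrow> p dvd b \<Longrightarrow> False"
  shows "coprime a b"
proof (rule ccontr)
  assume "\<not> coprime a b"
  hence "\<not> is_unit (gcd a b)" by (simp add: coprime_iff_gcd_eq_1)
  moreover have "gcd a b \<noteq> 0" using assms(1) by simp
  ultimately obtain p where "p dvd gcd a b" "prime p" using prime_divisor_exists by blast
  thus False using assms(2)[of p] by simp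
qed

lemma prime_disc_coprime:
  assumes "prime_disc q" "prime_disc r" "base_prime q \<noteq> base_prime r" shows "coprime q r"
proof (rule coprime_primesI)
  fix p assume p: "prime p" "p dvd q" "p dvd r"
  have *: "p = base_prime s" if "prime_disc s" "p dvd s" for s
    using kronecker_prime_prime_disc[OF that(1) p(1)] that(2)
    using kronecker_prime_eq_0_iff[of s p] psi_eq_0_iff[of s p] primes_dvd_imp_eq[OF prime_base_prime[OF that(1)] p(1)]
    by auto
  show False using *[OF assms(1) p(2)] *[OF assms(2) p(3)] assms(3) by simp
qed (use assms prime_disc_nz in auto)

lemma base_prime_dvd: "prime_disc q \<Longrightarrow> base_prime q dvd q"
  by (auto simp: base_prime_def)

lemma prime_dvd_prime_disc:
  assumes "prime_disc q" "prime p" "p dvd q" shows "p = base_prime q"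
  using kronecker_prime_prime_disc[OF assms(1,2)] kronecker_prime_eq_0_iff[of q p] psi_eq_0_iff[of q p]
    primes_dvd_imp_eq[OF prime_base_prime[OF assms(1)] assms(2)] assms(3) by auto

lemma psi_per: "prime_disc q \<Longrightarrow> psi q (x + \<bar>q\<bar>) = psi q x"
  by (rule psi_cong) (auto simp: cong_iff_dvd_diff)

text \<open>By \<open>kronecker_prime_prime_disc\<close> the first factor is \<open>psi r q\<close>,
  so the product is \<open>psi r (q |q|)\<close>, which is \<open>psi r (sgn q)\<close> up to a
  square. Stated with absolute values, the sign depends only on the signs of \<open>q\<close> and
  \<open>r\<close>.\<close>

lemma psi_reciprocity_aux:
  assumes q: "prime_disc q" and r: "prime_disc r" "odd r" and ne: "base_prime q \<noteq> base_prime r"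
  shows "psi q \<bar>r\<bar> * psi r \<bar>q\<bar> = (if q < 0 \<and> r < 0 then -1 else 1)"
proof -
  note o = prime_disc_odd[OF r]
  have "base_prime r = \<bar>r\<bar>" using r by (simp add: base_prime_def)
  have ndvd: "\<not> \<bar>r\<bar> dvd q"
  proof
    assume "\<bar>r\<bar> dvd q"
    hence "\<bar>r\<bar> = base_prime q" by (rule prime_dvd_prime_disc[OF q o(1)])
    thus False using ne \<open>base_prime r = \<bar>r\<bar>\<close> by simp
  qed
  have "psi q \<bar>r\<bar> = kronecker_prime q \<bar>r\<bar>" by (rule kronecker_prime_prime_disc[OF q o(1), symmetric])
  also have "\<dots> = psi r q" using o(3) r(2) by (simp add: kronecker_prime_def psi_def)
  finally have "psi q \<bar>r\<bar> * psi r \<bar>q\<bar> = psi r (q * \<bar>q\<bar>)" by (simp add: psi_mult[OF r(1)])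
  also have "q * \<bar>q\<bar> = (sgn q * q) * q" by (simp add: sgn_if)
  also have "psi r ((sgn q * q) * q) = psi r (sgn q) * (psi r q * psi r q)" by (simp add: psi_mult[OF r(1)])
  also have "psi r q * psi r q = 1" using psi_square[of r q] ndvd \<open>base_prime r = \<bar>r\<bar>\<close> by simp
  also have "psi r (sgn q) = (if q < 0 \<and> r < 0 then -1 else 1)"
    using psi_one[OF r(1)] psi_minus_one[OF r(1)] prime_disc_nz[OF q] prime_disc_nz[OF r(1)] by (auto simp: sgn_if)
  finally show ?thesis by simp
qed

lemma psi_reciprocity:
  assumes "prime_disc q" "prime_disc r" "base_prime q \<noteq> base_prime r"
  shows "psi q \<bar>r\<bar> * psi r \<bar>q\<bar> = (if q < 0 \<and> r < 0 then -1 else 1)"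
proof (cases "odd r")
  case True thus ?thesis using psi_reciprocity_aux assms by blast
next
  case False
  hence "odd q" using assms(3) by (auto simp: base_prime_def)
  from psi_reciprocity_aux[OF assms(2,1) this] assms(3) show ?thesis by (auto simp: mult.commute)
qed

lemma card_square_roots:
  fixes p :: int
  assumes p: "prime p" "p > 2"
  shows "int (card {y\<in>{0..<p}. [y\<^sup>2 = x] (mod p)}) = 1 + Legendre x p"
proof (cases "[x = 0] (mod p)")
  case True
  have "{y\<in>{0..<p}. [y\<^sup>2 = x] (mod p)} = {0}"
  proof -
    have "y = 0" if "0 \<le> y" "y < p" "[y\<^sup>2 = x] (mod p)" for y
    proof -
      have "p dvd y\<^sup>2" using that(3) True by (metis cong_0_iff cong_trans)
      hence "p dvd y" using p prime_dvd_power by blast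
      thus ?thesis using that zdvd_imp_le[of p y] by force
    qed
    thus ?thesis using True p by (auto simp: cong_sym)
  qed
  thus ?thesis using True by (simp add: Legendre_def)
next
  case nz: False
  show ?thesis
  proof (cases "QuadRes p x")
    case True
    then obtain z where z: "[z\<^sup>2 = x] (mod p)" by (auto simp: QuadRes_def)
    define y where "y = z mod p"
    have y: "[y\<^sup>2 = x] (mod p)" "0 \<le> y" "y < p" using z p by (auto simp: y_def cong_def power_mod)
    have y0: "y \<noteq> 0" using y nz by (auto simp: cong_sym_eq)
    have "{w\<in>{0..<p}. [w\<^sup>2 = x] (mod p)} = {y, p - y}"
    proof -
      have "w = y \<or> w = p - y" if "0 \<le> w" "w < p" "[w\<^sup>2 = x] (mod p)" for w
      proof -
        have "[w\<^sup>2 = y\<^sup>2] (mod p)" using that y by (metis cong_sym cong_trans)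
        hence "p dvd (w - y) * (w + y)" by (simp add: cong_iff_dvd_diff power2_eq_square algebra_simps)
        hence "p dvd w - y \<or> p dvd w + y" using p prime_dvd_mult_iff by blast
        thus ?thesis
        proof
          assume "p dvd w - y"
          hence "w - y = 0" using dvd_imp_le_int[of "w - y" p] that y by fastforce
          thus ?thesis by simp
        next
          assume "p dvd w + y"
          then obtain k where k: "w + y = p * k" by (elim dvdE)
          have "0 < p * k" "p * k < p * 2" using that y y0 k by linarith+
          hence "0 < k" "k < 2" using p by (auto simp: zero_less_mult_iff)
          hence "k = 1" by simp
          thus ?thesis using k by simp
        qed
      qed
      moreover have "[(p - y)\<^sup>2 = x] (mod p)"
      proof -
        have "[(p - y)\<^sup>2 = y\<^sup>2] (mod p)" by (simp add: cong_iff_dvd_diff power2_eq_square algebra_simps)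
        thus ?thesis using y(1) cong_trans by blast
      qed
      ultimately show ?thesis using y y0 by auto
    qed
    moreover have "y \<noteq> p - y"
    proof
      assume "y = p - y"
      hence "p = 2 * y" by simp
      thus False using p prime_odd_int[of p] by auto
    qed
    ultimately have "card {w\<in>{0..<p}. [w\<^sup>2 = x] (mod p)} = 2" by simp
    thus ?thesis using nz True by (simp add: Legendre_def)
  next
    case False
    hence e: "{w\<in>{0..<p}. [w\<^sup>2 = x] (mod p)} = {}" by (auto simp: QuadRes_def)
    show ?thesis unfolding e using nz False by (simp add: Legendre_def)
  qed
qed

lemma sum_squares_Legendre:
  fixes p :: int and f :: "int \<Rightarrow> 'a :: comm_ring_1"
  assumes p: "prime p" "p > 2" and per: "\<And>x. f (x + p) = f x"
  shows "(\<Sum>y\<in>{0..<p}. f (y\<^sup>2)) = (\<Sum>x\<in>{0..<p}. (1 + of_int (Legendre x p)) * f x)"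
proof -
  have "(\<Sum>y\<in>{0..<p}. f (y\<^sup>2)) = (\<Sum>y\<in>{0..<p}. f (y\<^sup>2 mod p))"
    by (simp add: periodic_mod[of f p, OF per])
  also have "\<dots> = (\<Sum>x\<in>{0..<p}. \<Sum>y\<in>{y\<in>{0..<p}. y\<^sup>2 mod p = x}. f (y\<^sup>2 mod p))"
    by (rule sum.group[symmetric]) (use p in auto)
  also have "\<dots> = (\<Sum>x\<in>{0..<p}. (1 + of_int (Legendre x p)) * f x)"
  proof (intro sum.cong refl)
    fix x assume x: "x \<in> {0..<p}"
    have C: "{y\<in>{0..<p}. y\<^sup>2 mod p = x} = {y\<in>{0..<p}. [y\<^sup>2 = x] (mod p)}" (is "_ = ?C")
      using x by (auto simp: cong_def)
    have "(\<Sum>y\<in>{y\<in>{0..<p}. y\<^sup>2 mod p = x}. f (y\<^sup>2 mod p)) = of_nat (card {y\<in>{0..<p}. y\<^sup>2 mod p = x}) * f x"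
      by simp
    also have "of_nat (card {y\<in>{0..<p}. y\<^sup>2 mod p = x}) = (of_int (int (card ?C)) :: 'a)"
      unfolding C by simp
    also have "\<dots> = 1 + of_int (Legendre x p)" unfolding card_square_roots[OF p] by simp
    finally show "(\<Sum>y\<in>{y\<in>{0..<p}. y\<^sup>2 mod p = x}. f (y\<^sup>2 mod p)) = (1 + of_int (Legendre x p)) * f x" .
  qed
  finally show ?thesis .
qed

lemma sum_Legendre:
  fixes p :: int
  assumes p: "prime p" "p > 2" shows "(\<Sum>x\<in>{0..<p}. Legendre x p) = 0"
  using sum_squares_Legendre[OF p, of "\<lambda>_. 1 :: int"] p by (simp add: sum.distrib)

section \<open>The Gauss sum of a single prime discriminant\<close>

definition gsum :: "int \<Rightarrow> int \<Rightarrow> complex" where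
  "gsum q n = (\<Sum>x\<in>{0..<\<bar>q\<bar>}. of_int (psi q x) * ee (of_int (x * n) / of_int \<bar>q\<bar>))"

lemma gsum_per:
  assumes "prime_disc q"
  shows "of_int (psi q (x + \<bar>q\<bar>)) * ee (of_int ((x + \<bar>q\<bar>) * n) / of_int \<bar>q\<bar>) =
     of_int (psi q x) * ee (of_int (x * n) / of_int \<bar>q\<bar>)"
proof -
  have "ee (of_int ((x + \<bar>q\<bar>) * n) / of_int \<bar>q\<bar>) = ee (of_int (x * n) / of_int \<bar>q\<bar>)"
    by (rule ee_frac_cong) (use prime_disc_nz[OF assms] in \<open>auto simp: cong_iff_dvd_diff algebra_simps\<close>)
  thus ?thesis by (simp add: psi_per[OF assms])
qed

text \<open>The form in which primitivity of the even characters is used: it kills the Gauss sum at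
  even arguments and later cancels pairs of 2-adic roots.\<close>

lemma psi_half_flip:
  assumes q: "prime_disc q" and ev: "even q"
  shows "psi q (x + \<bar>q\<bar> div 2) = - psi q x"
proof -
  define h where "h = \<bar>q\<bar> div 2"
    have "psi q (x + h) = - psi q x"
    proof (cases "even x")
      case True
      have "even h" using prime_disc_even_cases[OF q ev] by (auto simp: h_def)
      thus ?thesis using True ev by (simp add: psi_def)
    next
      case False
      hence x: "x mod 8 = 1 \<or> x mod 8 = 3 \<or> x mod 8 = 5 \<or> x mod 8 = 7" by presburger
      have px: "psi q (x + h) = psi q ((x mod 8) + h)"
        unfolding psi_mod8[OF q ev, of "x + h"] psi_mod8[OF q ev, of "x mod 8 + h"] by (simp add: mod_add_left_eq)
      show ?thesis unfolding px psi_mod8[OF q ev, of x]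
        using x prime_disc_even_cases[OF q ev] by (elim disjE) (simp_all add: psi_def h_def)
    qed
    thus ?thesis by (simp add: h_def)
qed

text \<open>For \<open>n\<close> prime to \<open>q\<close> substitute \<open>n x\<close> for
  \<open>x\<close>. Otherwise the sum vanishes: for even \<open>q\<close> the terms at
  \<open>x\<close> and \<open>x + |q|/2\<close> cancel, for odd \<open>q\<close> the exponential is
  trivial and the Legendre symbols sum to 0.\<close>

lemma gsum_separable:
  assumes q: "prime_disc q"
  shows "gsum q n = of_int (psi q n) * gsum q 1"
proof (cases "base_prime q dvd n")
  case False
  have co: "coprime n \<bar>q\<bar>"
  proof (rule coprime_primesI)
    fix p assume "prime p" "p dvd n" "p dvd \<bar>q\<bar>"
    thus False using prime_dvd_prime_disc[OF q, of p] False by simp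
  qed (use prime_disc_nz[OF q] in auto)
  define f where "f x = of_int (psi q x) * ee (of_int (x * 1) / of_int \<bar>q\<bar>)" for x
  have "gsum q 1 = (\<Sum>x\<in>{0..<\<bar>q\<bar>}. f x)" by (simp add: gsum_def f_def)
  also have "\<dots> = (\<Sum>x\<in>{0..<\<bar>q\<bar>}. f (n * x + 0))"
    unfolding f_def using prime_disc_nz[OF q] co
    by (intro sum_residue_affine[symmetric] gsum_per[OF q]) auto
  also have "\<dots> = of_int (psi q n) * gsum q n"
    by (simp add: f_def gsum_def psi_mult[OF q] sum_distrib_left mult_ac)
  finally have "of_int (psi q n) * gsum q 1 = (of_int (psi q n * psi q n) :: complex) * gsum q n" by simp
  thus ?thesis unfolding psi_square[OF False] by simp
next
  case True
  hence p0: "psi q n = 0" by (simp add: psi_eq_0_iff)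
  have "gsum q n = 0"
  proof (cases "even q")
    case ev: True
    have n2: "even n" using True ev by (simp add: base_prime_def)
    define h where "h = \<bar>q\<bar> div 2"
    have q2: "\<bar>q\<bar> = 2 * h" using ev by (simp add: h_def)
    have flip: "psi q (x + h) = - psi q x" for x
      unfolding h_def by (rule psi_half_flip[OF q ev])
    define f where "f x = of_int (psi q x) * ee (of_int (x * n) / of_int \<bar>q\<bar>)" for x
    have "(\<Sum>x\<in>{0..<\<bar>q\<bar>}. f (1 * x + h)) = (\<Sum>x\<in>{0..<\<bar>q\<bar>}. f x)"
      unfolding f_def using prime_disc_nz[OF q] by (intro sum_residue_affine gsum_per[OF q]) auto
    moreover have "f (1 * x + h) = - f x" for x
    proof -
      obtain j where j: "n = 2 * j" using n2 by (elim evenE)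
      have "ee (of_int ((x + h) * n) / of_int \<bar>q\<bar>) = ee (of_int (x * n) / of_int \<bar>q\<bar>)"
      proof (rule ee_frac_cong)
        show "\<bar>q\<bar> > 0" using prime_disc_nz[OF q] by simp
        have "(x + h) * n - x * n = \<bar>q\<bar> * j" unfolding j q2 by (simp add: algebra_simps)
        thus "[(x + h) * n = x * n] (mod \<bar>q\<bar>)" by (simp add: cong_iff_dvd_diff)
      qed
      thus ?thesis by (simp add: f_def flip)
    qed
    ultimately have "- (\<Sum>x\<in>{0..<\<bar>q\<bar>}. f x) = (\<Sum>x\<in>{0..<\<bar>q\<bar>}. f x)" by (simp add: sum_negf)
    thus ?thesis by (simp add: gsum_def f_def)
  next
    case False
    note o = prime_disc_odd[OF q False]
    have "\<bar>q\<bar> dvd n" using True False by (simp add: base_prime_def)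
    hence "ee (of_int (x * n) / of_int \<bar>q\<bar>) = 1" for x
      using ee_frac_cong[of "\<bar>q\<bar>" "x * n" 0] o by (simp add: cong_0_iff)
    hence "gsum q n = of_int (\<Sum>x\<in>{0..<\<bar>q\<bar>}. Legendre x \<bar>q\<bar>)"
      using False by (simp add: gsum_def psi_def)
    thus ?thesis using sum_Legendre[OF o(1,3)] by simp
  qed
  thus ?thesis using p0 by simp
qed

text \<open>Separability rewrites \<open>psi q x * gsum q 1\<close> as \<open>gsum q x\<close>;
  after exchanging the sums, orthogonality leaves only the residue \<open>-1\<close>.\<close>

lemma gsum_square:
  assumes q: "prime_disc q" "odd q"
  shows "gsum q 1 * gsum q 1 = of_int (psi q (-1) * \<bar>q\<bar>)"
proof -
  have p0: "\<bar>q\<bar> > 0" using prime_disc_nz[OF q(1)] by simp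
  note o = prime_disc_odd[OF q]
  have "gsum q 1 * gsum q 1 = (\<Sum>x\<in>{0..<\<bar>q\<bar>}. ee (of_int (x * 1) / of_int \<bar>q\<bar>) * gsum q x)"
  proof -
    have "gsum q 1 * gsum q 1 = (\<Sum>x\<in>{0..<\<bar>q\<bar>}. of_int (psi q x) * ee (of_int (x * 1) / of_int \<bar>q\<bar>) * gsum q 1)"
      by (subst (1) gsum_def) (simp add: sum_distrib_right)
    also have "\<dots> = (\<Sum>x\<in>{0..<\<bar>q\<bar>}. ee (of_int (x * 1) / of_int \<bar>q\<bar>) * gsum q x)"
    proof (intro sum.cong refl)
      fix x show "of_int (psi q x) * ee (of_int (x * 1) / of_int \<bar>q\<bar>) * gsum q 1 = ee (of_int (x * 1) / of_int \<bar>q\<bar>) * gsum q x"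
        unfolding gsum_separable[OF q(1), of x] by (simp add: mult_ac)
    qed
    finally show ?thesis .
  qed
  also have "\<dots> = (\<Sum>x\<in>{0..<\<bar>q\<bar>}. \<Sum>z\<in>{0..<\<bar>q\<bar>}. of_int (psi q z) * ee (of_int (x * (z + 1)) / of_int \<bar>q\<bar>))"
    unfolding gsum_def sum_distrib_left
    by (intro sum.cong refl) (simp add: ee_add[symmetric] add_divide_distrib algebra_simps)
  also have "\<dots> = (\<Sum>z\<in>{0..<\<bar>q\<bar>}. of_int (psi q z) * (if \<bar>q\<bar> dvd (z + 1) then of_int \<bar>q\<bar> else 0))"
    unfolding sum_ee[OF p0, symmetric] sum_distrib_left by (rule sum.swap)
  also have "\<dots> = (\<Sum>z\<in>{\<bar>q\<bar> - 1}. of_int (psi q z) * of_int \<bar>q\<bar>)"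
  proof (rule sum.mono_neutral_cong_right)
    show "\<forall>i\<in>{0..<\<bar>q\<bar>} - {\<bar>q\<bar> - 1}. of_int (psi q i) * (if \<bar>q\<bar> dvd (i + 1) then of_int \<bar>q\<bar> else 0) = (0::complex)"
    proof
      fix i assume i: "i \<in> {0..<\<bar>q\<bar>} - {\<bar>q\<bar> - 1}"
      have "\<not> \<bar>q\<bar> dvd i + 1"
      proof
        assume "\<bar>q\<bar> dvd i + 1"
        hence "\<bar>q\<bar> \<le> i + 1" using i by (intro zdvd_imp_le) auto
        thus False using i by auto
      qed
      thus "of_int (psi q i) * (if \<bar>q\<bar> dvd (i + 1) then of_int \<bar>q\<bar> else 0) = (0::complex)" by simp
    qed
  qed (use p0 in auto)
  finally have "gsum q 1 * gsum q 1 = of_int (psi q (\<bar>q\<bar> - 1)) * of_int \<bar>q\<bar>" by simp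
  moreover have "psi q (\<bar>q\<bar> - 1) = psi q (-1)"
    by (rule psi_cong[OF q(1)]) (simp add: cong_iff_dvd_diff)
  ultimately show ?thesis by simp
qed

lemma jordan_sine:
  assumes "0 \<le> x" "x \<le> pi / 2" shows "sin x \<ge> 2 * x / pi"
proof -
  have "convex_on {0..pi/2} (\<lambda>x. - sin x)"
  proof (rule f''_ge0_imp_convex[where f' = "\<lambda>x. - cos x" and f'' = sin])
    show "sin x \<ge> 0" if "x \<in> {0..pi/2}" for x
      using that by (intro sin_ge_zero) auto
  qed (auto intro!: derivative_eq_intros)
  from convex_onD_Icc[OF this, of "2 * x / pi"] assms
  have "- sin ((2 * x / pi) * (pi / 2)) \<le> (2 * x / pi) * (- sin (pi / 2))"
    by (simp add: field_simps)
  thus ?thesis by simp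
qed

text \<open>Abel summation. In the auxiliary bound the last boundary term is kept apart, so that the
  slack \<open>2 w M - w K\<close> grows by exactly the norm of each new term
  \<open>(w K - w (K+1)) F (K+1)\<close>.\<close>

lemma abel_bound:
  fixes F :: "nat \<Rightarrow> complex" and w :: "nat \<Rightarrow> real"
  assumes F: "\<And>m. norm (F m) = 1" and w0: "\<And>m. M \<le> m \<Longrightarrow> m < L \<Longrightarrow> w m \<ge> 0"
    and dec: "\<And>m. M \<le> m \<Longrightarrow> Suc m < L \<Longrightarrow> w (Suc m) \<le> w m" and MLt: "M < L"
  shows "norm (\<Sum>m\<in>{M..<L}. of_real (w m) * (F (Suc m) - F m)) \<le> 2 * w M"
proof -
  have aux: "norm ((\<Sum>m\<in>{M..<Suc K}. of_real (w m) * (F (Suc m) - F m)) - of_real (w K) * F (Suc K)) \<le> 2 * w M - w K"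
    if "M \<le> K" "K < L" for K
    using that
  proof (induction K rule: dec_induct)
    case base
    have "norm (- (of_real (w M) * F M)) = w M" using w0[of M] base by (simp add: norm_mult F)
    thus ?case by (simp add: algebra_simps)
  next
    case (step K)
    have "(\<Sum>m\<in>{M..<Suc (Suc K)}. of_real (w m) * (F (Suc m) - F m)) - of_real (w (Suc K)) * F (Suc (Suc K)) =
       ((\<Sum>m\<in>{M..<Suc K}. of_real (w m) * (F (Suc m) - F m)) - of_real (w K) * F (Suc K))
        + of_real (w K - w (Suc K)) * F (Suc K)"
      using step by (simp add: algebra_simps)
    moreover have "norm (of_real (w K - w (Suc K)) * F (Suc K)) = w K - w (Suc K)"
      using dec[of K] step by (simp add: norm_mult F del: of_real_diff)
    ultimately show ?case using step.IH step.prems norm_triangle_ineq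
      by (smt (verit) Suc_lessD)
  qed
  obtain K where K: "L = Suc K" using MLt by (cases L) auto
  have "norm (of_real (w K) * F (Suc K)) = w K" using w0[of K] K MLt by (simp add: norm_mult F)
  thus ?thesis using aux[of K] K MLt norm_triangle_sub[of "\<Sum>m\<in>{M..<L}. of_real (w m) * (F (Suc m) - F m)" "of_real (w K) * F (Suc K)"]
    by simp
qed

text \<open>
  The square of the Gauss sum determines it up to sign. The wrong sign is excluded by a
  lower bound for a real part: its terms of small index are nonnegative, and the remaining ones are
  bounded by summation by parts.
\<close>

context
  fixes p :: nat
  assumes p: "p \<ge> 3"
begin

text \<open>After completing the square, the quadratic Gauss sum has terms depending on
  \<open>(2 x - p)^2 / (8 p)\<close>; the odd number \<open>2 m + 1\<close> is
  \<open>|2 x - p|\<close>.\<close>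

definition "term_E m = ee ((2 * real m + 1)\<^sup>2 / (8 * real p))"
definition "weight m = 1 / (2 * sin (pi * (2 * real m + 1) / (2 * real p)))"

lemma angle_bounds:
  assumes "2 * m + 1 \<le> p"
  shows "0 < pi * (2 * real m + 1) / (2 * real p)" "pi * (2 * real m + 1) / (2 * real p) \<le> pi / 2"
proof -
  show "0 < pi * (2 * real m + 1) / (2 * real p)" using p by (intro divide_pos_pos mult_pos_pos) auto
  have "2 * real m + 1 \<le> real p" using assms by linarith
  hence "pi * (2 * real m + 1) / (2 * real p) \<le> pi * real p / (2 * real p)"
    by (intro divide_right_mono mult_left_mono) auto
  thus "pi * (2 * real m + 1) / (2 * real p) \<le> pi / 2" using p by simp
qed

lemma sin_angle_pos: "2 * m + 1 \<le> p \<Longrightarrow> sin (pi * (2 * real m + 1) / (2 * real p)) > 0"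
  using angle_bounds[of m] pi_gt_zero by (intro sin_gt_zero; linarith)

lemma sin_angle_ge: "2 * m + 1 \<le> p \<Longrightarrow> sin (pi * (2 * real m + 1) / (2 * real p)) \<ge> (2 * real m + 1) / real p"
  using jordan_sine[of "pi * (2 * real m + 1) / (2 * real p)"] angle_bounds[of m] by simp

text \<open>\<open>m^2/(2p)\<close> and \<open>(m+1)^2/(2p)\<close> lie symmetrically about
  \<open>c\<close>, and \<open>term_E m\<close> is \<open>ee c\<close> up to a fixed phase. The
  difference of the two exponentials is \<open>2 i sin\<close> of the half gap times
  \<open>ee c\<close>, and \<open>weight\<close> divides that sine out: the terms become weighted
  telescoping differences.\<close>

lemma term_E_eq:
  assumes "2 * m + 1 \<le> p"
  shows "term_E m = (ee (- (1 / (8 * real p))) / \<i>) *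
    (of_real (weight m) * (ee ((real (Suc m))\<^sup>2 / (2 * real p)) - ee ((real m)\<^sup>2 / (2 * real p))))"
proof -
  define c where "c = (2 * real m ^ 2 + 2 * real m + 1) / (4 * real p)"
  define t where "t = (2 * real m + 1) / (4 * real p)"
  have p0: "real p > 0" using p by simp
  have 1: "(real (Suc m))\<^sup>2 / (2 * real p) = c + t" using p0 by (simp add: c_def t_def power2_eq_square field_simps)
  have 2: "(real m)\<^sup>2 / (2 * real p) = c + (- t)" using p0 by (simp add: c_def t_def power2_eq_square field_simps)
  have 3: "(2 * real m + 1)\<^sup>2 / (8 * real p) = - (1 / (8 * real p)) + c" using p0 by (simp add: c_def t_def power2_eq_square field_simps)
  have a: "2 * pi * t = pi * (2 * real m + 1) / (2 * real p)" by (simp add: t_def)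
  define s where "s = sin (pi * (2 * real m + 1) / (2 * real p))"
  have s: "s > 0" unfolding s_def by (rule sin_angle_pos[OF assms])
  have "ee t - ee (- t) = 2 * \<i> * of_real s"
    unfolding ee_cis s_def a[symmetric] by (simp add: complex_eq_iff)
  hence H: "of_real (weight m) * (ee (c + t) - ee (c + (- t))) = \<i> * ee c"
    unfolding ee_add using s by (simp add: weight_def s_def[symmetric] right_diff_distrib[symmetric])
  have "ee (- (1 / (8 * real p))) / \<i> * (\<i> * ee c) = (ee (- (1 / (8 * real p))) * \<i> / \<i>) * ee c"
    by (simp only: mult.assoc[symmetric] times_divide_eq_left)
  also have "\<dots> = ee (- (1 / (8 * real p))) * ee c" by (subst nonzero_mult_div_cancel_right) simp_all
  finally show ?thesis unfolding term_E_def 1 2 3 H ee_add[of "- (1 / (8 * real p))" c] by simp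
qed

lemma weight_mono: "2 * Suc m + 1 \<le> p \<Longrightarrow> weight (Suc m) \<le> weight m"
proof -
  assume m: "2 * Suc m + 1 \<le> p"
  have "sin (pi * (2 * real m + 1) / (2 * real p)) \<le> sin (pi * (2 * real (Suc m) + 1) / (2 * real p))"
  proof (rule sin_monotone_2pi_le)
    show "- (pi / 2) \<le> pi * (2 * real m + 1) / (2 * real p)"
    proof -
      have "0 < pi * (2 * real m + 1) / (2 * real p)" using angle_bounds(1)[of m] m by simp
      thus ?thesis using pi_gt_zero by linarith
    qed
    show "pi * (2 * real m + 1) / (2 * real p) \<le> pi * (2 * real (Suc m) + 1) / (2 * real p)"
      using p by (intro divide_right_mono mult_left_mono) auto
    show "pi * (2 * real (Suc m) + 1) / (2 * real p) \<le> pi / 2" using angle_bounds(2)[OF m] .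
  qed
  thus ?thesis using sin_angle_pos[of m] m by (auto simp: weight_def intro!: divide_left_mono)
qed

text \<open>Summation by parts against decreasing weights leaves twice the first weight, whose sine
  is bounded below by Jordan's inequality.\<close>

lemma tail_bound:
  assumes "M < L" "2 * L \<le> p + 1"
  shows "norm (\<Sum>m\<in>{M..<L}. term_E m) \<le> real p / (2 * real M + 1)"
proof -
  have "(\<Sum>m\<in>{M..<L}. term_E m) = (ee (- (1 / (8 * real p))) / \<i>) *
    (\<Sum>m\<in>{M..<L}. of_real (weight m) * (ee ((real (Suc m))\<^sup>2 / (2 * real p)) - ee ((real m)\<^sup>2 / (2 * real p))))"
    unfolding sum_distrib_left using assms by (intro sum.cong refl term_E_eq) auto
  hence "norm (\<Sum>m\<in>{M..<L}. term_E m) =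
    norm (\<Sum>m\<in>{M..<L}. of_real (weight m) * (ee ((real (Suc m))\<^sup>2 / (2 * real p)) - ee ((real m)\<^sup>2 / (2 * real p))))"
    by (simp add: norm_mult norm_divide)
  also have "\<dots> \<le> 2 * weight M"
  proof (rule abel_bound[where F = "\<lambda>m. ee ((real m)\<^sup>2 / (2 * real p))"])
    fix m assume "M \<le> m" "m < L"
    thus "weight m \<ge> 0" using sin_angle_pos[of m] assms by (simp add: weight_def)
  next
    fix m assume "M \<le> m" "Suc m < L"
    thus "weight (Suc m) \<le> weight m" using assms by (intro weight_mono) auto
  qed (use assms in auto)
  also have "2 * weight M \<le> real p / (2 * real M + 1)"
  proof -
    have M: "2 * M + 1 \<le> p" using assms by simp
    have "2 * weight M = 1 / sin (pi * (2 * real M + 1) / (2 * real p))" by (simp add: weight_def)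
    also have "\<dots> \<le> 1 / ((2 * real M + 1) / real p)"
      using sin_angle_ge[OF M] sin_angle_pos[OF M] p by (intro divide_left_mono) auto
    finally show ?thesis by simp
  qed
  finally show ?thesis .
qed

text \<open>The rotation by \<open>ee (-1/8)\<close> (see \<open>cterm_eq\<close>) is the one that
  makes the complete sum real. With \<open>r = (2 m + 1)^2 / p\<close> the cosine is nonnegative up
  to \<open>r = 3\<close> and at least \<open>sqrt 2 / 2\<close> up to \<open>r = 2\<close>.\<close>

definition "cterm m = cos (pi / 4 * ((2 * real m + 1)\<^sup>2 / real p - 1))"

lemma cterm_eq: "cterm m = Re (ee (- (1 / 8)) * term_E m)"
proof -
  have "2 * pi * (- (1 / 8) + (2 * real m + 1)\<^sup>2 / (8 * real p)) = pi / 4 * ((2 * real m + 1)\<^sup>2 / real p - 1)"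
    using p by (simp add: field_simps)
  thus ?thesis unfolding term_E_def ee_add[symmetric] unfolding cterm_def ee_cis by (simp only: cis.sel)
qed

lemma cterm_nonneg: "(2 * real m + 1)\<^sup>2 \<le> 3 * real p \<Longrightarrow> cterm m \<ge> 0"
proof -
  assume a: "(2 * real m + 1)\<^sup>2 \<le> 3 * real p"
  define r where "r = (2 * real m + 1)\<^sup>2 / real p"
  have r: "0 \<le> r" "r \<le> 3" using a p by (auto simp: r_def field_simps)
  show ?thesis unfolding cterm_def r_def[symmetric]
  proof (rule cos_ge_zero)
    have "pi / 4 * (-2) \<le> pi / 4 * (r - 1)" using r by (intro mult_left_mono) auto
    thus "- (pi / 2) \<le> pi / 4 * (r - 1)" by simp
    have "pi / 4 * (r - 1) \<le> pi / 4 * 2" using r by (intro mult_left_mono) auto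
    thus "pi / 4 * (r - 1) \<le> pi / 2" by simp
  qed
qed

lemma cterm_ge: "(2 * real m + 1)\<^sup>2 \<le> 2 * real p \<Longrightarrow> cterm m \<ge> sqrt 2 / 2"
proof -
  assume a: "(2 * real m + 1)\<^sup>2 \<le> 2 * real p"
  define r where "r = (2 * real m + 1)\<^sup>2 / real p"
  have r: "0 \<le> r" "r \<le> 2" using a p by (auto simp: r_def field_simps)
  have "sqrt 2 / 2 = cos (pi / 4)" by (simp add: cos_45)
  also have "\<dots> \<le> cos \<bar>pi / 4 * (r - 1)\<bar>"
  proof (rule cos_monotone_0_pi_le)
    have "\<bar>r - 1\<bar> \<le> 1" using r by linarith
    hence "pi / 4 * \<bar>r - 1\<bar> \<le> pi / 4 * 1" by (intro mult_left_mono) auto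
    thus "\<bar>pi / 4 * (r - 1)\<bar> \<le> pi / 4" by (simp add: abs_mult)
  qed auto
  finally show ?thesis unfolding cterm_def r_def[symmetric] cos_abs_real .
qed

text \<open>\<open>K\<close> and \<open>M\<close> are the first indices with \<open>r > 2\<close>
  and \<open>r > 3\<close>. The terms below \<open>K\<close> contribute about \<open>s/2\<close>,
  those between are nonnegative, and the tail loses at most \<open>s / sqrt 3\<close>, where
  \<open>s = sqrt p\<close>. The bound is half of what \<open>gsum_sign\<close> needs, because the
  Gauss sum consists of two such sums.\<close>

lemma partial_sum_bound:
  assumes L: "2 * L \<le> p + 1"
  shows "(\<Sum>m<L. cterm m) > - sqrt (real p) / 2"
proof -
  define s where "s = sqrt (real p)"
  have s2: "s ^ 2 = real p" "s > 0" using p by (auto simp: s_def)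
  have s17: "s \<ge> 17/10"
  proof -
    have "(17/10::real) ^ 2 \<le> real p" using p by (simp add: power2_eq_square)
    thus ?thesis unfolding s_def by (rule real_le_rsqrt)
  qed
  define P where "P m \<longleftrightarrow> (2 * real m + 1)\<^sup>2 > 3 * real p" for m
  show ?thesis
  proof (cases "\<exists>m<L. P m")
    case False
    hence "\<not> P m" if "m < L" for m using that by blast
    hence "cterm m \<ge> 0" if "m < L" for m using that by (intro cterm_nonneg) (simp add: P_def not_less)
    hence "(\<Sum>m<L. cterm m) \<ge> 0" by (intro sum_nonneg) auto
    moreover have "- sqrt (real p) / 2 < 0" using p by simp
    ultimately show ?thesis by linarith
  next
    case True
    define M where "M = (LEAST m. P m)"
    obtain m0 where m0: "m0 < L" "P m0" using True by blast
    have PM: "P M" unfolding M_def by (rule LeastI[of P, OF m0(2)])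
    have MLt: "M < L" unfolding M_def by (rule le_less_trans[OF Least_le[of P, OF m0(2)] m0(1)])
    have Mlt: "\<And>m. m < M \<Longrightarrow> \<not> P m" unfolding M_def by (rule not_less_Least)
    define Q where "Q m \<longleftrightarrow> (2 * real m + 1)\<^sup>2 > 2 * real p" for m
    define K where "K = (LEAST m. Q m)"
    have QM: "Q M" using PM by (auto simp: P_def Q_def)
    have QK: "Q K" using LeastI[of Q, OF QM] by (simp add: K_def)
    have KM: "K \<le> M" using Least_le[of Q, OF QM] by (simp add: K_def)
    have Klt: "\<And>m. m < K \<Longrightarrow> \<not> Q m" using not_less_Least by (auto simp: K_def)
    have split: "(\<Sum>m<L. cterm m) = (\<Sum>m<K. cterm m) + (\<Sum>m\<in>{K..<M}. cterm m) + (\<Sum>m\<in>{M..<L}. cterm m)"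
      using KM MLt by (simp add: lessThan_atLeast0 sum.atLeastLessThan_concat)
    have 1: "(\<Sum>m<K. cterm m) \<ge> real K * (sqrt 2 / 2)"
    proof -
      have "(\<Sum>m<K. cterm m) \<ge> (\<Sum>m<K. sqrt 2 / 2)"
        using Klt by (intro sum_mono cterm_ge) (auto simp: Q_def not_less)
      thus ?thesis by simp
    qed
    have 2: "(\<Sum>m\<in>{K..<M}. cterm m) \<ge> 0"
      using Mlt by (intro sum_nonneg cterm_nonneg) (auto simp: P_def not_less)
    have "(\<Sum>m\<in>{M..<L}. cterm m) = Re (ee (- (1 / 8)) * (\<Sum>m\<in>{M..<L}. term_E m))"
      unfolding cterm_eq sum_distrib_left by simp
    moreover have "\<bar>Re (ee (- (1 / 8)) * (\<Sum>m\<in>{M..<L}. term_E m))\<bar> \<le> norm (\<Sum>m\<in>{M..<L}. term_E m)"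
      using abs_Re_le_cmod[of "ee (- (1 / 8)) * (\<Sum>m\<in>{M..<L}. term_E m)"] by (simp add: norm_mult)
    ultimately have 3: "(\<Sum>m\<in>{M..<L}. cterm m) \<ge> - (real p / (2 * real M + 1))"
      using tail_bound[OF MLt L] by linarith
    have "sqrt (3 * real p) < 2 * real M + 1"
      using PM unfolding P_def by (intro real_less_lsqrt) auto
    hence M1: "2 * real M + 1 > sqrt 3 * s" by (simp add: s_def real_sqrt_mult)
    have "sqrt (2 * real p) < 2 * real K + 1"
      using QK unfolding Q_def by (intro real_less_lsqrt) auto
    hence K1: "real K > (sqrt 2 * s - 1) / 2" by (simp add: s_def real_sqrt_mult)
    \<comment> \<open>Rational bounds for the final comparison
      \<open>sqrt 2 / 4 < s (1 - 1 / sqrt 3)\<close>, which holds comfortably for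
      \<open>s \<ge> 17/10\<close>.\<close>
    have r3: "sqrt 3 \<ge> (173/100)" by (rule real_le_rsqrt) (simp add: power2_eq_square)
    have r2: "sqrt 2 \<le> (71/50)" by (rule real_le_lsqrt) (simp_all add: power2_eq_square)
    have "(173/100) * s \<le> 2 * real M + 1" using M1 mult_right_mono[OF r3, of s] s2 by linarith
    hence "real p / (2 * real M + 1) \<le> s ^ 2 / ((173/100) * s)"
      unfolding s2(1) using s2 by (intro divide_left_mono) auto
    also have "\<dots> = s / (173/100)" using s2(2) by (simp add: power2_eq_square)
    finally have t: "real p / (2 * real M + 1) \<le> s / (173/100)" .
    have "real K * (sqrt 2 / 2) \<ge> ((sqrt 2 * s - 1) / 2) * (sqrt 2 / 2)"
      using K1 by (intro mult_right_mono) auto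
    also have "((sqrt 2 * s - 1) / 2) * (sqrt 2 / 2) = s / 2 - sqrt 2 / 4"
      by (simp add: field_simps)
    finally have k: "real K * (sqrt 2 / 2) \<ge> s / 2 - (71/50) / 4" using r2 by linarith
    have "(\<Sum>m<L. cterm m) \<ge> s / 2 - (71/50) / 4 - s / (173/100)"
      using split 1 2 3 t k by linarith
    moreover have "s / (173/100) < s - (71/200)" using s17 by (simp add: field_simps)
    ultimately show ?thesis unfolding s_def[symmetric] by simp
  qed
qed

end

text \<open>Read through odd numbers (\<open>V1\<close>) the sum \<open>V\<close> gives a lower
  bound for \<open>Re T\<close>; read through residues (\<open>V2\<close>) it is a known phase times
  \<open>gsum q 1\<close>, so that \<open>T^2 = p\<close>. The bound then leaves only the positive
  root.\<close>

lemma gsum_sign: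
  assumes q: "prime_disc q" "odd q"
  shows "gsum q 1 = (if q > 0 then of_real (sqrt \<bar>q\<bar>) else \<i> * of_real (sqrt \<bar>q\<bar>))"
proof -
  note o = prime_disc_odd[OF q]
  define p where "p = nat \<bar>q\<bar>"
  have p: "int p = \<bar>q\<bar>" "p \<ge> 3" using o by (auto simp: p_def)
  define P where "P = (p - 1) div 2"
  have "odd p" using q(2) p(1) by (metis even_abs_add_iff even_of_nat abs_of_nat even_add)
  hence P: "p = 2 * P + 1" using p by (auto simp: P_def elim: oddE)
  define V where "V = (\<Sum>x\<in>{0..<int p}. ee ((2 * of_int x - real p)\<^sup>2 / (8 * real p)))"
  define T where "T = ee (- (1 / 8)) * V"
  have pr: "real_of_int \<bar>q\<bar> = real p" using p(1) by (metis of_int_of_nat_eq)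
  have V1: "V = (\<Sum>m<Suc P. term_E p m) + (\<Sum>m<P. term_E p m)"
  proof -
    \<comment> \<open>As \<open>x\<close> runs over the residues, \<open>|2 x - p|\<close> takes the
      value \<open>p\<close> once and each smaller odd number twice.\<close>
    have "{0..<int p} = {0..int P} \<union> {int P + 1..<int p}" using P by auto
    hence "V = (\<Sum>x\<in>{0..int P}. ee ((2 * of_int x - real p)\<^sup>2 / (8 * real p))) +
       (\<Sum>x\<in>{int P + 1..<int p}. ee ((2 * of_int x - real p)\<^sup>2 / (8 * real p)))"
      unfolding V_def by (simp only:) (rule sum.union_disjoint, auto)
    also have "(\<Sum>x\<in>{0..int P}. ee ((2 * of_int x - real p)\<^sup>2 / (8 * real p))) = (\<Sum>m<Suc P. term_E p m)"
    proof (rule sum.reindex_bij_witness[of _ "\<lambda>m. int P - int m" "\<lambda>x. nat (int P - x)"])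
      fix x assume "x \<in> {0..int P}"
      hence "2 * real_of_int x - real p = - (2 * real (nat (int P - x)) + 1)" using P by simp
      hence "(2 * real_of_int x - real p)\<^sup>2 = (2 * real (nat (int P - x)) + 1)\<^sup>2" by (simp only: power2_minus)
      thus "term_E p (nat (int P - x)) = ee ((2 * of_int x - real p)\<^sup>2 / (8 * real p))"
        by (simp only: term_E_def[OF p(2)])
    qed auto
    also have "(\<Sum>x\<in>{int P + 1..<int p}. ee ((2 * of_int x - real p)\<^sup>2 / (8 * real p))) = (\<Sum>m<P. term_E p m)"
    proof (rule sum.reindex_bij_witness[of _ "\<lambda>m. int P + 1 + int m" "\<lambda>x. nat (x - int P - 1)"])
      fix x assume "x \<in> {int P + 1..<int p}"
      hence "2 * real_of_int x - real p = (2 * real (nat (x - int P - 1)) + 1)" using P by simp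
      thus "term_E p (nat (x - int P - 1)) = ee ((2 * of_int x - real p)\<^sup>2 / (8 * real p))"
        by (simp only: term_E_def[OF p(2)])
    qed (use P in auto)
    finally show ?thesis .
  qed
  have ReT: "Re T > - sqrt (real p)"
  proof -
    have "Re T = (\<Sum>m<Suc P. cterm p m) + (\<Sum>m<P. cterm p m)"
      unfolding T_def V1 distrib_left sum_distrib_left cterm_eq[OF p(2)] plus_complex.sel Re_sum ..
    moreover have "(\<Sum>m<Suc P. cterm p m) > - sqrt (real p) / 2"
      by (rule partial_sum_bound[OF p(2)]) (use P in auto)
    moreover have "(\<Sum>m<P. cterm p m) > - sqrt (real p) / 2"
      by (rule partial_sum_bound[OF p(2)]) (use P in auto)
    ultimately show ?thesis by linarith
  qed
  \<comment> \<open>The inverse of 2 modulo \<open>q\<close>; it turns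
    \<open>(x^2 - x |q|) / 2\<close> into \<open>c x^2\<close> modulo \<open>q\<close>.\<close>
  define c where "c = (\<bar>q\<bar> + 1) div 2"
  have "even (\<bar>q\<bar> + 1)" using q(2) by simp
  hence c: "2 * c = \<bar>q\<bar> + 1" unfolding c_def by (rule dvd_mult_div_cancel)
  have V2: "V = ee (real p / 8) * (of_int (psi q 2) * gsum q 1)"
  proof -
    have "V = (\<Sum>x\<in>{0..<\<bar>q\<bar>}. ee (real p / 8) * ee (of_int (c * x\<^sup>2) / of_int \<bar>q\<bar>))"
      unfolding V_def p(1)
    proof (intro sum.cong refl)
      fix x assume "x \<in> {0..<\<bar>q\<bar>}"
      have "even (x * (x + 1))" by simp
      then obtain j where j: "x * (x + 1) = 2 * j" by (elim evenE)
      have 1: "2 * (c * x\<^sup>2 - \<bar>q\<bar> * j) = x\<^sup>2 - x * \<bar>q\<bar>"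
      proof -
        have "2 * (c * x\<^sup>2 - \<bar>q\<bar> * j) = (2 * c) * x\<^sup>2 - \<bar>q\<bar> * (2 * j)" by (simp add: algebra_simps)
        also have "\<dots> = x\<^sup>2 - x * \<bar>q\<bar>" unfolding c j[symmetric] by (simp add: algebra_simps power2_eq_square)
        finally show ?thesis .
      qed
      have 2: "2 * real_of_int (c * x\<^sup>2 - \<bar>q\<bar> * j) = (of_int x)\<^sup>2 - of_int x * real p"
        using arg_cong[OF 1, of real_of_int] pr by simp
      have "(2 * of_int x - real p)\<^sup>2 = real p ^ 2 + 4 * ((of_int x)\<^sup>2 - of_int x * real p)"
        by (simp add: power2_eq_square algebra_simps)
      hence "(2 * of_int x - real p)\<^sup>2 / (8 * real p) = real p / 8 + of_int (c * x\<^sup>2 - \<bar>q\<bar> * j) / real p"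
        using p(2) unfolding 2[symmetric] by (simp add: field_simps power2_eq_square)
      also have "ee \<dots> = ee (real p / 8) * ee (of_int (c * x\<^sup>2 - \<bar>q\<bar> * j) / of_int \<bar>q\<bar>)"
        by (simp only: ee_add pr)
      also have "ee (of_int (c * x\<^sup>2 - \<bar>q\<bar> * j) / of_int \<bar>q\<bar>) = ee (of_int (c * x\<^sup>2) / of_int \<bar>q\<bar>)"
        by (rule ee_frac_cong) (use o in \<open>auto simp: cong_iff_dvd_diff\<close>)
      finally show "ee ((2 * of_int x - real p)\<^sup>2 / (8 * real p)) = ee (real p / 8) * ee (of_int (c * x\<^sup>2) / of_int \<bar>q\<bar>)" .
    qed
    also have "\<dots> = ee (real p / 8) * (\<Sum>x\<in>{0..<\<bar>q\<bar>}. ee (of_int (c * x\<^sup>2) / of_int \<bar>q\<bar>))"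
      by (simp add: sum_distrib_left)
    also have "(\<Sum>x\<in>{0..<\<bar>q\<bar>}. ee (of_int (c * x\<^sup>2) / of_int \<bar>q\<bar>)) =
       (\<Sum>x\<in>{0..<\<bar>q\<bar>}. (1 + of_int (Legendre x \<bar>q\<bar>)) * ee (of_int (c * x) / of_int \<bar>q\<bar>))"
    proof (rule sum_squares_Legendre[OF o(1,3)])
      show "ee (of_int (c * (x + \<bar>q\<bar>)) / of_int \<bar>q\<bar>) = ee (of_int (c * x) / of_int \<bar>q\<bar>)" for x
        by (rule ee_frac_cong) (use o in \<open>auto simp: cong_iff_dvd_diff algebra_simps\<close>)
    qed
    also have "\<dots> = (\<Sum>x\<in>{0..<\<bar>q\<bar>}. ee (of_int (x * c) / of_int \<bar>q\<bar>)) + gsum q c"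
      using q(2) by (simp add: gsum_def psi_def ring_distribs sum.distrib mult.commute)
    also have "(\<Sum>x\<in>{0..<\<bar>q\<bar>}. ee (of_int (x * c) / of_int \<bar>q\<bar>)) = 0"
    proof -
      have "\<not> \<bar>q\<bar> dvd c" using zdvd_imp_le[of "\<bar>q\<bar>" c] c o(3) by linarith
      thus ?thesis using sum_ee[of "\<bar>q\<bar>" c] o(3) by simp
    qed
    also have "gsum q c = of_int (psi q c) * gsum q 1" by (rule gsum_separable[OF q(1)])
    also have "psi q c = psi q 2"
    proof -
      have "psi q 2 * psi q c = psi q (2 * c)" by (simp add: psi_mult[OF q(1)])
      also have "\<dots> = psi q 1" unfolding c by (rule psi_cong[OF q(1)]) (simp add: cong_iff_dvd_diff)
      finally have "psi q 2 * psi q c = 1" by (simp add: psi_one[OF q(1)])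
      thus ?thesis using psi_values[of q 2] psi_values[of q c] by auto
    qed
    finally show ?thesis by simp
  qed
  have psi2: "psi q 2 = (if p mod 8 = 1 \<or> p mod 8 = 7 then 1 else -1)"
  proof -
    have "psi q 2 = (if \<bar>q\<bar> mod 8 = 1 \<or> \<bar>q\<bar> mod 8 = 7 then 1 else -1)"
      using q(2) Legendre_two[OF o(1,3)] by (simp add: psi_def)
    moreover have "\<bar>q\<bar> mod 8 = int (p mod 8)" using p(1) by (simp add: zmod_int)
    ultimately show ?thesis by auto
  qed
  have psim: "psi q (-1) = (if q > 0 then 1 else -1)"
    using psi_minus_one[OF q(1)] prime_disc_nz[OF q(1)] by (auto simp: sgn_if)
  have pm4: "q > 0 \<longleftrightarrow> p mod 4 = 1" "q < 0 \<longleftrightarrow> p mod 4 = 3"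
  proof -
    have i: "int p mod 4 = int (p mod 4)" by (simp add: zmod_int)
    have "q > 0 \<Longrightarrow> p mod 4 = 1" using p(1) o(2) i by simp
    have "q < 0 \<Longrightarrow> p mod 4 = 3"
    proof -
      assume "q < 0"
      hence "int p = - q" using p(1) by simp
      moreover have "(- q) mod 4 = 3" using o(2) by presburger
      ultimately show ?thesis using i by simp
    qed
    show "q > 0 \<longleftrightarrow> p mod 4 = 1" "q < 0 \<longleftrightarrow> p mod 4 = 3"
    proof -
      have "q > 0 \<or> q < 0" using prime_disc_nz[OF q(1)] by linarith
      thus "q > 0 \<longleftrightarrow> p mod 4 = 1" "q < 0 \<longleftrightarrow> p mod 4 = 3"
        using \<open>q > 0 \<Longrightarrow> p mod 4 = 1\<close> \<open>q < 0 \<Longrightarrow> p mod 4 = 3\<close> by auto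
    qed
  qed
  define j where "j = p div 8"
  have pj: "p = 8 * j + p mod 8" by (simp add: j_def)
  have p8: "p mod 8 = 1 \<or> p mod 8 = 3 \<or> p mod 8 = 5 \<or> p mod 8 = 7" using \<open>odd p\<close> by presburger
  have p84: "p mod 4 = p mod 8 mod 4" by (simp add: mod_mod_cancel)
  have e1: "ee (1/4) = \<i>" "ee (1/2) = -1" "ee (3/4) = -\<i>"
  proof -
    show a: "ee (1/4) = \<i>" by (simp add: ee_cis)
    have "ee (1/2) = ee (1/4 + 1/4)" by simp
    also have "\<dots> = -1" by (simp only: ee_add a) simp
    finally show b: "ee (1/2) = -1" .
    have "ee (3/4) = ee (1/4 + 1/2)" by simp
    also have "\<dots> = -\<i>" by (simp only: ee_add a b) simp
    finally show "ee (3/4) = -\<i>" .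
  qed
  \<comment> \<open>According to \<open>p mod 8\<close> the phase
    \<open>ee ((p mod 8 - 1) / 8)\<close> is \<open>1\<close>, \<open>i\<close>, \<open>-1\<close>
    or \<open>-i\<close>; the value of \<open>psi q 2\<close> corrects it to \<open>1\<close> for
    \<open>q > 0\<close> and to \<open>-i\<close> for \<open>q < 0\<close>.\<close>
  have fact1: "ee (- (1/8)) * ee (real p / 8) * of_int (psi q 2) = (if q > 0 then 1 else - \<i>)"
  proof -
    have "real p = 8 * real j + real (p mod 8)" using arg_cong[OF pj, of real] by simp
    hence "- (1/8) + real p / 8 = real_of_int (int j) + (real (p mod 8) - 1) / 8" by (simp add: field_simps)
    hence "ee (- (1/8)) * ee (real p / 8) = ee (real_of_int (int j) + (real (p mod 8) - 1) / 8)"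
      by (simp only: ee_add[symmetric])
    also have "\<dots> = ee ((real (p mod 8) - 1) / 8)" by (simp only: ee_add ee_of_int mult_1)
    finally have "ee (- (1/8)) * ee (real p / 8) = ee ((real (p mod 8) - 1) / 8)" .
    thus ?thesis using p8 pm4(1) p84 psi2 e1 by (elim disjE) simp_all
  qed
  have Tg: "T = (if q > 0 then 1 else - \<i>) * gsum q 1"
    unfolding T_def V2 fact1[symmetric] by (simp add: mult_ac)
  have pc: "(of_int \<bar>q\<bar> :: complex) = of_real (real p)"
    using p(1) by (metis of_int_of_nat_eq of_real_of_nat_eq)
  have "T ^ 2 = (if q > 0 then 1 else -1) * (gsum q 1 * gsum q 1)"
    unfolding Tg power_mult_distrib by (simp add: power2_eq_square)
  also have "\<dots> = of_real (real p)"
    unfolding gsum_square[OF q] psim of_int_mult pc by simp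
  finally have "T ^ 2 = (of_real (sqrt (real p))) ^ 2" by (simp flip: of_real_power)
  hence "T = of_real (sqrt (real p)) \<or> T = - of_real (sqrt (real p))"
    by (simp add: power2_eq_iff)
  hence "T = of_real (sqrt (real p))" using ReT by auto
  hence "(if q > 0 then 1 else - \<i>) * gsum q 1 = of_real (sqrt \<bar>q\<bar>)" using Tg pr by simp
  hence H: "(if q > 0 then 1 else - \<i>) * gsum q 1 = of_real (sqrt \<bar>q\<bar>)" .
  show ?thesis
  proof (cases "q > 0")
    case False
    have "gsum q 1 = \<i> * (- \<i> * gsum q 1)" by (simp add: mult.assoc[symmetric])
    also have "- \<i> * gsum q 1 = of_real (sqrt \<bar>q\<bar>)" using H False by (simp only: if_False)
    finally show ?thesis using False by simp
  qed (use H in simp)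
qed

lemma gsum_one:
  assumes q: "prime_disc q"
  shows "gsum q 1 = (if q > 0 then of_real (sqrt \<bar>q\<bar>) else \<i> * of_real (sqrt \<bar>q\<bar>))"
proof (cases "even q")
  case False thus ?thesis by (rule gsum_sign[OF q])
next
  case True
  define z where "z = ee (1/8)"
  have z1: "z = of_real (sqrt 2 / 2) * (1 + \<i>)"
    unfolding z_def ee_cis by (simp add: complex_eq_iff cos_45 sin_45)
  have r2: "complex_of_real (sqrt 2) * complex_of_real (sqrt 2) = 2" by (simp flip: of_real_mult)
  have z2: "z * z = \<i>" unfolding z1 using r2 by (simp add: algebra_simps)
  have e: "ee (real n / 8) = z ^ n" for n :: nat
    unfolding z_def ee_power by simp
  have z3: "z ^ 3 = \<i> * z" "z ^ 5 = - z" "z ^ 7 = - \<i> * z"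
  proof -
    show a: "z ^ 3 = \<i> * z" by (simp add: power3_eq_cube z2)
    have "z ^ 5 = z ^ 3 * (z * z)" by (simp add: eval_nat_numeral)
    also have "\<dots> = (\<i> * \<i>) * z" unfolding a z2 by (simp only: mult_ac)
    also have "\<dots> = - z" by simp
    finally show b: "z ^ 5 = - z" .
    have "z ^ 7 = z ^ 5 * (z * z)" by (simp add: eval_nat_numeral)
    also have "\<dots> = - \<i> * z" unfolding b z2 by simp
    finally show "z ^ 7 = - \<i> * z" .
  qed
  have e8: "ee (1/8) = z" "ee (3/8) = \<i> * z" "ee (5/8) = - z" "ee (7/8) = - \<i> * z"
    using e[of 1] e[of 3] e[of 5] e[of 7] z3 by simp_all
  have e4: "ee (1/4) = \<i>" "ee (3/4) = - \<i>"
  proof -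
    have "ee (1/4) = ee (1/8) * ee (1/8)" by (simp flip: ee_add)
    thus "ee (1/4) = \<i>" using e8 z2 by simp
    have "ee (3/4) = ee (3/8) * ee (3/8)" by (simp flip: ee_add)
    also have "\<dots> = (\<i> * \<i>) * (z * z)" unfolding e8 by (simp only: mult_ac)
    finally show "ee (3/4) = - \<i>" using z2 by simp
  qed
  have s8: "{0..<8::int} = {0,1,2,3,4,5,6,7}" by auto
  have s4: "{0..<4::int} = {0,1,2,3}" by auto
  have r8: "sqrt 8 = 2 * sqrt 2" using real_sqrt_mult[of 4 2] by simp
  from prime_disc_even_cases[OF q True] show ?thesis
  proof (elim disjE)
    assume "q = -4" thus ?thesis by (simp add: gsum_def s4 psi_def e4)
  next
    assume q8: "q = 8"
    have "gsum q 1 = z - \<i> * z + z - \<i> * z" unfolding q8 gsum_def by (simp add: s8 psi_def e8)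
    also have "\<dots> = 2 * (z * (1 - \<i>))" by (simp add: algebra_simps)
    also have "z * (1 - \<i>) = of_real (sqrt 2)" unfolding z1 by (simp add: algebra_simps)
    finally show ?thesis using q8 r8 by simp
  next
    assume q8: "q = -8"
    have "gsum q 1 = z + \<i> * z + z + \<i> * z" unfolding q8 gsum_def by (simp add: s8 psi_def e8)
    also have "\<dots> = 2 * (z * (1 + \<i>))" by (simp add: algebra_simps)
    also have "z * (1 + \<i>) = \<i> * of_real (sqrt 2)" unfolding z1 by (simp add: algebra_simps)
    finally show ?thesis using q8 r8 by simp
  qed
qed

section \<open>Gauss sums of products of prime discriminants\<close>

definition tau :: "int \<Rightarrow> complex" where
  "tau d = (if d > 0 then of_real (sqrt \<bar>d\<bar>) else \<i> * of_real (sqrt \<bar>d\<bar>))"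

text \<open>The sign is \<open>i * i\<close>, present when both factors are negative. It equals the
  reciprocity sign of \<open>disc_set_reciprocity\<close>, which is why the root number of a product
  takes the same form as that of a factor.\<close>

lemma tau_mult:
  assumes "a \<noteq> 0" "b \<noteq> 0"
  shows "tau (a * b) = (if a < 0 \<and> b < 0 then -1 else 1) * tau a * tau b"
proof -
  have ii: "\<i> * A * (\<i> * B) = - (A * B)" for A B :: complex
  proof -
    have "\<i> * A * (\<i> * B) = (\<i> * \<i>) * (A * B)" by (simp only: mult_ac)
    thus ?thesis by simp
  qed
  show ?thesis
    using assms by (auto simp: tau_def abs_mult real_sqrt_mult zero_less_mult_iff ii)
qed

text \<open>Injectivity of \<open>base_prime\<close> makes the members pairwise coprime; in
  particular at most one of \<open>-4\<close>, \<open>8\<close>, \<open>-8\<close> occurs.\<close>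

definition disc_set :: "int set \<Rightarrow> bool" where
  "disc_set S \<longleftrightarrow> finite S \<and> (\<forall>q\<in>S. prime_disc q) \<and> inj_on base_prime S"

lemma disc_set_insertD:
  assumes "disc_set (insert q S)" "q \<notin> S"
  shows "disc_set S" "prime_disc q" "\<And>r. r \<in> S \<Longrightarrow> base_prime q \<noteq> base_prime r"
  using assms by (auto simp: disc_set_def)

lemma disc_set_prod_nz: "disc_set S \<Longrightarrow> \<Prod>S \<noteq> 0"
  using prime_disc_nz by (auto simp: disc_set_def)

lemma abs_prod_int: "\<bar>\<Prod>S\<bar> = (\<Prod>q\<in>S. \<bar>q\<bar>)" for S :: "int set"
  by (rule abs_prod)

lemma disc_set_coprime:
  assumes "disc_set (insert q S)" "q \<notin> S" shows "coprime q (\<Prod>S)"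
  using disc_set_insertD[OF assms] assms
  by (intro prod_coprime_right) (auto simp: disc_set_def intro!: prime_disc_coprime)

lemma disc_set_reciprocity:
  assumes "disc_set (insert q S)" "q \<notin> S"
  shows "psi q \<bar>\<Prod>S\<bar> * (\<Prod>r\<in>S. psi r \<bar>q\<bar>) = (if q < 0 \<and> \<Prod>S < 0 then -1 else 1)"
proof -
  note D = disc_set_insertD[OF assms]
  have fin: "finite S" using D(1) by (simp add: disc_set_def)
  have "psi q \<bar>\<Prod>S\<bar> * (\<Prod>r\<in>S. psi r \<bar>q\<bar>) = (\<Prod>r\<in>S. psi q \<bar>r\<bar> * psi r \<bar>q\<bar>)"
    by (simp add: abs_prod_int psi_prod[OF D(2)] prod.distrib)
  also have "\<dots> = (\<Prod>r\<in>S. if q < 0 \<and> r < 0 then -1 else 1)"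
    using D by (intro prod.cong refl psi_reciprocity) (auto simp: disc_set_def)
  also have "\<dots> = (if q < 0 \<and> \<Prod>S < 0 then -1 else 1)"
    using fin disc_set_prod_nz[OF D(1)]
  proof (induction S rule: finite_induct)
    case (insert r S)
    thus ?case by (auto simp: mult_less_0_iff split: if_splits)
  qed simp
  finally show ?thesis .
qed

text \<open>Induction on \<open>S\<close> by the Chinese remainder theorem: with
  \<open>u a + v b = 1\<close> the exponential modulo \<open>a b\<close> splits into one modulo
  \<open>a\<close> twisted by \<open>v\<close> and one modulo \<open>b\<close> twisted by
  \<open>u\<close>.\<close>

theorem gauss_sum:
  assumes "disc_set S"
  shows "(\<Sum>x\<in>{0..<\<bar>\<Prod>S\<bar>}. of_int (\<Prod>q\<in>S. psi q x) * ee (of_int (x * n) / of_int \<bar>\<Prod>S\<bar>)) =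
    of_int (\<Prod>q\<in>S. psi q n) * tau (\<Prod>S)"
proof -
  have "finite S" using assms by (simp add: disc_set_def)
  thus ?thesis using assms
  proof (induction S arbitrary: n rule: finite_induct)
    case empty
    have "{0..<1::int} = {0}" by auto
    thus ?case by (simp add: tau_def)
  next
    case (insert q S)
    note D = disc_set_insertD[OF insert.prems insert.hyps(2)]
    define a b where "a = \<bar>q\<bar>" and "b = \<bar>\<Prod>S\<bar>"
    have ab: "a > 0" "b > 0" using prime_disc_nz[OF D(2)] disc_set_prod_nz[OF D(1)] by (auto simp: a_def b_def)
    have co: "coprime a b" using disc_set_coprime[OF insert.prems insert.hyps(2)] by (simp add: a_def b_def)
    obtain u v where uv: "u * a + v * b = 1"
      using bezout_int[of a b] co by (auto simp: coprime_iff_gcd_eq_1)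
    define X where "X x = (\<Prod>r\<in>S. psi r x)" for x
    define f where "f x = of_int (psi q x) * ee (of_int (x * (v * n)) / of_int a)" for x
    define g where "g x = of_int (X x) * ee (of_int (x * (u * n)) / of_int b)" for x
    have Xmult: "X (x * y) = X x * X y" for x y
      using D(1) by (auto simp: X_def disc_set_def psi_mult prod.distrib[symmetric] intro!: prod.cong)
    have Xcong: "X x = X y" if "[x = y] (mod b)" for x y
      unfolding X_def
    proof (intro prod.cong refl psi_cong)
      fix r assume r: "r \<in> S"
      thus "prime_disc r" using D(1) by (simp add: disc_set_def)
      have "r dvd \<Prod>S" using r insert.hyps(1) by (rule dvd_prodI[of S r "\<lambda>x. x", rotated])
      thus "[x = y] (mod r)" using that by (auto simp: b_def cong_iff_dvd_diff intro: dvd_trans)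
    qed
    have f_per: "f (x + a) = f x" for x
      unfolding f_def a_def by (rule gsum_per[OF D(2)])
    have g_per: "g (x + b) = g x" for x
    proof -
      have "ee (of_int ((x + b) * (u * n)) / of_int b) = ee (of_int (x * (u * n)) / of_int b)"
        by (rule ee_frac_cong[OF ab(2)]) (simp add: cong_iff_dvd_diff algebra_simps)
      moreover have "X (x + b) = X x" by (rule Xcong) (simp add: cong_iff_dvd_diff)
      ultimately show ?thesis by (simp add: g_def)
    qed
    have abs: "\<bar>\<Prod>(insert q S)\<bar> = a * b" using insert.hyps by (simp add: a_def b_def abs_mult)
    have "(\<Sum>x\<in>{0..<a * b}. of_int (psi q x * X x) * ee (of_int (x * n) / of_int (a * b))) = (\<Sum>x\<in>{0..<a*b}. f x * g x)"
    proof (intro sum.cong refl)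
      fix x
      have "x * n = x * n * (u * a + v * b)" by (simp add: uv)
      also have "real_of_int \<dots> / of_int (a * b) = of_int (x * (v * n)) / of_int a + of_int (x * (u * n)) / of_int b"
        using ab by (simp add: field_simps)
      finally show "of_int (psi q x * X x) * ee (of_int (x * n) / of_int (a * b)) = f x * g x"
        by (simp only: f_def g_def ee_add of_int_mult mult_ac)
    qed
    also have "\<dots> = (\<Sum>x\<in>{0..<a}. f x) * (\<Sum>x\<in>{0..<b}. g x)"
      by (rule sum_residue_crt[where f = f and g = g and a = a and b = b, OF f_per g_per ab co])
    also have "(\<Sum>x\<in>{0..<a}. f x) = of_int (psi q (v * n)) * tau q"
      using gsum_separable[OF D(2), of "v * n"] gsum_one[OF D(2)] by (simp add: gsum_def f_def a_def tau_def)
    also have "(\<Sum>x\<in>{0..<b}. g x) = of_int (X (u * n)) * tau (\<Prod>S)"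
      using insert.IH[OF D(1), of "u * n"] by (simp add: g_def b_def X_def)
    also have "of_int (psi q (v * n)) * tau q * (of_int (X (u * n)) * tau (\<Prod>S)) =
       of_int (psi q n * X n) * (of_int (psi q v * X u) * tau q * tau (\<Prod>S))"
      by (simp add: psi_mult[OF D(2)] Xmult)
    \<comment> \<open>\<open>v\<close> inverts \<open>b\<close> modulo \<open>a\<close> and
      \<open>u\<close> inverts \<open>a\<close> modulo \<open>b\<close>. A character with values
      \<open>1\<close> and \<open>-1\<close> does not distinguish an element from its inverse, so
      reciprocity evaluates the product.\<close>
    also have "psi q v * X u = (if q < 0 \<and> \<Prod>S < 0 then -1 else 1)"
    proof -
      have "psi q (v * b) = psi q 1"
      proof (rule psi_cong[OF D(2)])
        have "q dvd u * a" by (simp add: a_def)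
        moreover have "v * b - 1 = - (u * a)" using uv by simp
        ultimately show "[v * b = 1] (mod q)" by (simp add: cong_iff_dvd_diff)
      qed
      hence 1: "psi q v * psi q b = 1" by (simp add: psi_mult[OF D(2)] psi_one[OF D(2)])
      have "X (u * a) = X 1"
      proof (rule Xcong)
        have "u * a - 1 = - (v * b)" using uv by simp
        thus "[u * a = 1] (mod b)" by (simp add: cong_iff_dvd_diff)
      qed
      moreover have "X 1 = 1" using D(1) by (auto simp: X_def disc_set_def psi_one)
      ultimately have 2: "X u * X a = 1" by (simp add: Xmult)
      have 3: "psi q b * X a = (if q < 0 \<and> \<Prod>S < 0 then -1 else 1)"
        using disc_set_reciprocity[OF insert.prems insert.hyps(2)] by (simp add: a_def b_def X_def)
      have "psi q v = psi q b" using 1 psi_values[of q v] psi_values[of q b] by auto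
      moreover have "X u = X a" using 2 by (auto simp: zmult_eq_1_iff)
      ultimately show ?thesis using 3 by simp
    qed
    also have "of_int (if q < 0 \<and> \<Prod>S < 0 then - 1 else 1) * tau q * tau (\<Prod>S) = tau (q * \<Prod>S)"
      using tau_mult[OF prime_disc_nz[OF D(2)] disc_set_prod_nz[OF D(1)]] by auto
    finally show ?case unfolding abs using insert.hyps by (simp add: X_def)
  qed
qed

section \<open>Local generating functions\<close>

definition disc4 :: "int \<Rightarrow> bool" where
  "disc4 D \<longleftrightarrow> D mod 4 = 0 \<or> D mod 4 = 1"

text \<open>With \<open>b = 2 x + D mod 2\<close> this is \<open>(b^2 - D) / 4\<close>
  (\<open>qpol_4\<close>): classes of \<open>x\<close> modulo \<open>a\<close> replace the classes
  of \<open>b\<close> modulo \<open>2 a\<close> with \<open>b^2 = D\<close> modulo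
  \<open>4 a\<close>.\<close>

definition qpol :: "int \<Rightarrow> int \<Rightarrow> int" where
  "qpol D x = x\<^sup>2 + (D mod 2) * x - (D - D mod 2) div 4"

lemma disc4_dvd: "disc4 D \<Longrightarrow> 4 dvd D - D mod 2"
  unfolding disc4_def by presburger

lemma qpol_4: "disc4 D \<Longrightarrow> 4 * qpol D x = (2 * x + D mod 2)\<^sup>2 - D"
proof -
  assume "disc4 D"
  hence "4 * ((D - D mod 2) div 4) = D - D mod 2" using disc4_dvd by simp
  moreover have "D mod 2 = 0 \<or> D mod 2 = 1" by auto
  ultimately show ?thesis by (elim disjE) (simp_all add: qpol_def power2_eq_square algebra_simps)
qed

lemma qpol_shift: "qpol D (x + n * t) = qpol D x + n * t * (2 * x + D mod 2) + n\<^sup>2 * t\<^sup>2"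
  by (simp add: qpol_def power2_eq_square algebra_simps)

lemma disc4_mult: "disc4 a \<Longrightarrow> disc4 b \<Longrightarrow> disc4 (a * b)"
proof -
  assume "disc4 a" "disc4 b"
  moreover have "(a * b) mod 4 = ((a mod 4) * (b mod 4)) mod 4" by (simp add: mod_mult_eq)
  ultimately show ?thesis by (auto simp: disc4_def)
qed

lemma square_mod_4: "(x::int)\<^sup>2 mod 4 = (if even x then 0 else 1)"
proof (cases "even x")
  case True
  then obtain k where "x = 2 * k" by (elim evenE)
  thus ?thesis by (simp add: power2_eq_square)
next
  case False
  then obtain k where "x = 2 * k + 1" by (elim oddE)
  hence "x\<^sup>2 = 4 * (k * (k + 1)) + 1" by (simp add: power2_eq_square algebra_simps)
  thus ?thesis using False by simp
qed

lemma odd_square_mod_8: "odd (x::int) \<Longrightarrow> x\<^sup>2 mod 8 = 1"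
proof -
  assume "odd x"
  then obtain k where k: "x = 2 * k + 1" by (elim oddE)
  have "even (k * (k + 1))" by simp
  then obtain j where "k * (k + 1) = 2 * j" by (elim evenE)
  hence "x\<^sup>2 = 8 * j + 1" using k by (simp add: power2_eq_square algebra_simps)
  thus ?thesis by simp
qed

lemma disc4_square: "disc4 (x\<^sup>2)"
  by (simp add: disc4_def square_mod_4)

lemma disc4_div_odd_square:
  assumes "odd p" "disc4 (p\<^sup>2 * D)" shows "disc4 D"
proof -
  have "(p\<^sup>2 * D) mod 4 = ((p\<^sup>2 mod 4) * D) mod 4" by (simp add: mod_mult_left_eq)
  thus ?thesis using assms by (simp add: square_mod_4 disc4_def)
qed

lemma prime_disc_disc4: "prime_disc q \<Longrightarrow> disc4 q"
  by (auto simp: prime_disc_def disc4_def)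

lemma psi_eqI: "psi q (a * b) = 1 \<Longrightarrow> prime_disc q \<Longrightarrow> psi q a = psi q b"
  using psi_values[of q a] psi_values[of q b] by (auto simp: psi_mult)

text \<open>Odd values of the norm form lie in the kernel of the even characters. This is a check
  modulo 4 or 8, where \<open>E t^2\<close> is 0 or 1 modulo 4 because \<open>E\<close> is a
  discriminant.\<close>

lemma psi_even_norm:
  assumes q: "prime_disc q" "even q" and E: "disc4 E" and odd: "odd (u\<^sup>2 - (q div 4) * E * t\<^sup>2)"
  shows "psi q (u\<^sup>2 - (q div 4) * E * t\<^sup>2) = 1"
proof -
  have Et: "(E * t\<^sup>2) mod 4 = 0 \<or> (E * t\<^sup>2) mod 4 = 1"
    using disc4_mult[OF E disc4_square[of t]] by (simp add: disc4_def)
  define w where "w = E * t\<^sup>2"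
  have w: "w mod 4 = 0 \<or> w mod 4 = 1" using Et by (simp add: w_def)
  have o: "odd (u\<^sup>2 - (q div 4) * w)" using odd by (simp add: w_def mult.assoc)
  from prime_disc_even_cases[OF q] have "psi q (u\<^sup>2 - (q div 4) * w) = 1"
  proof (elim disjE)
    assume q4: "q = -4"
    have "(u\<^sup>2 + w) mod 4 = 1" using o w q4 square_mod_4[of u] by (simp split: if_splits) presburger+
    thus ?thesis using q4 o by (simp add: psi_def)
  next
    assume q8: "q = 8"
    hence "odd u" using o by simp
    hence "u\<^sup>2 mod 8 = 1" by (rule odd_square_mod_8)
    hence "(u\<^sup>2 - 2 * w) mod 8 = 1 \<or> (u\<^sup>2 - 2 * w) mod 8 = 7" using w by presburger
    thus ?thesis using q8 o by (simp add: psi_def)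
  next
    assume q8: "q = -8"
    hence "odd u" using o by simp
    hence "u\<^sup>2 mod 8 = 1" by (rule odd_square_mod_8)
    hence "(u\<^sup>2 + 2 * w) mod 8 = 1 \<or> (u\<^sup>2 + 2 * w) mod 8 = 3" using w by presburger
    thus ?thesis using q8 o by (simp add: psi_def)
  qed
  thus ?thesis by (simp add: w_def mult.assoc)
qed

text \<open>Two represented values prime to \<open>q\<close> have the same character. For odd
  \<open>q\<close>, \<open>4 a r\<close> is a square minus a multiple of \<open>q\<close>; for even
  \<open>q\<close>, \<open>b\<close> is even and \<open>a r\<close> is a value of the norm form of
  \<open>psi_even_norm\<close>.\<close>

lemma psi_form:
  assumes q: "prime_disc q" and E: "disc4 E" and disc: "b\<^sup>2 - 4 * a * c = q * E"
    and r: "r = a * X\<^sup>2 + b * X * Y + c * Y\<^sup>2"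
    and na: "\<not> base_prime q dvd a" and nr: "\<not> base_prime q dvd r"
  shows "psi q (a * r) = 1"
proof (cases "even q")
  case True
  have "even (b\<^sup>2)" using disc True by (metis even_add even_mult_iff even_numeral diff_add_cancel)
  then obtain h where h: "b = 2 * h" by (auto elim!: evenE)
  define k where "k = q div 4"
  have q4: "q = 4 * k" using prime_disc_even_cases[OF q True] by (auto simp: k_def)
  have "4 * (h\<^sup>2 - a * c) = 4 * (k * E)"
    using disc unfolding h q4 by (simp add: power2_eq_square algebra_simps)
  hence "4 * (h\<^sup>2 - a * c) = 4 * ((q div 4) * E)" by (simp only: k_def)
  hence hh: "h\<^sup>2 - a * c = (q div 4) * E" by simp
  have "a * r = (a * X + h * Y)\<^sup>2 - (h\<^sup>2 - a * c) * Y\<^sup>2" unfolding r h by (simp add: power2_eq_square algebra_simps)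
  hence e: "a * r = (a * X + h * Y)\<^sup>2 - (q div 4) * E * Y\<^sup>2" by (simp add: hh)
  have "odd (a * r)" using na nr True by (simp add: base_prime_def)
  thus ?thesis unfolding e by (intro psi_even_norm[OF q True E]) simp
next
  case False
  note o = prime_disc_odd[OF q False]
  have bp: "base_prime q = \<bar>q\<bar>" using False by (simp add: base_prime_def)
  have p2: "\<not> base_prime q dvd 2" unfolding bp using zdvd_imp_le[of "\<bar>q\<bar>" 2] o(3) by auto
  have e: "4 * (a * r) = (2 * a * X + b * Y)\<^sup>2 - (q * E) * Y\<^sup>2"
    unfolding r disc[symmetric] by (simp add: power2_eq_square algebra_simps)
  have "psi q (4 * (a * r)) = psi q ((2 * a * X + b * Y)\<^sup>2)"
    by (rule psi_cong[OF q]) (simp add: cong_iff_dvd_diff e)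
  moreover have "psi q (4 * (a * r)) = psi q 2 * psi q 2 * psi q (a * r)"
    using psi_mult[OF q, of 2 2] psi_mult[OF q, of 4 "a * r"] by simp
  moreover have "psi q ((2 * a * X + b * Y)\<^sup>2) = psi q (2 * a * X + b * Y) * psi q (2 * a * X + b * Y)"
    by (simp add: power2_eq_square psi_mult[OF q])
  moreover have "psi q (a * r) \<noteq> 0"
    using na nr by (simp add: psi_mult[OF q] psi_eq_0_iff)
  ultimately show ?thesis using psi_square[OF p2] psi_values[of q "a * r"] psi_values[of q "2 * a * X + b * Y"] by auto
qed

text \<open>\<open>h\<close> is the constant 1 at a prime that does not divide \<open>d\<close>, and
  \<open>psi q\<close> at the prime of \<open>q\<close>. In the second case \<open>psi q\<close>
  vanishes at \<open>p^\<nu>\<close>, so the weight is read off the cofactor.\<close>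

definition locsum :: "int \<Rightarrow> (int \<Rightarrow> int) \<Rightarrow> int \<Rightarrow> nat \<Rightarrow> int" where
  "locsum D h p \<nu> = (\<Sum>x\<in>{0..<p ^ \<nu>}. if p ^ \<nu> dvd qpol D x then h (qpol D x div p ^ \<nu>) else 0)"

lemma sum_div_mod:
  fixes f :: "int \<Rightarrow> 'a :: comm_monoid_add"
  assumes "n > 0" "m > 0"
  shows "(\<Sum>x\<in>{0..<n * m}. f x) = (\<Sum>y\<in>{0..<n}. \<Sum>t\<in>{0..<m}. f (y + n * t))"
proof -
  have "(\<Sum>y\<in>{0..<n}. \<Sum>t\<in>{0..<m}. f (y + n * t)) = (\<Sum>(y,t)\<in>{0..<n} \<times> {0..<m}. f (y + n * t))"
    by (simp add: sum.cartesian_product)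
  also have "\<dots> = (\<Sum>x\<in>{0..<n * m}. f x)"
  proof (rule sum.reindex_bij_witness[of _ "\<lambda>x. (x mod n, x div n)" "\<lambda>(y,t). y + n * t"])
    fix z assume "z \<in> {0..<n} \<times> {0..<m}"
    then obtain y t where z: "z = (y, t)" "0 \<le> y" "y < n" "0 \<le> t" "t < m" by auto
    show "(((case z of (y, t) \<Rightarrow> y + n * t) mod n), ((case z of (y, t) \<Rightarrow> y + n * t) div n)) = z"
      using z assms by simp
    have "n * t + y < n * t + n" using z by simp
    also have "\<dots> = n * (t + 1)" by (simp add: algebra_simps)
    also have "\<dots> \<le> n * m" using z assms by (intro mult_left_mono) auto
    finally show "(case z of (y, t) \<Rightarrow> y + n * t) \<in> {0..<n * m}" using z assms by (auto simp: algebra_simps)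
    show "f (case z of (y, t) \<Rightarrow> y + n * t) = (case z of (y, t) \<Rightarrow> f (y + n * t))" using z by simp
  next
    fix x assume x: "x \<in> {0..<n * m}"
    show "(case (x mod n, x div n) of (y, t) \<Rightarrow> y + n * t) = x" by simp
    have "n * (x div n) \<le> x" using assms by (simp add: minus_mod_eq_mult_div[symmetric])
    also have "x < n * m" using x by simp
    finally have "x div n < m" using assms by simp
    thus "(x mod n, x div n) \<in> {0..<n} \<times> {0..<m}" using x assms by (auto simp: pos_imp_zdiv_nonneg_iff)
  qed
  finally show ?thesis ..
qed

lemma sum_dvd_indicator:
  fixes p :: int and v :: "'a :: comm_semiring_1"
  assumes "p > 0" "coprime b p"
  shows "(\<Sum>t\<in>{0..<p}. if p dvd b * t + c then v else 0) = v"
proof -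
  define g where "g x = (if p dvd x then v else 0)" for x
  have per: "g (x + p) = g x" for x by (simp add: g_def)
  have "(\<Sum>t\<in>{0..<p}. g (b * t + c)) = (\<Sum>t\<in>{0..<p}. g t)"
    by (rule sum_residue_affine[where f = g, OF per assms])
  also have "\<dots> = (\<Sum>t\<in>{0}. g t)"
    by (rule sum.mono_neutral_right) (use assms in \<open>auto simp: g_def dest: zdvd_imp_le\<close>)
  finally show ?thesis by (simp add: g_def)
qed

lemma prime_coprime_iff: "prime (p::int) \<Longrightarrow> coprime b p \<longleftrightarrow> \<not> p dvd b"
  using prime_imp_coprime[of p b] by (auto simp: coprime_commute dest: coprime_common_divisor[of b p p] not_prime_unit)

lemma odd_prime_not_dvd_4: "prime (p::int) \<Longrightarrow> odd p \<Longrightarrow> coprime 2 p"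
  by (simp add: coprime_commute prime_coprime_iff coprime_left_2_iff_odd)

text \<open>The roots of \<open>qpol (p^2 D)\<close> modulo \<open>p^2\<close> form one class
  \<open>x = t + p y\<close>, on which the value is \<open>p^2 qpol D y\<close>. The exponent drops
  by two but the range of \<open>y\<close> only by one, so each root modulo \<open>p^\<nu>\<close>
  is met \<open>p\<close> times.\<close>

lemma locsum_square:
  assumes p: "prime p" and D: "disc4 D"
  shows "locsum (p\<^sup>2 * D) h p (\<nu> + 2) =
    (\<Sum>y\<in>{0..<p ^ (\<nu> + 1)}. if p ^ \<nu> dvd qpol D y then h (qpol D y div p ^ \<nu>) else 0)"
proof -
  have p0: "p > 0" "p \<ge> 2" using prime_gt_0_int[OF p] prime_ge_2_int[OF p] by auto
  define D' where "D' = p\<^sup>2 * D"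
  have D': "disc4 D'" unfolding D'_def by (intro disc4_mult disc4_square D)
  \<comment> \<open>Matches the two parity offsets: \<open>2 (p y + t) + D' mod 2\<close> becomes
    \<open>p\<close> times \<open>2 y + D mod 2\<close>.\<close>
  define t where "t = (p * (D mod 2) - D' mod 2) div 2"
  have t: "2 * t + D' mod 2 = p * (D mod 2)" and t2: "0 \<le> t" "t < p"
  proof -
    have par: "even (p * (D mod 2) - D' mod 2)"
      by (auto simp: D'_def even_iff_mod_2_eq_zero[symmetric] odd_iff_mod_2_eq_one[symmetric] dvd_mod_iff)
    thus e: "2 * t + D' mod 2 = p * (D mod 2)" unfolding t_def by simp
    have d: "D mod 2 = 0 \<or> D mod 2 = 1" "D' mod 2 = 0 \<or> D' mod 2 = 1" by auto
    have "D mod 2 = 0 \<Longrightarrow> D' mod 2 = 0" unfolding D'_def by (simp add: even_iff_mod_2_eq_zero[symmetric])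
    thus "0 \<le> t" "t < p" using e d p0 by auto
  qed
  have key: "qpol D' (p * y + t) = p\<^sup>2 * qpol D y" for y
  proof -
    have e: "2 * (p * y + t) + D' mod 2 = p * (2 * y + D mod 2)"
      using t by (simp add: algebra_simps)
    have "4 * qpol D' (p * y + t) = (p * (2 * y + D mod 2))\<^sup>2 - p\<^sup>2 * D"
      unfolding qpol_4[OF D'] e by (simp only: D'_def)
    also have "\<dots> = p\<^sup>2 * ((2 * y + D mod 2)\<^sup>2 - D)"
      by (simp add: power_mult_distrib right_diff_distrib)
    also have "\<dots> = 4 * (p\<^sup>2 * qpol D y)" unfolding qpol_4[OF D, symmetric] by simp
    finally show ?thesis by simp
  qed
  \<comment> \<open>Roots modulo \<open>p^2\<close> lie in the class of \<open>t\<close>: for odd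
    \<open>p\<close> because \<open>p\<close> divides \<open>2 x + D' mod 2\<close>, for
    \<open>p = 2\<close> because \<open>x\<close> and \<open>D\<close> have equal parity.\<close>
  have nec: "[x = t] (mod p)" if x: "p\<^sup>2 dvd qpol D' x" for x
  proof (cases "p = 2")
    case True
    hence D'e: "D' mod 2 = 0" "D' div 4 = D" by (auto simp: D'_def)
    have "t = D mod 2" using t True D'e by simp
    moreover have "4 dvd x\<^sup>2 - D" using x True D'e by (simp add: qpol_def)
    hence "even (x\<^sup>2 - D)" by (meson dvd_trans even_numeral)
    hence "even x \<longleftrightarrow> even D" by simp
    ultimately show ?thesis using True by (auto simp: cong_def) presburger
  next
    case False
    hence op: "odd p" using p p0 prime_odd_int[of p] by simp
    have "p\<^sup>2 dvd 4 * qpol D' x + D'" using x by (simp add: D'_def)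
    hence "p\<^sup>2 dvd (2 * x + D' mod 2)\<^sup>2" by (simp add: qpol_4[OF D'])
    hence "p dvd 2 * x + D' mod 2" by simp
    moreover have "2 * x + D' mod 2 = 2 * (x - t) + p * (D mod 2)" using t by simp
    ultimately have "p dvd 2 * (x - t) + p * (D mod 2)" by (simp only:)
    hence "p dvd 2 * (x - t)" by (simp only: dvd_add_left_iff dvd_triv_left)
    hence "p dvd x - t" using odd_prime_not_dvd_4[OF p op] by (metis coprime_commute coprime_dvd_mult_right_iff)
    thus ?thesis by (simp add: cong_iff_dvd_diff)
  qed
  define f where "f x = (if p ^ (\<nu> + 2) dvd qpol D' x then h (qpol D' x div p ^ (\<nu> + 2)) else 0)" for x
  have fy: "f (t + p * y) = (if p ^ \<nu> dvd qpol D y then h (qpol D y div p ^ \<nu>) else 0)" for y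
  proof -
    have a: "qpol D' (t + p * y) = p\<^sup>2 * qpol D y" using key[of y] by (simp add: add.commute)
    have b: "p ^ (\<nu> + 2) = p\<^sup>2 * p ^ \<nu>" by (simp add: power2_eq_square)
    show ?thesis unfolding f_def a b using p0 by simp
  qed
  have "locsum D' h p (\<nu> + 2) = (\<Sum>x\<in>{0..<p * p ^ (\<nu> + 1)}. f x)"
  proof -
    have e: "p * p ^ (\<nu> + 1) = p ^ (\<nu> + 2)" by simp
    show ?thesis unfolding e locsum_def f_def ..
  qed
  also have "\<dots> = (\<Sum>y\<in>{0..<p}. \<Sum>s\<in>{0..<p ^ (\<nu> + 1)}. f (y + p * s))"
    by (rule sum_div_mod) (use p0 in auto)
  also have "\<dots> = (\<Sum>y\<in>{t}. \<Sum>s\<in>{0..<p ^ (\<nu> + 1)}. f (y + p * s))"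
  proof (rule sum.mono_neutral_right)
    show "\<forall>y\<in>{0..<p} - {t}. (\<Sum>s\<in>{0..<p ^ (\<nu> + 1)}. f (y + p * s)) = 0"
    proof (intro ballI sum.neutral)
      fix y s assume y: "y \<in> {0..<p} - {t}"
      have "\<not> p\<^sup>2 dvd qpol D' (y + p * s)"
      proof
        assume "p\<^sup>2 dvd qpol D' (y + p * s)"
        hence "[y + p * s = t] (mod p)" by (rule nec)
        hence "y mod p = t mod p" by (simp add: cong_def)
        thus False using y t2 by simp
      qed
      moreover have "p\<^sup>2 dvd p ^ (\<nu> + 2)" by (rule le_imp_power_dvd) simp
      ultimately show "f (y + p * s) = 0" unfolding f_def by (metis dvd_trans)
    qed
  qed (use t2 in auto)
  finally show ?thesis by (simp add: fy D'_def)
qed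

lemma locterm_per_one:
  "(if p ^ \<nu> dvd qpol D (x + p ^ \<nu>) then (1::int) else 0) = (if p ^ \<nu> dvd qpol D x then 1 else 0)"
proof -
  have "qpol D (x + p ^ \<nu> * 1) = qpol D x + p ^ \<nu> * (2 * x + D mod 2 + p ^ \<nu>)"
    unfolding qpol_shift by (simp add: power2_eq_square algebra_simps)
  thus ?thesis by (simp add: dvd_add_left_iff)
qed

text \<open>\<open>c\<close> and \<open>a + b + c\<close> are both values of the form, compared by
  \<open>psi_form\<close> with \<open>a\<close> and \<open>c\<close> exchanged. This yields the
  periodicity of the ramified weight under \<open>x \<mapsto> x + n\<close>.\<close>

lemma psi_translate:
  assumes q: "prime_disc q" and E: "disc4 E" and disc: "b\<^sup>2 - 4 * a * c = q * E" and pa: "base_prime q dvd a"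
  shows "psi q (a + b + c) = psi q c"
proof -
  have pp: "prime (base_prime q)" by (rule prime_base_prime[OF q])
  have "base_prime q dvd b\<^sup>2"
  proof -
    have "b\<^sup>2 = q * E + 4 * a * c" using disc by simp
    thus ?thesis using base_prime_dvd[OF q] pa by simp
  qed
  hence pb: "base_prime q dvd b" using pp prime_dvd_power by blast
  hence iff: "base_prime q dvd a + b + c \<longleftrightarrow> base_prime q dvd c" using pa by (simp add: dvd_add_right_iff)
  show ?thesis
  proof (cases "base_prime q dvd c")
    case True
    hence "psi q (a + b + c) = 0" "psi q c = 0" using iff by (simp_all add: psi_eq_0_iff)
    thus ?thesis by simp
  next
    case False
    have "psi q (c * (a + b + c)) = 1"
      by (rule psi_form[OF q E, where a = c and b = b and c = a and X = 1 and Y = 1])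
        (use disc False iff in \<open>simp_all add: mult_ac add_ac\<close>)
    from psi_eqI[OF this q] show ?thesis by simp
  qed
qed

lemma locterm_per_psi:
  assumes q: "prime_disc q" and E: "disc4 E" and \<nu>: "n > 0" "base_prime q dvd n"
  shows "(if n dvd qpol (q * E) (x + n) then psi q (qpol (q * E) (x + n) div n) else 0) =
    (if n dvd qpol (q * E) x then psi q (qpol (q * E) x div n) else 0)"
proof -
  define D where "D = q * E"
  have D: "disc4 D" unfolding D_def by (intro disc4_mult E prime_disc_disc4 q)
  have sh: "qpol D (x + n) = qpol D x + n * (2 * x + D mod 2 + n)"
    using qpol_shift[of D x n 1] by (simp add: power2_eq_square algebra_simps)
  show ?thesis
  proof (cases "n dvd qpol D x")
    case True
    then obtain c where c: "qpol D x = n * c" by (elim dvdE)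
    have c': "qpol D (x + n) = n * (n + (2 * x + D mod 2) + c)" unfolding sh c by (simp add: algebra_simps)
    have "psi q (n + (2 * x + D mod 2) + c) = psi q c"
    proof (rule psi_translate[OF q E _ \<nu>(2)])
      show "(2 * x + D mod 2)\<^sup>2 - 4 * n * c = q * E"
        using qpol_4[OF D, of x] c by (simp add: D_def mult_ac)
    qed
    thus ?thesis unfolding D_def[symmetric] c c' using \<nu> by simp
  next
    case False
    hence "\<not> n dvd qpol D (x + n)" unfolding sh by (simp add: dvd_add_left_iff)
    thus ?thesis using False by (simp add: D_def)
  qed
qed

lemma locsum_0: "locsum D h p 0 = h (qpol D 0)"
proof -
  have "{0..<1::int} = {0}" by auto
  thus ?thesis by (simp add: locsum_def)
qed

lemma locsum_one_square_2: "prime p \<Longrightarrow> disc4 D \<Longrightarrow> locsum (p\<^sup>2 * D) (\<lambda>_. 1) p 2 = p"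
  using locsum_square[of p D "\<lambda>_. 1" 0] prime_gt_0_int[of p] by (simp add: numeral_2_eq_2)

lemma locsum_one_square:
  assumes p: "prime p" "disc4 D"
  shows "locsum (p\<^sup>2 * D) (\<lambda>_. 1) p (\<nu> + 2) = p * locsum D (\<lambda>_. 1) p \<nu>"
proof -
  have p0: "p > 0" using prime_gt_0_int[OF p(1)] .
  have "(\<Sum>y\<in>{0..<p ^ \<nu> * int (nat p)}. if p ^ \<nu> dvd qpol D y then 1 else 0 :: int) =
     of_nat (nat p) * (\<Sum>y\<in>{0..<p ^ \<nu>}. if p ^ \<nu> dvd qpol D y then 1 else 0)"
    by (rule sum_residue_mult[where f = "\<lambda>y. if p ^ \<nu> dvd qpol D y then 1 else 0 :: int", OF locterm_per_one]) (use p0 in auto)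
  thus ?thesis unfolding locsum_square[OF p] using p0 by (simp add: locsum_def mult.commute)
qed

lemma locsum_psi_square:
  assumes q: "prime_disc q" and E: "disc4 E" and p: "p = base_prime q" and \<nu>: "\<nu> > 0"
  shows "locsum (q * (p\<^sup>2 * E)) (psi q) p (\<nu> + 2) = p * locsum (q * E) (psi q) p \<nu>"
proof -
  have pp: "prime p" unfolding p by (rule prime_base_prime[OF q])
  have p0: "p > 0" using prime_gt_0_int[OF pp] .
  have D: "disc4 (q * E)" by (intro disc4_mult E prime_disc_disc4 q)
  have e: "q * (p\<^sup>2 * E) = p\<^sup>2 * (q * E)" by simp
  define f where "f y = (if p ^ \<nu> dvd qpol (q * E) y then psi q (qpol (q * E) y div p ^ \<nu>) else 0)" for y
  have "f (y + p ^ \<nu>) = f y" for y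
    unfolding f_def by (rule locterm_per_psi[OF q E]) (use p0 \<nu> p in auto)
  hence "(\<Sum>y\<in>{0..<p ^ \<nu> * int (nat p)}. f y) = of_nat (nat p) * (\<Sum>y\<in>{0..<p ^ \<nu>}. f y)"
    by (rule sum_residue_mult) (use p0 in auto)
  hence "(\<Sum>y\<in>{0..<p ^ (\<nu> + 1)}. f y) = p * (\<Sum>y\<in>{0..<p ^ \<nu>}. f y)"
    using p0 by (simp add: mult.commute)
  thus ?thesis unfolding e locsum_square[OF pp D] unfolding locsum_def f_def .
qed

lemma even_qpol: "even D \<Longrightarrow> qpol D x = x\<^sup>2 - D div 4"
  by (simp add: qpol_def)

lemma even_disc_qpol:
  assumes "prime_disc q" "even q" shows "qpol (q * E) x = x\<^sup>2 - (q div 4) * E"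
proof -
  have "q = 4 * (q div 4)" using prime_disc_even_cases[OF assms] by auto
  hence "(q * E) div 4 = (q div 4) * E" by (metis mult.assoc nonzero_mult_div_cancel_left zero_neq_numeral)
  thus ?thesis using assms by (simp add: even_qpol)
qed

lemma psi_4_mult:
  assumes "prime_disc q" "odd q" shows "psi q (4 * x) = psi q x"
proof -
  have "\<not> base_prime q dvd 2"
    using zdvd_imp_le[of "\<bar>q\<bar>" 2] prime_disc_odd(3)[OF assms] assms(2) by (auto simp: base_prime_def)
  hence "psi q 2 * psi q 2 = 1" by (rule psi_square)
  thus ?thesis using psi_mult[OF assms(1), of 2 2] psi_mult[OF assms(1), of 4 x] by simp
qed

text \<open>For odd \<open>q\<close> the substitution \<open>b = 2 x + D mod 2\<close> turns \<open>4 qpol D x\<close> into \<open>b\<^sup>2 - D\<close>.\<close>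

lemma sum_psi_qpol:
  assumes q: "prime_disc q" "odd q" and D: "disc4 D"
  shows "(\<Sum>y\<in>{0..<\<bar>q\<bar>}. psi q (qpol D y)) = (\<Sum>b\<in>{0..<\<bar>q\<bar>}. psi q (b\<^sup>2 - D))"
proof -
  have "(\<Sum>y\<in>{0..<\<bar>q\<bar>}. psi q (qpol D y)) = (\<Sum>y\<in>{0..<\<bar>q\<bar>}. psi q ((2 * y + D mod 2)\<^sup>2 - D))"
    by (simp add: qpol_4[OF D, symmetric] psi_4_mult[OF q])
  also have "\<dots> = (\<Sum>b\<in>{0..<\<bar>q\<bar>}. psi q (b\<^sup>2 - D))"
  proof (rule sum_residue_affine[where f = "\<lambda>b. psi q (b\<^sup>2 - D)"])
    show "psi q ((x + \<bar>q\<bar>)\<^sup>2 - D) = psi q (x\<^sup>2 - D)" for x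
      by (rule psi_cong[OF q(1)]) (simp add: cong_iff_dvd_diff power2_eq_square algebra_simps)
    show "\<bar>q\<bar> > 0" using prime_disc_nz[OF q(1)] by simp
    show "coprime 2 \<bar>q\<bar>" using q(2) by (simp add: coprime_left_2_iff_odd)
  qed
  finally show ?thesis .
qed

text \<open>By \<open>locsum_square\<close> with exponent 0 this is a sum of \<open>psi q\<close>
  over one period of \<open>qpol (q E)\<close>. The values are squares up to the factor 4 for odd
  \<open>q\<close> and norms for even \<open>q\<close>, and exactly one residue contributes
  0.\<close>

lemma locsum_psi_square_2:
  assumes q: "prime_disc q" and E: "disc4 E" and p: "p = base_prime q"
  shows "locsum (q * (p\<^sup>2 * E)) (psi q) p 2 = p - 1"
proof -
  have pp: "prime p" unfolding p by (rule prime_base_prime[OF q])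
  have D: "disc4 (q * E)" by (intro disc4_mult E prime_disc_disc4 q)
  have e: "q * (p\<^sup>2 * E) = p\<^sup>2 * (q * E)" by simp
  have s: "locsum (q * (p\<^sup>2 * E)) (psi q) p 2 = (\<Sum>y\<in>{0..<p}. psi q (qpol (q * E) y))"
    unfolding e using locsum_square[OF pp D, of "psi q" 0] by (simp add: numeral_2_eq_2)
  show ?thesis
  proof (cases "even q")
    case True
    have p2: "p = 2" using True p by (simp add: base_prime_def)
    have val: "psi q (y\<^sup>2 - (q div 4) * E) = (if odd (y\<^sup>2 - (q div 4) * E) then 1 else 0)" for y
      using psi_even_norm[OF q True E, of y 1] psi_eq_0_iff[of q "y\<^sup>2 - (q div 4) * E"] True
      by (auto simp: base_prime_def)
    have "{0..<2::int} = {0, 1}" by auto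
    hence "(\<Sum>y\<in>{0..<p}. psi q (qpol (q * E) y)) = psi q (0\<^sup>2 - (q div 4) * E) + psi q (1\<^sup>2 - (q div 4) * E)"
      unfolding p2 even_disc_qpol[OF q True] by simp
    also have "\<dots> = 1" unfolding val by auto
    finally show ?thesis unfolding s using p2 by simp
  next
    case False
    have pq: "p = \<bar>q\<bar>" using False p by (simp add: base_prime_def)
    have val: "psi q (b\<^sup>2 - q * E) = (if b = 0 then 0 else 1)" if "b \<in> {0..<p}" for b
    proof -
      have "psi q (b\<^sup>2 - q * E) = psi q (b\<^sup>2)" by (rule psi_cong[OF q]) (simp add: cong_iff_dvd_diff)
      moreover have "psi q (b\<^sup>2) = (if b = 0 then 0 else 1)"
      proof (cases "b = 0")
        case True thus ?thesis by (simp add: psi_eq_0_iff)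
      next
        case False
        hence "\<not> base_prime q dvd b" using that p by (auto dest: zdvd_imp_le)
        thus ?thesis using False psi_square by (simp add: power2_eq_square psi_mult[OF q])
      qed
      ultimately show ?thesis by simp
    qed
    have p0: "p > 0" using prime_gt_0_int[OF pp] .
    have "locsum (q * (p\<^sup>2 * E)) (psi q) p 2 = (\<Sum>b\<in>{0..<p}. if b = 0 then 0 else 1)"
      unfolding s unfolding pq sum_psi_qpol[OF q False D] using val pq by (intro sum.cong refl) simp
    also have "\<dots> = (\<Sum>b\<in>{0<..<p}. 1)" using p0 by (intro sum.mono_neutral_cong_right) auto
    finally show ?thesis using p0 by simp
  qed
qed

lemma odd_root_unique:
  assumes p: "prime p" "odd p" and D: "disc4 D" "p dvd D"
  shows "p dvd qpol D x \<longleftrightarrow> p dvd 2 * x + D mod 2"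
proof -
  have "coprime (2 * 2) p" using odd_prime_not_dvd_4[OF p] by (simp only: coprime_mult_left_iff)
  hence c: "coprime 4 p" by simp
  have "p dvd qpol D x \<longleftrightarrow> p dvd 4 * qpol D x"
    using c by (simp add: coprime_dvd_mult_right_iff coprime_commute)
  also have "\<dots> \<longleftrightarrow> p dvd (2 * x + D mod 2)\<^sup>2" unfolding qpol_4[OF D(1)] using D(2) by (simp add: dvd_diff_left_iff)
  also have "\<dots> \<longleftrightarrow> p dvd 2 * x + D mod 2" using p(1) by (simp add: prime_dvd_power_iff)
  finally show ?thesis .
qed

text \<open>Since \<open>p\<close> divides the discriminant there is a single root modulo
  \<open>p\<close>. For odd \<open>q\<close> its cofactor \<open>c\<close> satisfies
  \<open>4 c = - sgn q * E\<close> modulo \<open>q\<close>, and \<open>psi q (- sgn q) = 1\<close>;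
  for even \<open>q\<close> the residues of \<open>E\<close> modulo 8 are inspected.\<close>

lemma locsum_psi_1:
  assumes q: "prime_disc q" and E: "disc4 E" and p: "p = base_prime q"
  shows "locsum (q * E) (psi q) p 1 = kronecker_prime E p"
proof (cases "even q")
  case True
  have p2: "p = 2" using True p by (simp add: base_prime_def)
  have I: "{0..<2::int} = {0, 1}" by auto
  define e where "e = (q div 4) * E"
  have L: "locsum (q * E) (psi q) p 1 = (if even e then psi q ((- e) div 2) else psi q ((1 - e) div 2))"
    unfolding locsum_def p2 even_disc_qpol[OF q True] e_def[symmetric] power_one_right I by auto
  have k: "kronecker_prime E 2 = (if even E then 0 else if E mod 8 = 1 then 1 else -1)"
  proof -
    have "E mod 4 = 1" if "odd E" using that E unfolding disc4_def by presburger
    hence "E mod 8 \<noteq> 7" if "odd E" using that by presburger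
    thus ?thesis by (auto simp: kronecker_prime_def)
  qed
  have E4: "E mod 4 = 0 \<or> E mod 4 = 1" using E by (simp add: disc4_def)
  have E8: "E mod 4 = 0 \<or> E mod 8 = 1 \<or> E mod 8 = 5" using E4 by presburger
  from prime_disc_even_cases[OF q True] show ?thesis
  proof (elim disjE)
    assume q4: "q = -4"
    from E8 consider "E mod 4 = 0" | "E mod 8 = 1" | "E mod 8 = 5" by blast
    thus ?thesis
    proof cases
      case 1
      hence "even E" "even (E div 2)" by presburger+
      thus ?thesis unfolding L unfolding p2 k by (simp add: e_def q4 psi_def)
    next
      case 2
      hence "odd E" "odd ((1 + E) div 2)" "((1 + E) div 2) mod 4 = 1" by presburger+
      thus ?thesis unfolding L unfolding p2 k using 2 by (simp add: e_def q4 psi_def)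
    next
      case 3
      hence "odd E" "odd ((1 + E) div 2)" "((1 + E) div 2) mod 4 = 3" by presburger+
      thus ?thesis unfolding L unfolding p2 k using 3 by (simp add: e_def q4 psi_def)
    qed
  next
    assume q8: "q = 8"
    have "(- (2 * E)) div 2 = - E" by simp
    moreover have "E mod 8 = 1 \<Longrightarrow> (- E) mod 8 = 7" "E mod 8 = 5 \<Longrightarrow> (- E) mod 8 = 3" by presburger+
    moreover have "E mod 4 = 0 \<Longrightarrow> even E" "E mod 8 = 1 \<Longrightarrow> odd E" "E mod 8 = 5 \<Longrightarrow> odd E" by presburger+
    ultimately show ?thesis unfolding L unfolding p2 k using E8 by (auto simp: e_def q8 psi_def)
  next
    assume q8: "q = -8"
    moreover have "E mod 4 = 0 \<Longrightarrow> even E" "E mod 8 = 1 \<Longrightarrow> odd E" "E mod 8 = 5 \<Longrightarrow> odd E" by presburger+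
    ultimately show ?thesis unfolding L unfolding p2 k using E8 by (auto simp: e_def q8 psi_def)
  qed
next
  case False
  have pq: "p = \<bar>q\<bar>" using False p by (simp add: base_prime_def)
  have pp: "prime p" unfolding p by (rule prime_base_prime[OF q])
  have op: "odd p" using False pq by simp
  have p0: "p > 0" using prime_gt_0_int[OF pp] .
  define D where "D = q * E"
  have D: "disc4 D" unfolding D_def by (intro disc4_mult E prime_disc_disc4 q)
  have pD: "p dvd D" by (simp add: D_def pq)
  have val: "psi q (qpol D x div p) = kronecker_prime E p" if x: "p dvd 2 * x + D mod 2" for x
  proof -
    obtain c where c: "qpol D x = p * c" using x odd_root_unique[OF pp op D pD] by (auto elim: dvdE)
    obtain b where b: "2 * x + D mod 2 = p * b" using x by (auto elim: dvdE)
    have qs: "q = sgn q * p" by (simp add: pq sgn_if)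
    have "4 * (p * c) = (p * b)\<^sup>2 - (sgn q * p) * E"
      using qpol_4[OF D, of x] unfolding b c by (simp only: D_def qs[symmetric])
    hence "p * (4 * c) = p * (p * b\<^sup>2 - sgn q * E)"
      by (simp add: power2_eq_square algebra_simps)
    hence "4 * c = p * b\<^sup>2 - sgn q * E" using p0 by simp
    hence "psi q (4 * c) = psi q (- (sgn q) * E)"
      by (intro psi_cong[OF q]) (simp add: cong_iff_dvd_diff pq)
    hence "psi q c = psi q (- sgn q * E)" unfolding psi_4_mult[OF q False] .
    also have "\<dots> = psi q (- sgn q) * psi q E" by (rule psi_mult[OF q])
    also have "psi q (- sgn q) = 1"
      using psi_one[OF q] psi_minus_one[OF q] prime_disc_nz[OF q] by (auto simp: sgn_if)
    also have "psi q E = kronecker_prime E p"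
      using False prime_disc_odd(3)[OF q False] by (simp add: psi_def kronecker_prime_def pq)
    finally show ?thesis using c p0 by simp
  qed
  have "locsum D (psi q) p 1 = (\<Sum>x\<in>{0..<p}. if p dvd 2 * x + D mod 2 then kronecker_prime E p else 0)"
    unfolding locsum_def power_one_right odd_root_unique[OF pp op D pD] by (intro sum.cong refl) (simp add: val)
  also have "\<dots> = kronecker_prime E p"
    by (rule sum_dvd_indicator[OF p0 odd_prime_not_dvd_4[OF pp op]])
  finally show ?thesis by (simp add: D_def)
qed

text \<open>Minimality at \<open>p\<close>: no factor \<open>p^2\<close> can be removed within the
  discriminants. It marks the base case of the recursion under
  \<open>D \<mapsto> p^2 D\<close>.\<close>

definition pmin :: "int \<Rightarrow> int \<Rightarrow> bool" where
  "pmin p B \<longleftrightarrow> disc4 B \<and> (\<forall>B'. B = p\<^sup>2 * B' \<longrightarrow> \<not> disc4 B')"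

lemma pmin_odd: "odd p \<Longrightarrow> pmin p B \<Longrightarrow> \<not> p\<^sup>2 dvd B"
  using disc4_div_odd_square by (auto simp: pmin_def elim!: dvdE)

lemma qpol_root_dvd:
  assumes p: "prime p" "odd p" and D: "disc4 D" and dvd: "p\<^sup>2 dvd qpol D x" "p dvd D"
  shows "p\<^sup>2 dvd D"
proof -
  have "p dvd qpol D x" using dvd(1) unfolding power2_eq_square by (rule dvd_mult_left)
  hence "p dvd 2 * x + D mod 2" using odd_root_unique[OF p D dvd(2)] by simp
  hence "p\<^sup>2 dvd (2 * x + D mod 2)\<^sup>2" by (rule dvd_power_same)
  moreover have "p\<^sup>2 dvd 4 * qpol D x" using dvd(1) by simp
  ultimately have "p\<^sup>2 dvd (2 * x + D mod 2)\<^sup>2 - 4 * qpol D x" by (rule dvd_diff)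
  thus ?thesis by (simp add: qpol_4[OF D])
qed

lemma square_dvd_power: "(p::int)\<^sup>2 dvd p ^ (\<nu> + 2)"
  by (rule le_imp_power_dvd) simp

lemma locsum_zeroI:
  assumes "\<And>x. \<not> p\<^sup>2 dvd qpol D x" shows "locsum D h p (\<nu> + 2) = 0"
proof -
  have "\<not> p ^ (\<nu> + 2) dvd qpol D x" for x using assms dvd_trans[OF square_dvd_power] by blast
  thus ?thesis by (simp add: locsum_def)
qed

text \<open>As \<open>B\<close> is prime to \<open>p\<close>, no root modulo \<open>p^2\<close>
  exists: for odd \<open>p\<close> because \<open>p^2\<close> does not divide \<open>q B\<close>,
  for \<open>p = 2\<close> by residues modulo 4.\<close>

lemma locsum_psi_unit:
  assumes q: "prime_disc q" and p: "p = base_prime q" and B: "pmin p B" "\<not> p dvd B"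
  shows "locsum (q * B) (psi q) p (\<nu> + 2) = 0"
proof (rule locsum_zeroI)
  fix x
  have dB: "disc4 B" using B by (simp add: pmin_def)
  show "\<not> p\<^sup>2 dvd qpol (q * B) x"
  proof (cases "even q")
    case True
    have p2: "p = 2" using True p by (simp add: base_prime_def)
    have "B mod 4 = 1" using B dB p2 unfolding disc4_def by presburger
    moreover have "x\<^sup>2 mod 4 = 0 \<or> x\<^sup>2 mod 4 = 1" by (simp add: square_mod_4)
    ultimately have "\<not> 4 dvd x\<^sup>2 + B" "\<not> 4 dvd x\<^sup>2 - 2 * B" "\<not> 4 dvd x\<^sup>2 + 2 * B" by presburger+
    with prime_disc_even_cases[OF q True] show ?thesis unfolding even_disc_qpol[OF q True] p2 by auto
  next
    case False
    have pq: "p = \<bar>q\<bar>" using False p by (simp add: base_prime_def)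
    have pp: "prime p" unfolding p by (rule prime_base_prime[OF q])
    have D: "disc4 (q * B)" by (intro disc4_mult dB prime_disc_disc4 q)
    have "\<not> p\<^sup>2 dvd q * B"
    proof
      assume "p\<^sup>2 dvd q * B"
      hence "q * q dvd q * B" unfolding pq by (simp add: power2_eq_square)
      hence "p dvd B" using prime_disc_nz[OF q] pq by simp
      thus False using B by simp
    qed
    thus ?thesis using qpol_root_dvd[OF pp _ D] False pq by auto
  qed
qed

lemma sum_psi_conic:
  assumes q: "prime_disc q" "odd q" and w: "\<not> \<bar>q\<bar> dvd w"
  shows "(\<Sum>b\<in>{0..<\<bar>q\<bar>}. psi q (b\<^sup>2 - w)) = -1"
proof -
  define p where "p = \<bar>q\<bar>"
  note o = prime_disc_odd[OF q]
  have p: "prime p" "p > 2" using o by (auto simp: p_def)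
  have L: "psi q x = Legendre x p" for x using q(2) by (simp add: psi_def p_def)
  have op: "coprime 2 p" using q(2) by (simp add: p_def coprime_left_2_iff_odd)
  have wp: "\<not> p dvd w" using w by (simp add: p_def)
  text \<open>Count the points of \<open>b\<^sup>2 - y\<^sup>2 = w\<close> in the coordinates \<open>u = b + y\<close> and \<open>y\<close>: for each \<open>u\<close>
    prime to \<open>p\<close> the equation \<open>u (u - 2 y) = w\<close> determines \<open>y\<close>.\<close>
  define g :: "int \<Rightarrow> int \<Rightarrow> int" where "g b y = (if p dvd b\<^sup>2 - w - y\<^sup>2 then 1 else 0)" for b y
  have "(\<Sum>b\<in>{0..<p}. \<Sum>y\<in>{0..<p}. g b y) = (\<Sum>b\<in>{0..<p}. 1 + psi q (b\<^sup>2 - w))"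
  proof (intro sum.cong refl)
    fix b
    have "(\<Sum>y\<in>{0..<p}. g b y) = (\<Sum>y\<in>{y\<in>{0..<p}. [y\<^sup>2 = b\<^sup>2 - w] (mod p)}. 1)"
      unfolding g_def by (intro sum.mono_neutral_cong_right) (auto simp: cong_iff_dvd_diff dvd_diff_commute)
    also have "\<dots> = int (card {y\<in>{0..<p}. [y\<^sup>2 = b\<^sup>2 - w] (mod p)})" by simp
    finally show "(\<Sum>y\<in>{0..<p}. g b y) = 1 + psi q (b\<^sup>2 - w)" unfolding card_square_roots[OF p] L .
  qed
  also have "\<dots> = p + (\<Sum>b\<in>{0..<p}. psi q (b\<^sup>2 - w))" using p by (simp add: sum.distrib)
  finally have 1: "(\<Sum>b\<in>{0..<p}. \<Sum>y\<in>{0..<p}. g b y) = p + (\<Sum>b\<in>{0..<p}. psi q (b\<^sup>2 - w))" .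
  have gper: "g (b + p) y = g b y" for b y
  proof -
    have "(b + p)\<^sup>2 - w - y\<^sup>2 = (b\<^sup>2 - w - y\<^sup>2) + p * (2 * b + p)" by (simp add: power2_eq_square algebra_simps)
    thus ?thesis unfolding g_def by (simp only: dvd_add_left_iff dvd_triv_left)
  qed
  have "(\<Sum>b\<in>{0..<p}. \<Sum>y\<in>{0..<p}. g b y) = (\<Sum>y\<in>{0..<p}. \<Sum>b\<in>{0..<p}. g b y)" by (rule sum.swap)
  also have "\<dots> = (\<Sum>y\<in>{0..<p}. \<Sum>u\<in>{0..<p}. g (1 * u + (- y)) y)"
    by (intro sum.cong refl sum_residue_affine[symmetric] gper) (use p in auto)
  also have "\<dots> = (\<Sum>u\<in>{0..<p}. \<Sum>y\<in>{0..<p}. g (1 * u + (- y)) y)" by (rule sum.swap)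
  also have "\<dots> = (\<Sum>u\<in>{0..<p}. if u = 0 then 0 else 1)"
  proof (intro sum.cong refl)
    fix u assume u: "u \<in> {0..<p}"
    have e: "(1 * u + (- y))\<^sup>2 - w - y\<^sup>2 = (- 2 * u) * y + (u\<^sup>2 - w)" for y by (simp add: power2_eq_square algebra_simps)
    show "(\<Sum>y\<in>{0..<p}. g (1 * u + (- y)) y) = (if u = 0 then 0 else 1)"
    proof (cases "u = 0")
      case True thus ?thesis using wp by (simp add: g_def)
    next
      case False
      hence "\<not> p dvd u" using u by (auto dest: zdvd_imp_le)
      hence "coprime u p" using prime_coprime_iff[OF p(1)] by simp
      hence "coprime (- 2 * u) p" using op by simp
      hence "(\<Sum>y\<in>{0..<p}. if p dvd (- 2 * u) * y + (u\<^sup>2 - w) then 1 else 0) = (1::int)"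
        using p by (intro sum_dvd_indicator) auto
      thus ?thesis unfolding g_def e using False by simp
    qed
  qed
  also have "\<dots> = (\<Sum>u\<in>{0<..<p}. 1)" using p by (intro sum.mono_neutral_cong_right) auto
  also have "\<dots> = p - 1" using p by simp
  finally show ?thesis using 1 by (simp add: p_def)
qed

lemma sum_psi_linear:
  assumes q: "prime_disc q" "odd q" and b: "\<not> \<bar>q\<bar> dvd b"
  shows "(\<Sum>t\<in>{0..<\<bar>q\<bar>}. psi q (b * t + c)) = 0"
proof -
  note o = prime_disc_odd[OF q]
  have "(\<Sum>t\<in>{0..<\<bar>q\<bar>}. psi q (b * t + c)) = (\<Sum>t\<in>{0..<\<bar>q\<bar>}. psi q t)"
    by (rule sum_residue_affine[where f = "psi q" and n = "\<bar>q\<bar>", OF psi_per[OF q(1)]]) (use b prime_coprime_iff[OF o(1)] o in auto)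
  also have "\<dots> = 0" using sum_Legendre[OF o(1,3)] q(2) by (simp add: psi_def)
  finally show ?thesis .
qed

text \<open>Here \<open>q B = p^2 w\<close> with \<open>w\<close> prime to \<open>p\<close>, and
  \<open>locsum_square\<close> applies. For \<open>\<nu> = 0\<close> the conic sum gives
  \<open>-1\<close>. For \<open>\<nu> > 0\<close> the cofactors along the lifts
  \<open>y + n t\<close> of a root are linear in \<open>t\<close> modulo \<open>p\<close> with slope
  prime to \<open>p\<close>, so their characters cancel.\<close>

lemma locsum_psi_ram_odd:
  assumes q: "prime_disc q" "odd q" and p: "p = base_prime q" and B: "pmin p B" "p dvd B"
  shows "locsum (q * B) (psi q) p (\<nu> + 2) = (if \<nu> = 0 then -1 else 0)"
proof -
  have pq: "p = \<bar>q\<bar>" using q p by (simp add: base_prime_def)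
  have pp: "prime p" unfolding p by (rule prime_base_prime[OF q(1)])
  have p0: "p > 0" using prime_gt_0_int[OF pp] .
  have dB: "disc4 B" using B by (simp add: pmin_def)
  obtain B1 where B1: "B = p * B1" using B(2) by (elim dvdE)
  have nB1: "\<not> p dvd B1"
  proof
    assume "p dvd B1"
    hence "p\<^sup>2 dvd B" unfolding B1 power2_eq_square by simp
    thus False using pmin_odd[OF _ B(1)] q(2) pq by simp
  qed
  define w where "w = sgn q * B1"
  have e: "q * B = p\<^sup>2 * w" unfolding B1 w_def pq by (cases "q > 0") (auto simp: power2_eq_square sgn_if)
  have nw: "\<not> p dvd w" using nB1 prime_disc_nz[OF q(1)] by (auto simp: w_def sgn_if)
  have "disc4 (p\<^sup>2 * w)" unfolding e[symmetric] by (intro disc4_mult dB prime_disc_disc4 q)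
  hence dw: "disc4 w" using disc4_div_odd_square[of p w] q(2) pq by simp
  have S: "locsum (q * B) (psi q) p (\<nu> + 2) =
     (\<Sum>y\<in>{0..<p ^ (\<nu> + 1)}. if p ^ \<nu> dvd qpol w y then psi q (qpol w y div p ^ \<nu>) else 0)"
    unfolding e by (rule locsum_square[OF pp dw])
  show ?thesis
  proof (cases "\<nu> = 0")
    case True
    have "locsum (q * B) (psi q) p (\<nu> + 2) = (\<Sum>y\<in>{0..<p}. psi q (qpol w y))"
      unfolding S unfolding True by simp
    also have "\<dots> = -1" unfolding pq sum_psi_qpol[OF q dw]
      by (rule sum_psi_conic[OF q]) (use nw pq in simp)
    finally show ?thesis using True by simp
  next
    case False
    define n where "n = p ^ \<nu>"
    have n: "n > 0" "p dvd n" using p0 False by (auto simp: n_def)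
    have "locsum (q * B) (psi q) p (\<nu> + 2) =
      (\<Sum>y\<in>{0..<n * p}. if n dvd qpol w y then psi q (qpol w y div n) else 0)"
    proof -
      have e: "p ^ (\<nu> + 1) = n * p" by (simp add: n_def)
      show ?thesis unfolding S e unfolding n_def ..
    qed
    also have "\<dots> = (\<Sum>y\<in>{0..<n}. \<Sum>t\<in>{0..<p}. if n dvd qpol w (y + n * t) then psi q (qpol w (y + n * t) div n) else 0)"
      by (rule sum_div_mod) (use n p0 in auto)
    also have "\<dots> = 0"
    proof (rule sum.neutral, rule ballI)
      fix y assume "y \<in> {0..<n}"
      show "(\<Sum>t\<in>{0..<p}. if n dvd qpol w (y + n * t) then psi q (qpol w (y + n * t) div n) else 0) = 0"
      proof (cases "n dvd qpol w y")
        case False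
        have "\<not> n dvd qpol w (y + n * t)" for t
          unfolding qpol_shift using False by (simp add: dvd_add_left_iff power2_eq_square mult.assoc)
        thus ?thesis by simp
      next
        case True
        then obtain c where c: "qpol w y = n * c" by (elim dvdE)
        define b where "b = 2 * y + w mod 2"
        have e2: "qpol w (y + n * t) = n * (b * t + c + n * t\<^sup>2)" for t
          unfolding qpol_shift c b_def by (simp add: power2_eq_square algebra_simps)
        have "b\<^sup>2 = 4 * qpol w y + w" using qpol_4[OF dw, of y] by (simp add: b_def)
        moreover have "p dvd 4 * qpol w y" using n(2) True dvd_trans by auto
        ultimately have "\<not> p dvd b\<^sup>2" using nw by (simp add: dvd_add_right_iff)
        hence nb: "\<not> p dvd b" by (auto simp: power2_eq_square)
        have "(\<Sum>t\<in>{0..<p}. if n dvd qpol w (y + n * t) then psi q (qpol w (y + n * t) div n) else 0) =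
          (\<Sum>t\<in>{0..<p}. psi q (b * t + c))"
          unfolding e2 using n by (intro sum.cong refl) (auto intro!: psi_cong[OF q(1)] simp: cong_iff_dvd_diff pq)
        also have "\<dots> = 0" unfolding pq by (rule sum_psi_linear[OF q]) (use nb pq in simp)
        finally show ?thesis .
      qed
    qed
    finally show ?thesis using False by simp
  qed
qed

text \<open>\<open>b\<close> stands for \<open>B / 4\<close>, and minimality of \<open>B\<close> at
  2 is the condition on \<open>b mod 4\<close>; then \<open>q B = 16 v\<close>.\<close>

lemma even_disc_v_cases:
  assumes q: "prime_disc q" "even q" and b: "b mod 4 = 2 \<or> b mod 4 = 3" and v: "v = (q div 4) * b"
  shows "(q = -4 \<and> v mod 4 = 1) \<or> (q = -4 \<and> v mod 4 = 2) \<or> (q = 8 \<and> v mod 8 = 6)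
    \<or> (q = -8 \<and> v mod 8 = 2) \<or> (q \<in> {8, -8} \<and> v mod 8 = 4)"
  using prime_disc_even_cases[OF q]
proof (elim disjE)
  assume "q = -4" moreover have "(- b) mod 4 = 1 \<or> (- b) mod 4 = 2" using b by presburger
  ultimately show ?thesis by (auto simp: v)
next
  assume "q = 8" moreover have "(2 * b) mod 8 = 6 \<or> (2 * b) mod 8 = 4" using b by presburger
  ultimately show ?thesis by (auto simp: v)
next
  assume "q = -8" moreover have "(- 2 * b) mod 8 = 2 \<or> (- 2 * b) mod 8 = 4" using b by presburger
  ultimately show ?thesis by (auto simp: v)
qed

lemma psi_flip:
  assumes q: "prime_disc q" "even q" and c: "(c' - c) mod \<bar>q\<bar> = \<bar>q\<bar> div 2"
  shows "psi q c' + psi q c = 0"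
proof -
  have "(c' - c) mod \<bar>q\<bar> = (\<bar>q\<bar> div 2) mod \<bar>q\<bar>"
    using c prime_disc_nz[OF q(1)] by (metis mod_mod_trivial)
  hence "\<bar>q\<bar> dvd (c' - c) - \<bar>q\<bar> div 2" by (simp only: mod_eq_dvd_iff)
  hence "[c' = c + \<bar>q\<bar> div 2] (mod q)" by (simp add: cong_iff_dvd_diff algebra_simps)
  from psi_cong[OF q(1) this] psi_half_flip[OF q] show ?thesis by simp
qed

lemma psi_m4_flip: "(c' - c) mod 4 = 2 \<Longrightarrow> psi (-4) c' + psi (-4) c = 0"
  by (rule psi_flip) (auto simp: prime_disc_def)

lemma psi_8_flip:
  assumes "q = 8 \<or> q = -8" "(c' - c) mod 8 = 4" shows "psi q c' + psi q c = 0"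
  by (rule psi_flip) (use assms in \<open>auto simp: prime_disc_def\<close>)

text \<open>Passing from the root \<open>y\<close> to \<open>y + 2^\<nu>\<close> moves the cofactor
  from \<open>c\<close> to \<open>c + 2 y + 2^\<nu>\<close>. In each residue case either the move is
  half the conductor and flips the character, or both cofactors are even, or the hypothesis is
  contradictory; a few cases with \<open>\<nu> = 1\<close> are read off the residues of
  \<open>c\<close> modulo 8.\<close>

lemma psi_pair_cancel:
  assumes v: "(q = -4 \<and> v mod 4 = 1) \<or> (q = -4 \<and> v mod 4 = 2) \<or> (q = 8 \<and> v mod 8 = 6)
      \<or> (q = -8 \<and> v mod 8 = 2) \<or> (q \<in> {8, -8} \<and> v mod 8 = 4)"
    and \<nu>: "\<nu> > 0" and y: "0 \<le> y" "y < 2 ^ \<nu>" and c: "y\<^sup>2 - v = 2 ^ \<nu> * c"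
  shows "psi q (c + 2 * y + 2 ^ \<nu>) + psi q c = 0"
proof -
  have eq: "psi q x = 0" if "even q" "even x" for x using that by (simp add: psi_def)
  consider "\<nu> = 1" | "\<nu> = 2" | j where "\<nu> = j + 3"
    using \<nu> by atomize_elim presburger
  thus ?thesis
  proof cases
    case 1
    hence yy: "y = 0 \<or> y = 1" using y by auto
    have c2: "y\<^sup>2 - v = 2 * c" using c 1 by simp
    from v show ?thesis
    proof (elim disjE conjE)
      assume a: "q = -4" "v mod 4 = 1"
      have "y = 1" using yy c2 a(2) by (elim disjE) (simp_all, presburger)
      hence "1 - v = 2 * c" using c2 by simp
      hence "even c" using a by presburger
      thus ?thesis using a(1) 1 by (simp add: psi_def)
    next
      assume a: "q = -4" "v mod 4 = 2"
      have "y = 0" using yy c2 a(2) by (elim disjE) (simp_all, presburger)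
      thus ?thesis using a(1) 1 psi_m4_flip[of "c + 2" c] by simp
    next
      assume a: "q = 8" "v mod 8 = 6"
      have y0: "y = 0" using yy c2 a(2) by (elim disjE) (simp_all, presburger)
      hence "- v = 2 * c" using c2 by simp
      hence "c mod 4 = 1" using a(2) by presburger
      hence "c mod 8 = 1 \<or> c mod 8 = 5" by presburger
      hence "(c mod 8 = 1 \<and> (c + 2) mod 8 = 3) \<or> (c mod 8 = 5 \<and> (c + 2) mod 8 = 7)" by presburger
      moreover from this have "odd c" by presburger
      ultimately show ?thesis using a(1) 1 y0 by (auto simp: psi_def)
    next
      assume a: "q = -8" "v mod 8 = 2"
      have y0: "y = 0" using yy c2 a(2) by (elim disjE) (simp_all, presburger)
      hence "- v = 2 * c" using c2 by simp
      hence "c mod 4 = 3" using a(2) by presburger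
      hence "c mod 8 = 3 \<or> c mod 8 = 7" by presburger
      hence "(c mod 8 = 3 \<and> (c + 2) mod 8 = 5) \<or> (c mod 8 = 7 \<and> (c + 2) mod 8 = 1)" by presburger
      moreover from this have "odd c" by presburger
      ultimately show ?thesis using a(1) 1 y0 by (auto simp: psi_def)
    next
      assume "q \<in> {8, -8}" and "v mod 8 = 4"
      hence a: "q = 8 \<or> q = -8" "v mod 8 = 4" by auto
      have y0: "y = 0" using yy c2 a(2) by (elim disjE) (simp_all, presburger)
      hence "- v = 2 * c" using c2 by simp
      hence "even c" using a by presburger
      thus ?thesis using a(1) 1 y0 by (auto simp: psi_def)
    qed
  next
    case 2
    have c4: "y\<^sup>2 - v = 4 * c" using c 2 by simp
    have y4: "y\<^sup>2 mod 4 = (if even y then 0 else 1)" by (rule square_mod_4)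
    from v show ?thesis
    proof (elim disjE conjE)
      assume a: "q = -4" "v mod 4 = 1"
      have "odd y" using y4 c4 a(2) by (cases "even y") (simp_all, presburger)
      hence "(c + 2 * y + 2 ^ \<nu> - c) mod 4 = 2" using 2 by simp presburger
      thus ?thesis using psi_m4_flip a(1) by simp
    next
      assume a: "v mod 4 = 2"
      hence False using y4 c4 by (cases "even y") (simp_all, presburger+)
      thus ?thesis ..
    next
      assume a: "v mod 8 = 6"
      hence False using y4 c4 by (cases "even y") (simp_all, presburger+)
      thus ?thesis ..
    next
      assume a: "v mod 8 = 2"
      hence False using y4 c4 by (cases "even y") (simp_all, presburger+)
      thus ?thesis ..
    next
      assume "q \<in> {8, -8}" and "v mod 8 = 4"
      hence a: "q = 8 \<or> q = -8" "v mod 8 = 4" by auto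
      have "even y" using y4 c4 a(2) by (cases "even y") (simp_all, presburger)
      then obtain z where z: "y = 2 * z" by (elim evenE)
      have zc: "4 * z\<^sup>2 - v = 4 * c" using c4 by (simp add: z power2_eq_square)
      show ?thesis
      proof (cases "even z")
        case True
        then obtain k where "z = 2 * k" by (elim evenE)
        hence "(c + 2 * y + 2 ^ \<nu> - c) mod 8 = 4" using 2 z by simp
        thus ?thesis using psi_8_flip[OF a(1)] by simp
      next
        case False
        have "z\<^sup>2 mod 4 = 1" using False by (simp add: square_mod_4)
        hence "even c" using zc a(2) by presburger
        thus ?thesis using eq a(1) 2 by auto
      qed
    qed
  next
    case (3 j)
    define m where "m = (2::int) ^ j"
    have c8: "y\<^sup>2 - v = 8 * (m * c)" using c 3 by (simp add: power_add m_def)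
    have n8: "(2::int) ^ \<nu> = 8 * m" using 3 by (simp add: power_add m_def)
    have y4: "y\<^sup>2 mod 4 = (if even y then 0 else 1)" by (rule square_mod_4)
    define M where "M = m * c"
    have c8: "y\<^sup>2 - v = 8 * M" using c8 by (simp add: M_def)
    from v show ?thesis
    proof (elim disjE conjE)
      assume a: "q = -4" "v mod 4 = 1"
      have "odd y" using y4 c8 a(2) by (cases "even y") (simp_all, presburger)
      hence "(c + 2 * y + 2 ^ \<nu> - c) mod 4 = 2" unfolding n8 by simp presburger
      thus ?thesis using psi_m4_flip a(1) by simp
    next
      assume a: "v mod 4 = 2"
      hence False using y4 c8 by (cases "even y") (simp_all, presburger+)
      thus ?thesis ..
    next
      assume a: "v mod 8 = 6"
      hence False using y4 c8 by (cases "even y") (simp_all, presburger+)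
      thus ?thesis ..
    next
      assume a: "v mod 8 = 2"
      hence False using y4 c8 by (cases "even y") (simp_all, presburger+)
      thus ?thesis ..
    next
      assume "q \<in> {8, -8}" and "v mod 8 = 4"
      hence a: "q = 8 \<or> q = -8" "v mod 8 = 4" by auto
      have "even y" using y4 c8 a(2) by (cases "even y") (simp_all, presburger)
      then obtain z where z: "y = 2 * z" by (elim evenE)
      have zc: "4 * z\<^sup>2 - v = 8 * M" using c8 by (simp add: z power2_eq_square)
      have "odd z"
      proof
        assume "even z"
        hence "z\<^sup>2 mod 4 = 0" by (simp add: square_mod_4)
        thus False using zc a(2) by presburger
      qed
      hence "(c + 2 * y + 2 ^ \<nu> - c) mod 8 = 4" unfolding n8 z by simp presburger
      thus ?thesis using psi_8_flip[OF a(1)] by simp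
    qed
  qed
qed

text \<open>The 2-adic counterpart of \<open>locsum_psi_ram_odd\<close>: cancellation in the pair
  \<open>y\<close>, \<open>y + 2^\<nu>\<close> replaces the linear character sum.\<close>

lemma locsum_psi_ram_even:
  assumes q: "prime_disc q" "even q" and B: "pmin 2 B" "even B"
  shows "locsum (q * B) (psi q) 2 (\<nu> + 2) = (if \<nu> = 0 then -1 else 0)"
proof -
  have dB: "disc4 B" using B by (simp add: pmin_def)
  hence "B mod 4 = 0" using B(2) unfolding disc4_def by presburger
  then obtain b where b: "B = 4 * b" by (auto elim: dvdE)
  have "\<not> disc4 b" using B(1) b by (simp add: pmin_def)
  hence bm: "b mod 4 = 2 \<or> b mod 4 = 3" unfolding disc4_def by presburger
  define v where "v = (q div 4) * b"
  have q4: "q = 4 * (q div 4)" using prime_disc_even_cases[OF q] by auto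
  have e: "q * B = 2\<^sup>2 * (4 * v)" unfolding b v_def by (subst (1) q4) simp
  have d4: "disc4 (4 * v)" by (simp add: disc4_def)
  have qp: "qpol (4 * v) y = y\<^sup>2 - v" for y by (simp add: even_qpol)
  note vc = even_disc_v_cases[OF q bm v_def]
  have S: "locsum (q * B) (psi q) 2 (\<nu> + 2) =
     (\<Sum>y\<in>{0..<2 ^ (\<nu> + 1)}. if 2 ^ \<nu> dvd y\<^sup>2 - v then psi q ((y\<^sup>2 - v) div 2 ^ \<nu>) else 0)"
  proof -
    have "prime (2::int)" by simp
    from locsum_square[OF this d4, of "psi q" \<nu>] show ?thesis unfolding e qp .
  qed
  show ?thesis
  proof (cases "\<nu> = 0")
    case True
    have "{0..<2::int} = {0, 1}" by auto
    hence "locsum (q * B) (psi q) 2 (\<nu> + 2) = psi q (- v) + psi q (1 - v)"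
      unfolding S unfolding True by simp
    also have "\<dots> = -1"
      using vc
    proof (elim disjE conjE)
      assume a: "q = -4" "v mod 4 = 1"
      have "(- v) mod 4 = 3" "odd v" using a by presburger+
      thus ?thesis using a by (simp add: psi_def)
    next
      assume a: "q = -4" "v mod 4 = 2"
      have "(1 - v) mod 4 = 3" "even v" using a by presburger+
      thus ?thesis using a by (simp add: psi_def)
    next
      assume a: "q = 8" "v mod 8 = 6"
      have "(1 - v) mod 8 = 3" "even v" using a by presburger+
      thus ?thesis using a by (simp add: psi_def)
    next
      assume a: "q = -8" "v mod 8 = 2"
      have "(1 - v) mod 8 = 7" "even v" using a by presburger+
      thus ?thesis using a by (simp add: psi_def)
    next
      assume a: "q \<in> {8, -8}" "v mod 8 = 4"
      have "(1 - v) mod 8 = 5" "even v" using a by presburger+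
      thus ?thesis using a by (auto simp: psi_def)
    qed
    finally show ?thesis using True by simp
  next
    case False
    define n where "n = (2::int) ^ \<nu>"
    define f where "f y = (if n dvd y\<^sup>2 - v then psi q ((y\<^sup>2 - v) div n) else 0)" for y
    have n: "n > 0" by (simp add: n_def)
    have "{0..<2::int} = {0, 1}" by auto
    hence T: "(\<Sum>t\<in>{0..<2}. f (y + n * t)) = f y + f (y + n)" for y by simp
    have e: "(2::int) ^ (\<nu> + 1) = n * 2" by (simp add: n_def)
    have "locsum (q * B) (psi q) 2 (\<nu> + 2) = (\<Sum>y\<in>{0..<n * 2}. f y)"
      unfolding S e unfolding n_def f_def ..
    also have "\<dots> = (\<Sum>y\<in>{0..<n}. f y + f (y + n))"
      unfolding T[symmetric] by (rule sum_div_mod) (use n in auto)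
    also have "\<dots> = 0"
    proof (rule sum.neutral, rule ballI)
      fix y assume y: "y \<in> {0..<n}"
      have sh: "(y + n)\<^sup>2 - v = (y\<^sup>2 - v) + n * (2 * y + n)" by (simp add: power2_eq_square algebra_simps)
      show "f y + f (y + n) = 0"
      proof (cases "n dvd y\<^sup>2 - v")
        case False
        hence "\<not> n dvd (y + n)\<^sup>2 - v" unfolding sh by (simp only: dvd_add_left_iff dvd_triv_left not_False_eq_True)
        thus ?thesis using False by (simp add: f_def)
      next
        case True
        then obtain c where c: "y\<^sup>2 - v = n * c" by (elim dvdE)
        have c': "(y + n)\<^sup>2 - v = n * (c + 2 * y + n)" unfolding sh c by (simp add: algebra_simps)
        have "psi q (c + 2 * y + n) + psi q c = 0"
          unfolding n_def by (rule psi_pair_cancel[OF vc]) (use False y c n_def in auto)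
        thus ?thesis unfolding f_def c c' using n by simp
      qed
    qed
    finally show ?thesis using False by simp
  qed
qed

lemma locsum_psi_ram:
  assumes q: "prime_disc q" and p: "p = base_prime q" and B: "pmin p B" "p dvd B"
  shows "locsum (q * B) (psi q) p (\<nu> + 2) = (if \<nu> = 0 then -1 else 0)"
proof (cases "even q")
  case True
  hence "p = 2" using p by (simp add: base_prime_def)
  thus ?thesis using locsum_psi_ram_even[OF q True, of B \<nu>] B by simp
qed (use locsum_psi_ram_odd[OF q _ p B] in simp)

section \<open>Root counts with trivial weight\<close>

lemma locsum_one_1:
  assumes p: "prime p" and D: "disc4 D"
  shows "locsum D (\<lambda>_. 1) p 1 = 1 + kronecker_prime D p"
proof (cases "p = 2")
  case True
  have I: "{0..<2::int} = {0, 1}" by auto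
  have L: "locsum D (\<lambda>_. 1) 2 1 = (if even (qpol D 0) then 1 else 0) + (if even (qpol D 1) then 1 else 0)"
    unfolding locsum_def power_one_right I by simp
  have D4: "D mod 4 = 0 \<or> D mod 4 = 1" using D by (simp add: disc4_def)
  show ?thesis
  proof (cases "even D")
    case True
    have "qpol D 0 = - (D div 4)" "qpol D 1 = 1 - D div 4" using True by (simp_all add: even_qpol)
    hence "locsum D (\<lambda>_. 1) 2 1 = 1" unfolding L by simp
    thus ?thesis using True \<open>p = 2\<close> by (simp add: kronecker_prime_def)
  next
    case False
    have q0: "qpol D 0 = - ((D - 1) div 4)" "qpol D 1 = 2 - (D - 1) div 4"
      using False by (simp_all add: qpol_def odd_iff_mod_2_eq_one)
    have "D mod 8 = 1 \<or> D mod 8 = 5" using D4 False by presburger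
    moreover have "D mod 8 = 1 \<Longrightarrow> even ((D - 1) div 4)" "D mod 8 = 5 \<Longrightarrow> odd ((D - 1) div 4)" by presburger+
    ultimately show ?thesis using L q0 False \<open>p = 2\<close> by (auto simp: kronecker_prime_def)
  qed
next
  case False
  hence p2: "p > 2" using prime_ge_2_int[OF p] by simp
  have op: "odd p" using prime_odd_int[OF p p2] .
  have c: "coprime 4 p" using odd_prime_not_dvd_4[OF p op] coprime_mult_left_iff[of 2 2 p] by simp
  have iff: "p dvd qpol D x \<longleftrightarrow> p dvd (2 * x + D mod 2)\<^sup>2 - D" for x
    unfolding qpol_4[OF D, symmetric] using c by (simp add: coprime_dvd_mult_right_iff coprime_commute)
  define f where "f b = (if p dvd b\<^sup>2 - D then 1 else 0 :: int)" for b
  have per: "f (b + p) = f b" for b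
  proof -
    have "(b + p)\<^sup>2 - D = (b\<^sup>2 - D) + p * (2 * b + p)" by (simp add: power2_eq_square algebra_simps)
    thus ?thesis unfolding f_def by (simp only: dvd_add_left_iff dvd_triv_left)
  qed
  have "locsum D (\<lambda>_. 1) p 1 = (\<Sum>x\<in>{0..<p}. f (2 * x + D mod 2))"
    unfolding locsum_def power_one_right iff f_def ..
  also have "\<dots> = (\<Sum>b\<in>{0..<p}. f b)"
    by (rule sum_residue_affine[where f = f, OF per]) (use p2 odd_prime_not_dvd_4[OF p op] in auto)
  also have "\<dots> = (\<Sum>b\<in>{b\<in>{0..<p}. [b\<^sup>2 = D] (mod p)}. 1)"
    unfolding f_def by (intro sum.mono_neutral_cong_right) (auto simp: cong_iff_dvd_diff)
  also have "\<dots> = int (card {b\<in>{0..<p}. [b\<^sup>2 = D] (mod p)})" by simp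
  also have "\<dots> = 1 + kronecker_prime D p" unfolding card_square_roots[OF p p2] using False by (simp add: kronecker_prime_def)
  finally show ?thesis .
qed

text \<open>Hensel lifting: at a root the derivative \<open>2 y + D mod 2\<close> is prime to
  \<open>p\<close>, because its square is \<open>D\<close> modulo \<open>p\<close>, so each root
  lifts uniquely.\<close>

lemma locsum_one_Suc:
  assumes p: "prime p" and D: "disc4 D" "\<not> p dvd D" and \<nu>: "\<nu> > 0"
  shows "locsum D (\<lambda>_. 1) p (Suc \<nu>) = locsum D (\<lambda>_. 1) p \<nu>"
proof -
  have p0: "p > 0" using prime_gt_0_int[OF p] .
  define n where "n = p ^ \<nu>"
  have n: "n > 0" "p dvd n" using p0 \<nu> by (auto simp: n_def)
  have e: "p ^ Suc \<nu> = n * p" by (simp add: n_def)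
  have "locsum D (\<lambda>_. 1) p (Suc \<nu>) = (\<Sum>x\<in>{0..<n * p}. if n * p dvd qpol D x then 1 else 0)"
    unfolding locsum_def e ..
  also have "\<dots> = (\<Sum>y\<in>{0..<n}. \<Sum>t\<in>{0..<p}. if n * p dvd qpol D (y + n * t) then 1 else 0)"
    by (rule sum_div_mod) (use n p0 in auto)
  also have "\<dots> = (\<Sum>y\<in>{0..<n}. if n dvd qpol D y then 1 else 0)"
  proof (rule sum.cong[OF refl])
    fix y assume "y \<in> {0..<n}"
    show "(\<Sum>t\<in>{0..<p}. if n * p dvd qpol D (y + n * t) then 1 else 0) = (if n dvd qpol D y then 1 else (0::int))"
    proof (cases "n dvd qpol D y")
      case False
      have "\<not> n dvd qpol D (y + n * t)" for t
      proof -
        have "qpol D (y + n * t) = qpol D y + n * (t * (2 * y + D mod 2) + n * t\<^sup>2)"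
          unfolding qpol_shift by (simp add: power2_eq_square algebra_simps)
        thus ?thesis using False by (simp only: dvd_add_left_iff dvd_triv_left not_False_eq_True)
      qed
      hence "\<not> n * p dvd qpol D (y + n * t)" for t using dvd_mult_left by blast
      thus ?thesis using False by simp
    next
      case True
      then obtain c where c: "qpol D y = n * c" by (elim dvdE)
      define b where "b = 2 * y + D mod 2"
      have e2: "qpol D (y + n * t) = n * ((b * t + c) + n * t\<^sup>2)" for t
        unfolding qpol_shift c b_def by (simp add: power2_eq_square algebra_simps)
      have iff: "n * p dvd qpol D (y + n * t) \<longleftrightarrow> p dvd b * t + c" for t
      proof -
        have "p dvd n * t\<^sup>2" using n(2) by simp
        thus ?thesis unfolding e2 using n(1) by (simp add: dvd_add_left_iff)
      qed
      have "b\<^sup>2 = 4 * qpol D y + D" using qpol_4[OF D(1), of y] by (simp add: b_def)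
      moreover have "p dvd 4 * qpol D y" using n(2) True dvd_trans by auto
      ultimately have "\<not> p dvd b\<^sup>2" using D(2) by (simp add: dvd_add_right_iff)
      hence "\<not> p dvd b" by (auto simp: power2_eq_square)
      hence "coprime b p" using prime_coprime_iff[OF p] by simp
      thus ?thesis unfolding iff using sum_dvd_indicator[OF p0, where b = b and v = "1::int" and c = c] True by simp
    qed
  qed
  finally show ?thesis by (simp add: locsum_def n_def)
qed

lemma locsum_one_unit:
  assumes p: "prime p" and D: "disc4 D" "\<not> p dvd D"
  shows "locsum D (\<lambda>_. 1) p (Suc \<nu>) = 1 + kronecker_prime D p"
proof (induction \<nu>)
  case 0 thus ?case using locsum_one_1[OF p D(1)] by simp
next
  case (Suc \<nu>) thus ?case using locsum_one_Suc[OF p D, of "Suc \<nu>"] by simp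
qed

lemma locsum_one_ram:
  assumes p: "prime p" and B: "pmin p B" "p dvd B"
  shows "locsum B (\<lambda>_. 1) p (\<nu> + 2) = 0"
proof (rule locsum_zeroI)
  fix x
  have dB: "disc4 B" using B by (simp add: pmin_def)
  show "\<not> p\<^sup>2 dvd qpol B x"
  proof (cases "p = 2")
    case True
    hence "even B" using B by simp
    hence "B mod 4 = 0" using dB unfolding disc4_def by presburger
    then obtain b where b: "B = 4 * b" by (auto elim: dvdE)
    have "\<not> disc4 b" using B(1) b True by (simp add: pmin_def)
    hence "b mod 4 = 2 \<or> b mod 4 = 3" unfolding disc4_def by presburger
    moreover have "x\<^sup>2 mod 4 = 0 \<or> x\<^sup>2 mod 4 = 1" by (simp add: square_mod_4)
    ultimately have "\<not> 4 dvd x\<^sup>2 - b" by presburger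
    thus ?thesis using True b by (simp add: even_qpol)
  next
    case False
    hence "p > 2" using prime_ge_2_int[OF p] by simp
    hence op: "odd p" using prime_odd_int[OF p] by simp
    show ?thesis using qpol_root_dvd[OF p op dB _ B(2)] pmin_odd[OF op B(1)] by blast
  qed
qed

text \<open>The Euler factor of the rescaled finite sum in Cohen's number: at
  \<open>Y = p^(-k)\<close> it is the sum for \<open>p^\<phi>\<close> divided by
  \<open>p^(\<phi> (2k-1))\<close> (\<open>cohen_sum_prime_power\<close>).\<close>

definition Tfac :: "int \<Rightarrow> int \<Rightarrow> nat \<Rightarrow> real \<Rightarrow> real" where
  "Tfac p c \<phi> Y = (\<Sum>i\<le>\<phi>. (of_int p * Y\<^sup>2) ^ i) - of_int c * Y * (\<Sum>i<\<phi>. (of_int p * Y\<^sup>2) ^ i)"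

lemma Tfac_0 [simp]: "Tfac p c 0 Y = 1" by (simp add: Tfac_def)

lemma Tfac_Suc: "Tfac p c (Suc \<phi>) Y = of_int p * Y\<^sup>2 * Tfac p c \<phi> Y + (1 - of_int c * Y)"
proof -
  have "(\<Sum>i\<le>Suc \<phi>. (of_int p * Y\<^sup>2) ^ i) = 1 + of_int p * Y\<^sup>2 * (\<Sum>i\<le>\<phi>. (of_int p * Y\<^sup>2) ^ i)"
    by (subst sum.atMost_Suc_shift) (simp add: sum_distrib_left)
  moreover have "(\<Sum>i<Suc \<phi>. (of_int p * Y\<^sup>2) ^ i) = 1 + of_int p * Y\<^sup>2 * (\<Sum>i<\<phi>. (of_int p * Y\<^sup>2) ^ i)"
    by (subst sum.lessThan_Suc_shift) (simp add: sum_distrib_left)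
  ultimately show ?thesis unfolding Tfac_def by (simp add: algebra_simps)
qed

lemma sums_shift2:
  fixes f :: "nat \<Rightarrow> real"
  assumes "(\<lambda>n. f (n + 2)) sums s" shows "f sums (s + f 0 + f 1)"
  using assms sums_iff_shift[of f 2 s] by (simp add: numeral_2_eq_2 add_ac)

text \<open>The rule \<open>a (\<phi>+1) (\<nu>+2) = p * a \<phi> \<nu>\<close> would multiply the
  generating function by \<open>p Y^2\<close>; at \<open>\<nu> = 0\<close> the value is
  \<open>p - 1 + \<rho>\<close> instead of \<open>p\<close>. With the two initial coefficients the
  correction is \<open>1 + \<rho> Y - (1 - \<rho>) Y^2\<close>, which is the base value times
  \<open>1 - c Y\<close>, exactly as in \<open>Tfac_Suc\<close>. \<open>\<rho>\<close> is 1 for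
  trivial weight and 0 in the ramified case.\<close>

lemma gen_recursion:
  fixes a :: "nat \<Rightarrow> nat \<Rightarrow> int" and Y :: real
  assumes Y: "\<bar>Y\<bar> < 1" and c: "c = 1 \<or> c = 0 \<or> c = -1" and \<rho>: "\<rho> = 0 \<or> \<rho> = 1"
    and base: "(\<lambda>\<nu>. of_int (a 0 \<nu>) * Y ^ \<nu>) sums ((1 - Y\<^sup>2) / ((1 - of_int \<rho> * Y) * (1 - of_int c * Y)))"
    and a0: "\<And>\<phi>. a \<phi> 0 = 1" and a1: "\<And>\<phi>. a (Suc \<phi>) 1 = \<rho>" and a2: "\<And>\<phi>. a (Suc \<phi>) 2 = p - 1 + \<rho>"
    and a3: "\<And>\<phi> \<nu>. a (Suc \<phi>) (\<nu> + 3) = p * a \<phi> (\<nu> + 1)"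
  shows "(\<lambda>\<nu>. of_int (a \<phi> \<nu>) * Y ^ \<nu>) sums ((1 - Y\<^sup>2) / ((1 - of_int \<rho> * Y) * (1 - of_int c * Y)) * Tfac p c \<phi> Y)"
proof (induction \<phi>)
  case 0 thus ?case using base by simp
next
  case (Suc \<phi>)
  define B where "B = (1 - Y\<^sup>2) / ((1 - of_int \<rho> * Y) * (1 - of_int c * Y))"
  define E where "E = B * Tfac p c \<phi> Y"
  have E: "(\<lambda>\<nu>. of_int (a \<phi> \<nu>) * Y ^ \<nu>) sums E" using Suc by (simp add: E_def B_def)
  hence "(\<lambda>\<nu>. of_int (a \<phi> (Suc \<nu>)) * Y ^ Suc \<nu>) sums (E - 1)"
    by (subst sums_Suc_iff[where f = "\<lambda>\<nu>. of_int (a \<phi> \<nu>) * Y ^ \<nu>"]) (simp add: a0)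
  hence "(\<lambda>\<nu>. of_int p * Y\<^sup>2 * (of_int (a \<phi> (Suc \<nu>)) * Y ^ Suc \<nu>)) sums (of_int p * Y\<^sup>2 * (E - 1))"
    by (rule sums_mult)
  moreover have "of_int p * Y\<^sup>2 * (of_int (a \<phi> (Suc \<nu>)) * Y ^ Suc \<nu>) = of_int (a (Suc \<phi>) (\<nu> + 3)) * Y ^ (\<nu> + 3)" for \<nu>
    unfolding a3 by (simp add: power2_eq_square eval_nat_numeral mult_ac)
  ultimately have "(\<lambda>\<nu>. of_int (a (Suc \<phi>) (\<nu> + 3)) * Y ^ (\<nu> + 3)) sums (of_int p * Y\<^sup>2 * (E - 1))" by simp
  hence "(\<lambda>\<nu>. of_int (a (Suc \<phi>) \<nu>) * Y ^ \<nu>) sums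
     (of_int p * Y\<^sup>2 * (E - 1) + (\<Sum>i<3. of_int (a (Suc \<phi>) i) * Y ^ i))"
    using sums_iff_shift[of "\<lambda>\<nu>. of_int (a (Suc \<phi>) \<nu>) * Y ^ \<nu>" 3] by simp
  also have "(\<Sum>i<3. of_int (a (Suc \<phi>) i) * Y ^ i) = 1 + of_int \<rho> * Y + (of_int p - 1 + of_int \<rho>) * Y\<^sup>2"
  proof -
    have "{..<3::nat} = {0, 1, 2}" by auto
    thus ?thesis using a0[of "Suc \<phi>"] a1[of \<phi>] a2[of \<phi>] by (simp add: add_ac)
  qed
  also have "of_int p * Y\<^sup>2 * (E - 1) + (1 + of_int \<rho> * Y + (of_int p - 1 + of_int \<rho>) * Y\<^sup>2) =
     of_int p * Y\<^sup>2 * E + (1 + of_int \<rho> * Y - (1 - of_int \<rho>) * Y\<^sup>2)"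
    by (simp add: algebra_simps)
  also have "1 + of_int \<rho> * Y - (1 - of_int \<rho>) * Y\<^sup>2 = B * (1 - of_int c * Y)"
  proof -
    have Yb: "Y < 1" "-1 < Y" using Y by (auto simp: abs_less_iff)
    have "1 - of_int c * Y \<noteq> 0" using c Yb by auto
    hence "B * (1 - of_int c * Y) = (1 - Y\<^sup>2) / (1 - of_int \<rho> * Y)" by (simp add: B_def)
    moreover have "1 - Y\<^sup>2 = (1 - Y) * (1 + Y)" by (simp add: power2_eq_square algebra_simps)
    ultimately show ?thesis using \<rho> Yb by auto
  qed
  also have "of_int p * Y\<^sup>2 * E + B * (1 - of_int c * Y) = B * Tfac p c (Suc \<phi>) Y"
    unfolding E_def Tfac_Suc by (simp add: algebra_simps)
  finally show ?case by (simp add: B_def)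
qed

lemma pmin_shift: "pmin p B \<Longrightarrow> disc4 (p ^ (2 * \<phi>) * B)"
proof -
  have "p ^ (2 * \<phi>) = (p ^ \<phi>)\<^sup>2" by (simp add: power_even_eq)
  thus "pmin p B \<Longrightarrow> ?thesis" using disc4_mult[OF disc4_square[of "p ^ \<phi>"]] by (simp add: pmin_def)
qed

lemma unramified_gen:
  fixes Y :: real
  assumes p: "prime p" and B: "pmin p B" and Y: "\<bar>Y\<bar> < 1"
  shows "(\<lambda>\<nu>. of_int (locsum (p ^ (2 * \<phi>) * B) (\<lambda>_. 1) p \<nu>) * Y ^ \<nu>) sums
    ((1 - Y\<^sup>2) / ((1 - Y) * (1 - of_int (kronecker_prime B p) * Y)) * Tfac p (kronecker_prime B p) \<phi> Y)"
proof -
  define c where "c = kronecker_prime B p"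
  define a where "a \<phi> \<nu> = locsum (p ^ (2 * \<phi>) * B) (\<lambda>_. 1) p \<nu>" for \<phi> \<nu>
  have Yb: "Y < 1" "-1 < Y" using Y by (auto simp: abs_less_iff)
  have dB: "disc4 B" using B by (simp add: pmin_def)
  have sq: "p ^ (2 * Suc \<phi>) * B = p\<^sup>2 * (p ^ (2 * \<phi>) * B)" for \<phi> by (simp add: power2_eq_square)
  have "(\<lambda>\<nu>. of_int (a \<phi> \<nu>) * Y ^ \<nu>) sums
    ((1 - Y\<^sup>2) / ((1 - of_int 1 * Y) * (1 - of_int c * Y)) * Tfac p c \<phi> Y)"
  proof (rule gen_recursion[OF Y])
    show "c = 1 \<or> c = 0 \<or> c = -1" unfolding c_def by (rule kronecker_prime_values)
    show "a \<phi> 0 = 1" for \<phi> by (simp add: a_def locsum_0)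
    show "a (Suc \<phi>) 1 = 1" for \<phi>
      unfolding a_def using locsum_one_1[OF p pmin_shift[OF B, of "Suc \<phi>"]] by (simp add: kronecker_prime_eq_0_iff)
    show "a (Suc \<phi>) 2 = p - 1 + 1" for \<phi>
      unfolding a_def sq using locsum_one_square_2[OF p pmin_shift[OF B]] by simp
    show "a (Suc \<phi>) (\<nu> + 3) = p * a \<phi> (\<nu> + 1)" for \<phi> \<nu>
      unfolding a_def sq using locsum_one_square[OF p pmin_shift[OF B], of "\<phi>" "\<nu> + 1"] by (simp add: numeral_3_eq_3)
    show "(\<lambda>\<nu>. of_int (a 0 \<nu>) * Y ^ \<nu>) sums ((1 - Y\<^sup>2) / ((1 - of_int 1 * Y) * (1 - of_int c * Y)))"
    proof (cases "p dvd B")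
      case True
      hence c0: "c = 0" by (simp add: c_def kronecker_prime_eq_0_iff)
      have "a 0 (\<nu> + 2) = 0" for \<nu> unfolding a_def using locsum_one_ram[OF p B True] by simp
      hence "(\<lambda>\<nu>. of_int (a 0 (\<nu> + 2)) * Y ^ (\<nu> + 2)) sums 0" by simp
      from sums_shift2[OF this] have "(\<lambda>\<nu>. of_int (a 0 \<nu>) * Y ^ \<nu>) sums (1 + Y)"
        using locsum_one_1[OF p dB] c0 by (simp add: a_def locsum_0 c_def)
      moreover have "(1 - Y\<^sup>2) / (1 - Y) = 1 + Y" using Yb by (simp add: field_simps power2_eq_square)
      ultimately show ?thesis using c0 by simp
    next
      case False
      hence c1: "c = 1 \<or> c = -1" using kronecker_prime_values[of B p] by (auto simp: c_def kronecker_prime_eq_0_iff)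
      have "a 0 (Suc \<nu>) = 1 + c" for \<nu> unfolding a_def c_def using locsum_one_unit[OF p dB False] by simp
      hence "(\<lambda>\<nu>. of_int (a 0 (Suc \<nu>)) * Y ^ Suc \<nu>) sums ((1 + of_int c) * Y * (1 / (1 - Y)))"
        using sums_mult[OF geometric_sums[of Y], of "(1 + of_int c) * Y"] Y by (simp add: mult_ac)
      hence "(\<lambda>\<nu>. of_int (a 0 \<nu>) * Y ^ \<nu>) sums ((1 + of_int c) * Y * (1 / (1 - Y)) + 1)"
        by (subst (asm) sums_Suc_iff[where f = "\<lambda>\<nu>. of_int (a 0 \<nu>) * Y ^ \<nu>"]) (simp add: a_def locsum_0)
      moreover have "(1 + of_int c) * Y * (1 / (1 - Y)) + 1 = (1 - Y\<^sup>2) / ((1 - of_int 1 * Y) * (1 - of_int c * Y))"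
      proof -
        have e: "1 - Y\<^sup>2 = (1 - Y) * (1 + Y)" by (simp add: power2_eq_square algebra_simps)
        from c1 show ?thesis
        proof
          assume "c = 1"
          moreover have "2 * Y * (1 / (1 - Y)) + 1 = (1 + Y) / (1 - Y)" using Yb by (simp add: field_simps)
          ultimately show ?thesis unfolding e using Yb by simp
        next
          assume "c = -1"
          thus ?thesis unfolding e using Yb by simp
        qed
      qed
      ultimately show ?thesis by simp
    qed
  qed auto
  thus ?thesis by (simp add: a_def c_def)
qed

text \<open>The coefficient at \<open>\<nu> = 0\<close> is set to 1 by hand: \<open>locsum\<close>
  would give \<open>psi q (qpol D 0)\<close> there, whereas the genus weight at \<open>a = 1\<close>
  is \<open>psi q 1\<close>.\<close>

lemma ramified_gen:
  fixes Y :: real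
  assumes q: "prime_disc q" and p: "p = base_prime q" and B: "pmin p B" and Y: "\<bar>Y\<bar> < 1"
  shows "(\<lambda>\<nu>. of_int (if \<nu> = 0 then 1 else locsum (q * (p ^ (2 * \<phi>) * B)) (psi q) p \<nu>) * Y ^ \<nu>) sums
    ((1 - Y\<^sup>2) / (1 - of_int (kronecker_prime B p) * Y) * Tfac p (kronecker_prime B p) \<phi> Y)"
proof -
  define c where "c = kronecker_prime B p"
  define a where "a \<phi> \<nu> = (if \<nu> = 0 then 1 else locsum (q * (p ^ (2 * \<phi>) * B)) (psi q) p \<nu>)" for \<phi> \<nu>
  have Yb: "Y < 1" "-1 < Y" using Y by (auto simp: abs_less_iff)
  have dB: "disc4 B" using B by (simp add: pmin_def)
  have sq: "p ^ (2 * Suc \<phi>) * B = p\<^sup>2 * (p ^ (2 * \<phi>) * B)" for \<phi> by (simp add: power2_eq_square)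
  have "(\<lambda>\<nu>. of_int (a \<phi> \<nu>) * Y ^ \<nu>) sums
    ((1 - Y\<^sup>2) / ((1 - of_int 0 * Y) * (1 - of_int c * Y)) * Tfac p c \<phi> Y)"
  proof (rule gen_recursion[OF Y])
    show "c = 1 \<or> c = 0 \<or> c = -1" unfolding c_def by (rule kronecker_prime_values)
    show "a \<phi> 0 = 1" for \<phi> by (simp add: a_def)
    show "a (Suc \<phi>) 1 = 0" for \<phi>
      unfolding a_def using locsum_psi_1[OF q pmin_shift[OF B, of "Suc \<phi>"] p] by (simp add: kronecker_prime_eq_0_iff)
    show "a (Suc \<phi>) 2 = p - 1 + 0" for \<phi>
      unfolding a_def sq using locsum_psi_square_2[OF q pmin_shift[OF B] p] by simp
    show "a (Suc \<phi>) (\<nu> + 3) = p * a \<phi> (\<nu> + 1)" for \<phi> \<nu>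
      unfolding a_def sq using locsum_psi_square[OF q pmin_shift[OF B] p, of "\<nu> + 1" "\<phi>"] by (simp add: numeral_3_eq_3)
    have a01: "a 0 1 = c" unfolding a_def c_def using locsum_psi_1[OF q dB p] by simp
    show "(\<lambda>\<nu>. of_int (a 0 \<nu>) * Y ^ \<nu>) sums ((1 - Y\<^sup>2) / ((1 - of_int 0 * Y) * (1 - of_int c * Y)))"
    proof (cases "p dvd B")
      case True
      hence c0: "c = 0" by (simp add: c_def kronecker_prime_eq_0_iff)
      have "a 0 (\<nu> + 2) = (if \<nu> = 0 then -1 else 0)" for \<nu>
        unfolding a_def using locsum_psi_ram[OF q p B True] by simp
      hence "(\<lambda>\<nu>. of_int (a 0 (\<nu> + 2)) * Y ^ (\<nu> + 2)) = (\<lambda>\<nu>. if \<nu> = 0 then - Y\<^sup>2 else 0)"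
        by (auto simp: fun_eq_iff power2_eq_square)
      moreover have "(\<lambda>\<nu>::nat. if \<nu> = 0 then - Y\<^sup>2 else 0) sums (- Y\<^sup>2)"
        using sums_single[of 0 "\<lambda>_. - Y\<^sup>2"] by simp
      ultimately have "(\<lambda>\<nu>. of_int (a 0 (\<nu> + 2)) * Y ^ (\<nu> + 2)) sums (- Y\<^sup>2)" by simp
      from sums_shift2[OF this] show ?thesis using a01 c0 by (simp add: a_def)
    next
      case False
      hence c1: "c = 1 \<or> c = -1" using kronecker_prime_values[of B p] by (auto simp: c_def kronecker_prime_eq_0_iff)
      have "a 0 (\<nu> + 2) = 0" for \<nu> unfolding a_def using locsum_psi_unit[OF q p B False] by simp
      hence "(\<lambda>\<nu>. of_int (a 0 (\<nu> + 2)) * Y ^ (\<nu> + 2)) sums 0" by simp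
      from sums_shift2[OF this] have "(\<lambda>\<nu>. of_int (a 0 \<nu>) * Y ^ \<nu>) sums (1 + of_int c * Y)"
        using a01 by (simp add: a_def)
      moreover have "(1 - Y\<^sup>2) / (1 - of_int c * Y) = 1 + of_int c * Y"
        using c1 Yb by (auto simp: field_simps power2_eq_square)
      ultimately show ?thesis by simp
    qed
  qed auto
  thus ?thesis by (simp add: a_def c_def)
qed

section \<open>Euler products\<close>

definition smooth :: "nat set \<Rightarrow> nat set" where
  "smooth P = {n. n > 0 \<and> prime_factors n \<subseteq> P}"

lemma smooth_empty: "smooth {} = {1}"
proof -
  have "n = 1" if "n > 0" "prime_factors n = {}" for n :: nat
    using that prime_factor_nat[of n] by (auto simp: prime_factors_dvd)
  thus ?thesis by (auto simp: smooth_def)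
qed

lemma coprime_smooth_prime:
  assumes "n \<in> smooth P" "prime p" "p \<notin> P" shows "coprime n p"
proof -
  have "\<not> p dvd n" using assms by (auto simp: smooth_def prime_factors_dvd)
  thus ?thesis using prime_imp_coprime[OF assms(2)] by (simp add: coprime_commute)
qed

lemma smooth_insert_bij:
  assumes "prime p" "p \<notin> P"
  shows "bij_betw (\<lambda>(m, \<nu>). m * p ^ \<nu>) (smooth P \<times> UNIV) (smooth (insert p P))"
proof (rule bij_betw_byWitness[where f' = "\<lambda>n. (n div p ^ multiplicity p n, multiplicity p n)"])
  have p0: "p > 0" using prime_gt_0_nat[OF assms(1)] .
  have mult: "multiplicity p (m * p ^ \<nu>) = \<nu>" if m: "m \<in> smooth P" for m \<nu>
  proof -
    have "\<not> p dvd m" "m \<noteq> 0" using m assms by (auto simp: smooth_def prime_factors_dvd)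
    thus ?thesis using assms(1) by (simp add: prime_elem_multiplicity_mult_distrib not_dvd_imp_multiplicity_0 prime_imp_prime_elem)
  qed
  show "\<forall>a\<in>smooth P \<times> UNIV. (\<lambda>n. (n div p ^ multiplicity p n, multiplicity p n)) ((\<lambda>(m, \<nu>). m * p ^ \<nu>) a) = a"
    using mult p0 by auto
  show "\<forall>a'\<in>smooth (insert p P). (\<lambda>(m, \<nu>). m * p ^ \<nu>) ((\<lambda>n. (n div p ^ multiplicity p n, multiplicity p n)) a') = a'"
    by (auto simp: multiplicity_dvd)
  show "(\<lambda>(m, \<nu>). m * p ^ \<nu>) ` (smooth P \<times> UNIV) \<subseteq> smooth (insert p P)"
  proof safe
    fix m \<nu> assume m: "m \<in> smooth P"
    have "prime_factors (m * p ^ \<nu>) \<subseteq> insert p (prime_factors m)"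
    proof
      fix x assume "x \<in> prime_factors (m * p ^ \<nu>)"
      hence x: "prime x" "x dvd m * p ^ \<nu>" by (auto simp: prime_factors_dvd)
      hence "x dvd m \<or> x dvd p" using prime_dvd_mult_iff prime_dvd_power by blast
      thus "x \<in> insert p (prime_factors m)"
        using x m primes_dvd_imp_eq[OF x(1) assms(1)] by (auto simp: prime_factors_dvd smooth_def)
    qed
    thus "m * p ^ \<nu> \<in> smooth (insert p P)" using m p0 by (auto simp: smooth_def)
  qed
  show "(\<lambda>n. (n div p ^ multiplicity p n, multiplicity p n)) ` smooth (insert p P) \<subseteq> smooth P \<times> UNIV"
  proof safe
    fix n assume n: "n \<in> smooth (insert p P)"
    hence n0: "n > 0" by (simp add: smooth_def)
    obtain m where m: "n = p ^ multiplicity p n * m" "\<not> p dvd m"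
      using multiplicity_decompose'[of n p] n0 assms(1) by (metis not_prime_unit less_not_refl)
    have "n div p ^ multiplicity p n = m" using m(1) p0 by (metis nonzero_mult_div_cancel_left power_not_zero less_not_refl)
    moreover have "prime_factors m \<subseteq> prime_factors n"
      using m(1) n0 by (metis dvd_prime_factors dvd_triv_right less_not_refl)
    hence "m \<in> smooth P" using n m n0 by (auto simp: smooth_def prime_factors_dvd intro!: Nat.gr0I)
    ultimately show "n div p ^ multiplicity p n \<in> smooth P" by simp
  qed auto
qed

definition multiplicative :: "(nat \<Rightarrow> real) \<Rightarrow> bool" where
  "multiplicative h \<longleftrightarrow> h 1 = 1 \<and> (\<forall>a b. a > 0 \<longrightarrow> b > 0 \<longrightarrow> coprime a b \<longrightarrow> h (a * b) = h a * h b)"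

text \<open>Each new prime adds one factor, since a smooth number is uniquely
  \<open>m * p^\<nu>\<close>; absolute convergence is carried through the induction to allow
  iterated summation.\<close>

lemma has_sum_smooth:
  assumes h: "multiplicative h"
    and e: "\<And>p. prime p \<Longrightarrow> (\<lambda>\<nu>. h (p ^ \<nu>)) sums e p" "\<And>p. prime p \<Longrightarrow> summable (\<lambda>\<nu>. \<bar>h (p ^ \<nu>)\<bar>)"
    and P: "finite P" "\<And>p. p \<in> P \<Longrightarrow> prime p"
  shows "(h has_sum (\<Prod>p\<in>P. e p)) (smooth P)" "h abs_summable_on smooth P"
proof -
  have "(h has_sum (\<Prod>p\<in>P. e p)) (smooth P) \<and> h abs_summable_on smooth P"
    using P
  proof (induction P rule: finite_induct)
    case empty
    have "(h has_sum h 1) {1}" using has_sum_finiteI[of "{1}" "h 1" h] by simp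
    thus ?case using h by (simp add: smooth_empty multiplicative_def)
  next
    case (insert p P)
    have p: "prime p" using insert.prems by auto
    have hs: "((\<lambda>\<nu>. h (p ^ \<nu>)) has_sum e p) UNIV"
      by (rule norm_summable_imp_has_sum) (use e[OF p] in auto)
    have abs: "(\<lambda>\<nu>. h (p ^ \<nu>)) abs_summable_on UNIV"
      using norm_summable_imp_summable_on[of "\<lambda>\<nu>. \<bar>h (p ^ \<nu>)\<bar>"] e(2)[OF p] by simp
    have IH: "(h has_sum (\<Prod>p\<in>P. e p)) (smooth P)" "h abs_summable_on smooth P"
      using insert.IH insert.prems by auto
    define F where "F = (\<lambda>(m, \<nu>). h m * h (p ^ \<nu>))"
    have "F abs_summable_on (smooth P \<times> UNIV)"
      unfolding Infinite_Sum.abs_summable_on_Sigma_iff F_def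
    proof (intro conjI ballI)
      fix m assume "m \<in> smooth P"
      show "(\<lambda>\<nu>. case (m, \<nu>) of (m, \<nu>) \<Rightarrow> h m * h (p ^ \<nu>)) abs_summable_on UNIV"
        using summable_on_cmult_right[OF abs, of "\<bar>h m\<bar>"] by (simp add: abs_mult)
    next
      have "infsum (\<lambda>\<nu>. norm (case (m, \<nu>) of (m, \<nu>) \<Rightarrow> h m * h (p ^ \<nu>))) UNIV = \<bar>h m\<bar> * infsum (\<lambda>\<nu>. \<bar>h (p ^ \<nu>)\<bar>) UNIV" for m
        by (simp add: abs_mult infsum_cmult_right')
      moreover have "(\<lambda>m. \<bar>h m\<bar> * infsum (\<lambda>\<nu>. \<bar>h (p ^ \<nu>)\<bar>) UNIV) summable_on smooth P"
        using IH(2) by (intro summable_on_cmult_left) auto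
      moreover have "infsum (\<lambda>\<nu>. \<bar>h (p ^ \<nu>)\<bar>) UNIV \<ge> 0" by (rule infsum_nonneg) auto
      ultimately show "(\<lambda>m. infsum (\<lambda>\<nu>. norm (case (m, \<nu>) of (m, \<nu>) \<Rightarrow> h m * h (p ^ \<nu>))) UNIV) abs_summable_on smooth P"
        by (simp add: abs_mult)
    qed
    note Fabs = this
    have "F summable_on (smooth P \<times> UNIV)" by (rule abs_summable_summable[OF Fabs])
    hence Fsum: "(F has_sum ((\<Prod>p\<in>P. e p) * e p)) (smooth P \<times> UNIV)"
      by (rule has_sum_SigmaI[rotated 2, where g = "\<lambda>m. h m * e p"])
        (auto simp: F_def intro!: has_sum_cmult_right has_sum_cmult_left hs IH(1))
    have heq: "h ((\<lambda>(m, \<nu>). m * p ^ \<nu>) x) = F x" if xm: "x \<in> smooth P \<times> UNIV" for x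
    proof -
      obtain m \<nu> where x: "x = (m, \<nu>)" "m \<in> smooth P" using xm by (cases x) auto
      have "coprime m (p ^ \<nu>)" using coprime_smooth_prime[OF x(2) p] insert.hyps by simp
      thus ?thesis using h x prime_gt_0_nat[OF p] by (simp add: multiplicative_def F_def smooth_def)
    qed
    note bij = smooth_insert_bij[OF p insert.hyps(2)]
    have "(h has_sum ((\<Prod>p\<in>P. e p) * e p)) (smooth (insert p P))"
      using Fsum has_sum_reindex_bij_betw[OF bij, of h] has_sum_cong[of "smooth P \<times> UNIV" "\<lambda>x. h ((\<lambda>(m, \<nu>). m * p ^ \<nu>) x)" F] heq by auto
    moreover have "(\<lambda>x. norm (h ((\<lambda>(m, \<nu>). m * p ^ \<nu>) x))) summable_on (smooth P \<times> UNIV)"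
      using Fabs summable_on_cong[of "smooth P \<times> UNIV" "\<lambda>x. norm (h ((\<lambda>(m, \<nu>). m * p ^ \<nu>) x))" "\<lambda>x. norm (F x)"] heq by auto
    hence "h abs_summable_on smooth (insert p P)"
      using summable_on_reindex_bij_betw[OF bij, of "\<lambda>n. norm (h n)"] by simp
    ultimately show ?case using insert.hyps by (simp add: mult.commute)
  qed
  thus "(h has_sum (\<Prod>p\<in>P. e p)) (smooth P)" "h abs_summable_on smooth P" by auto
qed

text \<open>A finite set of positive integers involves finitely many primes, so a bound on finite
  Euler products bounds every finite sum.\<close>

lemma multiplicative_summable:
  assumes h: "multiplicative h" and nn: "\<And>n. h n \<ge> 0"
    and e: "\<And>p. prime p \<Longrightarrow> (\<lambda>\<nu>. h (p ^ \<nu>)) sums e p"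
    and bd: "\<And>P. finite P \<Longrightarrow> (\<And>p. p \<in> P \<Longrightarrow> prime p) \<Longrightarrow> (\<Prod>p\<in>P. e p) \<le> C"
  shows "h summable_on {0<..}"
proof (rule nonneg_bdd_above_summable_on)
  show "bdd_above (sum h ` {F. F \<subseteq> {0<..} \<and> finite F})"
  proof (rule bdd_aboveI2)
    fix F :: "nat set" assume "F \<in> {F. F \<subseteq> {0<..} \<and> finite F}"
    hence F: "F \<subseteq> {0<..}" "finite F" by auto
    define P where "P = (\<Union>n\<in>F. prime_factors n)"
    have P: "finite P" "\<And>p. p \<in> P \<Longrightarrow> prime p" using F by (auto simp: P_def)
    have FP: "F \<subseteq> smooth P" using F by (auto simp: smooth_def P_def)
    have hs: "(h has_sum (\<Prod>p\<in>P. e p)) (smooth P)"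
      by (rule has_sum_smooth[OF h e(1) _ P]) (use e nn in \<open>auto simp: sums_iff\<close>)
    have "sum h F \<le> infsum h (smooth P)"
      by (rule finite_sum_le_infsum) (use hs F FP nn in \<open>auto intro: has_sum_imp_summable\<close>)
    also have "\<dots> \<le> C" using infsumI[OF hs] bd[OF P] by simp
    finally show "sum h F \<le> C" .
  qed
qed (use nn in auto)

definition primes_upto :: "nat \<Rightarrow> nat set" where "primes_upto x = {p. prime p \<and> p \<le> x}"

lemma finite_primes_upto [simp]: "finite (primes_upto x)"
  by (simp add: primes_upto_def)

lemma smooth_primes_upto: "n > 0 \<Longrightarrow> n \<le> x \<Longrightarrow> n \<in> smooth (primes_upto x)"
  by (auto simp: smooth_def primes_upto_def prime_factors_dvd dest: dvd_imp_le)

text \<open>The finite product sums \<open>h\<close> over the numbers with prime factors up to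
  \<open>x\<close>, which include all \<open>n \<le> x\<close>; the error is at most a tail of the
  absolutely convergent series.\<close>

lemma euler_product:
  assumes h: "multiplicative h" and abs: "h abs_summable_on {0<..}"
    and e: "\<And>p. prime p \<Longrightarrow> (\<lambda>\<nu>. h (p ^ \<nu>)) sums e p"
  shows "(\<lambda>x. \<Prod>p\<in>primes_upto x. e p) \<longlonglongrightarrow> infsum h {0<..}"
proof -
  define H where "H n = (if n > 0 then \<bar>h n\<bar> else 0)" for n
  define T where "T = infsum (\<lambda>n. \<bar>h n\<bar>) {0<..}"
  have abs': "(\<lambda>n. \<bar>h n\<bar>) summable_on A" if "A \<subseteq> {0<..}" for A
    using summable_on_subset_banach[OF _ that] abs by simp
  have su: "h summable_on A" if "A \<subseteq> {0<..}" for A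
    by (rule abs_summable_summable) (use abs'[OF that] in simp)
  have "(H has_sum T) UNIV"
    using has_sum_infsum[OF abs'[OF order_refl]] unfolding T_def[symmetric]
    by (subst (asm) has_sum_cong_neutral[of UNIV "{0<..}" H]) (auto simp: H_def)
  hence "H sums T" by (rule has_sum_imp_sums)
  hence lim: "(\<lambda>x. T - (\<Sum>n<Suc x. H n)) \<longlonglongrightarrow> T - T"
    unfolding sums_def by (intro tendsto_diff tendsto_const LIMSEQ_Suc[of "\<lambda>x. \<Sum>n<x. H n"])
  have ab: "summable (\<lambda>\<nu>. \<bar>h (p ^ \<nu>)\<bar>)" if p: "prime p" for p
  proof -
    have "inj (\<lambda>\<nu>. p ^ \<nu>)" using prime_gt_1_nat[OF p] by (auto intro: injI simp: power_inject_exp)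
    moreover have "(\<lambda>n. \<bar>h n\<bar>) summable_on range (\<lambda>\<nu>. p ^ \<nu>)"
      by (rule abs') (use prime_gt_0_nat[OF p] in auto)
    ultimately have "(\<lambda>\<nu>. \<bar>h (p ^ \<nu>)\<bar>) summable_on UNIV" by (subst (asm) summable_on_reindex) (auto simp: o_def)
    thus ?thesis by (rule summable_on_imp_summable)
  qed
  have close: "\<bar>(\<Prod>p\<in>primes_upto x. e p) - infsum h {0<..}\<bar> \<le> T - (\<Sum>n<Suc x. H n)" for x
  proof -
    define S where "S = smooth (primes_upto x)"
    have S: "S \<subseteq> {0<..}" "{0<..x} \<subseteq> S" by (auto simp: S_def smooth_primes_upto) (simp add: smooth_def)
    have hs: "(h has_sum (\<Prod>p\<in>primes_upto x. e p)) S" unfolding S_def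
      by (rule has_sum_smooth[OF h e ab]) (auto simp: primes_upto_def)
    have "infsum h {0<..} = infsum h S + infsum h ({0<..} - S)"
      using infsum_Un_disjoint[of h S "{0<..} - S"] su S by (simp add: Un_absorb1)
    hence "\<bar>(\<Prod>p\<in>primes_upto x. e p) - infsum h {0<..}\<bar> = \<bar>infsum h ({0<..} - S)\<bar>" using infsumI[OF hs] by simp
    also have "\<dots> \<le> infsum (\<lambda>n. \<bar>h n\<bar>) ({0<..} - S)"
      using norm_infsum_bound[of h "{0<..} - S"] abs' by simp
    also have "\<dots> \<le> infsum (\<lambda>n. \<bar>h n\<bar>) ({0<..} - {0<..x})"
      by (rule infsum_mono_neutral) (use S in \<open>auto intro!: abs' simp: subset_iff\<close>)
    also have "\<dots> = T - infsum (\<lambda>n. \<bar>h n\<bar>) {0<..x}"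
      unfolding T_def by (rule infsum_Diff) (auto intro!: abs')
    also have "infsum (\<lambda>n. \<bar>h n\<bar>) {0<..x} = (\<Sum>n<Suc x. H n)"
    proof -
      have "(\<Sum>n\<in>{0<..x}. \<bar>h n\<bar>) = (\<Sum>n<Suc x. H n)"
        by (rule sum.mono_neutral_cong_left) (auto simp: H_def)
      thus ?thesis by simp
    qed
    finally show ?thesis .
  qed
  have "(\<lambda>x. (\<Prod>p\<in>primes_upto x. e p) - infsum h {0<..}) \<longlonglongrightarrow> 0"
  proof (rule Lim_null_comparison)
    show "(\<lambda>x. T - (\<Sum>n<Suc x. H n)) \<longlonglongrightarrow> 0" using lim by (simp only: diff_self)
    show "\<forall>\<^sub>F x in sequentially. norm ((\<Prod>p\<in>primes_upto x. e p) - infsum h {0<..}) \<le> T - (\<Sum>n<Suc x. H n)"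
      by (intro always_eventually allI) (simp only: real_norm_def close)
  qed
  thus ?thesis by (simp add: LIM_zero_iff)
qed

lemma multiplicative_prod:
  assumes h: "multiplicative h" and P: "finite P" "\<And>p. p \<in> P \<Longrightarrow> prime p"
  shows "h (\<Prod>p\<in>P. p ^ v p) = (\<Prod>p\<in>P. h (p ^ v p))"
  using P
proof (induction P rule: finite_induct)
  case (insert p P)
  have "coprime (p ^ v p) (\<Prod>q\<in>P. q ^ v q)"
    using insert by (intro prod_coprime_right) (auto intro!: primes_coprime)
  moreover have "(\<Prod>q\<in>P. q ^ v q) > 0" using insert prime_gt_0_nat by (intro prod_pos) auto
  ultimately show ?case using insert h prime_gt_0_nat[of p] by (simp add: multiplicative_def)
qed (use h in \<open>simp add: multiplicative_def\<close>)

lemma multiplicative_eq_prod: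
  assumes h: "multiplicative h" and n: "n > 0" "n \<le> x"
  shows "h n = (\<Prod>p\<in>primes_upto x. h (p ^ multiplicity p n))"
proof -
  have "n = (\<Prod>p\<in>prime_factors n. p ^ multiplicity p n)" using prod_prime_factors[of n] n by simp
  also have "\<dots> = (\<Prod>p\<in>primes_upto x. p ^ multiplicity p n)"
    using n by (intro prod.mono_neutral_left)
      (auto simp: primes_upto_def prime_factors_dvd not_dvd_imp_multiplicity_0 dest: dvd_imp_le)
  finally have "n = (\<Prod>p\<in>primes_upto x. p ^ multiplicity p n)" .
  hence "h n = h (\<Prod>p\<in>primes_upto x. p ^ multiplicity p n)" by simp
  also have "\<dots> = (\<Prod>p\<in>primes_upto x. h (p ^ multiplicity p n))"
    by (rule multiplicative_prod[OF h]) (auto simp: primes_upto_def)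
  finally show ?thesis .
qed

lemma divisors_coprime_bij:
  fixes a b :: nat
  assumes "coprime a b" "a > 0" "b > 0"
  shows "bij_betw (\<lambda>(r, s). r * s) ({r. r dvd a} \<times> {s. s dvd b}) {t. t dvd a * b}"
proof -
  have inj: "inj_on (\<lambda>(r, s). r * s) ({r. r dvd a} \<times> {s. s dvd b})"
  proof (rule inj_onI, clarify)
    fix r s r' s' assume d: "r dvd a" "s dvd b" "r' dvd a" "s' dvd b" and e: "r * s = r' * s'"
    have co: "coprime r s'" "coprime r' s"
      using assms(1) d coprime_divisors by blast+
    have "r dvd r'" using e co(1) by (metis coprime_dvd_mult_left_iff dvd_triv_left)
    moreover have "r' dvd r" using e co(2) by (metis coprime_dvd_mult_left_iff dvd_triv_left)
    ultimately have "r = r'" by (rule dvd_antisym)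
    moreover have "r > 0" using d assms by (auto intro: Nat.gr0I)
    ultimately show "r = r' \<and> s = s'" using e by simp
  qed
  have "(\<lambda>(r, s). r * s) ` ({r. r dvd a} \<times> {s. s dvd b}) = {t. t dvd a * b}"
  proof (intro equalityI subsetI)
    fix t assume "t \<in> {t. t dvd a * b}"
    then obtain r s where "t = r * s" "r dvd a" "s dvd b" using division_decomp[of t a b] by auto
    thus "t \<in> (\<lambda>(r, s). r * s) ` ({r. r dvd a} \<times> {s. s dvd b})" by auto
  qed (auto intro: mult_dvd_mono)
  thus ?thesis using inj by (simp add: bij_betw_def)
qed

lemma multiplicative_convolution:
  assumes f: "multiplicative f" and g: "multiplicative g"
  shows "multiplicative (\<lambda>n. \<Sum>r | r dvd n. f r * g (n div r))"
  unfolding multiplicative_def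
proof (intro conjI allI impI)
  show "(\<Sum>r | r dvd 1. f r * g (1 div r)) = 1" using f g by (simp add: multiplicative_def)
  fix a b :: nat assume ab: "a > 0" "b > 0" "coprime a b"
  have "(\<Sum>t | t dvd a * b. f t * g (a * b div t)) =
     (\<Sum>(r, s)\<in>{r. r dvd a} \<times> {s. s dvd b}. f (r * s) * g (a * b div (r * s)))"
    using sum.reindex_bij_betw[OF divisors_coprime_bij[OF ab(3,1,2)], of "\<lambda>t. f t * g (a * b div t)"]
    by (simp add: case_prod_beta)
  also have "\<dots> = (\<Sum>(r, s)\<in>{r. r dvd a} \<times> {s. s dvd b}. (f r * g (a div r)) * (f s * g (b div s)))"
  proof (intro sum.cong refl, clarify)
    fix r s assume d: "r dvd a" "s dvd b"
    have c: "coprime r s" using coprime_divisors[OF d ab(3)] .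
    have c2: "coprime (a div r) (b div s)"
      by (rule coprime_divisors[OF _ _ ab(3)]) (use d in auto)
    have pos: "r > 0" "s > 0" "a div r > 0" "b div s > 0"
      using d ab by (auto intro: Nat.gr0I simp: dvd_imp_le div_greater_zero_iff)
    have "a * b div (r * s) = (a div r) * (b div s)" using d by (simp add: div_mult_div_if_dvd)
    thus "f (r * s) * g (a * b div (r * s)) = (f r * g (a div r)) * (f s * g (b div s))"
      using f g c c2 pos by (simp add: multiplicative_def)
  qed
  also have "\<dots> = (\<Sum>r | r dvd a. f r * g (a div r)) * (\<Sum>s | s dvd b. f s * g (b div s))"
    by (simp add: sum_product sum.cartesian_product)
  finally show "(\<Sum>t | t dvd a * b. f t * g (a * b div t)) =
    (\<Sum>r | r dvd a. f r * g (a div r)) * (\<Sum>s | s dvd b. f s * g (b div s))" .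
qed

section \<open>Weighted counts of quadratic congruences\<close>

text \<open>
  Here \<open>D\<close> is the full discriminant. The pairs \<open>(a, x)\<close> with \<open>a > 0\<close> and \<open>a dvd qpol D x\<close>
  parametrise the quadratic functions \<open>[-a, -(2 x + D mod 2), -(qpol D x div a)]\<close> of discriminant \<open>D\<close>,
  and \<open>wt S D a x\<close> is the value of the genus character of \<open>\<Prod>S\<close> there, up to the sign of \<open>\<Prod>S\<close>.
\<close>

definition wt :: "int set \<Rightarrow> int \<Rightarrow> int \<Rightarrow> int \<Rightarrow> int" where
  "wt S D a x = (if a dvd qpol D x
     then \<Prod>q\<in>S. if base_prime q dvd a then psi q (qpol D x div a) else psi q a else 0)"

definition wsum :: "int set \<Rightarrow> int \<Rightarrow> int \<Rightarrow> int" where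
  "wsum S D a = (\<Sum>x\<in>{0..<a}. wt S D a x)"

lemma disc4_prod: "finite S \<Longrightarrow> (\<And>q. q \<in> S \<Longrightarrow> prime_disc q) \<Longrightarrow> disc4 (\<Prod>S)"
proof (induction S rule: finite_induct)
  case (insert q S)
  have "disc4 (q * \<Prod>S)" by (intro disc4_mult insert.IH prime_disc_disc4 insert.prems) auto
  thus ?case using insert.hyps by simp
qed (simp add: disc4_def)

lemma disc_set_split:
  assumes "disc_set S" "q \<in> S"
  shows "\<Prod>S = q * \<Prod>(S - {q})" "disc_set (insert q (S - {q}))" "q \<notin> S - {q}" "disc4 (\<Prod>(S - {q}))"
  using assms by (auto simp: disc_set_def prod.remove insert_absorb intro!: disc4_prod)

lemma wt_per:
  assumes S: "disc_set S" and D: "disc4 D" and a: "a > 0"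
  shows "wt S (\<Prod>S * D) a (x + a) = wt S (\<Prod>S * D) a x"
proof -
  define E where "E = \<Prod>S * D"
  have sh: "qpol E (x + a) = qpol E x + a * (2 * x + E mod 2 + a)"
    using qpol_shift[of E x a 1] by (simp add: power2_eq_square algebra_simps)
  show ?thesis
  proof (cases "a dvd qpol E x")
    case False
    hence "\<not> a dvd qpol E (x + a)" unfolding sh by (simp only: dvd_add_left_iff dvd_triv_left not_False_eq_True)
    thus ?thesis using False by (simp add: wt_def E_def)
  next
    case True
    hence T': "a dvd qpol E (x + a)" unfolding sh by simp
    have "psi q (qpol E (x + a) div a) = psi q (qpol E x div a)" if q: "q \<in> S" "base_prime q dvd a" for q
    proof -
      have e: "E = q * (\<Prod>(S - {q}) * D)" unfolding E_def disc_set_split(1)[OF S q(1)] by simp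
      have "disc4 (\<Prod>(S - {q}) * D)" by (intro disc4_mult disc_set_split(4)[OF S q(1)] D)
      from locterm_per_psi[OF _ this a q(2), of x] show ?thesis
        using True T' S q unfolding e[symmetric] by (auto simp: disc_set_def)
    qed
    thus ?thesis using True T' unfolding wt_def E_def[symmetric] by (auto intro!: prod.cong)
  qed
qed

text \<open>A prime of \<open>S\<close> divides at most one of \<open>a\<close> and
  \<open>b\<close>. The cofactor of one contains the other as a unit, whose character enters twice
  and so disappears.\<close>

lemma wt_mult:
  assumes S: "disc_set S" and a: "a > 0" "b > 0" "coprime a b"
  shows "wt S D (a * b) x = wt S D a x * wt S D b x"
proof (cases "a dvd qpol D x \<and> b dvd qpol D x")
  case False
  hence "\<not> a * b dvd qpol D x" using dvd_mult_left dvd_mult_right by blast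
  thus ?thesis using False by (auto simp: wt_def)
next
  case True
  hence ab: "a * b dvd qpol D x" using a(3) by (simp add: divides_mult)
  then obtain c where c: "qpol D x = a * b * c" by (elim dvdE)
  have dv: "qpol D x div (a * b) = c" "qpol D x div a = b * c" "qpol D x div b = a * c"
    using a unfolding c by (simp_all add: mult.assoc mult.left_commute[of a b])
  have "(if base_prime q dvd a * b then psi q c else psi q (a * b)) =
     (if base_prime q dvd a then psi q (b * c) else psi q a) *
     (if base_prime q dvd b then psi q (a * c) else psi q b)" if q: "q \<in> S" for q
  proof -
    have pq: "prime_disc q" using S q by (simp add: disc_set_def)
    note pp = prime_base_prime[OF pq]
    have dm: "base_prime q dvd a * b \<longleftrightarrow> base_prime q dvd a \<or> base_prime q dvd b" using pp by (rule prime_dvd_mult_iff)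
    have nb: "\<not> (base_prime q dvd a \<and> base_prime q dvd b)"
      using a(3) pp by (meson coprime_common_divisor not_prime_unit)
    show ?thesis
    proof (cases "base_prime q dvd a")
      case True
      hence n: "\<not> base_prime q dvd b" using nb by simp
      have "psi q (b * c) * psi q b = (psi q b * psi q b) * psi q c" by (simp add: psi_mult[OF pq])
      thus ?thesis using True n dm psi_square[OF n] by simp
    next
      case False
      have "psi q a * psi q (a * c) = (psi q a * psi q a) * psi q c" by (simp add: psi_mult[OF pq])
      thus ?thesis using False dm psi_square[OF False] by (simp add: psi_mult[OF pq])
    qed
  qed
  hence "(\<Prod>q\<in>S. if base_prime q dvd a * b then psi q c else psi q (a * b)) =
     (\<Prod>q\<in>S. if base_prime q dvd a then psi q (b * c) else psi q a) *
     (\<Prod>q\<in>S. if base_prime q dvd b then psi q (a * c) else psi q b)"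
    unfolding prod.distrib[symmetric] by (intro prod.cong refl)
  thus ?thesis unfolding wt_def dv using True ab by simp
qed

lemma wsum_mult:
  assumes S: "disc_set S" and D: "disc4 D" and a: "a > 0" "b > 0" "coprime a b"
  shows "wsum S (\<Prod>S * D) (a * b) = wsum S (\<Prod>S * D) a * wsum S (\<Prod>S * D) b"
proof -
  have "wsum S (\<Prod>S * D) (a * b) = (\<Sum>x\<in>{0..<a*b}. wt S (\<Prod>S * D) a x * wt S (\<Prod>S * D) b x)"
    by (simp add: wsum_def wt_mult[OF S a])
  also have "\<dots> = wsum S (\<Prod>S * D) a * wsum S (\<Prod>S * D) b"
    unfolding wsum_def
    by (rule sum_residue_crt[where f = "wt S (\<Prod>S * D) a" and g = "wt S (\<Prod>S * D) b", OF wt_per[OF S D] wt_per[OF S D]]) (use a in auto)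
  finally show ?thesis .
qed

lemma wsum_1: "disc_set S \<Longrightarrow> wsum S D 1 = 1"
proof -
  assume S: "disc_set S"
  have "{0..<1::int} = {0}" by auto
  moreover have "wt S D 1 0 = (\<Prod>q\<in>S. 1)"
  proof -
    have "\<not> base_prime q dvd 1" if "q \<in> S" for q
      using S that prime_base_prime[of q] not_prime_unit[of "base_prime q"] by (auto simp: disc_set_def)
    thus ?thesis unfolding wt_def using S by (auto simp: disc_set_def psi_one intro!: prod.neutral)
  qed
  ultimately show ?thesis by (simp add: wsum_def)
qed

lemma prime_dvd_prime_power: "prime (p::int) \<Longrightarrow> prime r \<Longrightarrow> r dvd p ^ \<nu> \<longleftrightarrow> \<nu> > 0 \<and> r = p"
  using primes_dvd_imp_eq[of r p] prime_dvd_power[of r p \<nu>] by (cases "\<nu> = 0") (auto dest: not_prime_unit)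

lemma wsum_unramified:
  assumes S: "disc_set S" and p: "prime p" and np: "\<And>q. q \<in> S \<Longrightarrow> base_prime q \<noteq> p"
  shows "wsum S D (p ^ \<nu>) = (\<Prod>q\<in>S. psi q p) ^ \<nu> * locsum D (\<lambda>_. 1) p \<nu>"
proof -
  have "wt S D (p ^ \<nu>) x = (\<Prod>q\<in>S. psi q p) ^ \<nu> * (if p ^ \<nu> dvd qpol D x then 1 else 0)" for x
  proof -
    have "(\<Prod>q\<in>S. if base_prime q dvd p ^ \<nu> then psi q (qpol D x div p ^ \<nu>) else psi q (p ^ \<nu>)) = (\<Prod>q\<in>S. psi q p ^ \<nu>)"
      using S np p prime_base_prime by (intro prod.cong refl) (auto simp: disc_set_def psi_power prime_dvd_prime_power)
    thus ?thesis by (simp add: wt_def prod_power_distrib)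
  qed
  thus ?thesis by (simp add: wsum_def locsum_def sum_distrib_left)
qed

lemma wsum_ramified:
  assumes S: "disc_set S" and q: "q \<in> S" "p = base_prime q" and \<nu>: "\<nu> > 0"
  shows "wsum S D (p ^ \<nu>) = (\<Prod>r\<in>S - {q}. psi r p) ^ \<nu> * locsum D (psi q) p \<nu>"
proof -
  have fin: "finite S" and pq: "prime_disc q" using S q by (auto simp: disc_set_def)
  have p: "prime p" unfolding q(2) by (rule prime_base_prime[OF pq])
  have "wt S D (p ^ \<nu>) x = (\<Prod>r\<in>S - {q}. psi r p) ^ \<nu> * (if p ^ \<nu> dvd qpol D x then psi q (qpol D x div p ^ \<nu>) else 0)" for x
  proof -
    have "(\<Prod>r\<in>S - {q}. if base_prime r dvd p ^ \<nu> then psi r (qpol D x div p ^ \<nu>) else psi r (p ^ \<nu>)) = (\<Prod>r\<in>S - {q}. psi r p ^ \<nu>)"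
    proof (intro prod.cong refl)
      fix r assume r: "r \<in> S - {q}"
      hence "base_prime r \<noteq> p" using S q by (auto simp: disc_set_def dest: inj_onD)
      moreover have "prime_disc r" using r S by (simp add: disc_set_def)
      ultimately show "(if base_prime r dvd p ^ \<nu> then psi r (qpol D x div p ^ \<nu>) else psi r (p ^ \<nu>)) = psi r p ^ \<nu>"
        using prime_base_prime[of r] p by (simp add: psi_power prime_dvd_prime_power)
    qed
    moreover have "base_prime q dvd p ^ \<nu>" using q(2) \<nu> by simp
    ultimately show ?thesis unfolding wt_def prod.remove[OF fin q(1)] by (simp add: prod_power_distrib)
  qed
  thus ?thesis by (simp add: wsum_def locsum_def sum_distrib_left)
qed

text \<open>Fundamental discriminants in the shape that the local recursion needs; the agreement
  with the definition through quadratic fields is \<open>fundamental_iff\<close>.\<close>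

definition min_disc :: "int \<Rightarrow> bool" where
  "min_disc D \<longleftrightarrow> D \<noteq> 0 \<and> disc4 D \<and> (\<forall>p. prime p \<longrightarrow> pmin p D)"

lemma pmin_mult:
  assumes p: "prime p" and D: "pmin p D" and m: "\<not> p dvd m" "disc4 m"
  shows "pmin p (D * m)"
  unfolding pmin_def
proof (intro conjI allI impI notI)
  show "disc4 (D * m)" using D m by (intro disc4_mult) (auto simp: pmin_def)
  fix B assume B: "D * m = p\<^sup>2 * B" "disc4 B"
  have "coprime (p\<^sup>2) m" using prime_coprime_iff[OF p] m(1) by (simp add: coprime_commute)
  moreover have "p\<^sup>2 dvd D * m" unfolding B by simp
  ultimately have "p\<^sup>2 dvd D" by (simp add: coprime_dvd_mult_left_iff)
  then obtain C where C: "D = p\<^sup>2 * C" by (elim dvdE)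
  hence BC: "B = C * m" using B(1) p by auto
  have "disc4 C"
  proof (cases "p = 2")
    case True
    hence "m mod 4 = 1" using m unfolding disc4_def by presburger
    hence "(C * m) mod 4 = C mod 4" by (metis mod_mult_right_eq mult.right_neutral)
    thus ?thesis using B(2) by (simp add: BC disc4_def)
  next
    case False
    hence "odd p" using p prime_ge_2_int[OF p] prime_odd_int[of p] by simp
    thus ?thesis using disc4_div_odd_square[of p C] D C by (auto simp: pmin_def)
  qed
  thus False using D C by (simp add: pmin_def)
qed

lemma Tfac_twist:
  assumes "\<epsilon> = 1 \<or> \<epsilon> = -1"
  shows "Tfac p (c * \<epsilon>) \<phi> (of_int \<epsilon> * X) = Tfac p c \<phi> X"
  using assms by (auto simp: Tfac_def power2_eq_square)

text \<open>With \<open>X = p^(-k)\<close> this is the factor at \<open>p\<close> of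
  \<open>L_d(k) L_D0(k) T(f) / \<zeta>(2k)\<close>, where \<open>kd\<close> and \<open>k0\<close>
  are the symbols of \<open>d\<close> and \<open>D0\<close> at \<open>p\<close>.\<close>

definition efac :: "int \<Rightarrow> int \<Rightarrow> int \<Rightarrow> nat \<Rightarrow> real \<Rightarrow> real" where
  "efac p kd k0 \<phi> X = (1 - X\<^sup>2) / ((1 - of_int kd * X) * (1 - of_int k0 * X)) * Tfac p k0 \<phi> X"

text \<open>The full discriminant is written as \<open>p^(2 \<phi>)\<close> times one minimal at
  \<open>p\<close>, with a further factor \<open>q\<close> if \<open>p\<close> is ramified. The
  members of \<open>S\<close> prime to \<open>p\<close> contribute \<open>\<epsilon>^\<nu>\<close>
  at exponent \<open>\<nu>\<close>, so the generating function is taken at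
  \<open>\<epsilon> X\<close>; the same \<open>\<epsilon>\<close> enters the symbol of the minimal
  part, and by \<open>Tfac_twist\<close> the two cancel in everything that belongs to
  \<open>D0\<close>.\<close>

theorem local_factor:
  assumes S: "disc_set S" and p: "prime p" and D0: "min_disc D0" and f: "f = p ^ \<phi> * u" "\<not> p dvd u"
    and X: "\<bar>X\<bar> < 1"
  shows "(\<lambda>\<nu>. of_int (wsum S (\<Prod>S * (D0 * f\<^sup>2)) (p ^ \<nu>)) * X ^ \<nu>) sums
    efac p (kronecker_prime (\<Prod>S) p) (kronecker_prime D0 p) \<phi> X"
proof -
  have fin: "finite S" and PD: "\<And>q. q \<in> S \<Longrightarrow> prime_disc q" using S by (auto simp: disc_set_def)
  have kprod: "kronecker_prime (\<Prod>T) p = (\<Prod>q\<in>T. psi q p)" if "T \<subseteq> S" for T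
    using kronecker_prod[of T p] that fin PD kronecker_prime_eq[OF p] by (metis finite_subset subsetD)
  have pf: "f\<^sup>2 = p ^ (2 * \<phi>) * u\<^sup>2" unfolding f by (simp add: power_mult_distrib power_even_eq)
  have pm: "pmin p D0" using D0 p by (simp add: min_disc_def)
  show ?thesis
  proof (cases "\<exists>q\<in>S. base_prime q = p")
    case False
    define d where "d = \<Prod>S"
    have nd: "\<not> p dvd d"
    proof
      assume "p dvd d"
      then obtain q where "q \<in> S" "p dvd q" using p fin by (auto simp: d_def prime_dvd_prod_iff)
      thus False using prime_dvd_prime_disc[OF PD _ ] p False by auto
    qed
    have dd: "disc4 d" unfolding d_def by (rule disc4_prod[OF fin PD])
    define m where "m = u\<^sup>2 * d"
    have nm: "\<not> p dvd m" using nd f(2) p by (auto simp: m_def prime_dvd_mult_iff dest: prime_dvd_power)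
    have pmB: "pmin p (D0 * m)" by (rule pmin_mult[OF p pm nm]) (auto simp: m_def intro: disc4_mult disc4_square dd)
    define \<epsilon> where "\<epsilon> = kronecker_prime d p"
    have eps: "\<epsilon> = 1 \<or> \<epsilon> = -1" using kronecker_prime_values[of d p] nd by (auto simp: \<epsilon>_def kronecker_prime_eq_0_iff)
    have kB: "kronecker_prime (D0 * m) p = kronecker_prime D0 p * \<epsilon>"
    proof -
      have "D0 * m = (D0 * d) * u\<^sup>2" by (simp add: m_def)
      hence "kronecker_prime (D0 * m) p = kronecker_prime (D0 * d) p"
        using kronecker_prime_square[OF p f(2), of "D0 * d"] by (simp only:)
      also have "\<dots> = kronecker_prime D0 p * \<epsilon>" unfolding \<epsilon>_def by (rule kronecker_prime_mult[OF p])
      finally show ?thesis .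
    qed
    have disc: "d * (D0 * f\<^sup>2) = p ^ (2 * \<phi>) * (D0 * m)" by (simp add: pf m_def)
    have "\<bar>of_int \<epsilon> * X\<bar> < 1" using eps X by auto
    from unramified_gen[OF p pmB this, of \<phi>]
    have "(\<lambda>\<nu>. of_int (locsum (d * (D0 * f\<^sup>2)) (\<lambda>_. 1) p \<nu>) * (of_int \<epsilon> * X) ^ \<nu>) sums
      ((1 - X\<^sup>2) / ((1 - of_int \<epsilon> * X) * (1 - of_int (kronecker_prime D0 p) * X)) * Tfac p (kronecker_prime D0 p) \<phi> X)"
      unfolding disc kB Tfac_twist[OF eps] using eps by (auto simp: power2_eq_square)
    moreover have "of_int (locsum (d * (D0 * f\<^sup>2)) (\<lambda>_. 1) p \<nu>) * (of_int \<epsilon> * X) ^ \<nu> =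
       of_int (wsum S (d * (D0 * f\<^sup>2)) (p ^ \<nu>)) * X ^ \<nu>" for \<nu>
      using wsum_unramified[OF S p, of "d * (D0 * f\<^sup>2)" \<nu>] False kprod[of S]
      by (auto simp: \<epsilon>_def d_def power_mult_distrib mult_ac)
    ultimately show ?thesis unfolding efac_def d_def[symmetric] \<epsilon>_def by simp
  next
    case True
    then obtain q where q: "q \<in> S" "p = base_prime q" by auto
    define e where "e = \<Prod>(S - {q})"
    have ne: "\<not> p dvd e"
    proof
      assume "p dvd e"
      then obtain r where r: "r \<in> S - {q}" "p dvd r" using p fin by (auto simp: e_def prime_dvd_prod_iff)
      have "p = base_prime r" by (rule prime_dvd_prime_disc[OF PD p]) (use r in auto)
      thus False using S q r by (auto simp: disc_set_def dest: inj_onD)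
    qed
    have d: "\<Prod>S = q * e" unfolding e_def by (rule disc_set_split(1)[OF S q(1)])
    have dd: "disc4 e" unfolding e_def by (rule disc_set_split(4)[OF S q(1)])
    define m where "m = u\<^sup>2 * e"
    have nm: "\<not> p dvd m" using ne f(2) p by (auto simp: m_def prime_dvd_mult_iff dest: prime_dvd_power)
    have pmB: "pmin p (D0 * m)" by (rule pmin_mult[OF p pm nm]) (auto simp: m_def intro: disc4_mult disc4_square dd)
    define \<epsilon> where "\<epsilon> = kronecker_prime e p"
    have eps: "\<epsilon> = 1 \<or> \<epsilon> = -1" using kronecker_prime_values[of e p] ne by (auto simp: \<epsilon>_def kronecker_prime_eq_0_iff)
    have kB: "kronecker_prime (D0 * m) p = kronecker_prime D0 p * \<epsilon>"
    proof -
      have "D0 * m = (D0 * e) * u\<^sup>2" by (simp add: m_def)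
      hence "kronecker_prime (D0 * m) p = kronecker_prime (D0 * e) p"
        using kronecker_prime_square[OF p f(2), of "D0 * e"] by (simp only:)
      also have "\<dots> = kronecker_prime D0 p * \<epsilon>" unfolding \<epsilon>_def by (rule kronecker_prime_mult[OF p])
      finally show ?thesis .
    qed
    have disc: "q * e * (D0 * f\<^sup>2) = q * (p ^ (2 * \<phi>) * (D0 * m))" by (simp add: pf m_def)
    have k0: "kronecker_prime (\<Prod>S) p = 0"
      unfolding kronecker_prime_eq_0_iff d q(2) using base_prime_dvd[OF PD[OF q(1)]] by simp
    have "\<bar>of_int \<epsilon> * X\<bar> < 1" using eps X by auto
    from ramified_gen[OF PD[OF q(1)] q(2) pmB this, of \<phi>]
    have "(\<lambda>\<nu>. of_int (if \<nu> = 0 then 1 else locsum (q * e * (D0 * f\<^sup>2)) (psi q) p \<nu>) * (of_int \<epsilon> * X) ^ \<nu>) sums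
      ((1 - X\<^sup>2) / ((1 - of_int 0 * X) * (1 - of_int (kronecker_prime D0 p) * X)) * Tfac p (kronecker_prime D0 p) \<phi> X)"
      unfolding disc kB Tfac_twist[OF eps] using eps by (auto simp: power2_eq_square)
    moreover have "of_int (if \<nu> = 0 then 1 else locsum (q * e * (D0 * f\<^sup>2)) (psi q) p \<nu>) * (of_int \<epsilon> * X) ^ \<nu> =
       of_int (wsum S (q * e * (D0 * f\<^sup>2)) (p ^ \<nu>)) * X ^ \<nu>" for \<nu>
    proof (cases "\<nu> = 0")
      case True thus ?thesis using wsum_1[OF S] by simp
    next
      case False
      have "(\<Prod>r\<in>S - {q}. psi r p) = \<epsilon>" unfolding \<epsilon>_def e_def by (rule kprod[symmetric]) auto
      thus ?thesis using wsum_ramified[OF S q, of \<nu> "q * e * (D0 * f\<^sup>2)"] False by (simp add: power_mult_distrib mult_ac)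
    qed
    ultimately show ?thesis unfolding efac_def k0 unfolding d by simp
  qed
qed

section \<open>The Dirichlet series identity\<close>

definition Lreal :: "int \<Rightarrow> nat \<Rightarrow> real" where
  "Lreal d k = infsum (\<lambda>n. of_int (kronecker d (int n)) / real n ^ k) {0<..}"

lemma kronecker_fund_mult:
  assumes "disc_set S" shows "kronecker (\<Prod>S) (a * b) = kronecker (\<Prod>S) a * kronecker (\<Prod>S) b"
  using assms by (simp add: disc_set_def kronecker_prod psi_mult prod.distrib)

lemma kronecker_fund_one: "disc_set S \<Longrightarrow> kronecker (\<Prod>S) 1 = 1"
  by (simp add: disc_set_def kronecker_prod psi_one)

lemma kronecker_abs_le: "disc_set S \<Longrightarrow> \<bar>kronecker (\<Prod>S) n\<bar> \<le> 1"
proof -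
  assume S: "disc_set S"
  have "\<bar>\<Prod>q\<in>S. psi q n\<bar> = (\<Prod>q\<in>S. \<bar>psi q n\<bar>)" by (rule abs_prod)
  also have "\<dots> \<le> 1" by (intro prod_le_1) (auto simp: psi_abs_le)
  finally show ?thesis using S by (simp add: disc_set_def kronecker_prod)
qed

lemma summable_zeta: "k \<ge> 2 \<Longrightarrow> (\<lambda>n. 1 / real n ^ k) summable_on {0<..}"
proof -
  assume "k \<ge> 2"
  hence "summable (\<lambda>n. inverse (real n ^ k))" by (intro inverse_power_summable) auto
  hence "(\<lambda>n. 1 / real n ^ k) summable_on UNIV"
    by (intro norm_summable_imp_summable_on) (simp add: inverse_eq_divide)
  thus ?thesis by (rule summable_on_subset_banach) auto
qed

lemma L_abs_summable:
  assumes "disc_set S" "k \<ge> 2"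
  shows "(\<lambda>n. of_int (kronecker (\<Prod>S) (int n)) / real n ^ k) abs_summable_on {0<..}"
proof (rule summable_on_comparison_test[OF summable_zeta[OF assms(2)]])
  fix n :: nat assume "n \<in> {0<..}"
  have "real_of_int \<bar>kronecker (\<Prod>S) (int n)\<bar> \<le> 1"
    using kronecker_abs_le[OF assms(1), of "int n"] by linarith
  thus "norm (of_int (kronecker (\<Prod>S) (int n)) / real n ^ k) \<le> 1 / real n ^ k"
    by (simp add: divide_right_mono)
qed auto

lemma L_multiplicative:
  assumes "disc_set S" shows "multiplicative (\<lambda>n. of_int (kronecker (\<Prod>S) (int n)) / real n ^ k)"
  using kronecker_fund_mult[OF assms] kronecker_fund_one[OF assms]
  by (simp add: multiplicative_def power_mult_distrib)

lemma prime_power_ge_2: "prime p \<Longrightarrow> k \<ge> 2 \<Longrightarrow> 1 / real p ^ k \<le> 1 / 4"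
proof -
  assume p: "prime p" and k: "k \<ge> 2"
  have "(2::real) ^ 2 \<le> real p ^ 2" using prime_ge_2_nat[OF p] by (intro power_mono) auto
  also have "\<dots> \<le> real p ^ k" using prime_ge_2_nat[OF p] k by (intro power_increasing) auto
  finally show ?thesis using prime_gt_0_nat[OF p] by (simp add: field_simps)
qed

lemma L_local:
  assumes S: "disc_set S" and p: "prime p" and k: "k \<ge> 2"
  shows "(\<lambda>\<nu>. of_int (kronecker (\<Prod>S) (int (p ^ \<nu>))) / real (p ^ \<nu>) ^ k) sums
    (1 / (1 - of_int (kronecker_prime (\<Prod>S) (int p)) * (1 / real p ^ k)))"
proof -
  define c where "c = kronecker (\<Prod>S) (int p)"
  have "kronecker (\<Prod>S) (int (p ^ \<nu>)) = c ^ \<nu>" for \<nu>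
    by (induction \<nu>) (simp_all add: kronecker_fund_one[OF S] kronecker_fund_mult[OF S] c_def)
  moreover have "real (p ^ \<nu>) ^ k = (real p ^ k) ^ \<nu>" for \<nu> by (simp add: power_mult[symmetric] mult.commute)
  ultimately have e: "(\<lambda>\<nu>. of_int (kronecker (\<Prod>S) (int (p ^ \<nu>))) / real (p ^ \<nu>) ^ k) = (\<lambda>\<nu>. (of_int c * (1 / real p ^ k)) ^ \<nu>)"
    by (simp add: power_mult_distrib power_inverse fun_eq_iff divide_inverse)
  have "\<bar>real_of_int c\<bar> \<le> 1" using kronecker_abs_le[OF S, of "int p"] unfolding c_def by linarith
  hence "\<bar>of_int c * (1 / real p ^ k)\<bar> \<le> 1 * (1 / 4)"
    unfolding abs_mult using prime_power_ge_2[OF p k] by (intro mult_mono) auto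
  hence "norm (of_int c * (1 / real p ^ k)) < 1" unfolding real_norm_def by linarith
  from geometric_sums[OF this] show ?thesis unfolding e using kronecker_prime_eq[of "int p" "\<Prod>S"] p by (simp add: c_def)
qed

definition cohen_sum :: "int \<Rightarrow> nat \<Rightarrow> nat \<Rightarrow> real" where
  "cohen_sum D0 k f = (\<Sum>r | r dvd f. of_int (moebius_mu r * kronecker D0 (int r)) * real (r ^ (k - 1)) *
      real (divisor_sigma (2 * k - 1) (f div r)))"

lemma moebius_multiplicative: "multiplicative (\<lambda>n. of_int (moebius_mu n))"
  unfolding multiplicative_def
proof (intro conjI allI impI)
  show "real_of_int (moebius_mu 1) = 1" by (simp add: moebius_mu_def)
  fix a b :: nat assume ab: "a > 0" "b > 0" "coprime a b"
  show "real_of_int (moebius_mu (a * b)) = real_of_int (moebius_mu a) * real_of_int (moebius_mu b)"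
  proof (cases "squarefree (a * b)")
    case False
    hence "\<not> (squarefree a \<and> squarefree b)" using squarefree_mult_coprime[OF ab(3)] by blast
    thus ?thesis using False by (auto simp: moebius_mu_def)
  next
    case True
    hence sq: "squarefree a" "squarefree b" using squarefree_multD by blast+
    have "prime_factors (a * b) = prime_factors a \<union> prime_factors b"
      using ab by (simp add: prime_factorization_mult)
    moreover have "prime_factors a \<inter> prime_factors b = {}"
      using ab(3) by (auto simp: prime_factors_dvd dest: coprime_common_divisor not_prime_unit)
    ultimately have "card (prime_factors (a * b)) = card (prime_factors a) + card (prime_factors b)"
      by (simp add: card_Un_disjoint)
    thus ?thesis using True sq by (simp add: moebius_mu_def power_add)
  qed
qed

lemma sigma_multiplicative: "multiplicative (\<lambda>n. real (divisor_sigma m n))"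
proof -
  have "multiplicative (\<lambda>n. real (n ^ m))" "multiplicative (\<lambda>n. 1)"
    by (auto simp: multiplicative_def power_mult_distrib)
  from multiplicative_convolution[OF this] show ?thesis by (simp add: divisor_sigma_def)
qed

lemma multiplicative_times: "multiplicative f \<Longrightarrow> multiplicative g \<Longrightarrow> multiplicative (\<lambda>n. f n * g n)"
  by (simp add: multiplicative_def)

lemma cohen_sum_multiplicative:
  assumes "disc_set S" shows "multiplicative (cohen_sum (\<Prod>S) k)"
proof -
  have 1: "multiplicative (\<lambda>n. of_int (kronecker (\<Prod>S) (int n)))"
    using L_multiplicative[OF assms, of 0] by simp
  have 2: "multiplicative (\<lambda>n. real (n ^ (k - 1)))" by (auto simp: multiplicative_def power_mult_distrib)
  from multiplicative_convolution[OF multiplicative_times[OF multiplicative_times[OF moebius_multiplicative 1] 2] sigma_multiplicative[of "2 * k - 1"]]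
  show ?thesis unfolding cohen_sum_def[abs_def] by simp
qed

lemma divisor_sigma_prime_power: "prime p \<Longrightarrow> divisor_sigma m (p ^ \<phi>) = (\<Sum>i\<le>\<phi>. (p ^ m) ^ i)"
proof -
  assume p: "prime p"
  have "divisor_sigma m (p ^ \<phi>) = (\<Sum>t\<in>(\<lambda>i. p ^ i) ` {..\<phi>}. t ^ m)"
    unfolding divisor_sigma_def by (intro sum.cong) (auto simp: divides_primepow_nat[OF p])
  also have "\<dots> = (\<Sum>i\<le>\<phi>. (p ^ i) ^ m)"
    using prime_gt_1_nat[OF p] by (subst sum.reindex) (auto simp: inj_on_def power_inject_exp)
  finally show ?thesis by (simp add: power_mult[symmetric] mult.commute)
qed

text \<open>The Moebius function leaves only \<open>r = 1\<close> and \<open>r = p\<close>; the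
  divisor sums are rewritten as geometric sums in \<open>1 / p^(2k-1)\<close>.\<close>

lemma cohen_sum_prime_power:
  assumes S: "disc_set S" and p: "prime p" and k: "k \<ge> 2"
  shows "cohen_sum (\<Prod>S) k (p ^ \<phi>) = (real p ^ \<phi>) ^ (2 * k - 1) * Tfac (int p) (kronecker_prime (\<Prod>S) (int p)) \<phi> (1 / real p ^ k)"
proof -
  define c where "c = kronecker_prime (\<Prod>S) (int p)"
  define P where "P = real p"
  have P0: "P > 0" using prime_gt_0_nat[OF p] by (simp add: P_def)
  have kc: "kronecker (\<Prod>S) (int p) = c" unfolding c_def using kronecker_prime_eq[of "int p"] p by simp
  obtain j where j: "k = j + 2" using k by (metis le_add_diff_inverse2)
  define M where "M = 2 * k - 1"
  have M: "M = 2 * j + 3" using j by (simp add: M_def)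
  have z: "of_int (int p) * (1 / real p ^ k)\<^sup>2 = 1 / P ^ M"
    using P0 by (simp add: P_def[symmetric] M j power2_eq_square power_add field_simps eval_nat_numeral)
  have sig: "real (divisor_sigma M (p ^ \<psi>)) = (P ^ \<psi>) ^ M * (\<Sum>i\<le>\<psi>. (1 / P ^ M) ^ i)" for \<psi>
  proof -
    have "real (divisor_sigma M (p ^ \<psi>)) = (\<Sum>i\<le>\<psi>. (P ^ M) ^ i)"
      by (simp add: divisor_sigma_prime_power[OF p] P_def)
    also have "\<dots> = (\<Sum>i\<le>\<psi>. (P ^ M) ^ (\<psi> - i))"
      by (rule sum.reindex_bij_witness[of _ "\<lambda>i. \<psi> - i" "\<lambda>i. \<psi> - i"]) auto
    also have "\<dots> = (\<Sum>i\<le>\<psi>. (P ^ \<psi>) ^ M * (1 / P ^ M) ^ i)"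
    proof (intro sum.cong refl)
      fix i assume "i \<in> {..\<psi>}"
      hence "(P ^ M) ^ (\<psi> - i) = (P ^ M) ^ \<psi> / (P ^ M) ^ i" using P0 by (intro power_diff) auto
      also have "(P ^ M) ^ \<psi> = (P ^ \<psi>) ^ M" by (simp add: power_mult[symmetric] mult.commute)
      finally show "(P ^ M) ^ (\<psi> - i) = (P ^ \<psi>) ^ M * (1 / P ^ M) ^ i" by (simp add: power_one_over)
    qed
    finally show ?thesis by (simp add: sum_distrib_left)
  qed
  show ?thesis
  proof (cases \<phi>)
    case 0
    have "{r::nat. r dvd 1} = {1}" by auto
    thus ?thesis using 0 by (simp add: cohen_sum_def moebius_mu_def divisor_sigma_def kronecker_fund_one[OF S])
  next
    case (Suc \<psi>)
    define g where "g r = of_int (moebius_mu r * kronecker (\<Prod>S) (int r)) * real (r ^ (k - 1)) *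
      real (divisor_sigma M (p ^ \<phi> div r))" for r
    have "cohen_sum (\<Prod>S) k (p ^ \<phi>) = (\<Sum>r | r dvd p ^ \<phi>. g r)" by (simp add: cohen_sum_def g_def M_def)
    also have "{r. r dvd p ^ \<phi>} = (\<lambda>i. p ^ i) ` {..\<phi>}" by (auto simp: divides_primepow_nat[OF p])
    also have "(\<Sum>r\<in>(\<lambda>i. p ^ i) ` {..\<phi>}. g r) = (\<Sum>i\<le>\<phi>. g (p ^ i))"
      using prime_gt_1_nat[OF p] by (subst sum.reindex) (auto simp: inj_on_def power_inject_exp)
    also have "\<dots> = (\<Sum>i\<in>{0, 1}. g (p ^ i))"
    proof (rule sum.mono_neutral_right)
      show "\<forall>i\<in>{..\<phi>} - {0, 1}. g (p ^ i) = 0"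
      proof
        fix i assume "i \<in> {..\<phi>} - {0, 1}"
        hence i: "i \<ge> 2" by auto
        have "\<not> squarefree (p ^ i)" using squarefree_power_iff[of p i] i p by (auto simp: prime_nat_iff)
        thus "g (p ^ i) = 0" by (simp add: g_def moebius_mu_def)
      qed
    qed (use Suc in auto)
    also have "\<dots> = g 1 + g p" by simp
    also have "g 1 = real (divisor_sigma M (p ^ \<phi>))" by (simp add: g_def moebius_mu_def kronecker_fund_one[OF S])
    also have "g p = - (of_int c * P ^ (k - 1) * real (divisor_sigma M (p ^ \<psi>)))"
    proof -
      have "moebius_mu p = -1" using p by (simp add: moebius_mu_def squarefree_prime prime_prime_factors)
      moreover have "p ^ \<phi> div p = p ^ \<psi>" using Suc prime_gt_0_nat[OF p] by simp
      ultimately show ?thesis by (simp add: g_def kc P_def)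
    qed
    also have "real (divisor_sigma M (p ^ \<phi>)) + - (of_int c * P ^ (k - 1) * real (divisor_sigma M (p ^ \<psi>))) =
      (P ^ \<phi>) ^ M * ((\<Sum>i\<le>\<phi>. (1 / P ^ M) ^ i) - of_int c * (1 / P ^ k) * (\<Sum>i\<le>\<psi>. (1 / P ^ M) ^ i))"
    proof -
      \<comment> \<open>Compares exponents: with \<open>\<phi> = \<psi> + 1\<close> one has
        \<open>(k - 1) + \<psi> (2k - 1) = \<phi> (2k - 1) - k\<close>.\<close>
      have K: "P ^ (k - 1) * (P ^ \<psi>) ^ M = (P ^ \<phi>) ^ M * (1 / P ^ k)"
      proof -
        have "P ^ k * (P ^ (k - 1) * (P ^ \<psi>) ^ M) = (P ^ \<phi>) ^ M"
          unfolding Suc M j by (simp add: power_add[symmetric] power_mult[symmetric] algebra_simps) (simp add: power_add power3_eq_cube)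
        thus ?thesis using P0 by (simp add: field_simps)
      qed
      define SS SF where "SS = (\<Sum>i\<le>\<psi>. (1 / P ^ M) ^ i)" and "SF = (\<Sum>i\<le>\<phi>. (1 / P ^ M) ^ i)"
      have "of_int c * P ^ (k - 1) * ((P ^ \<psi>) ^ M * SS) = of_int c * (P ^ (k - 1) * (P ^ \<psi>) ^ M) * SS"
        by (simp only: mult_ac)
      also have "\<dots> = (P ^ \<phi>) ^ M * (of_int c * (1 / P ^ k) * SS)" unfolding K by (simp only: mult_ac)
      finally show ?thesis unfolding sig SS_def[symmetric] SF_def[symmetric]
        by (simp only: right_diff_distrib diff_conv_add_uminus[symmetric])
    qed
    finally show ?thesis unfolding Tfac_def z c_def[symmetric] by (simp add: P_def M_def Suc lessThan_Suc_atMost)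
  qed
qed

lemma efac_eq:
  assumes "kd = 1 \<or> kd = 0 \<or> kd = -1" "\<bar>X\<bar> < 1"
  shows "efac p kd k0 \<phi> X * (1 / (1 - X\<^sup>2)) = (1 / (1 - of_int kd * X)) * (1 / (1 - of_int k0 * X)) * Tfac p k0 \<phi> X"
proof -
  have "X\<^sup>2 < 1" using assms(2) by (simp add: abs_square_less_1)
  thus ?thesis by (simp add: efac_def)
qed

definition wreal :: "int set \<Rightarrow> int \<Rightarrow> nat \<Rightarrow> nat \<Rightarrow> real" where
  "wreal S D k a = of_int (wsum S (\<Prod>S * D) (int a)) / real a ^ k"

lemma wreal_multiplicative: "disc_set S \<Longrightarrow> disc4 D \<Longrightarrow> multiplicative (wreal S D k)"
  using wsum_1[of S] wsum_mult[of S D] by (simp add: multiplicative_def wreal_def power_mult_distrib)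

lemma wreal_local:
  assumes S: "disc_set S" and D0: "min_disc D0" and f: "f > 0" and p: "prime p" and k: "k \<ge> 2"
  shows "(\<lambda>\<nu>. wreal S (D0 * (int f)\<^sup>2) k (p ^ \<nu>)) sums
    efac (int p) (kronecker_prime (\<Prod>S) (int p)) (kronecker_prime D0 (int p)) (multiplicity p f) (1 / real p ^ k)"
proof -
  obtain u where u: "f = p ^ multiplicity p f * u" "\<not> p dvd u"
    using multiplicity_decompose'[of f p] f p by (metis not_prime_unit less_not_refl)
  have u': "int f = int p ^ multiplicity p f * int u" using u(1) by (metis of_nat_mult of_nat_power)
  have "\<bar>1 / real p ^ k\<bar> < 1" using prime_power_ge_2[OF p k] by simp
  from local_factor[OF S _ D0 u' _ this]
  have "(\<lambda>\<nu>. of_int (wsum S (\<Prod>S * (D0 * (int f)\<^sup>2)) (int p ^ \<nu>)) * (1 / real p ^ k) ^ \<nu>) sums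
    efac (int p) (kronecker_prime (\<Prod>S) (int p)) (kronecker_prime D0 (int p)) (multiplicity p f) (1 / real p ^ k)"
    using p u(2) by simp
  moreover have "real (p ^ \<nu>) ^ k = (real p ^ k) ^ \<nu>" for \<nu> by (simp add: power_mult[symmetric] mult.commute)
  ultimately show ?thesis by (simp add: wreal_def power_inverse divide_inverse)
qed

lemma wsum_abs_le: "disc_set S \<Longrightarrow> \<bar>wsum S D a\<bar> \<le> wsum {} D a"
proof -
  assume S: "disc_set S"
  have "\<bar>wt S D a x\<bar> \<le> wt {} D a x" for x
  proof -
    have "\<bar>\<Prod>q\<in>S. if base_prime q dvd a then psi q (qpol D x div a) else psi q a\<bar> \<le> 1"
      unfolding abs_prod by (intro prod_le_1) (auto simp: psi_abs_le)
    thus ?thesis by (simp add: wt_def)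
  qed
  thus ?thesis unfolding wsum_def by (intro order.trans[OF sum_abs] sum_mono)
qed

lemma disc_set_empty: "disc_set {}" by (simp add: disc_set_def)

text \<open>The weights are at most 1 in absolute value, so absolute convergence is settled for
  \<open>S = {}\<close> at the same full discriminant. Its finite Euler products are bounded by the
  square of \<open>\<zeta>(k)\<close> times a finite product over the primes of
  \<open>f\<close>.\<close>

lemma wreal_summable_one:
  assumes D0: "min_disc D0" and f: "f > 0" and k: "k \<ge> 2"
  shows "wreal {} (D0 * (int f)\<^sup>2) k summable_on {0<..}"
proof -
  define v where "v p = multiplicity p f" for p
  define e where "e p = efac (int p) 1 (kronecker_prime D0 (int p)) (v p) (1 / real p ^ k)" for p
  define z where "z p = 1 / (1 - 1 / real p ^ k)" for p
  define T where "T p = Tfac (int p) (kronecker_prime D0 (int p)) (v p) (1 / real p ^ k)" for p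
  define Z where "Z = infsum (\<lambda>n. 1 / real n ^ k) {0<..}"
  have d4: "disc4 (D0 * (int f)\<^sup>2)" using D0 by (intro disc4_mult disc4_square) (simp add: min_disc_def)
  have k1: "kronecker_prime 1 (int p) = 1" if "prime p" for p
    using kronecker_prime_eq[of "int p" 1] that kronecker_1 by simp
  have loc: "(\<lambda>\<nu>. wreal {} (D0 * (int f)\<^sup>2) k (p ^ \<nu>)) sums e p" if "prime p" for p
    using wreal_local[OF disc_set_empty D0 f that k] k1[OF that] by (simp add: e_def v_def)
  have nn: "wreal {} D k a \<ge> 0" for D a
    by (auto simp: wreal_def wsum_def wt_def intro!: divide_nonneg_nonneg sum_nonneg)
  have e0: "e p \<ge> 0" if "prime p" for p
    using sums_le[OF _ sums_zero loc[OF that]] nn by auto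
  have X: "0 < 1 / real p ^ k" "1 / real p ^ k \<le> 1 / 4" if "prime p" for p
    using prime_power_ge_2[OF that k] prime_gt_0_nat[OF that] by auto
  have z1: "z p \<ge> 1" if "prime p" for p using X[OF that] by (simp add: z_def)
  text \<open>Away from the primes dividing \<open>f\<close> the local factor is dominated by that of the square of zeta.\<close>
  have ez: "e p \<le> z p * z p" if p: "prime p" "\<not> p dvd f" for p
  proof -
    define x where "x = 1 / real p ^ k"
    define c where "c = real_of_int (kronecker_prime D0 (int p))"
    have x: "0 < x" "x \<le> 1/4" using X[OF p(1)] by (auto simp: x_def)
    have c: "c \<le> 1" "-1 \<le> c" using kronecker_prime_values[of D0 "int p"] by (auto simp: c_def)
    have cx: "c * x \<le> x" using c x mult_right_mono[of c 1 x] by simp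
    have ep: "e p = (1 - x\<^sup>2) / ((1 - x) * (1 - c * x))"
      using p(2) by (simp add: e_def efac_def v_def not_dvd_imp_multiplicity_0 x_def c_def)
    have zp: "z p * z p = 1 / ((1 - x) * (1 - x))" by (simp add: z_def x_def)
    have "(1 - x\<^sup>2) / ((1 - x) * (1 - c * x)) \<le> 1 / ((1 - x) * (1 - x))"
      using x cx by (intro frac_le mult_left_mono mult_pos_pos) auto
    thus ?thesis by (simp only: ep zp)
  qed
  have zs: "(\<Prod>p\<in>P. z p) \<le> Z" if P: "finite P" "\<And>p. p \<in> P \<Longrightarrow> prime p" for P
  proof -
    have zl: "(\<lambda>\<nu>. 1 / real (p ^ \<nu>) ^ k) sums z p" if "prime p" for p
      using L_local[OF disc_set_empty that k] k1[OF that] by (simp add: kronecker_1 z_def)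
    have hs: "((\<lambda>n. 1 / real n ^ k) has_sum (\<Prod>p\<in>P. z p)) (smooth P)"
    proof (rule has_sum_smooth[OF _ zl _ P])
      show "multiplicative (\<lambda>n. 1 / real n ^ k)" using L_multiplicative[OF disc_set_empty, of k] by (simp add: kronecker_1)
      show "summable (\<lambda>\<nu>. \<bar>1 / real (p ^ \<nu>) ^ k\<bar>)" if "prime p" for p using zl[OF that] by (simp add: sums_iff)
    qed
    have "(\<Prod>p\<in>P. z p) = infsum (\<lambda>n. 1 / real n ^ k) (smooth P)" using infsumI[OF hs] by simp
    also have "\<dots> \<le> Z" unfolding Z_def
      by (rule infsum_mono_neutral) (use hs summable_zeta[OF k] in \<open>auto intro: has_sum_imp_summable simp: smooth_def\<close>)
    finally show ?thesis .
  qed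
  define Q where "Q = prime_factors f"
  have Q: "finite Q" "\<And>p. p \<in> Q \<Longrightarrow> prime p" by (auto simp: Q_def)
  define C where "C = (\<Prod>p\<in>Q. max 1 (e p)) * (Z * Z)"
  show ?thesis
  proof (rule multiplicative_summable[OF wreal_multiplicative[OF disc_set_empty d4] nn loc])
    fix P :: "nat set" assume P: "finite P" "\<And>p. p \<in> P \<Longrightarrow> prime p"
    have "(\<Prod>p\<in>P. e p) = (\<Prod>p\<in>P \<inter> Q. e p) * (\<Prod>p\<in>P - Q. e p)"
      using prod.Int_Diff[OF P(1)] by blast
    also have "\<dots> \<le> (\<Prod>p\<in>Q. max 1 (e p)) * (Z * Z)"
    proof (rule mult_mono)
      have "(\<Prod>p\<in>P \<inter> Q. e p) \<le> (\<Prod>p\<in>P \<inter> Q. max 1 (e p))" using P e0 by (intro prod_mono) auto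
      also have "\<dots> \<le> (\<Prod>p\<in>Q. max 1 (e p))" using Q by (intro prod_mono2) auto
      finally show "(\<Prod>p\<in>P \<inter> Q. e p) \<le> (\<Prod>p\<in>Q. max 1 (e p))" .
      have "(\<Prod>p\<in>P - Q. e p) \<le> (\<Prod>p\<in>P - Q. z p * z p)"
        using P e0 ez f by (intro prod_mono) (auto simp: Q_def prime_factors_dvd)
      also have "\<dots> = (\<Prod>p\<in>P - Q. z p) * (\<Prod>p\<in>P - Q. z p)" by (rule prod.distrib)
      also have "\<dots> \<le> Z * Z"
      proof -
        have zb: "(\<Prod>p\<in>P - Q. z p) \<le> Z" using P by (intro zs) auto
        have z0: "(\<Prod>p\<in>P - Q. z p) \<ge> 0"
        proof (rule prod_nonneg)
          fix p assume "p \<in> P - Q"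
          thus "z p \<ge> 0" using z1[of p] P by force
        qed
        show ?thesis using zb z0 by (intro mult_mono) auto
      qed
      finally show "(\<Prod>p\<in>P - Q. e p) \<le> Z * Z" .
      show "(\<Prod>p\<in>Q. max 1 (e p)) \<ge> 0" by (intro prod_nonneg) auto
      show "(\<Prod>p\<in>P - Q. e p) \<ge> 0" using P e0 by (intro prod_nonneg) auto
    qed
    finally show "(\<Prod>p\<in>P. e p) \<le> C" by (simp add: C_def)
  qed
qed

lemma wreal_abs_summable:
  assumes S: "disc_set S" and D0: "min_disc D0" and f: "f > 0" and k: "k \<ge> 2"
    and D': "\<Prod>S * D = D0 * (int f)\<^sup>2"
  shows "wreal S D k abs_summable_on {0<..}"
proof (rule summable_on_comparison_test[OF wreal_summable_one[OF D0 f k]])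
  fix a :: nat
  have "real_of_int \<bar>wsum S (\<Prod>S * D) (int a)\<bar> \<le> real_of_int (wsum {} (\<Prod>S * D) (int a))"
    using wsum_abs_le[OF S] by (subst of_int_le_iff)
  thus "norm (wreal S D k a) \<le> wreal {} (D0 * (int f)\<^sup>2) k a"
    by (simp add: wreal_def D' divide_right_mono)
qed auto

text \<open>Two decompositions enter: the one of \<open>D\<close> supplies the local factors, the
  one of the full discriminant as \<open>D1 g^2\<close> supplies absolute convergence. After
  multiplication by \<open>\<zeta>(2k)\<close> both sides are limits of the same finite products,
  compared prime by prime.\<close>

theorem dirichlet_identity:
  assumes S: "disc_set S" and S0: "disc_set S0" and D0: "min_disc (\<Prod>S0)" and f: "f > 0" and k: "k \<ge> 2"
    and D1: "min_disc D1" and g: "g > 0" and D': "\<Prod>S * (\<Prod>S0 * (int f)\<^sup>2) = D1 * (int g)\<^sup>2"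
  shows "infsum (wreal S (\<Prod>S0 * (int f)\<^sup>2) k) {0<..} * Lreal 1 (2 * k) =
    Lreal (\<Prod>S) k * Lreal (\<Prod>S0) k * (cohen_sum (\<Prod>S0) k f / real f ^ (2 * k - 1))"
proof -
  define D where "D = \<Prod>S0 * (int f)\<^sup>2"
  define kd where "kd p = kronecker_prime (\<Prod>S) (int p)" for p
  define k0 where "k0 p = kronecker_prime (\<Prod>S0) (int p)" for p
  define v where "v p = multiplicity p f" for p
  define X where "X p = 1 / real p ^ k" for p
  have d4: "disc4 D" using D0 unfolding D_def by (intro disc4_mult disc4_square) (simp add: min_disc_def)
  have A: "(\<lambda>x. \<Prod>p\<in>primes_upto x. efac (int p) (kd p) (k0 p) (v p) (X p)) \<longlonglongrightarrow> infsum (wreal S D k) {0<..}"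
  proof (rule euler_product[OF wreal_multiplicative[OF S d4]])
    show "wreal S D k abs_summable_on {0<..}"
      unfolding D_def by (rule wreal_abs_summable[OF S D1 g k D'])
    show "(\<lambda>\<nu>. wreal S D k (p ^ \<nu>)) sums efac (int p) (kd p) (k0 p) (v p) (X p)" if "prime p" for p
      unfolding D_def kd_def k0_def v_def X_def by (rule wreal_local[OF S D0 f that k])
  qed
  have L: "(\<lambda>x. \<Prod>p\<in>primes_upto x. 1 / (1 - of_int (kronecker_prime (\<Prod>T) (int p)) * (1 / real p ^ m))) \<longlonglongrightarrow> Lreal (\<Prod>T) m"
    if T: "disc_set T" "m \<ge> 2" for T m
    unfolding Lreal_def
    by (rule euler_product[OF L_multiplicative[OF T(1)] L_abs_summable[OF T]]) (rule L_local[OF T(1) _ T(2)])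
  have Zt: "(\<lambda>x. \<Prod>p\<in>primes_upto x. 1 / (1 - (X p)\<^sup>2)) \<longlonglongrightarrow> Lreal 1 (2 * k)"
  proof -
    have "(\<Prod>p\<in>primes_upto x. 1 / (1 - of_int (kronecker_prime (\<Prod>{}) (int p)) * (1 / real p ^ (2 * k)))) = (\<Prod>p\<in>primes_upto x. 1 / (1 - (X p)\<^sup>2))" for x
    proof (intro prod.cong refl)
      fix p assume "p \<in> primes_upto x"
      hence "prime p" by (simp add: primes_upto_def)
      hence "kronecker_prime 1 (int p) = 1" using kronecker_prime_eq[of "int p" 1] kronecker_1 by simp
      moreover have "1 / real p ^ (2 * k) = (X p)\<^sup>2" by (simp add: X_def power_one_over power_even_eq)
      ultimately show "1 / (1 - of_int (kronecker_prime (\<Prod>{}) (int p)) * (1 / real p ^ (2 * k))) = 1 / (1 - (X p)\<^sup>2)" by simp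
    qed
    thus ?thesis using L[OF disc_set_empty, of "2 * k"] k by simp
  qed
  have lhs: "(\<lambda>x. (\<Prod>p\<in>primes_upto x. efac (int p) (kd p) (k0 p) (v p) (X p)) * (\<Prod>p\<in>primes_upto x. 1 / (1 - (X p)\<^sup>2)))
     \<longlonglongrightarrow> infsum (wreal S D k) {0<..} * Lreal 1 (2 * k)"
    by (rule tendsto_mult[OF A Zt])
  define t where "t = cohen_sum (\<Prod>S0) k f / real f ^ (2 * k - 1)"
  have T: "(\<Prod>p\<in>primes_upto x. Tfac (int p) (k0 p) (v p) (X p)) = t" if "x \<ge> f" for x
  proof -
    have "cohen_sum (\<Prod>S0) k f = (\<Prod>p\<in>primes_upto x. cohen_sum (\<Prod>S0) k (p ^ v p))"
      unfolding v_def by (rule multiplicative_eq_prod[OF cohen_sum_multiplicative[OF S0] f that])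
    also have "\<dots> = (\<Prod>p\<in>primes_upto x. (real p ^ v p) ^ (2 * k - 1) * Tfac (int p) (k0 p) (v p) (X p))"
      unfolding k0_def X_def by (intro prod.cong refl cohen_sum_prime_power[OF S0 _ k]) (simp add: primes_upto_def)
    also have "\<dots> = (\<Prod>p\<in>primes_upto x. (real p ^ v p) ^ (2 * k - 1)) * (\<Prod>p\<in>primes_upto x. Tfac (int p) (k0 p) (v p) (X p))"
      by (rule prod.distrib)
    also have "(\<Prod>p\<in>primes_upto x. (real p ^ v p) ^ (2 * k - 1)) = real f ^ (2 * k - 1)"
    proof -
      have "multiplicative (\<lambda>n. real n ^ (2 * k - 1))" by (simp add: multiplicative_def power_mult_distrib)
      from multiplicative_eq_prod[OF this f that] show ?thesis by (simp add: v_def)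
    qed
    finally show ?thesis using f by (simp add: t_def)
  qed
  have Tl: "(\<lambda>x. \<Prod>p\<in>primes_upto x. Tfac (int p) (k0 p) (v p) (X p)) \<longlonglongrightarrow> t"
    by (rule tendsto_eventually) (use T in \<open>auto simp: eventually_sequentially\<close>)
  have rhs: "(\<lambda>x. (\<Prod>p\<in>primes_upto x. 1 / (1 - of_int (kd p) * X p)) * (\<Prod>p\<in>primes_upto x. 1 / (1 - of_int (k0 p) * X p))
      * (\<Prod>p\<in>primes_upto x. Tfac (int p) (k0 p) (v p) (X p))) \<longlonglongrightarrow> Lreal (\<Prod>S) k * Lreal (\<Prod>S0) k * t"
    unfolding kd_def k0_def X_def by (intro tendsto_mult L[OF S k] L[OF S0 k] Tl[unfolded k0_def X_def])
  have eq: "(\<Prod>p\<in>primes_upto x. efac (int p) (kd p) (k0 p) (v p) (X p)) * (\<Prod>p\<in>primes_upto x. 1 / (1 - (X p)\<^sup>2)) =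
     (\<Prod>p\<in>primes_upto x. 1 / (1 - of_int (kd p) * X p)) * (\<Prod>p\<in>primes_upto x. 1 / (1 - of_int (k0 p) * X p))
      * (\<Prod>p\<in>primes_upto x. Tfac (int p) (k0 p) (v p) (X p))" for x
    unfolding prod.distrib[symmetric]
  proof (intro prod.cong refl efac_eq)
    fix p assume "p \<in> primes_upto x"
    hence p: "prime p" by (simp add: primes_upto_def)
    show "kd p = 1 \<or> kd p = 0 \<or> kd p = -1" unfolding kd_def by (rule kronecker_prime_values)
    show "\<bar>X p\<bar> < 1" using prime_power_ge_2[OF p k] by (simp add: X_def)
  qed
  show ?thesis using LIMSEQ_unique[OF lhs[unfolded eq] rhs] by (simp add: D_def t_def)
qed

section \<open>Fundamental discriminants\<close>

text \<open>For even \<open>D\<close> the residue of \<open>D / 4\<close> modulo 8 decides which of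
  \<open>-4\<close>, \<open>8\<close>, \<open>-8\<close> splits off; for odd \<open>D\<close> any
  prime divisor does, with the sign that makes it 1 modulo 4. The cofactor is again a discriminant
  and inherits minimality.\<close>

lemma min_disc_peel:
  assumes D: "min_disc D" "D \<noteq> 1"
  shows "\<exists>q E. prime_disc q \<and> D = q * E \<and> min_disc E \<and> \<not> base_prime q dvd E"
proof -
  have D0: "D \<noteq> 0" and d4: "disc4 D" and pm: "\<And>p. prime p \<Longrightarrow> pmin p D" using D by (auto simp: min_disc_def)
  have main: "min_disc E" if "prime_disc q" "D = q * E" "disc4 E" for q E
    unfolding min_disc_def
  proof (intro conjI allI impI)
    fix p :: int assume p: "prime p"
    show "pmin p E" unfolding pmin_def
    proof (intro conjI allI impI notI)
      fix B assume "E = p\<^sup>2 * B" "disc4 B"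
      hence "D = p\<^sup>2 * (q * B)" "disc4 (q * B)" using that by (auto intro: disc4_mult prime_disc_disc4)
      thus False using pm[OF p] by (simp add: pmin_def)
    qed fact
  qed (use that D0 in auto)
  show ?thesis
  proof (cases "even D")
    case True
    hence "D mod 4 = 0" using d4 unfolding disc4_def by presburger
    then obtain m where m: "D = 4 * m" by (auto elim: dvdE)
    have "\<not> disc4 m" using pm[of 2] m by (simp add: pmin_def)
    moreover have "m mod 8 mod 4 = m mod 4" by (rule mod_mod_cancel) simp
    moreover have "m mod 8 \<in> {0, 1, 2, 3, 4, 5, 6, 7}" by auto
    ultimately have "m mod 4 = 3 \<or> m mod 8 = 2 \<or> m mod 8 = 6" unfolding disc4_def by auto
    thus ?thesis
    proof (elim disjE)
      assume a: "m mod 4 = 3"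
      hence "disc4 (- m)" "odd (- m)" unfolding disc4_def by presburger+
      thus ?thesis using main[of "-4" "- m"] m by (intro exI[of _ "-4"] exI[of _ "- m"]) (auto simp: prime_disc_def base_prime_def)
    next
      assume a: "m mod 8 = 2"
      hence "m = 2 * (m div 2)" "disc4 (m div 2)" "odd (m div 2)" unfolding disc4_def by presburger+
      thus ?thesis using main[of 8 "m div 2"] m by (intro exI[of _ 8] exI[of _ "m div 2"]) (auto simp: prime_disc_def base_prime_def)
    next
      assume a: "m mod 8 = 6"
      hence "m = 2 * (m div 2)" "disc4 (- (m div 2))" "odd (m div 2)" unfolding disc4_def by presburger+
      thus ?thesis using main[of "-8" "- (m div 2)"] m by (intro exI[of _ "-8"] exI[of _ "- (m div 2)"]) (auto simp: prime_disc_def base_prime_def)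
    qed
  next
    case False
    have "\<not> is_unit D"
    proof
      assume "is_unit D"
      hence "D = 1 \<or> D = -1" by (simp add: abs_if split: if_splits)
      thus False using D(2) d4 by (auto simp: disc4_def)
    qed
    then obtain p where p: "prime p" "p dvd D" using prime_divisor_exists D0 by blast
    have op: "odd p" using p False dvd_trans by blast
    define q where "q = (if p mod 4 = 1 then p else - p)"
    have p4: "p mod 4 = 1 \<or> p mod 4 = 3" using op by presburger
    have q4: "q mod 4 = 1"
    proof (cases "p mod 4 = 1")
      case False
      hence "(- p) mod 4 = 1" using p4 by presburger
      thus ?thesis using False by (simp add: q_def)
    qed (simp add: q_def)
    have aq: "\<bar>q\<bar> = p" using prime_gt_0_int[OF p(1)] by (auto simp: q_def)
    have q: "prime_disc q" "odd q" using q4 aq p(1) op by (auto simp: prime_disc_def)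
    have "q dvd D" using p aq by (metis abs_dvd_iff)
    then obtain E where E: "D = q * E" by (elim dvdE)
    have "odd E" using False E by simp
    moreover have "(q * E) mod 4 = E mod 4" using q4 by (metis mod_mult_left_eq mult_1)
    ultimately have "disc4 E" using d4 E by (simp add: disc4_def)
    moreover have "\<not> base_prime q dvd E"
    proof
      assume "base_prime q dvd E"
      hence "p dvd E" using q aq by (simp add: base_prime_def)
      hence "p * p dvd q * E" using aq by (intro mult_dvd_mono) (auto simp: q_def)
      thus False using pmin_odd[OF op pm[OF p(1)]] E by (simp add: power2_eq_square)
    qed
    ultimately show ?thesis using main[OF q(1) E] q E by blast
  qed
qed

lemma min_disc_disc_set:
  assumes "min_disc D" shows "\<exists>S. disc_set S \<and> \<Prod>S = D"
  using assms
proof (induction "nat \<bar>D\<bar>" arbitrary: D rule: less_induct)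
  case less
  show ?case
  proof (cases "D = 1")
    case True thus ?thesis using disc_set_empty by (intro exI[of _ "{}"]) simp
  next
    case False
    then obtain q E where q: "prime_disc q" "D = q * E" "min_disc E" "\<not> base_prime q dvd E"
      using min_disc_peel[OF less.prems] by blast
    have E0: "E \<noteq> 0" using q by (simp add: min_disc_def)
    have "\<bar>E\<bar> * 1 < \<bar>E\<bar> * \<bar>q\<bar>" using prime_disc_abs_gt[OF q(1)] E0 by (intro mult_strict_left_mono) auto
    hence "nat \<bar>E\<bar> < nat \<bar>D\<bar>" unfolding q(2) abs_mult by (simp add: mult.commute)
    from less.hyps[OF this q(3)] obtain S where S: "disc_set S" "\<Prod>S = E" by blast
    have ne: "base_prime q \<noteq> base_prime r" if "r \<in> S" for r
    proof -
      have "r dvd E" unfolding S(2)[symmetric] using S(1) that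
        by (intro dvd_prodI[of S r "\<lambda>x. x"]) (auto simp: disc_set_def)
      hence "base_prime r dvd E" using base_prime_dvd[of r] S(1) that by (auto simp: disc_set_def intro: dvd_trans)
      thus ?thesis using q(4) by auto
    qed
    have "disc_set (insert q S)" using S(1) q(1) ne ne[symmetric] by (auto simp: disc_set_def inj_on_def)
    moreover have "q \<notin> S" using ne by blast
    hence "\<Prod>(insert q S) = D" using S q(2) by (simp add: disc_set_def)
    ultimately show ?thesis by blast
  qed
qed

lemma min_disc_decomp_exists:
  assumes "disc4 D" "D \<noteq> 0" shows "\<exists>D0 f. min_disc D0 \<and> 1 \<le> f \<and> D = D0 * (int f)\<^sup>2"
  using assms
proof (induction "nat \<bar>D\<bar>" arbitrary: D rule: less_induct)
  case less
  show ?case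
  proof (cases "min_disc D")
    case True thus ?thesis by (intro exI[of _ D] exI[of _ 1]) simp
  next
    case False
    then obtain p B where p: "prime p" "D = p\<^sup>2 * B" "disc4 B" using less.prems by (auto simp: min_disc_def pmin_def)
    have B0: "B \<noteq> 0" using p less.prems by auto
    have p2: "p \<ge> 2" by (rule prime_ge_2_int[OF p(1)])
    have "\<bar>B\<bar> * 1 < \<bar>B\<bar> * p\<^sup>2" using p2 B0 one_less_power[of p 2] by (intro mult_strict_left_mono) auto
    hence "nat \<bar>B\<bar> < nat \<bar>D\<bar>" unfolding p(2) abs_mult by (simp add: mult.commute)
    from less.hyps[OF this p(3) B0] obtain D0 f where f: "min_disc D0" "1 \<le> f" "B = D0 * (int f)\<^sup>2" by blast
    have "D = D0 * (int (nat p * f))\<^sup>2" using p2 by (simp add: p(2) f(3) power_mult_distrib)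
    moreover have "1 \<le> nat p * f" using p2 f(2) by (simp add: Suc_le_eq)
    ultimately show ?thesis using f(1) by blast
  qed
qed

text \<open>A prime \<open>p\<close> dividing \<open>g\<close> but not \<open>f\<close> forces
  \<open>p^2\<close> to divide \<open>D0\<close>, and the quotient is still a discriminant, against
  minimality. Applied in both directions it gives uniqueness.\<close>

lemma min_disc_decomp_aux:
  assumes D0: "min_disc D0" and D1: "disc4 D1" and eq: "D0 * (int f)\<^sup>2 = D1 * (int g)\<^sup>2"
    and co: "coprime f g" and f: "f \<ge> 1" and g: "g \<ge> 1"
  shows "g = 1"
proof (rule ccontr)
  assume "g \<noteq> 1"
  then obtain p where p: "prime p" "p dvd g" using prime_factor_nat by blast
  have np: "\<not> p dvd f" using p co by (meson coprime_common_divisor not_prime_unit)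
  obtain h where h: "g = p * h" using p(2) by (elim dvdE)
  have pp: "prime (int p)" using p(1) by simp
  have npi: "\<not> int p dvd int f" using np by simp
  have "(int p)\<^sup>2 dvd D0 * (int f)\<^sup>2" unfolding eq h by (simp add: power_mult_distrib)
  moreover have "coprime ((int p)\<^sup>2) ((int f)\<^sup>2)"
    using prime_coprime_iff[OF pp] npi by (simp add: coprime_commute)
  ultimately have "(int p)\<^sup>2 dvd D0" by (simp add: coprime_dvd_mult_left_iff)
  then obtain C where C: "D0 = (int p)\<^sup>2 * C" by (elim dvdE)
  have "(int p)\<^sup>2 * (C * (int f)\<^sup>2) = (int p)\<^sup>2 * (D1 * (int h)\<^sup>2)"
    using eq unfolding C h by (simp add: power_mult_distrib mult_ac)
  hence Cf: "C * (int f)\<^sup>2 = D1 * (int h)\<^sup>2" using p(1) by auto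
  have "disc4 C"
  proof (cases "p = 2")
    case True
    hence "odd (int f)" using npi by simp
    hence "(int f)\<^sup>2 mod 4 = 1" by (simp add: square_mod_4)
    hence "(C * (int f)\<^sup>2) mod 4 = C mod 4" by (metis mod_mult_right_eq mult.right_neutral)
    moreover have "disc4 (C * (int f)\<^sup>2)" unfolding Cf by (intro disc4_mult D1 disc4_square)
    ultimately show ?thesis by (simp add: disc4_def)
  next
    case False
    hence "odd (int p)" using p(1) prime_odd_nat[of p] prime_ge_2_nat[of p] by simp
    thus ?thesis using disc4_div_odd_square[of "int p" C] D0 C by (auto simp: min_disc_def)
  qed
  moreover have "pmin (int p) D0" using D0 pp by (simp add: min_disc_def)
  ultimately show False using C by (auto simp: pmin_def)
qed

lemma min_disc_decomp_unique:
  assumes "min_disc D0" "min_disc D1" "D0 * (int f)\<^sup>2 = D1 * (int g)\<^sup>2" "f \<ge> 1" "g \<ge> 1"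
  shows "D0 = D1 \<and> f = g"
proof -
  define h where "h = gcd f g"
  have h0: "h > 0" using assms by (auto simp: h_def)
  obtain f' g' where fg: "f = f' * h" "g = g' * h" "coprime f' g'"
    using gcd_coprime_exists[of f g] h0 unfolding h_def by auto
  have "D0 * (int f')\<^sup>2 * (int h)\<^sup>2 = D1 * (int g')\<^sup>2 * (int h)\<^sup>2"
    using assms(3) unfolding fg by (simp add: power_mult_distrib mult_ac)
  hence e: "D0 * (int f')\<^sup>2 = D1 * (int g')\<^sup>2" using h0 by simp
  have pos: "f' \<ge> 1" "g' \<ge> 1" using assms(4,5) fg by (auto intro: Suc_leI Nat.gr0I)
  have "g' = 1" by (rule min_disc_decomp_aux[OF assms(1) _ e fg(3) pos]) (use assms(2) in \<open>simp add: min_disc_def\<close>)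
  moreover have "f' = 1"
    by (rule min_disc_decomp_aux[OF assms(2) _ e[symmetric] _ pos(2,1)]) (use assms(1) fg(3) in \<open>simp_all add: min_disc_def coprime_commute\<close>)
  ultimately show ?thesis using e fg by simp
qed

section \<open>Quadratic fields\<close>

lemma of_int_map_poly_mult: "map_poly of_int (p * q) = (map_poly of_int p * map_poly of_int q :: complex poly)"
  by (intro poly_eqI) (simp add: coeff_map_poly coeff_mult)

lemma of_int_map_poly_add: "map_poly of_int (p + q) = (map_poly of_int p + map_poly of_int q :: complex poly)"
  by (intro poly_eqI) (simp add: coeff_map_poly)

lemma of_int_map_poly_smult: "map_poly of_int (Polynomial.smult c p) = (Polynomial.smult (of_int c) (map_poly of_int p) :: complex poly)"
  by (intro poly_eqI) (simp add: coeff_map_poly)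

context
  fixes m :: int
  assumes m: "\<nexists>n. m = n\<^sup>2"
begin

lemma csqrt_square: "csqrt (of_int m) * csqrt (of_int m) = of_int m"
  using power2_csqrt[of "of_int m"] by (simp add: power2_eq_square)

lemma csqrt_irrational: "csqrt (of_int m) \<noteq> of_rat r"
proof
  assume e: "csqrt (of_int m) = of_rat r"
  hence "csqrt (of_int m) \<in> \<rat>" by simp
  moreover have "algebraic_int (csqrt (of_int m))" by (intro algebraic_int_csqrt int_imp_algebraic_int) simp
  ultimately have "csqrt (of_int m) \<in> \<int>" by (rule rational_algebraic_int_is_int[rotated])
  then obtain n where "csqrt (of_int m) = of_int n" by (elim Ints_cases)
  hence "(of_int m :: complex) = of_int (n\<^sup>2)" using csqrt_square by (simp add: power2_eq_square)
  thus False using m of_int_eq_iff by blast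
qed

lemma quad_elem_eq_0: "quad_elem m x y = 0 \<longleftrightarrow> x = 0 \<and> y = 0"
proof
  assume a: "quad_elem m x y = 0"
  have "y = 0"
  proof (rule ccontr)
    assume y: "y \<noteq> 0"
    have "csqrt (of_int m) = - of_rat x / of_rat y"
      using a y by (simp add: quad_elem_def field_simps add_eq_0_iff)
    also have "\<dots> = of_rat (- x / y)" by (simp add: of_rat_divide of_rat_minus)
    finally show False using csqrt_irrational by blast
  qed
  thus "x = 0 \<and> y = 0" using a by (simp add: quad_elem_def)
qed (simp add: quad_elem_def)

lemma quad_elem_diff: "quad_elem m x y - quad_elem m x' y' = quad_elem m (x - x') (y - y')"
  by (simp add: quad_elem_def of_rat_diff algebra_simps)

lemma quad_elem_eq_iff: "quad_elem m x y = quad_elem m x' y' \<longleftrightarrow> x = x' \<and> y = y'"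
  using quad_elem_eq_0[of "x - x'" "y - y'"] quad_elem_diff[of x y x' y'] by auto

lemma quad_elem_comb:
  "of_int u * quad_elem m x y + of_int v * quad_elem m x' y' = quad_elem m (of_int u * x + of_int v * x') (of_int u * y + of_int v * y')"
  by (simp add: quad_elem_def of_rat_add of_rat_mult algebra_simps)

lemma quad_elem_root:
  "(quad_elem m x y)\<^sup>2 - of_rat (2 * x) * quad_elem m x y + of_rat (x\<^sup>2 - of_int m * y\<^sup>2) = 0"
proof -
  define X Y s where "X = (of_rat x :: complex)" and "Y = (of_rat y :: complex)" and "s = csqrt (of_int m)"
  have "(X + Y * s)\<^sup>2 - 2 * X * (X + Y * s) + (X\<^sup>2 - s * s * Y\<^sup>2) = 0"
    by (simp add: power2_eq_square algebra_simps)
  thus ?thesis unfolding X_def Y_def s_def csqrt_square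
    by (simp add: quad_elem_def of_rat_mult of_rat_diff of_rat_power)
qed

text \<open>The direction from algebraic integrality is Gauss's lemma: the primitive integral
  quadratic polynomial \<open>G\<close> of \<open>z\<close> divides a monic integral polynomial
  within the integral polynomials, so its leading coefficient is 1. Trace and norm are then read off
  its coefficients.\<close>

lemma algebraic_int_quad_elem_iff:
  "algebraic_int (quad_elem m x y) \<longleftrightarrow> 2 * x \<in> \<int> \<and> x\<^sup>2 - of_int m * y\<^sup>2 \<in> \<int>"
proof
  define z where "z = quad_elem m x y"
  assume "2 * x \<in> \<int> \<and> x\<^sup>2 - of_int m * y\<^sup>2 \<in> \<int>"
  then obtain t n :: int where tn: "2 * x = of_int t" "x\<^sup>2 - of_int m * y\<^sup>2 = of_int n" by (auto elim!: Ints_cases)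
  have "poly [:of_int n, - of_int t, 1:] z = 0"
    using quad_elem_root[of x y] unfolding tn z_def[symmetric] by (simp add: power2_eq_square algebra_simps)
  moreover have "poly.coeff [:of_int n, - of_int t, 1 :: complex:] i \<in> \<int>" for i
    by (auto simp: coeff_pCons split: nat.splits)
  ultimately show "algebraic_int (quad_elem m x y)" unfolding z_def[symmetric]
    by (intro algebraic_int.intros[of "[:of_int n, - of_int t, 1:]"]) auto
next
  define z where "z = quad_elem m x y"
  assume alg: "algebraic_int (quad_elem m x y)"
  show "2 * x \<in> \<int> \<and> x\<^sup>2 - of_int m * y\<^sup>2 \<in> \<int>"
  proof (cases "y = 0")
    case True
    hence "quad_elem m x y = of_rat x" by (simp add: quad_elem_def)
    hence "(of_rat x :: complex) \<in> \<int>" using alg rational_algebraic_int_is_int[of "of_rat x :: complex"] by simp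
    then obtain n :: int where "(of_rat x :: complex) = of_int n" by (elim Ints_cases)
    hence "x = of_int n" by (metis of_rat_eq_iff of_rat_of_int_eq)
    thus ?thesis using True by simp
  next
    case False
    define N where "N = x\<^sup>2 - of_int m * y\<^sup>2"
    obtain a1 b1 where ab1: "2 * x = of_int a1 / of_int b1" "b1 > 0" by (metis Rat_cases_nonzero Rat_cases Fract_of_int_quotient)
    obtain a2 b2 where ab2: "N = of_int a2 / of_int b2" "b2 > 0" by (metis Rat_cases Fract_of_int_quotient)
    \<comment> \<open>Clearing denominators and dividing by \<open>g\<close> makes the quadratic
      polynomial of \<open>z\<close> primitive.\<close>
    define g where "g = gcd (gcd (b1 * b2) (a1 * b2)) (a2 * b1)"
    have g0: "g > 0" using ab1 ab2 by (auto simp: g_def)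
    define A B C where "A = (b1 * b2) div g" and "B = - ((a1 * b2) div g)" and "C = (a2 * b1) div g"
    have gA: "g * A = b1 * b2" "g * B = - (a1 * b2)" "g * C = a2 * b1"
    proof -
      have "g dvd b1 * b2" "g dvd a1 * b2" "g dvd a2 * b1" unfolding g_def by (blast intro: gcd_dvd1 gcd_dvd2 dvd_trans)+
      thus "g * A = b1 * b2" "g * B = - (a1 * b2)" "g * C = a2 * b1" by (simp_all add: A_def B_def C_def)
    qed
    have A0: "A > 0" using gA(1) ab1 ab2 g0 by (metis mult_pos_pos zero_less_mult_pos)
    have tB: "2 * x = - of_int B / of_int A" "N = of_int C / of_int A"
    proof -
      have g: "(of_int g * of_int A :: rat) = of_int b1 * of_int b2" "(of_int g * of_int B :: rat) = - (of_int a1 * of_int b2)"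
        "(of_int g * of_int C :: rat) = of_int a2 * of_int b1"
        using gA by (metis of_int_mult, metis of_int_mult of_int_minus, metis of_int_mult)
      have b: "2 * x * of_int b1 = of_int a1" "N * of_int b2 = of_int a2" using ab1 ab2 by simp_all
      have nz: "(of_int g :: rat) \<noteq> 0" "(of_int A :: rat) \<noteq> 0" using g0 A0 by simp_all
      have "of_int g * (2 * x * of_int A) = 2 * x * (of_int g * of_int A)" by (simp only: mult_ac)
      also have "\<dots> = (2 * x * of_int b1) * of_int b2" unfolding g by (simp only: mult_ac)
      also have "\<dots> = of_int g * (- of_int B)" unfolding b using g(2) by simp
      finally have "2 * x * of_int A = - of_int B" by (rule mult_left_cancel[OF nz(1), THEN iffD1])
      thus "2 * x = - of_int B / of_int A" using nz(2) by (metis nonzero_mult_div_cancel_right)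
      have "of_int g * (N * of_int A) = N * (of_int g * of_int A)" by (simp only: mult_ac)
      also have "\<dots> = (N * of_int b2) * of_int b1" unfolding g by (simp only: mult_ac)
      also have "\<dots> = of_int g * of_int C" unfolding b using g(3) by simp
      finally have "N * of_int A = of_int C" using nz by simp
      thus "N = of_int C / of_int A" using nz(2) by (metis nonzero_mult_div_cancel_right)
    qed
    define G where "G = [:C, B, A:]"
    have degG: "degree G = 2" using A0 by (simp add: G_def)
    have "gcd (gcd A B) C = 1"
    proof -
      have "g * gcd (gcd A B) C = g"
      proof -
        have "g * gcd (gcd A B) C = gcd (gcd (g * A) (g * B)) (g * C)"
          using g0 by (simp add: gcd_mult_left abs_mult)
        also have "\<dots> = g" unfolding gA by (simp add: g_def)
        finally show ?thesis .
      qed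
      thus ?thesis using g0 by simp
    qed
    hence contG: "content G = 1" using A0 by (simp add: G_def content_def coeffs_def cCons_def gcd.commute gcd.left_commute gcd.assoc)
    have Gz: "poly (map_poly of_int G) z = 0"
    proof -
      have "of_int A * (z\<^sup>2 - of_rat (2 * x) * z + of_rat N) = 0"
        using quad_elem_root[of x y] by (simp add: z_def N_def)
      hence "of_int A * (of_int A * z\<^sup>2 + of_int B * z + of_int C) = 0"
        unfolding tB using A0 by (simp add: of_rat_divide of_rat_minus field_simps)
      hence "of_int A * z\<^sup>2 + of_int B * z + of_int C = 0" using A0 by simp
      thus ?thesis by (simp add: G_def map_poly_pCons power2_eq_square algebra_simps)
    qed
    obtain f :: "int poly" where f: "poly (map_poly of_int f) z = 0" "lead_coeff f = 1"
      using alg unfolding algebraic_int_altdef_ipoly z_def by blast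
    obtain q r where qr: "pseudo_divmod f G = (q, r)" by (cases "pseudo_divmod f G")
    define K where "K = A ^ (Suc (degree f) - degree G)"
    have G0: "G \<noteq> 0" using A0 by (simp add: G_def)
    have lcG: "poly.coeff G (degree G) = A" unfolding degG by (simp add: G_def numeral_2_eq_2)
    have pd: "Polynomial.smult K f = G * q + r" "r = 0 \<or> degree r < degree G"
      using pseudo_divmod[OF G0 qr] unfolding K_def lcG by auto
    have "poly (map_poly of_int r) z = 0"
      using arg_cong[OF pd(1), of "\<lambda>p. poly (map_poly of_int p) z"] f(1) Gz
      by (simp add: of_int_map_poly_mult of_int_map_poly_add of_int_map_poly_smult)
    \<comment> \<open>The pseudo-remainder is at most linear, and a nonzero such polynomial over the
      integers cannot vanish at \<open>z\<close>, which is irrational since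
      \<open>y \<noteq> 0\<close>.\<close>
    have "r = 0"
    proof (rule ccontr)
      assume "r \<noteq> 0"
      hence "degree r \<le> 1" using pd(2) degG by simp
      hence rr: "r = [:poly.coeff r 0, poly.coeff r 1:]"
        by (intro poly_eqI) (auto simp: coeff_pCons coeff_eq_0 split: nat.splits)
      define c d where "c = poly.coeff r 0" and "d = poly.coeff r 1"
      have "poly (map_poly of_int [:c, d:]) z = 0" using \<open>poly (map_poly of_int r) z = 0\<close> rr by (simp add: c_def d_def)
      hence "of_int c + of_int d * z = 0" by (simp add: map_poly_pCons mult.commute)
      hence "quad_elem m (of_int c + of_int d * x) (of_int d * y) = 0"
        by (simp add: z_def quad_elem_def of_rat_add of_rat_mult algebra_simps)
      hence "d = 0" "c = 0" using quad_elem_eq_0 False by auto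
      thus False using rr \<open>r \<noteq> 0\<close> by (simp add: c_def d_def)
    qed
    hence fG: "Polynomial.smult K f = G * q" using pd by simp
    have K0: "K > 0" using A0 by (simp add: K_def)
    have contf: "content f = 1"
      using content_dvd_coeff[of f "degree f"] f(2) by (metis content_0 is_unit_content_iff normalize_content zero_neq_one is_unit_normalize)
    have "content q = K"
      using arg_cong[OF fG, of content] contG contf K0 by (simp add: content_mult)
    hence "Polynomial.smult K f = Polynomial.smult K (G * primitive_part q)"
      using fG content_times_primitive_part[of q] by (metis mult_smult_right)
    hence "f = G * primitive_part q" using K0 by (simp add: poly_eq_iff)
    hence "1 = A * lead_coeff (primitive_part q)" using f(2) lead_coeff_mult lcG by metis
    hence "A dvd 1" by (metis dvd_triv_left)
    hence "A = 1" using A0 by simp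
    thus ?thesis using tB unfolding N_def by simp
  qed
qed

end

lemma rat_square_int:
  fixes w :: rat
  assumes "squarefree m" "of_int m * w\<^sup>2 \<in> \<int>" shows "w \<in> \<int>"
proof -
  obtain a b where ab: "w = Fract a b" "b > 0" "coprime a b" by (rule Rat_cases)
  obtain n where n: "of_int m * w\<^sup>2 = of_int n" using assms(2) by (elim Ints_cases)
  have "of_int m * (of_int a)\<^sup>2 = (of_int n * (of_int b)\<^sup>2 :: rat)"
    using n ab(2) unfolding ab(1) Fract_of_int_quotient by (simp add: field_simps)
  hence "of_int (m * a\<^sup>2) = (of_int (n * b\<^sup>2) :: rat)" by simp
  hence "m * a\<^sup>2 = n * b\<^sup>2" using of_int_eq_iff by blast
  hence "b\<^sup>2 dvd m * a\<^sup>2" by simp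
  moreover have "coprime (b\<^sup>2) (a\<^sup>2)" using ab(3) by (simp add: coprime_commute)
  ultimately have "b\<^sup>2 dvd m" by (simp add: coprime_dvd_mult_left_iff)
  hence "is_unit b" by (rule squarefreeD[OF assms(1)])
  hence "b = 1" using ab(2) by simp
  thus ?thesis using ab by (simp add: Fract_of_int_quotient)
qed

text \<open>Integrality of the norm forces \<open>2 z\<close> to be an integer because
  \<open>m0\<close> is squarefree; a half-integral \<open>z\<close> requires \<open>a^2 = m0\<close>
  modulo 4 with \<open>a\<close> odd, hence \<open>m0 mod 4 = 1\<close>.\<close>

lemma quad_lattice:
  fixes x z :: rat
  assumes m0: "squarefree m0"
  shows "(2 * x \<in> \<int> \<and> x\<^sup>2 - of_int m0 * z\<^sup>2 \<in> \<int>) \<longleftrightarrow>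
    (\<exists>u v. (x = of_int u \<and> z = of_int v) \<or> (m0 mod 4 = 1 \<and> x = of_int u + of_int v / 2 \<and> z = of_int v / 2))"
proof
  assume "2 * x \<in> \<int> \<and> x\<^sup>2 - of_int m0 * z\<^sup>2 \<in> \<int>"
  then obtain a n where a: "2 * x = of_int a" "x\<^sup>2 - of_int m0 * z\<^sup>2 = of_int n" by (auto elim!: Ints_cases)
  have e: "(of_int a)\<^sup>2 - of_int m0 * (2 * z)\<^sup>2 = (of_int (4 * n) :: rat)"
    unfolding a(1)[symmetric] using a(2) by (simp add: power_mult_distrib algebra_simps)
  have "of_int m0 * (2 * z)\<^sup>2 = (of_int (a\<^sup>2 - 4 * n) :: rat)" using e by simp
  hence "2 * z \<in> \<int>" using rat_square_int[OF m0, of "2 * z"] by (metis Ints_of_int)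
  then obtain b where b: "2 * z = of_int b" by (elim Ints_cases)
  have "(of_int (a\<^sup>2 - m0 * b\<^sup>2) :: rat) = of_int (4 * n)" using e unfolding b by simp
  hence ab: "a\<^sup>2 - m0 * b\<^sup>2 = 4 * n" using of_int_eq_iff by blast
  have x: "x = of_int a / 2" "z = of_int b / 2" using a b by simp_all
  show "\<exists>u v. (x = of_int u \<and> z = of_int v) \<or> (m0 mod 4 = 1 \<and> x = of_int u + of_int v / 2 \<and> z = of_int v / 2)"
  proof (cases "even b")
    case True
    then obtain b' where b': "b = 2 * b'" by (elim evenE)
    have "even (a\<^sup>2)" using ab b' by (metis dvd_diff_right_iff dvd_mult dvd_mult2 even_mult_iff even_numeral power2_eq_square diff_add_cancel even_add)
    then obtain a' where "a = 2 * a'" by (auto elim!: evenE)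
    thus ?thesis using x b' by auto
  next
    case False
    have m4: "m0 mod 4 \<noteq> 0"
    proof
      assume "m0 mod 4 = 0"
      hence "2\<^sup>2 dvd m0" by (simp add: mod_eq_0_iff_dvd)
      hence "is_unit (2::int)" using squarefreeD[OF m0] by blast
      thus False by simp
    qed
    have "b\<^sup>2 mod 4 = 1" using False by (simp add: square_mod_4)
    hence "(m0 * b\<^sup>2) mod 4 = m0 mod 4" by (metis mod_mult_right_eq mult.right_neutral)
    hence am: "a\<^sup>2 mod 4 = m0 mod 4" using ab by presburger
    hence "odd a" "m0 mod 4 = 1" using m4 square_mod_4[of a] by (auto split: if_splits)
    moreover from this False have "even (a - b)" by simp
    then obtain u where "a - b = 2 * u" by (elim evenE)
    hence "a = 2 * u + b" by simp
    ultimately show ?thesis using x by (intro exI[of _ u] exI[of _ b]) (simp add: field_simps)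
  qed
next
  assume "\<exists>u v. (x = of_int u \<and> z = of_int v) \<or> (m0 mod 4 = 1 \<and> x = of_int u + of_int v / 2 \<and> z = of_int v / 2)"
  then obtain u v where "(x = of_int u \<and> z = of_int v) \<or> (m0 mod 4 = 1 \<and> x = of_int u + of_int v / 2 \<and> z = of_int v / 2)" by blast
  thus "2 * x \<in> \<int> \<and> x\<^sup>2 - of_int m0 * z\<^sup>2 \<in> \<int>"
  proof
    assume "x = of_int u \<and> z = of_int v" thus ?thesis by auto
  next
    assume a: "m0 mod 4 = 1 \<and> x = of_int u + of_int v / 2 \<and> z = of_int v / 2"
    then obtain k where k: "m0 = 4 * k + 1" by (metis mult_div_mod_eq)
    have xz: "x = of_int u + of_int v / 2" "z = of_int v / 2" using a by auto
    have "x\<^sup>2 - of_int m0 * z\<^sup>2 = of_int (u\<^sup>2 + u * v - k * v\<^sup>2)"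
      unfolding k xz by (simp add: power2_eq_square field_simps)
    moreover have "2 * x = of_int (2 * u + v)" using a by simp
    ultimately show ?thesis by (metis Ints_of_int)
  qed
qed

text \<open>With \<open>std_x\<close> the coordinates of the second standard basis element:
  \<open>(1 + sqrt m0) / 2\<close> if \<open>m0 mod 4 = 1\<close>, and \<open>sqrt m0\<close>
  otherwise.\<close>

definition std_y :: "int \<Rightarrow> rat" where "std_y m0 = (if m0 mod 4 = 1 then 1/2 else 1)"
definition std_x :: "int \<Rightarrow> rat" where "std_x m0 = (if m0 mod 4 = 1 then 1/2 else 0)"

lemma quad_lattice':
  fixes x z :: rat
  assumes m0: "squarefree m0"
  shows "(2 * x \<in> \<int> \<and> x\<^sup>2 - of_int m0 * z\<^sup>2 \<in> \<int>) \<longleftrightarrow> (\<exists>u v. x = of_int u + of_int v * std_x m0 \<and> z = of_int v * std_y m0)"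
  unfolding quad_lattice[OF m0]
proof (cases "m0 mod 4 = 1")
  case True
  have "\<exists>u v. x = of_int u + of_int v / 2 \<and> z = of_int v / 2" if "x = of_int a" "z = of_int b" for a b
    using that by (intro exI[of _ "a - b"] exI[of _ "2 * b"]) simp
  thus "(\<exists>u v. (x = of_int u \<and> z = of_int v) \<or> (m0 mod 4 = 1 \<and> x = of_int u + of_int v / 2 \<and> z = of_int v / 2)) =
    (\<exists>u v. x = of_int u + of_int v * std_x m0 \<and> z = of_int v * std_y m0)"
    using True by (auto simp: std_x_def std_y_def)
qed (auto simp: std_x_def std_y_def)

text \<open>Two bases of one lattice are related by integer matrices whose determinants multiply to
  1, so each is \<open>1\<close> or \<open>-1\<close>.\<close>

lemma lattice_det:
  fixes a b c d a' b' c' d' :: rat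
  assumes 1: "\<And>x y. (\<exists>u v. x = of_int u * a + of_int v * c \<and> y = of_int u * b + of_int v * d) \<longleftrightarrow>
      (\<exists>u v. x = of_int u * a' + of_int v * c' \<and> y = of_int u * b' + of_int v * d')"
    and nz: "a' * d' - b' * c' \<noteq> 0"
  shows "(a * d - b * c)\<^sup>2 = (a' * d' - b' * c')\<^sup>2"
proof -
  obtain p q where pq: "a = of_int p * a' + of_int q * c'" "b = of_int p * b' + of_int q * d'"
    using 1[of a b] by (metis add.right_neutral mult_zero_left of_int_0 mult_1 of_int_1)
  obtain r s where rs: "c = of_int r * a' + of_int s * c'" "d = of_int r * b' + of_int s * d'"
    using 1[of c d] by (metis add.left_neutral mult_zero_left of_int_0 mult_1 of_int_1)
  obtain p' q' where pq': "a' = of_int p' * a + of_int q' * c" "b' = of_int p' * b + of_int q' * d"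
    using 1[of a' b'] by (metis add.right_neutral mult_zero_left of_int_0 mult_1 of_int_1)
  obtain r' s' where rs': "c' = of_int r' * a + of_int s' * c" "d' = of_int r' * b + of_int s' * d"
    using 1[of c' d'] by (metis add.left_neutral mult_zero_left of_int_0 mult_1 of_int_1)
  have e1: "a * d - b * c = of_int (p * s - q * r) * (a' * d' - b' * c')"
    unfolding pq rs by (simp add: algebra_simps)
  have e2: "a' * d' - b' * c' = of_int (p' * s' - q' * r') * (a * d - b * c)"
    by (subst pq'(1), subst pq'(2), subst rs'(1), subst rs'(2)) (simp add: algebra_simps)
  have "a' * d' - b' * c' = of_int ((p' * s' - q' * r') * (p * s - q * r)) * (a' * d' - b' * c')"
    using e1 e2 by (metis mult.assoc of_int_mult)
  hence "of_int ((p' * s' - q' * r') * (p * s - q * r)) = (1::rat)" using nz by simp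
  hence "(p' * s' - q' * r') * (p * s - q * r) = 1" by (metis of_int_eq_1_iff)
  hence "\<bar>p * s - q * r\<bar> = 1" by (metis zmult_eq_1_iff abs_one abs_minus_cancel)
  hence "(p * s - q * r)\<^sup>2 = 1" by (metis power2_abs power_one)
  hence "(of_int (p * s - q * r) :: rat)\<^sup>2 = 1" by (metis of_int_1 of_int_power)
  thus ?thesis unfolding e1 power_mult_distrib by simp
qed

lemma quad_disc_expr:
  assumes "\<nexists>n. m = n\<^sup>2"
  shows "(quad_elem m x1 y1 * quad_elem m x2 (- y2) - quad_elem m x2 y2 * quad_elem m x1 (- y1))\<^sup>2 =
    of_rat (4 * of_int m * (x1 * y2 - y1 * x2)\<^sup>2)"
proof -
  define X1 Y1 X2 Y2 s where "X1 = (of_rat x1 :: complex)" and "Y1 = (of_rat y1 :: complex)"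
    and "X2 = (of_rat x2 :: complex)" and "Y2 = (of_rat y2 :: complex)" and "s = csqrt (of_int m)"
  have "((X1 + Y1 * s) * (X2 + - Y2 * s) - (X2 + Y2 * s) * (X1 + - Y1 * s))\<^sup>2 = 4 * (s * s) * (X1 * Y2 - Y1 * X2)\<^sup>2"
    by (simp add: power2_eq_square algebra_simps)
  thus ?thesis unfolding X1_def X2_def Y1_def Y2_def s_def csqrt_square[OF assms]
    by (simp add: quad_elem_def of_rat_mult of_rat_diff of_rat_power of_rat_minus)
qed

text \<open>The definition of the field allows any non-square \<open>m\<close>; the square part
  \<open>s^2\<close> merely rescales the second coordinate.\<close>

lemma quad_ring_coords:
  assumes m: "\<nexists>n. m = n\<^sup>2" and ms: "m = m0 * s\<^sup>2" "s > 0" and m0: "squarefree m0"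
  shows "quad_elem m x y \<in> quad_ring_of_integers m \<longleftrightarrow>
    (\<exists>u v. x = of_int u * 1 + of_int v * std_x m0 \<and> y = of_int u * 0 + of_int v * (std_y m0 / of_int s))"
proof -
  have "quad_elem m x y \<in> quad_ring_of_integers m \<longleftrightarrow> algebraic_int (quad_elem m x y)"
    by (auto simp: quad_ring_of_integers_def)
  also have "\<dots> \<longleftrightarrow> 2 * x \<in> \<int> \<and> x\<^sup>2 - of_int m0 * (of_int s * y)\<^sup>2 \<in> \<int>"
    unfolding algebraic_int_quad_elem_iff[OF m] by (simp add: ms power_mult_distrib mult_ac)
  also have "\<dots> \<longleftrightarrow> (\<exists>u v. x = of_int u * 1 + of_int v * std_x m0 \<and> y = of_int u * 0 + of_int v * (std_y m0 / of_int s))"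
    unfolding quad_lattice'[OF m0] using ms(2) by (simp add: field_simps)
  finally show ?thesis .
qed

lemma squarefree_decomp_int: "m \<noteq> 0 \<Longrightarrow> \<exists>m0 s. m = m0 * s\<^sup>2 \<and> s > 0 \<and> squarefree (m0::int)"
proof (induction "nat \<bar>m\<bar>" arbitrary: m rule: less_induct)
  case less
  show ?case
  proof (cases "squarefree m")
    case True thus ?thesis by (intro exI[of _ m] exI[of _ 1]) simp
  next
    case False
    then obtain t where t: "t\<^sup>2 dvd m" "\<not> is_unit t" by (auto simp: squarefree_def)
    then obtain n where n: "m = t\<^sup>2 * n" by (elim dvdE)
    have n0: "n \<noteq> 0" "t \<noteq> 0" using less.prems n by auto
    have "\<bar>t\<bar> > 1" using t(2) n0 by auto
    hence "\<bar>t\<bar>\<^sup>2 > 1" by (intro one_less_power) auto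
    hence "\<bar>n\<bar> * 1 < \<bar>n\<bar> * t\<^sup>2" using n0 by (intro mult_strict_left_mono) auto
    hence "nat \<bar>n\<bar> < nat \<bar>m\<bar>" unfolding n abs_mult by (simp add: mult.commute)
    from less.hyps[OF this n0(1)] obtain m0 s where "n = m0 * s\<^sup>2" "s > 0" "squarefree m0" by blast
    thus ?thesis using n n0 by (intro exI[of _ m0] exI[of _ "s * \<bar>t\<bar>"]) (simp add: power_mult_distrib)
  qed
qed

definition field_disc :: "int \<Rightarrow> int" where "field_disc m0 = (if m0 mod 4 = 1 then m0 else 4 * m0)"

lemma quad_field_disc_iff:
  "is_quadratic_field_discriminant D \<longleftrightarrow> (\<exists>m0. squarefree m0 \<and> m0 \<noteq> 1 \<and> D = field_disc m0)"
proof
  assume "is_quadratic_field_discriminant D"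
  then obtain m x1 y1 x2 y2 where m: "\<nexists>n. m = n\<^sup>2"
    and ring: "quad_ring_of_integers m = {of_int u * quad_elem m x1 y1 + of_int v * quad_elem m x2 y2 | u v. True}"
    and D: "of_int D = (quad_elem m x1 y1 * quad_elem m x2 (- y2) - quad_elem m x2 y2 * quad_elem m x1 (- y1))\<^sup>2"
    unfolding is_quadratic_field_discriminant_def by blast
  have "m \<noteq> 0" using m by (metis zero_power2)
  then obtain m0 s where ms: "m = m0 * s\<^sup>2" "s > 0" "squarefree m0" using squarefree_decomp_int by blast
  have "(\<exists>u v. x = of_int u * x1 + of_int v * x2 \<and> y = of_int u * y1 + of_int v * y2) \<longleftrightarrow>
     (\<exists>u v. x = of_int u * 1 + of_int v * std_x m0 \<and> y = of_int u * 0 + of_int v * (std_y m0 / of_int s))" for x y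
  proof -
    have "quad_elem m x y \<in> quad_ring_of_integers m \<longleftrightarrow>
      (\<exists>u v. x = of_int u * x1 + of_int v * x2 \<and> y = of_int u * y1 + of_int v * y2)"
      unfolding ring by (simp add: quad_elem_comb[OF m] quad_elem_eq_iff[OF m])
    thus ?thesis using quad_ring_coords[OF m ms(1,2,3), of x y] by simp
  qed
  from lattice_det[OF this] have det: "(x1 * y2 - y1 * x2)\<^sup>2 = (std_y m0 / of_int s)\<^sup>2"
    using ms(2) by (simp add: std_y_def split: if_splits)
  have "of_int D = (of_rat (4 * of_int m * (std_y m0 / of_int s)\<^sup>2) :: complex)"
    unfolding D quad_disc_expr[OF m] det ..
  hence "of_int D = 4 * of_int m * (std_y m0 / of_int s)\<^sup>2" by (metis of_rat_eq_iff of_rat_of_int_eq)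
  also have "\<dots> = of_int (field_disc m0)"
    using ms(2) by (simp add: ms(1) std_y_def field_disc_def power_divide)
  finally have "D = field_disc m0" by (simp only: of_int_eq_iff)
  moreover have "m0 \<noteq> 1" using m ms(1) by auto
  ultimately show "\<exists>m0. squarefree m0 \<and> m0 \<noteq> 1 \<and> D = field_disc m0" using ms(3) by blast
next
  assume "\<exists>m0. squarefree m0 \<and> m0 \<noteq> 1 \<and> D = field_disc m0"
  then obtain m where m0: "squarefree m" "m \<noteq> 1" "D = field_disc m" by blast
  have m: "\<nexists>n. m = n\<^sup>2"
  proof
    assume "\<exists>n. m = n\<^sup>2"
    then obtain n where n: "m = n\<^sup>2" by blast
    hence "is_unit n" using m0(1) squarefreeD[of m n] by simp
    hence "\<bar>n\<bar> = 1" by simp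
    hence "m = 1" unfolding n by (metis power2_abs power_one)
    thus False using m0 by simp
  qed
  have "quad_ring_of_integers m = {of_int u * quad_elem m 1 0 + of_int v * quad_elem m (std_x m) (std_y m) | u v. True}"
  proof (intro equalityI subsetI)
    fix z assume z: "z \<in> quad_ring_of_integers m"
    then obtain x y where xy: "z = quad_elem m x y" by (auto simp: quad_ring_of_integers_def)
    from z[unfolded xy] obtain u v where "x = of_int u * 1 + of_int v * std_x m" "y = of_int u * 0 + of_int v * (std_y m / of_int 1)"
      using quad_ring_coords[OF m, of m 1 x y] m0 by auto
    hence "z = of_int u * quad_elem m 1 0 + of_int v * quad_elem m (std_x m) (std_y m)"
      unfolding quad_elem_comb[OF m] xy by simp
    thus "z \<in> {of_int u * quad_elem m 1 0 + of_int v * quad_elem m (std_x m) (std_y m) | u v. True}" by blast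
  next
    fix z assume "z \<in> {of_int u * quad_elem m 1 0 + of_int v * quad_elem m (std_x m) (std_y m) | u v. True}"
    then obtain u v where "z = quad_elem m (of_int u * 1 + of_int v * std_x m) (of_int u * 0 + of_int v * std_y m)"
      unfolding quad_elem_comb[OF m] by blast
    thus "z \<in> quad_ring_of_integers m" using quad_ring_coords[OF m, of m 1] m0 by auto
  qed
  moreover have "of_int D = (quad_elem m 1 0 * quad_elem m (std_x m) (- std_y m) - quad_elem m (std_x m) (std_y m) * quad_elem m 1 (- 0))\<^sup>2"
  proof -
    have "(of_int D :: rat) = 4 * of_int m * (1 * std_y m - 0 * std_x m)\<^sup>2"
      by (simp add: m0(3) field_disc_def std_y_def power_divide)
    hence "(of_rat (of_int D) :: complex) = of_rat (4 * of_int m * (1 * std_y m - 0 * std_x m)\<^sup>2)" by simp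
    thus ?thesis unfolding quad_disc_expr[OF m] by simp
  qed
  ultimately show "is_quadratic_field_discriminant D" unfolding is_quadratic_field_discriminant_def using m by blast
qed

text \<open>At odd primes minimality says that the square does not divide \<open>D\<close>; for even
  \<open>D\<close> minimality at 2 says that \<open>D / 4\<close> is 2 or 3 modulo 4.\<close>

lemma min_disc_iff: "min_disc D \<longleftrightarrow> D = 1 \<or> (\<exists>m0. squarefree m0 \<and> m0 \<noteq> 1 \<and> D = field_disc m0)"
proof (intro iffI; (elim disjE exE conjE)?)
  assume D: "min_disc D"
  have d4: "disc4 D" and pm: "\<And>p. prime p \<Longrightarrow> pmin p D" and D0: "D \<noteq> 0" using D by (auto simp: min_disc_def)
  have sq: "squarefree x" if "x \<noteq> 0" "\<And>p. prime p \<Longrightarrow> \<not> p\<^sup>2 dvd x" for x :: int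
    using that squarefree_factorial_semiring by blast
  show "D = 1 \<or> (\<exists>m0. squarefree m0 \<and> m0 \<noteq> 1 \<and> D = field_disc m0)"
  proof (cases "even D")
    case False
    have "\<not> p\<^sup>2 dvd D" if "prime p" for p
    proof
      assume a: "p\<^sup>2 dvd D"
      hence "odd p" using False by (auto simp: power2_eq_square dest: dvd_mult_left dvd_trans)
      thus False using pmin_odd[OF _ pm[OF that]] a by simp
    qed
    hence "squarefree D" by (intro sq D0)
    moreover have "D mod 4 = 1" using False d4 unfolding disc4_def by presburger
    ultimately show ?thesis by (auto simp: field_disc_def)
  next
    case True
    hence "D mod 4 = 0" using d4 unfolding disc4_def by presburger
    then obtain n where n: "D = 4 * n" by (auto elim: dvdE)
    have nd: "\<not> disc4 n" using pm[of 2] n by (simp add: pmin_def)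
    have "\<not> p\<^sup>2 dvd n" if p: "prime p" for p
    proof
      assume "p\<^sup>2 dvd n"
      then obtain B where B: "n = p\<^sup>2 * B" by (elim dvdE)
      have "D = p\<^sup>2 * (4 * B)" using n B by simp
      moreover have "disc4 (4 * B)" by (simp add: disc4_def)
      ultimately show False using pm[OF p] by (simp add: pmin_def)
    qed
    hence "squarefree n" using D0 n by (intro sq) auto
    thus ?thesis using nd n by (auto simp: field_disc_def disc4_def intro!: exI[of _ n])
  qed
next
  assume "D = 1"
  thus "min_disc D" by (auto simp: min_disc_def pmin_def disc4_def zmult_eq_1_iff power2_eq_square dest: not_prime_unit)
next
  fix m0 assume m0: "squarefree m0" "m0 \<noteq> 1" "D = field_disc m0"
  have np: "\<not> p\<^sup>2 dvd m0" if "prime p" for p using m0(1) that not_prime_unit squarefreeD by blast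
  have m00: "m0 \<noteq> 0" using m0(1) by auto
  show "min_disc D"
  proof (cases "m0 mod 4 = 1")
    case True
    hence "D = m0" using m0 by (simp add: field_disc_def)
    moreover have "pmin p m0" if "prime p" for p
      unfolding pmin_def using True np[OF that] by (auto simp: disc4_def)
    ultimately show ?thesis using True m00 by (auto simp: min_disc_def disc4_def)
  next
    case False
    hence D: "D = 4 * m0" using m0 by (simp add: field_disc_def)
    have m4: "m0 mod 4 \<noteq> 0"
    proof
      assume "m0 mod 4 = 0"
      hence "2\<^sup>2 dvd m0" by (simp add: mod_eq_0_iff_dvd)
      thus False using np[of 2] by simp
    qed
    have "pmin p D" if p: "prime p" for p
      unfolding pmin_def
    proof (intro conjI allI impI notI)
      show "disc4 D" using D by (simp add: disc4_def)
      fix B assume B: "D = p\<^sup>2 * B" "disc4 B"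
      show False
      proof (cases "p = 2")
        case True thus False using B D False m4 by (simp add: disc4_def)
      next
        case F: False
        hence "p > 2" using prime_ge_2_int[OF p] by simp
        hence op: "odd p" using prime_odd_int[OF p] by simp
        have "p\<^sup>2 dvd 4 * m0" using B D by simp
        moreover have "coprime (p\<^sup>2) (2 * 2)" using odd_prime_not_dvd_4[OF p op] by (simp only: coprime_mult_right_iff) (simp add: coprime_commute)
        hence "coprime (p\<^sup>2) 4" by simp
        ultimately have "p\<^sup>2 dvd m0" by (simp add: coprime_dvd_mult_right_iff)
        thus False using np[OF p] by simp
      qed
    qed
    thus ?thesis using D m00 by (auto simp: min_disc_def disc4_def)
  qed
qed

lemma fundamental_iff: "fundamental_discriminant D \<longleftrightarrow> min_disc D"
  unfolding fundamental_discriminant_def quad_field_disc_iff min_disc_iff ..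

lemma disc_decomp_eq:
  assumes "min_disc D0" "1 \<le> f" shows "disc_decomp (D0 * (int f)\<^sup>2) = (D0, f)"
  unfolding disc_decomp_def fundamental_iff
proof (rule the_equality)
  fix x assume "case x of (D0', f') \<Rightarrow> min_disc D0' \<and> 1 \<le> f' \<and> D0 * (int f)\<^sup>2 = D0' * (int f')\<^sup>2"
  moreover obtain D1 g where "x = (D1, g)" by (cases x)
  ultimately show "x = (D0, f)" using min_disc_decomp_unique[OF assms(1), of D1 f g] assms(2) by auto
qed (use assms in auto)

section \<open>The genus character\<close>

lemma prime_dvd_prod_disc_set:
  assumes S: "disc_set S" and p: "prime p" "p dvd \<Prod>S" shows "\<exists>q\<in>S. base_prime q = p"
proof -
  obtain q where "q \<in> S" "p dvd q" using S p by (auto simp: disc_set_def prime_dvd_prod_iff)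
  thus ?thesis using prime_dvd_prime_disc[of q p] S p(1) by (auto simp: disc_set_def)
qed

lemma base_prime_dvd_prod: "disc_set S \<Longrightarrow> q \<in> S \<Longrightarrow> base_prime q dvd \<Prod>S"
  using base_prime_dvd[of q] dvd_prodI[of S q "\<lambda>x. x"] by (auto simp: disc_set_def intro: dvd_trans)

text \<open>The choice hidden in \<open>SOME\<close> is harmless: by \<open>psi_form\<close> each
  \<open>psi q r\<close> equals the character of whichever of \<open>a\<close>, \<open>c\<close> is
  prime to \<open>q\<close>. If the gcd exceeds 1, some \<open>q\<close> has its prime in both and
  the product vanishes.\<close>

lemma genus_character_eq:
  assumes S: "disc_set S" and D: "disc4 D" and disc: "b\<^sup>2 - 4 * a * c = D * \<Prod>S"
  shows "genus_character (\<Prod>S) (a, b, c) = (\<Prod>q\<in>S. if base_prime q dvd a then psi q c else psi q a)"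
proof -
  have fin: "finite S" and pd: "\<And>q. q \<in> S \<Longrightarrow> prime_disc q" using S by (auto simp: disc_set_def)
  define d where "d = \<Prod>S"
  define g where "g = gcd (gcd a b) (gcd c d)"
  have d0: "d \<noteq> 0" using disc_set_prod_nz[OF S] by (simp add: d_def)
  have g0: "g > 0" using d0 by (simp add: g_def)
  show ?thesis
  proof (cases "g > 1")
    case True
    then obtain p where p: "prime p" "p dvd g" using prime_divisor_exists[of g] g0 by auto
    have pa: "p dvd a" "p dvd c" "p dvd d" using p(2) by (auto simp: g_def)
    obtain q where q: "q \<in> S" "base_prime q = p"
      using prime_dvd_prod_disc_set[OF S p(1)] pa(3) by (auto simp: d_def)
    have "(\<Prod>q\<in>S. if base_prime q dvd a then psi q c else psi q a) = 0"
      using q pa psi_eq_0_iff[of q c] by (intro prod_zero[OF fin] bexI[OF _ q(1)]) auto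
    thus ?thesis using True by (simp add: g_def d_def)
  next
    case False
    have bp: "base_prime q dvd b" if "q \<in> S" "base_prime q dvd a" for q
    proof -
      have "base_prime q dvd D * \<Prod>S" using base_prime_dvd_prod[OF S that(1)] by (rule dvd_mult)
      hence "base_prime q dvd (b\<^sup>2 - 4 * a * c) + 4 * a * c" unfolding disc using that(2) by simp
      thus ?thesis using prime_dvd_power[OF prime_base_prime[OF pd[OF that(1)]], of b 2] by simp
    qed
    have nc: "\<not> base_prime q dvd c" if "q \<in> S" "base_prime q dvd a" for q
    proof
      assume "base_prime q dvd c"
      hence "base_prime q dvd g" using that bp[OF that] base_prime_dvd_prod[OF S that(1)] by (simp add: g_def d_def)
      moreover have "g = 1" using False g0 by simp
      ultimately show False using prime_base_prime[OF pd[OF that(1)]] not_prime_unit by auto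
    qed
    let ?P = "\<lambda>r. coprime r d \<and> (\<exists>X Y. r = a * X\<^sup>2 + b * X * Y + c * Y\<^sup>2)"
    \<comment> \<open>A witness that a value prime to \<open>d\<close> exists: at primes of
      \<open>d\<close> dividing \<open>a\<close> only the term \<open>c Y^2\<close> survives, at the
      others only \<open>a X^2\<close>.\<close>
    define X where "X = (\<Prod>q\<in>{q\<in>S. base_prime q dvd a}. base_prime q)"
    define Y where "Y = (\<Prod>q\<in>{q\<in>S. \<not> base_prime q dvd a}. base_prime q)"
    have pX: "\<exists>q\<in>S. p = base_prime q \<and> base_prime q dvd a" if p: "prime p" "p dvd X" for p
    proof -
      obtain q where "q \<in> {q\<in>S. base_prime q dvd a}" "p dvd base_prime q"
        using p fin unfolding X_def by (auto simp: prime_dvd_prod_iff)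
      thus ?thesis using primes_dvd_imp_eq[OF p(1) prime_base_prime[OF pd]] by auto
    qed
    have pY: "\<exists>q\<in>S. p = base_prime q \<and> \<not> base_prime q dvd a" if p: "prime p" "p dvd Y" for p
    proof -
      obtain q where "q \<in> {q\<in>S. \<not> base_prime q dvd a}" "p dvd base_prime q"
        using p fin unfolding Y_def by (auto simp: prime_dvd_prod_iff)
      thus ?thesis using primes_dvd_imp_eq[OF p(1) prime_base_prime[OF pd]] by auto
    qed
    have "coprime (a * X\<^sup>2 + b * X * Y + c * Y\<^sup>2) d"
    proof (rule coprime_primesI)
      fix p assume p: "prime p" "p dvd a * X\<^sup>2 + b * X * Y + c * Y\<^sup>2" "p dvd d"
      obtain q where q: "q \<in> S" "base_prime q = p" using prime_dvd_prod_disc_set[OF S p(1)] p(3) by (auto simp: d_def)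
      show False
      proof (cases "p dvd a")
        case True
        have "p dvd X" unfolding X_def q(2)[symmetric] using q True fin by (intro dvd_prodI) auto
        hence "p dvd a * X\<^sup>2 + b * X * Y" by (simp add: power2_eq_square)
        hence "p dvd c * Y\<^sup>2" using p(2) by (simp only: dvd_add_right_iff)
        moreover have "\<not> p dvd c" using nc[OF q(1)] True q(2) by simp
        ultimately have "p dvd Y" using p(1) by (auto simp: prime_dvd_mult_iff dest: prime_dvd_power)
        thus False using pY[OF p(1)] True by auto
      next
        case False
        have "p dvd Y" unfolding Y_def q(2)[symmetric] using q False fin by (intro dvd_prodI) auto
        hence "p dvd b * X * Y + c * Y\<^sup>2" by (simp add: power2_eq_square)
        hence "p dvd a * X\<^sup>2" using p(2) unfolding add.assoc by (simp only: dvd_add_left_iff)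
        hence "p dvd X" using False p(1) by (auto simp: prime_dvd_mult_iff dest: prime_dvd_power)
        thus False using pX[OF p(1)] False by auto
      qed
    qed (use d0 in simp)
    hence "\<exists>r. ?P r" by blast
    hence "?P (SOME r. ?P r)" by (rule someI_ex)
    then obtain r X Y where r: "r = (SOME r. ?P r)" "coprime r d" "r = a * X\<^sup>2 + b * X * Y + c * Y\<^sup>2" by blast
    have "genus_character d (a, b, c) = kronecker d r" using False unfolding r(1) by (simp add: g_def)
    also have "\<dots> = (\<Prod>q\<in>S. psi q r)" unfolding d_def by (rule kronecker_prod[OF fin pd])
    also have "\<dots> = (\<Prod>q\<in>S. if base_prime q dvd a then psi q c else psi q a)"
    proof (intro prod.cong refl)
      fix q assume q: "q \<in> S"
      have nr: "\<not> base_prime q dvd r"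
        using r(2) base_prime_dvd_prod[OF S q] prime_base_prime[OF pd[OF q]] unfolding d_def
        by (meson coprime_common_divisor not_prime_unit)
      have E: "disc4 (\<Prod>(S - {q}) * D)" by (intro disc4_mult disc_set_split(4)[OF S q] D)
      have e1: "b\<^sup>2 - 4 * a * c = q * (\<Prod>(S - {q}) * D)" using disc disc_set_split(1)[OF S q] by (simp add: mult_ac)
      have e2: "b\<^sup>2 - 4 * c * a = q * (\<Prod>(S - {q}) * D)" using e1 by (simp add: mult_ac)
      have r2: "r = c * Y\<^sup>2 + b * Y * X + a * X\<^sup>2" using r(3) by (simp add: mult_ac)
      show "psi q r = (if base_prime q dvd a then psi q c else psi q a)"
      proof (cases "base_prime q dvd a")
        case True
        have "psi q (c * r) = 1" by (rule psi_form[OF pd[OF q] E e2 r2 nc[OF q True] nr])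
        from psi_eqI[OF this pd[OF q]] show ?thesis using True by simp
      next
        case False
        have "psi q (a * r) = 1" by (rule psi_form[OF pd[OF q] E e1 r(3) False nr])
        from psi_eqI[OF this pd[OF q]] show ?thesis using False by simp
      qed
    qed
    finally show ?thesis by (simp add: d_def)
  qed
qed

text \<open>Each \<open>psi q (-1)\<close> is \<open>sgn q\<close>, so negating all coefficients
  multiplies the character by the sign of \<open>d\<close>.\<close>

lemma genus_character_wt:
  assumes S: "disc_set S" and D: "disc4 D" and a: "a > 0" "a dvd qpol (D * \<Prod>S) x"
  shows "genus_character (\<Prod>S) (- a, - (2 * x + (D * \<Prod>S) mod 2), - (qpol (D * \<Prod>S) x div a)) =
    sgn (\<Prod>S) * wt S (D * \<Prod>S) a x"
proof -
  have fin: "finite S" and pd: "\<And>q. q \<in> S \<Longrightarrow> prime_disc q" using S by (auto simp: disc_set_def)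
  define E where "E = D * \<Prod>S"
  define c where "c = qpol E x div a"
  have qc: "qpol E x = a * c" using a(2) by (simp add: c_def E_def)
  have dE: "disc4 E" unfolding E_def by (intro disc4_mult D disc4_prod fin pd)
  have "4 * (a * c) = (2 * x + E mod 2)\<^sup>2 - E" using qpol_4[OF dE, of x] unfolding qc .
  hence "(- (2 * x + E mod 2))\<^sup>2 - 4 * (- a) * (- c) = D * \<Prod>S"
    by (simp only: power2_minus E_def)
  from genus_character_eq[OF S D this]
  have "genus_character (\<Prod>S) (- a, - (2 * x + E mod 2), - c) =
    (\<Prod>q\<in>S. if base_prime q dvd - a then psi q (- c) else psi q (- a))" .
  also have "\<dots> = (\<Prod>q\<in>S. sgn q * (if base_prime q dvd a then psi q c else psi q a))"
  proof (intro prod.cong refl)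
    fix q assume "q \<in> S"
    hence "psi q (- n) = sgn q * psi q n" for n using psi_mult[OF pd, of q "-1" n] psi_minus_one[OF pd] by simp
    thus "(if base_prime q dvd - a then psi q (- c) else psi q (- a)) = sgn q * (if base_prime q dvd a then psi q c else psi q a)"
      by simp
  qed
  also have "\<dots> = sgn (\<Prod>S) * (\<Prod>q\<in>S. if base_prime q dvd a then psi q c else psi q a)"
  proof -
    have "sgn (\<Prod>S) = (\<Prod>q\<in>S. sgn q)" using fin by (induction S rule: finite_induct) (auto simp: sgn_mult)
    thus ?thesis by (simp add: prod.distrib)
  qed
  also have "(\<Prod>q\<in>S. if base_prime q dvd a then psi q c else psi q a) = wt S E a x"
    using a(2) unfolding wt_def c_def E_def by simp
  finally show ?thesis unfolding E_def[symmetric] c_def[symmetric] .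
qed

section \<open>The integral of F\<close>

text \<open>
  A function \<open>Q = [-a, -b, -c]\<close> of discriminant \<open>\<Delta>\<close> satisfies
  \<open>Q(t) = \<Delta> / (4 a) - a u\<^sup>2\<close> with \<open>u = t + b / (2 a)\<close>.
\<close>

definition hump :: "real \<Rightarrow> nat \<Rightarrow> nat \<Rightarrow> real \<Rightarrow> real" where
  "hump \<Delta> k a u = (max 0 (\<Delta> / (4 * real a) - real a * u\<^sup>2)) ^ (k - 1)"

definition hump_mass :: "real \<Rightarrow> nat \<Rightarrow> nat \<Rightarrow> real" where
  "hump_mass \<Delta> k a = sqrt \<Delta> * \<Delta> ^ (k - 1) * Beta (real k) (real k) / real a ^ k"

lemma hump_nonneg [simp]: "hump \<Delta> k a u \<ge> 0"
  by (simp add: hump_def)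

lemma hump_continuous: "continuous_on A (hump \<Delta> k a)"
  unfolding hump_def[abs_def] by (intro continuous_intros)

lemma hump_outside:
  assumes "\<Delta> > 0" "a > 0" "k \<ge> 2" "u \<notin> {- (sqrt \<Delta> / (2 * real a))..sqrt \<Delta> / (2 * real a)}"
  shows "hump \<Delta> k a u = 0"
proof -
  have "sqrt \<Delta> / (2 * real a) \<le> \<bar>u\<bar>" using assms(4) by auto
  hence "(sqrt \<Delta> / (2 * real a))\<^sup>2 \<le> \<bar>u\<bar>\<^sup>2" using assms by (intro power_mono) auto
  hence "real a * (\<Delta> / (4 * (real a)\<^sup>2)) \<le> real a * u\<^sup>2"
    using assms by (intro mult_left_mono) (auto simp: power_divide power_mult_distrib)
  hence "\<Delta> / (4 * real a) \<le> real a * u\<^sup>2" using assms by (simp add: power2_eq_square)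
  thus ?thesis using assms(3) by (simp add: hump_def)
qed

text \<open>The support is \<open>[-R, R]\<close>. The substitution \<open>u = R (2 v - 1)\<close>
  gives \<open>(\<Delta>/a)^(k-1) (v (1 - v))^(k-1)\<close> with \<open>du = 2 R dv\<close>, a Beta
  integral.\<close>

lemma hump_integral:
  assumes D: "\<Delta> > 0" and a: "a > 0" and k: "k \<ge> 2"
    and st: "s \<le> - (sqrt \<Delta> / (2 * real a))" "sqrt \<Delta> / (2 * real a) \<le> t"
  shows "(hump \<Delta> k a has_integral hump_mass \<Delta> k a) {s..t}"
proof -
  define R where "R = sqrt \<Delta> / (2 * real a)"
  have R0: "R > 0" using D a by (simp add: R_def)
  have aR: "real a * R\<^sup>2 = \<Delta> / (4 * real a)" using D a by (simp add: R_def power_divide power2_eq_square)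
  define G where "G v = v powr (real k - 1) * (1 - v) powr (real k - 1)" for v :: real
  have "(G has_integral Beta (real k) (real k)) (cbox 0 1)"
    unfolding G_def using has_integral_Beta_real[of "real k" "real k"] k by simp
  from has_integral_affinity'[OF this, of "1 / (2 * R)" "1 / 2"] R0
  have "((\<lambda>u. G (u / (2 * R) + 1 / 2)) has_integral Beta (real k) (real k) * (2 * R)) {- R..R}"
    by (simp add: field_simps)
  hence "((\<lambda>u. (\<Delta> / real a) ^ (k - 1) * G (u / (2 * R) + 1 / 2)) has_integral
      (\<Delta> / real a) ^ (k - 1) * (Beta (real k) (real k) * (2 * R))) {- R..R}"
    by (rule has_integral_mult_right)
  also have "(\<Delta> / real a) ^ (k - 1) * (Beta (real k) (real k) * (2 * R)) = hump_mass \<Delta> k a"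
  proof -
    obtain j where j: "k = Suc j" using k by (cases k) auto
    show ?thesis using a by (simp add: hump_mass_def R_def j power_divide mult_ac)
  qed
  finally have 1: "((\<lambda>u. (\<Delta> / real a) ^ (k - 1) * G (u / (2 * R) + 1 / 2)) has_integral hump_mass \<Delta> k a) {- R..R}" .
  have "(hump \<Delta> k a has_integral hump_mass \<Delta> k a) {- R..R}"
  proof (rule has_integral_eq[OF _ 1])
    fix u assume u: "u \<in> {- R..R}"
    define v where "v = u / (2 * R) + 1 / 2"
    have v: "v \<ge> 0" "1 - v \<ge> 0" using u R0 by (auto simp: v_def field_simps)
    have pw: "w powr (real k - 1) = w ^ (k - 1)" if "w \<ge> 0" for w :: real
    proof (cases "w = 0")
      case True thus ?thesis using k by simp
    next
      case False
      have e: "real k - 1 = real (k - 1)" using k by simp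
      show ?thesis unfolding e by (rule powr_realpow) (use that False in simp)
    qed
    have uv: "u = R * (2 * v - 1)" using R0 by (simp add: v_def field_simps)
    have "\<Delta> / (4 * real a) - real a * u\<^sup>2 = (real a * R\<^sup>2) * (4 * (v * (1 - v)))"
      unfolding uv aR[symmetric] by (simp add: power2_eq_square algebra_simps)
    also have "\<dots> = \<Delta> / real a * (v * (1 - v))" unfolding aR by simp
    finally have e: "\<Delta> / (4 * real a) - real a * u\<^sup>2 = \<Delta> / real a * (v * (1 - v))" .
    have "\<Delta> / real a * (v * (1 - v)) \<ge> 0" using D v by (intro mult_nonneg_nonneg) auto
    hence "hump \<Delta> k a u = (\<Delta> / real a * (v * (1 - v))) ^ (k - 1)" unfolding hump_def e by (simp add: max_def)
    also have "\<dots> = (\<Delta> / real a) ^ (k - 1) * G v" unfolding G_def pw[OF v(1)] pw[OF v(2)] by (simp only: power_mult_distrib)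
    finally show "(\<Delta> / real a) ^ (k - 1) * G (u / (2 * R) + 1 / 2) = hump \<Delta> k a u" by (simp add: v_def)
  qed
  thus ?thesis
  proof (rule has_integral_on_superset)
    show "hump \<Delta> k a u = 0" if "u \<notin> {- R..R}" for u using hump_outside[OF D a k] that by (simp add: R_def)
  qed (use st in \<open>auto simp: R_def\<close>)
qed

definition hump_cell :: "real \<Rightarrow> nat \<Rightarrow> nat \<Rightarrow> real \<Rightarrow> real" where
  "hump_cell \<Delta> k a s = integral {0..1} (\<lambda>t. hump \<Delta> k a (t + s))"

lemma hump_cell_eq: "hump_cell \<Delta> k a s = integral {s..s + 1} (hump \<Delta> k a)"
  unfolding hump_cell_def using integral_shift_Icc_real[of 0 1 "hump \<Delta> k a" s] by (simp add: o_def add.commute)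

lemma hump_cell_nonneg: "hump_cell \<Delta> k a s \<ge> 0"
  unfolding hump_cell_eq by (intro integral_nonneg integrable_continuous_real hump_continuous) auto

lemma hump_cells_sum: "(\<Sum>i<n. hump_cell \<Delta> k a (s + real i)) = integral {s..s + real n} (hump \<Delta> k a)"
proof (induction n)
  case (Suc n)
  have "integral {s..s + real n} (hump \<Delta> k a) + integral {s + real n..s + real n + 1} (hump \<Delta> k a)
      = integral {s..s + real n + 1} (hump \<Delta> k a)"
    by (intro Henstock_Kurzweil_Integration.integral_combine integrable_continuous_real hump_continuous) auto
  thus ?case using Suc by (simp add: hump_cell_eq add_ac)
qed simp

text \<open>The translated unit intervals tile the line and only finitely many meet the support, so
  the sum is the full integral.\<close>

lemma hump_cell_has_sum:
  assumes D: "\<Delta> > 0" and a: "a > 0" and k: "k \<ge> 2"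
  shows "((\<lambda>n::int. hump_cell \<Delta> k a (s + of_int n)) has_sum hump_mass \<Delta> k a) UNIV"
proof -
  define R where "R = sqrt \<Delta> / (2 * real a)"
  define M where "M = nat \<lceil>R + \<bar>s\<bar> + 1\<rceil>"
  have M: "real M \<ge> R + \<bar>s\<bar> + 1" unfolding M_def by linarith
  show ?thesis
  proof (rule has_sum_finite_neutralI[of "(\<lambda>i. int i - int M) ` {..<2 * M}"])
    fix n :: int assume n: "n \<in> UNIV - (\<lambda>i. int i - int M) ` {..<2 * M}"
    have "n < - int M \<or> n \<ge> int M"
    proof (rule ccontr)
      assume "\<not> ?thesis"
      hence "n = int (nat (n + int M)) - int M" "nat (n + int M) < 2 * M" by auto
      thus False using n by blast
    qed
    hence "s + of_int n + 1 \<le> - R \<or> R \<le> s + of_int n"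
    proof
      assume "n < - int M"
      hence "of_int n \<le> - real M - 1" by linarith
      thus ?thesis using M by linarith
    next
      assume "n \<ge> int M"
      hence "of_int n \<ge> real M" by linarith
      thus ?thesis using M by linarith
    qed
    hence out: "hump \<Delta> k a u = 0" if "u \<in> {s + of_int n..s + of_int n + 1} - {- R, R}" for u
      using hump_outside[OF D a k, of u] that by (fastforce simp: R_def)
    \<comment> \<open>A cell outside the support may still touch its end points, which are discarded
      as a negligible set.\<close>
    have "integral {s + of_int n..s + of_int n + 1} (hump \<Delta> k a) = integral {s + of_int n..s + of_int n + 1} (\<lambda>_. 0)"
      by (rule integral_spike[of "{- R, R}"]) (use out in auto)
    thus "hump_cell \<Delta> k a (s + of_int n) = 0" by (simp add: hump_cell_eq)
  next
    have "(\<Sum>n\<in>(\<lambda>i. int i - int M) ` {..<2 * M}. hump_cell \<Delta> k a (s + of_int n)) =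
       (\<Sum>i<2 * M. hump_cell \<Delta> k a ((s - real M) + real i))"
      by (subst sum.reindex) (auto simp: inj_on_def algebra_simps)
    also have "\<dots> = integral {s - real M..s - real M + real (2 * M)} (hump \<Delta> k a)" by (rule hump_cells_sum)
    also have "\<dots> = hump_mass \<Delta> k a"
      by (intro integral_unique hump_integral D a k) (use M in \<open>auto simp: R_def\<close>)
    finally show "hump_mass \<Delta> k a = (\<Sum>n\<in>(\<lambda>i. int i - int M) ` {..<2 * M}. hump_cell \<Delta> k a (s + of_int n))" ..
  qed auto
qed

text \<open>The unfolding step: writing an integer as \<open>x + n a\<close> with
  \<open>0 \<le> x < a\<close> shifts the hump by the integer \<open>n\<close>, and the shifts of
  each class add up to the full mass.\<close>

lemma periodic_hump_has_sum:
  fixes v :: "int \<Rightarrow> real"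
  assumes D: "\<Delta> > 0" and a: "a > 0" and k: "k \<ge> 2" and per: "\<And>x. v (x + int a) = v x"
  shows "((\<lambda>x. v x * hump_cell \<Delta> k a ((of_int x + e) / real a)) has_sum (\<Sum>x\<in>{0..<int a}. v x) * hump_mass \<Delta> k a) UNIV"
proof -
  define G where "G = (\<lambda>(x, n). v x * hump_cell \<Delta> k a ((of_int x + e) / real a + of_int n))"
  have inner: "((\<lambda>n. G (x, n)) has_sum v x * hump_mass \<Delta> k a) UNIV" for x
    unfolding G_def prod.case by (intro has_sum_cmult_right hump_cell_has_sum D a k)
  have "((\<lambda>n. norm (G (x, n))) has_sum \<bar>v x\<bar> * hump_mass \<Delta> k a) UNIV" for x
    unfolding G_def prod.case norm_mult using hump_cell_nonneg
    by (auto intro!: has_sum_cmult_right hump_cell_has_sum D a k)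
  hence "(\<lambda>z. norm (G z)) summable_on ({0..<int a} \<times> UNIV)"
    by (intro summable_on_SigmaI[where g = "\<lambda>x. \<bar>v x\<bar> * hump_mass \<Delta> k a"]) auto
  hence "G summable_on ({0..<int a} \<times> UNIV)" by (rule abs_summable_summable)
  hence "(G has_sum (\<Sum>x\<in>{0..<int a}. v x * hump_mass \<Delta> k a)) ({0..<int a} \<times> UNIV)"
    by (intro has_sum_SigmaI[where g = "\<lambda>x. v x * hump_mass \<Delta> k a"] inner has_sum_finite) auto
  also have "?this \<longleftrightarrow> ((\<lambda>x. v x * hump_cell \<Delta> k a ((of_int x + e) / real a)) has_sum (\<Sum>x\<in>{0..<int a}. v x) * hump_mass \<Delta> k a) UNIV"
  proof (rule has_sum_reindex_bij_witness[of _ "\<lambda>x. (x mod int a, x div int a)" "\<lambda>(x, n). x + n * int a"])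
    fix z assume "z \<in> {0..<int a} \<times> (UNIV :: int set)"
    then obtain x n where z: "z = (x, n)" "0 \<le> x" "x < int a" by auto
    have "v (x + n * int a) = v x" by (rule periodic_cong[of v "int a", OF per]) (simp add: cong_iff_dvd_diff)
    moreover have "(of_int (x + n * int a) + e) / real a = (of_int x + e) / real a + of_int n"
      using a by (simp add: field_simps)
    ultimately show "(v (case z of (x, n) \<Rightarrow> x + n * int a)) * hump_cell \<Delta> k a ((of_int (case z of (x, n) \<Rightarrow> x + n * int a) + e) / real a) = G z"
      unfolding z(1) prod.case G_def by simp
  qed (use a in \<open>auto simp: sum_distrib_right\<close>)
  finally show ?thesis .
qed

lemma AE_summable_norm:
  fixes f :: "nat \<Rightarrow> 'a \<Rightarrow> real"
  assumes f: "\<And>i. integrable M (f i)" and s: "summable (\<lambda>i. \<integral>x. norm (f i x) \<partial>M)"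
  shows "AE x in M. summable (\<lambda>i. norm (f i x))"
proof -
  have "(\<integral>\<^sup>+x. (\<Sum>i. ennreal (norm (f i x))) \<partial>M) = (\<Sum>i. \<integral>\<^sup>+x. ennreal (norm (f i x)) \<partial>M)"
    using f by (intro nn_integral_suminf) auto
  also have "\<dots> = (\<Sum>i. ennreal (\<integral>x. norm (f i x) \<partial>M))"
    using f by (intro suminf_cong nn_integral_eq_integral) auto
  also have "\<dots> = ennreal (\<Sum>i. \<integral>x. norm (f i x) \<partial>M)"
    by (intro suminf_ennreal2 s integral_nonneg) auto
  finally have "(\<integral>\<^sup>+x. (\<Sum>i. ennreal (norm (f i x))) \<partial>M) \<noteq> \<infinity>" by simp
  hence "AE x in M. (\<Sum>i. ennreal (norm (f i x))) \<noteq> \<infinity>" using f by (intro nn_integral_PInf_AE) auto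
  thus ?thesis by (rule AE_mp) (auto intro!: AE_I2 summable_suminf_not_top)
qed

text \<open>Summability of the integrated absolute values gives absolute convergence only for almost
  every \<open>t\<close>. On the exceptional null set \<open>infsum\<close> may take its default
  value, so that set is removed by \<open>integral_spike\<close>.\<close>

lemma integral_infsum_unit:
  fixes f :: "'b \<Rightarrow> real \<Rightarrow> real"
  assumes P: "countable P" "infinite P"
    and cont: "\<And>p. p \<in> P \<Longrightarrow> continuous_on {0..1} (f p)"
    and nrm: "(\<lambda>p. integral {0..1} (\<lambda>t. \<bar>f p t\<bar>)) summable_on P"
    and hs: "((\<lambda>p. integral {0..1} (f p)) has_sum S) P"
  shows "integral {0..1} (\<lambda>t. infsum (\<lambda>p. f p t) P) = S"
proof -
  define en where "en = from_nat_into P"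
  have bij: "bij_betw en UNIV P" unfolding en_def by (rule bij_betw_from_nat_into[OF P])
  have enP: "en i \<in> P" for i using bij by (auto simp: bij_betw_def)
  let ?M = "lebesgue_on {0..1::real}"
  define g where "g i = f (en i)" for i
  have int: "integrable ?M (g i)" for i unfolding g_def by (intro continuous_imp_integrable_real cont enP)
  have inta: "integrable ?M (\<lambda>t. \<bar>g i t\<bar>)" for i using int by simp
  have eq: "integral\<^sup>L ?M (g i) = integral {0..1} (g i)" for i by (intro lebesgue_integral_eq_integral int) auto
  have eqa: "integral\<^sup>L ?M (\<lambda>t. \<bar>g i t\<bar>) = integral {0..1} (\<lambda>t. \<bar>g i t\<bar>)" for i
    by (intro lebesgue_integral_eq_integral inta) auto
  have "(\<lambda>i. integral {0..1} (\<lambda>t. \<bar>g i t\<bar>)) summable_on UNIV"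
    unfolding g_def using nrm summable_on_reindex_bij_betw[OF bij, of "\<lambda>p. integral {0..1} (\<lambda>t. \<bar>f p t\<bar>)"] by simp
  hence sm: "summable (\<lambda>i. \<integral>t. norm (g i t) \<partial>?M)" by (simp add: eqa summable_on_imp_summable)
  note ae = AE_summable_norm[OF int sm]
  have "(\<lambda>i. integral\<^sup>L ?M (g i)) sums (\<integral>t. (\<Sum>i. g i t) \<partial>?M)" by (rule sums_integral[OF int ae sm])
  moreover have "(\<lambda>i. integral\<^sup>L ?M (g i)) sums S"
    using hs has_sum_reindex_bij_betw[OF bij, of "\<lambda>p. integral {0..1} (f p)"]
    unfolding eq unfolding g_def by (intro has_sum_imp_sums) simp
  ultimately have "(\<integral>t. (\<Sum>i. g i t) \<partial>?M) = S" by (rule sums_unique2)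
  moreover have "(\<integral>t. (\<Sum>i. g i t) \<partial>?M) = integral {0..1} (\<lambda>t. \<Sum>i. g i t)"
    by (intro lebesgue_integral_eq_integral integrable_suminf[OF int ae sm]) auto
  moreover obtain N where N: "\<And>t. t \<in> space ?M - N \<Longrightarrow> summable (\<lambda>i. norm (g i t))" "N \<in> null_sets ?M"
    using AE_E3[OF ae] by blast
  have "negligible N" using N(2) by (simp add: null_sets_restrict_space negligible_iff_null_sets)
  hence "integral {0..1} (\<lambda>t. infsum (\<lambda>p. f p t) P) = integral {0..1} (\<lambda>t. \<Sum>i. g i t)"
  proof (rule integral_spike)
    fix t :: real assume "t \<in> {0..1} - N"
    hence s: "summable (\<lambda>i. norm (g i t))" by (intro N(1)) auto
    have "((\<lambda>i. g i t) has_sum (\<Sum>i. g i t)) UNIV"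
      by (rule norm_summable_imp_has_sum[OF s summable_sums[OF summable_norm_cancel[OF s]]])
    hence "((\<lambda>p. f p t) has_sum (\<Sum>i. g i t)) P"
      unfolding g_def using has_sum_reindex_bij_betw[OF bij, of "\<lambda>p. f p t"] by simp
    thus "(\<Sum>i. g i t) = infsum (\<lambda>p. f p t) P" by (simp add: infsumI)
  qed
  ultimately show ?thesis by simp
qed

lemma integral_hump_sum:
  fixes w :: "nat \<Rightarrow> int \<Rightarrow> real"
  assumes D: "\<Delta> > 0" and k: "k \<ge> 2" and per: "\<And>a x. a > 0 \<Longrightarrow> w a (x + int a) = w a x"
    and sm: "(\<lambda>a. (\<Sum>x\<in>{0..<int a}. \<bar>w a x\<bar>) / real a ^ k) summable_on {0<..}"
  shows "integral {0..1} (\<lambda>t. infsum (\<lambda>(a, x). w a x * hump \<Delta> k a (t + (of_int x + e) / real a)) ({0<..} \<times> UNIV)) =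
     sqrt \<Delta> * \<Delta> ^ (k - 1) * Beta (real k) (real k) * infsum (\<lambda>a. (\<Sum>x\<in>{0..<int a}. w a x) / real a ^ k) {0<..}"
proof -
  define C where "C = sqrt \<Delta> * \<Delta> ^ (k - 1) * Beta (real k) (real k)"
  have mass: "hump_mass \<Delta> k a = C / real a ^ k" for a by (simp add: hump_mass_def C_def)
  define P where "P = {0::nat<..} \<times> (UNIV :: int set)"
  define f where "f = (\<lambda>(a, x) t. w a x * hump \<Delta> k a (t + (of_int x + e) / real a))"
  have int: "integral {0..1} (f (a, x)) = w a x * hump_cell \<Delta> k a ((of_int x + e) / real a)" for a x
    unfolding f_def prod.case hump_cell_def by (rule integral_mult_right)
  have inta: "integral {0..1} (\<lambda>t. \<bar>f (a, x) t\<bar>) = \<bar>w a x\<bar> * hump_cell \<Delta> k a ((of_int x + e) / real a)" for a x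
    unfolding f_def prod.case hump_cell_def abs_mult by (simp del: integral_mult_right add: integral_mult_right[symmetric])
  have nrm: "(\<lambda>p. integral {0..1} (\<lambda>t. \<bar>f p t\<bar>)) summable_on P"
    unfolding P_def
  proof (rule summable_on_SigmaI[where g = "\<lambda>a. (\<Sum>x\<in>{0..<int a}. \<bar>w a x\<bar>) * hump_mass \<Delta> k a"])
    show "(\<lambda>a. (\<Sum>x\<in>{0..<int a}. \<bar>w a x\<bar>) * hump_mass \<Delta> k a) summable_on {0<..}"
      using summable_on_cmult_right[OF sm, of C] by (simp add: mass mult.commute)
    show "((\<lambda>x. integral {0..1} (\<lambda>t. \<bar>f (a, x) t\<bar>)) has_sum (\<Sum>x\<in>{0..<int a}. \<bar>w a x\<bar>) * hump_mass \<Delta> k a) UNIV"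
      if "a \<in> {0<..}" for a unfolding inta
      using that by (intro periodic_hump_has_sum D k) (auto simp: per)
  qed (auto simp: inta hump_cell_nonneg)
  have sm2: "(\<lambda>a. (\<Sum>x\<in>{0..<int a}. w a x) / real a ^ k) summable_on {0<..}"
  proof (rule abs_summable_summable, rule summable_on_comparison_test[OF sm])
    show "norm ((\<Sum>x\<in>{0..<int a}. w a x) / real a ^ k) \<le> (\<Sum>x\<in>{0..<int a}. \<bar>w a x\<bar>) / real a ^ k" for a
      by (simp add: divide_right_mono)
  qed auto
  have "(\<lambda>p. integral {0..1} (f p)) summable_on P"
  proof (rule abs_summable_summable, rule summable_on_comparison_test[OF nrm])
    show "norm (integral {0..1} (f p)) \<le> integral {0..1} (\<lambda>t. \<bar>f p t\<bar>)" for p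
      by (cases p) (simp add: int inta abs_mult hump_cell_nonneg)
  qed auto
  hence hs: "((\<lambda>p. integral {0..1} (f p)) has_sum C * infsum (\<lambda>a. (\<Sum>x\<in>{0..<int a}. w a x) / real a ^ k) {0<..}) P"
    unfolding P_def
  proof (rule has_sum_SigmaI[where g = "\<lambda>a. (\<Sum>x\<in>{0..<int a}. w a x) * hump_mass \<Delta> k a", rotated 2])
    show "((\<lambda>a. (\<Sum>x\<in>{0..<int a}. w a x) * hump_mass \<Delta> k a) has_sum
        C * infsum (\<lambda>a. (\<Sum>x\<in>{0..<int a}. w a x) / real a ^ k) {0<..}) {0<..}"
      using has_sum_cmult_right[OF has_sum_infsum[OF sm2], of C] by (simp add: mass mult.commute)
    show "((\<lambda>x. integral {0..1} (f (a, x))) has_sum (\<Sum>x\<in>{0..<int a}. w a x) * hump_mass \<Delta> k a) UNIV"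
      if "a \<in> {0<..}" for a unfolding int
      using that by (intro periodic_hump_has_sum D k) (auto simp: per)
  qed
  have "infinite P" unfolding P_def by (auto simp: finite_cartesian_product_iff)
  moreover have "countable P" by simp
  moreover have "continuous_on {0..1} (f p)" for p
    unfolding f_def case_prod_beta
    by (intro continuous_intros continuous_on_compose2[OF hump_continuous[of UNIV]]) auto
  ultimately have "integral {0..1} (\<lambda>t. infsum (\<lambda>p. f p t) P) = C * infsum (\<lambda>a. (\<Sum>x\<in>{0..<int a}. w a x) / real a ^ k) {0<..}"
    by (intro integral_infsum_unit nrm hs) auto
  moreover have "infsum (\<lambda>p. f p t) P = infsum (\<lambda>(a, x). w a x * hump \<Delta> k a (t + (of_int x + e) / real a)) ({0<..} \<times> UNIV)" for t
    unfolding P_def f_def by (intro infsum_cong) auto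
  ultimately show ?thesis by (simp add: C_def)
qed

text \<open>\<open>max 0\<close> lets the sum run over all functions with \<open>a < 0\<close>,
  since the additional terms vanish for \<open>k \<ge> 2\<close>; pairs with \<open>a\<close> not
  dividing \<open>qpol\<close> have weight 0. The index set thus becomes a product independent of
  \<open>t\<close>.\<close>

lemma F_eq_hump_sum:
  assumes S: "disc_set S" and D: "disc4 D" and pos: "D * \<Prod>S > 0" and k: "k \<ge> 2"
  shows "F k D (\<Prod>S) t = of_int (sgn (\<Prod>S)) * infsum (\<lambda>(a, x). of_int (wt S (D * \<Prod>S) (int a) x) *
     hump (of_int (D * \<Prod>S)) k a (t + (of_int x + of_int ((D * \<Prod>S) mod 2) / 2) / real a)) ({0<..} \<times> UNIV)"
proof -
  define E \<delta> where "E = D * \<Prod>S" and "\<delta> = E mod 2"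
  have fin: "finite S" and pd: "\<And>q. q \<in> S \<Longrightarrow> prime_disc q" using S by (auto simp: disc_set_def)
  have dE: "disc4 E" unfolding E_def by (intro disc4_mult D disc4_prod fin pd)
  define P where "P = {0::nat<..} \<times> (UNIV :: int set)"
  define P0 where "P0 = {(a, x). (a, x) \<in> P \<and> int a dvd qpol E x}"
  define T where "T = {Q \<in> quads E. fst Q < 0}"
  define mk where "mk = (\<lambda>(a, x). (- int a, - (2 * x + \<delta>), - (qpol E x div int a)))"
  define un where "un = (\<lambda>(A, B, C :: int). (nat (- A), (- B - \<delta>) div 2 :: int))"
  define f where "f = (\<lambda>(a, x). of_int (wt S E (int a) x) * hump (of_int E) k a (t + (of_int x + of_int \<delta> / 2) / real a))"
  have mkT: "mk p \<in> T" "un (mk p) = p" if p0: "p \<in> P0" for p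
  proof -
    obtain a x where p: "p = (a, x)" "a > 0" "int a dvd qpol E x" using p0 by (auto simp: P0_def P_def)
    define c where "c = qpol E x div int a"
    have q: "qpol E x = int a * c" using p(3) by (simp add: c_def)
    have "4 * (int a * c) = (2 * x + \<delta>)\<^sup>2 - E" using qpol_4[OF dE, of x] unfolding q \<delta>_def .
    hence "(- (2 * x + \<delta>))\<^sup>2 - 4 * (- int a) * (- c) = E" by (simp only: power2_minus)
    thus "mk p \<in> T" using p unfolding mk_def T_def quads_def c_def by simp
    show "un (mk p) = p" by (simp add: p un_def mk_def)
  qed
  have unP: "un Q \<in> P0" "mk (un Q) = Q" if Q: "Q \<in> T" for Q
  proof -
    obtain A B C where ABC: "Q = (A, B, C)" "A < 0" "B\<^sup>2 - 4 * A * C = E"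
      using Q by (cases Q) (auto simp: T_def quads_def)
    define a x where "a = nat (- A)" and "x = (- B - \<delta>) div 2"
    have a: "A = - int a" "a > 0" using ABC(2) by (auto simp: a_def)
    have "even (B\<^sup>2 - E)" using ABC(3) by (simp add: ABC(3)[symmetric])
    hence "even (- B - \<delta>)" unfolding \<delta>_def by simp
    hence B: "B = - (2 * x + \<delta>)" unfolding x_def by simp
    have "4 * qpol E x = (2 * x + \<delta>)\<^sup>2 - E" using qpol_4[OF dE, of x] by (simp add: \<delta>_def)
    also have "\<dots> = B\<^sup>2 - E" unfolding B by (simp only: power2_minus)
    also have "\<dots> = 4 * (int a * (- C))" using ABC(3) a by (simp add: algebra_simps)
    finally have q: "qpol E x = int a * (- C)" by simp
    have un: "un Q = (a, x)" by (simp add: un_def ABC(1) a_def x_def)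
    show "un Q \<in> P0" unfolding un using a q by (simp add: P0_def P_def)
    have "qpol E x div int a = - C" unfolding q by (rule nonzero_mult_div_cancel_left) (use a in simp)
    thus "mk (un Q) = Q" unfolding un using a B by (simp add: mk_def ABC(1))
  qed
  have bij: "bij_betw mk P0 T" by (rule bij_betw_byWitness[of _ un]) (use mkT unP in auto)
  have val: "of_int (genus_character (\<Prod>S) (mk p)) * (max 0 (quad_eval (mk p) t)) ^ (k - 1) = of_int (sgn (\<Prod>S)) * f p"
    if p0: "p \<in> P0" for p
  proof -
    obtain a x where p: "p = (a, x)" "a > 0" "int a dvd qpol E x" using p0 by (auto simp: P0_def P_def)
    define c where "c = qpol E x div int a"
    have q: "qpol E x = int a * c" using p(3) by (simp add: c_def)
    have g: "genus_character (\<Prod>S) (mk p) = sgn (\<Prod>S) * wt S E (int a) x"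
      using genus_character_wt[OF S D, of "int a" x] p unfolding mk_def E_def \<delta>_def by simp
    have "4 * (int a * c) = (2 * x + \<delta>)\<^sup>2 - E" using qpol_4[OF dE, of x] unfolding q \<delta>_def .
    hence "of_int (4 * (int a * c)) = (of_int ((2 * x + \<delta>)\<^sup>2 - E) :: real)" by (rule arg_cong)
    hence E: "of_int E = (2 * of_int x + of_int \<delta>)\<^sup>2 - 4 * real a * (of_int c :: real)" by simp
    have "of_int E / (4 * real a) - real a * (t + (of_int x + of_int \<delta> / 2) / real a)\<^sup>2 = quad_eval (mk p) t"
      unfolding E p(1) mk_def using p(2) by (simp add: c_def[symmetric] field_simps power2_eq_square)
    thus ?thesis unfolding g by (simp add: f_def p(1) hump_def)
  qed
  have "F k D (\<Prod>S) t = infsum (\<lambda>Q. of_int (genus_character (\<Prod>S) Q) * (max 0 (quad_eval Q t)) ^ (k - 1)) T"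
    unfolding F_def
  proof (rule infsum_cong_neutral)
    fix Q assume "Q \<in> T - {Q \<in> quads (D * \<Prod>S). fst Q < 0 \<and> 0 < quad_eval Q t}"
    hence "quad_eval Q t \<le> 0" by (auto simp: T_def E_def)
    thus "of_int (genus_character (\<Prod>S) Q) * (max 0 (quad_eval Q t)) ^ (k - 1) = 0" using k by (simp add: max_def)
  qed (auto simp: T_def E_def max_def)
  also have "\<dots> = infsum (\<lambda>p. of_int (genus_character (\<Prod>S) (mk p)) * (max 0 (quad_eval (mk p) t)) ^ (k - 1)) P0"
    by (rule infsum_reindex_bij_betw[OF bij, symmetric])
  also have "\<dots> = infsum (\<lambda>p. of_int (sgn (\<Prod>S)) * f p) P0" by (intro infsum_cong val)
  also have "\<dots> = of_int (sgn (\<Prod>S)) * infsum f P0" by (rule infsum_cmult_right')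
  also have "infsum f P0 = infsum f P"
    by (rule infsum_cong_neutral) (auto simp: P0_def f_def wt_def split: if_splits)
  finally show ?thesis unfolding f_def E_def \<delta>_def P_def .
qed

lemma integral_F:
  assumes S: "disc_set S" and D: "min_disc D0" "f > 0" and D': "\<Prod>S * D = D0 * (int f)\<^sup>2"
    and dD: "disc4 D" and pos: "D * \<Prod>S > 0" and k: "k \<ge> 2"
  shows "integral {0..1} (F k D (\<Prod>S)) = of_int (sgn (\<Prod>S)) * sqrt (of_int (D * \<Prod>S)) * of_int (D * \<Prod>S) ^ (k - 1) *
     ((fact (k - 1))\<^sup>2 / fact (2 * k - 1)) * infsum (wreal S D k) {0<..}"
proof -
  define E e where "E = D * \<Prod>S" and "e = (of_int (E mod 2) / 2 :: real)"
  have Ec: "\<Prod>S * D = E" by (simp add: E_def)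
  have bound: "real_of_int \<bar>wt S E a x\<bar> \<le> of_int (wt {} E a x)" for a x
  proof -
    have "\<bar>\<Prod>q\<in>S. if base_prime q dvd a then psi q (qpol E x div a) else psi q a\<bar> \<le> 1"
      unfolding abs_prod by (intro prod_le_1) (auto simp: psi_abs_le)
    hence "\<bar>wt S E a x\<bar> \<le> wt {} E a x" by (simp add: wt_def)
    thus ?thesis by (subst of_int_le_iff)
  qed
  have sm: "(\<lambda>a. (\<Sum>x\<in>{0..<int a}. \<bar>real_of_int (wt S E (int a) x)\<bar>) / real a ^ k) summable_on {0<..}"
  proof (rule summable_on_comparison_test[OF wreal_summable_one[OF D k]])
    fix a :: nat
    have "(\<Sum>x\<in>{0..<int a}. \<bar>real_of_int (wt S E (int a) x)\<bar>) \<le> of_int (wsum {} E (int a))"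
      unfolding wsum_def of_int_sum using bound by (intro sum_mono) simp
    thus "(\<Sum>x\<in>{0..<int a}. \<bar>real_of_int (wt S E (int a) x)\<bar>) / real a ^ k \<le> wreal {} (D0 * (int f)\<^sup>2) k a"
      unfolding wreal_def D'[symmetric] Ec[symmetric] by (simp add: divide_right_mono)
  qed (auto intro!: divide_nonneg_nonneg sum_nonneg)
  have B: "Beta (real k) (real k) = (fact (k - 1))\<^sup>2 / fact (2 * k - 1)"
  proof -
    have "Gamma (real k) = fact (k - 1)" "Gamma (real k + real k) = fact (2 * k - 1)"
      using Gamma_fact[of "k - 1", where 'a = real] Gamma_fact[of "2 * k - 1", where 'a = real] k by (simp_all add: of_nat_diff)
    thus ?thesis by (simp add: Beta_def power2_eq_square)
  qed
  have "integral {0..1} (F k D (\<Prod>S)) = integral {0..1} (\<lambda>t. of_int (sgn (\<Prod>S)) *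
      infsum (\<lambda>(a, x). of_int (wt S E (int a) x) * hump (of_int E) k a (t + (of_int x + e) / real a)) ({0<..} \<times> UNIV))"
    unfolding E_def e_def by (rule arg_cong[of _ _ "integral {0..1}"], rule ext, rule F_eq_hump_sum[OF S dD pos k])
  also have "\<dots> = of_int (sgn (\<Prod>S)) * integral {0..1} (\<lambda>t.
      infsum (\<lambda>(a, x). of_int (wt S E (int a) x) * hump (of_int E) k a (t + (of_int x + e) / real a)) ({0<..} \<times> UNIV))"
    by (rule integral_mult_right)
  also have "integral {0..1} (\<lambda>t.
      infsum (\<lambda>(a, x). of_int (wt S E (int a) x) * hump (of_int E) k a (t + (of_int x + e) / real a)) ({0<..} \<times> UNIV)) =
      sqrt (of_int E) * of_int E ^ (k - 1) * Beta (real k) (real k) *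
      infsum (\<lambda>a. (\<Sum>x\<in>{0..<int a}. of_int (wt S E (int a) x)) / real a ^ k) {0<..}"
  proof (rule integral_hump_sum)
    show "(of_int (wt S E (int a) (x + int a)) :: real) = of_int (wt S E (int a) x)" if "a > 0" for a x
      using wt_per[OF S dD, of "int a" x] that by (simp add: Ec)
    show "(0::real) < of_int E" using pos unfolding E_def[symmetric] by (simp only: of_int_0_less_iff)
  qed (use sm k in auto)
  also have "infsum (\<lambda>a. (\<Sum>x\<in>{0..<int a}. of_int (wt S E (int a) x)) / real a ^ k) {0<..} = infsum (wreal S D k) {0<..}"
    by (intro infsum_cong) (simp add: wreal_def Ec wsum_def)
  finally show ?thesis by (simp add: B E_def)
qed

section \<open>Special values and Cohen numbers\<close>

lemma Lreal_sums:
  assumes "disc_set S" "k \<ge> 2"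
  shows "(\<lambda>n. of_int (kronecker (\<Prod>S) (int (Suc n))) / real (Suc n) ^ k) sums Lreal (\<Prod>S) k"
proof -
  have "((\<lambda>n. of_int (kronecker (\<Prod>S) (int n)) / real n ^ k) has_sum Lreal (\<Prod>S) k) {0<..}"
    unfolding Lreal_def by (rule has_sum_infsum[OF abs_summable_summable[OF L_abs_summable[OF assms]]])
  moreover have "bij_betw Suc UNIV {0<..}" by (rule bij_betw_byWitness[of _ "\<lambda>n. n - 1"]) auto
  ultimately have "((\<lambda>n. of_int (kronecker (\<Prod>S) (int (Suc n))) / real (Suc n) ^ k) has_sum Lreal (\<Prod>S) k) UNIV"
    using has_sum_reindex_bij_betw[of Suc UNIV "{0<..}" "\<lambda>n. of_int (kronecker (\<Prod>S) (int n)) / real n ^ k" "Lreal (\<Prod>S) k"]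
    by simp
  thus ?thesis by (rule has_sum_imp_sums)
qed

lemma lval_kronecker:
  assumes "disc_set S" "k \<ge> 2"
  shows "lval (\<lambda>n. of_int (kronecker (\<Prod>S) (int n))) k = of_real (Lreal (\<Prod>S) k)"
proof -
  have "(\<lambda>n. of_real (of_int (kronecker (\<Prod>S) (int (Suc n))) / real (Suc n) ^ k)) sums (of_real (Lreal (\<Prod>S) k) :: complex)"
    by (rule sums_of_real[OF Lreal_sums[OF assms]])
  thus ?thesis unfolding lval_def by (simp add: sums_iff del: of_nat_Suc)
qed

text \<open>The terms from 2 on are dominated by \<open>1 / ((n + 3/2) (n + 5/2))\<close>, which
  telescopes to \<open>2/3\<close>. This gives both non-vanishing and a uniform upper bound.\<close>

lemma Lreal_bounds:
  assumes S: "disc_set S" and k: "k \<ge> 2"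
  shows "\<bar>Lreal (\<Prod>S) k - 1\<bar> \<le> 2 / 3"
proof -
  define c where "c n = of_int (kronecker (\<Prod>S) (int n)) / real n ^ k" for n
  define g where "g n = 1 / (real n + 3 / 2)" for n
  have "g \<longlonglongrightarrow> 0" unfolding g_def by real_asymp
  hence tel: "(\<lambda>n. g n - g (Suc n)) sums (g 0 - 0)" by (rule telescope_sums')
  have bnd: "norm (c (Suc (Suc n))) \<le> g n - g (Suc n)" for n
  proof -
    have "real_of_int \<bar>kronecker (\<Prod>S) (int (Suc (Suc n)))\<bar> \<le> 1"
      using kronecker_abs_le[OF S, of "int (Suc (Suc n))"] by linarith
    hence "norm (c (Suc (Suc n))) \<le> 1 / (real n + 2) ^ k"
      by (simp add: c_def divide_right_mono add.commute)
    also have "\<dots> \<le> 1 / (real n + 2) ^ 2"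
      using k by (intro divide_left_mono power_increasing) auto
    also have "\<dots> \<le> 1 / ((real n + 3 / 2) * (real n + 5 / 2))"
      by (intro divide_left_mono mult_pos_pos zero_less_power) (auto simp: power2_eq_square algebra_simps)
    also have "\<dots> = g n - g (Suc n)" by (simp add: g_def field_simps)
    finally show ?thesis .
  qed
  have "(\<lambda>n. c (Suc n)) sums Lreal (\<Prod>S) k" unfolding c_def by (rule Lreal_sums[OF S k])
  hence "(\<lambda>n. c (Suc (Suc n))) sums (Lreal (\<Prod>S) k - c 1)" by (subst sums_Suc_iff) simp
  moreover have "c 1 = 1" by (simp add: c_def kronecker_fund_one[OF S])
  ultimately have s: "Lreal (\<Prod>S) k - 1 = (\<Sum>n. c (Suc (Suc n)))" by (simp add: sums_iff)
  have "norm (\<Sum>n. c (Suc (Suc n))) \<le> (\<Sum>n. g n - g (Suc n))"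
    using bnd sums_summable[OF tel] by (rule norm_suminf_le)
  also have "\<dots> = 2 / 3" using tel by (simp add: sums_iff g_def)
  finally show ?thesis unfolding s by simp
qed

lemma Lreal_nz: "disc_set S \<Longrightarrow> k \<ge> 2 \<Longrightarrow> Lreal (\<Prod>S) k \<noteq> 0"
  using Lreal_bounds[of S k] by auto

lemma tau_square: "d \<noteq> 0 \<Longrightarrow> tau d * tau d = of_int d"
  by (cases "d > 0") (auto simp: tau_def complex_eq_iff)

text \<open>For \<open>d = 1\<close> this is \<open>zeta_functional\<close>, the sign condition
  forcing \<open>k\<close> to be even. Otherwise the Gauss sum and the parity
  \<open>kronecker d (-1) = sgn d\<close> feed the functional equation.\<close>

lemma dirichlet_L_fundamental:
  assumes S: "disc_set S" and D: "min_disc (\<Prod>S)" and k: "k \<ge> 2" and sg: "sgn (\<Prod>S) = (- 1) ^ k"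
  shows "dirichlet_L (\<Prod>S) (1 - of_nat k) =
    2 * fact (k - 1) * of_nat (nat \<bar>\<Prod>S\<bar>) ^ (k - 1) * tau (\<Prod>S) / (2 * of_real pi * \<i>) ^ k * of_real (Lreal (\<Prod>S) k)"
proof -
  define d N where "d = \<Prod>S" and "N = nat \<bar>d\<bar>"
  define chi where "chi n = (of_int (kronecker d (int n)) :: complex)" for n
  have fin: "finite S" and pd: "\<And>q. q \<in> S \<Longrightarrow> prime_disc q" using S by (auto simp: disc_set_def)
  have kr: "kronecker d n = (\<Prod>q\<in>S. psi q n)" for n unfolding d_def by (rule kronecker_prod[OF fin pd])
  have d0: "d \<noteq> 0" and d4: "disc4 d" using D by (auto simp: min_disc_def d_def)
  have lv: "lval chi k = of_real (Lreal d k)" unfolding chi_def d_def by (rule lval_kronecker[OF S k])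
  show ?thesis
  proof (cases "d = 1")
    case True
    hence "even k" using sg by (cases "even k") (auto simp: d_def)
    moreover have "chi = (\<lambda>_. 1)" by (intro ext) (simp add: chi_def True kronecker_1)
    ultimately show ?thesis unfolding d_def[symmetric] using zeta_functional[of k] k lv
      by (simp add: True dirichlet_L_def zeta_def kronecker_1 tau_def)
  next
    case False
    have "d \<noteq> -1" using d4 by (auto simp: disc4_def)
    hence ad: "\<bar>d\<bar> \<noteq> 1" using False by linarith
    hence N: "N \<ge> 2" unfolding N_def using d0 by linarith
    have iN: "int N = \<bar>d\<bar>" by (simp add: N_def)
    have cong: "kronecker d x = kronecker d y" if "[x = y] (mod d)" for x y
    proof -
      have "psi q x = psi q y" if q: "q \<in> S" for q
      proof (rule psi_cong[OF pd[OF q]])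
        have "q dvd d" unfolding d_def disc_set_split(1)[OF S q] by simp
        thus "[x = y] (mod q)" using \<open>[x = y] (mod d)\<close> by (metis cong_dvd_modulus)
      qed
      thus ?thesis by (simp add: kr)
    qed
    have dN: "d dvd int N" by (simp add: iN)
    have t0: "tau d \<noteq> 0" using d0 by (auto simp: tau_def)
    have sgd: "of_int d = ((-1) ^ k * of_nat N :: complex)"
    proof -
      have "d = sgn d * \<bar>d\<bar>" by (simp add: sgn_mult_abs)
      hence "d = (-1) ^ k * int N" unfolding iN using sg by (simp add: d_def)
      hence "of_int d = (of_int ((-1) ^ k * int N) :: complex)" by (rule arg_cong)
      thus ?thesis by simp
    qed
    have "dirichlet_continuation chi (1 - of_nat k) =
      2 * (-1) ^ k * fact (k - 1) * of_nat N ^ k / (tau d * (2 * of_real pi * \<i>) ^ k) * lval chi k"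
    proof (rule dirichlet_continuation_functional[OF N k t0])
      show "chi (n * N + m) = chi m" for n m
      proof -
        have "[int (n * N + m) = int m] (mod d)" using dN by (simp add: cong_iff_dvd_diff)
        thus ?thesis unfolding chi_def by (simp only: cong)
      qed
      show "chi 0 = 0" using ad by (simp add: chi_def kronecker_def)
      show "norm (chi n) \<le> 1" for n
      proof -
        have "real_of_int \<bar>kronecker d (int n)\<bar> \<le> 1" using kronecker_abs_le[OF S, of "int n"] unfolding d_def by linarith
        thus ?thesis by (simp add: chi_def)
      qed
      show "(\<Sum>m\<in>{1..<N}. chi m * rt N m ^ n) = chi n * tau d" for n
      proof -
        define h where "h x = of_int (\<Prod>q\<in>S. psi q x) * ee (of_int (x * int n) / of_int \<bar>d\<bar>)" for x
        have "(\<Sum>m\<in>{1..<N}. chi m * rt N m ^ n) = (\<Sum>m\<in>{1..<N}. h (int m))"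
        proof (intro sum.cong refl)
          fix m
          have "rt N m ^ n = ee (of_int (int m * int n) / of_int \<bar>d\<bar>)"
            unfolding rt_def ee_def iN[symmetric] by (simp add: exp_of_nat_mult[symmetric] mult_ac)
          thus "chi m * rt N m ^ n = h (int m)" by (simp add: chi_def h_def kr)
        qed
        also have "\<dots> = (\<Sum>x\<in>int ` {1..<N}. h x)" by (subst sum.reindex) auto
        also have "int ` {1..<N} = {1..<int N}" by (simp add: image_int_atLeastLessThan)
        also have "(\<Sum>x\<in>{1..<int N}. h x) = (\<Sum>x\<in>{0..<int N}. h x)"
        proof (rule sum.mono_neutral_left)
          have "h 0 = 0" using ad kr[of 0] by (simp add: h_def kronecker_def)
          thus "\<forall>x\<in>{0..<int N} - {1..<int N}. h x = 0"
            by (metis DiffE atLeastLessThan_iff int_one_le_iff_zero_less order_le_less)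
        qed auto
        also have "\<dots> = chi n * tau d" unfolding h_def iN d_def gauss_sum[OF S] by (simp add: chi_def kr d_def[symmetric])
        finally show ?thesis .
      qed
      show "chi (N - m) = (-1) ^ k * chi m" if "m \<in> {1..<N}" for m
      proof -
        have "[int (N - m) = - int m] (mod d)" using that dN by (simp add: cong_iff_dvd_diff of_nat_diff)
        hence "kronecker d (int (N - m)) = kronecker d (- int m)" by (rule cong)
        also have "\<dots> = (\<Prod>q\<in>S. sgn q * psi q (int m))"
          unfolding kr using psi_mult[OF pd, of _ "-1"] psi_minus_one[OF pd] by (intro prod.cong refl) simp
        also have "\<dots> = sgn d * kronecker d (int m)"
        proof -
          have "sgn d = (\<Prod>q\<in>S. sgn q)" unfolding d_def using fin by (induction S rule: finite_induct) (auto simp: sgn_mult)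
          thus ?thesis by (simp add: prod.distrib kr)
        qed
        finally show ?thesis using sg by (simp add: chi_def d_def)
      qed
    qed
    also have "2 * (-1) ^ k * fact (k - 1) * of_nat N ^ k / (tau d * (2 * of_real pi * \<i>) ^ k) =
      2 * fact (k - 1) * of_nat N ^ (k - 1) * tau d / (2 * of_real pi * \<i>) ^ k"
    proof -
      obtain j where j: "k = Suc j" using k by (cases k) auto
      \<comment> \<open>Moves \<open>tau d\<close> from the denominator to the numerator, using
        \<open>tau d * tau d = d = (-1)^k N\<close>.\<close>
      have "(-1) ^ k * of_nat N ^ k = tau d * tau d * of_nat N ^ (k - 1)"
        unfolding tau_square[OF d0] sgd by (simp add: j mult_ac)
      hence "2 * (-1) ^ k * fact (k - 1) * of_nat N ^ k = 2 * fact (k - 1) * of_nat N ^ (k - 1) * tau d * tau d"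
        by (simp add: mult_ac)
      thus ?thesis using t0 by (simp add: divide_simps)
    qed
    finally show ?thesis unfolding dirichlet_L_def d_def[symmetric] N_def[symmetric] lv chi_def[symmetric] .
  qed
qed

lemma cohen_H_eq:
  assumes D0: "min_disc D0" and f: "f \<ge> 1" and sg: "sgn D0 = (- 1) ^ k"
  shows "cohen_H k (nat \<bar>D0 * (int f)\<^sup>2\<bar>) = dirichlet_L D0 (1 - of_nat k) * of_real (cohen_sum D0 k f)"
proof -
  define D where "D = D0 * (int f)\<^sup>2"
  have nz: "D \<noteq> 0" using D0 f by (auto simp: D_def min_disc_def)
  have "sgn D = (-1) ^ k" using f sg by (simp add: D_def sgn_mult)
  hence e: "(- 1) ^ k * int (nat \<bar>D\<bar>) = D" using sgn_mult_abs[of D] by simp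
  have "disc_decomp D = (D0, f)" unfolding D_def by (rule disc_decomp_eq[OF D0 f])
  thus ?thesis unfolding D_def[symmetric] cohen_H_def e using nz by (simp add: cohen_sum_def)
qed

text \<open>The functional equations bring in \<open>(2 pi i)^(-k)\<close> twice on the left and
  \<open>(2 pi i)^(-2k)\<close> once through zeta on the right, so the powers match. The sign
  \<open>(-1)^k\<close> arises from the product of the two root numbers on one side and from
  \<open>sgn d\<close> in the integral on the other.\<close>

lemma cohen_H_product:
  assumes S: "disc_set S" and d: "min_disc (\<Prod>S)" "sgn (\<Prod>S) = (- 1) ^ k" and k: "k \<ge> 2"
    and D: "is_discriminant D" "sgn D = (- 1) ^ k"
  shows "cohen_H k (nat \<bar>\<Prod>S\<bar>) * cohen_H k (nat \<bar>D\<bar>) =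
    2 * zeta (1 - 2 * of_nat k) * of_real (integral {0..1} (F k D (\<Prod>S)))"
proof -
  have dD: "disc4 D" "D \<noteq> 0" using D by (auto simp: is_discriminant_def disc4_def)
  obtain D0 f where f: "min_disc D0" "1 \<le> f" "D = D0 * (int f)\<^sup>2" using min_disc_decomp_exists[OF dD] by blast
  obtain S0 where S0: "disc_set S0" "\<Prod>S0 = D0" using min_disc_disc_set[OF f(1)] by blast
  define d' where "d' = \<Prod>S"
  have d'0: "d' \<noteq> 0" "disc4 d'" using d(1) by (auto simp: d'_def min_disc_def)
  have D00: "D0 \<noteq> 0" using f(1) by (simp add: min_disc_def)
  have sg0: "sgn D0 = (- 1) ^ k" using D(2) f by (simp add: sgn_mult)
  have "disc4 (d' * D)" "d' * D \<noteq> 0" using d'0 dD by (auto intro: disc4_mult)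
  then obtain D1 g where g: "min_disc D1" "1 \<le> g" "d' * D = D1 * (int g)\<^sup>2" using min_disc_decomp_exists by blast
  have same: "sgn d' = sgn D" using d(2) D(2) by (simp add: d'_def)
  have pos: "D * d' > 0" using same d'0 dD by (auto simp: sgn_if zero_less_mult_iff split: if_splits)
  define n m where "n = real (nat \<bar>d'\<bar>)" and "m = real (nat \<bar>D0\<bar>)"
  define w where "w = (2 * of_real pi * \<i>) ^ k"
  define W where "W = infsum (wreal S D k) {0<..}"
  define cs where "cs = cohen_sum D0 k f"
  have f0: "real f > 0" using f(2) by simp
  have ident: "W * Lreal 1 (2 * k) * real f ^ (2 * k - 1) = Lreal d' k * Lreal D0 k * cs"
  proof -
    have "W * Lreal 1 (2 * k) = Lreal d' k * Lreal D0 k * (cs / real f ^ (2 * k - 1))"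
      using dirichlet_identity[OF S S0(1) _ _ k g(1) _, of f g] f g unfolding S0(2) f(3)[symmetric] W_def d'_def[symmetric] cs_def
      by simp
    thus ?thesis using f0 by simp
  qed
  have Ed: "D * d' = sgn D0 * sgn d' * (\<bar>D0\<bar> * \<bar>d'\<bar> * (int f)\<^sup>2)" unfolding f(3)
    by (metis (no_types, opaque_lifting) mult.assoc mult.commute mult.left_commute sgn_mult_abs)
  have "sgn D0 * sgn d' = 1" using sg0 d(2) by (simp add: d'_def power_add[symmetric])
  hence Em: "D * d' = \<bar>D0\<bar> * \<bar>d'\<bar> * (int f)\<^sup>2" using Ed by simp
  have Er: "real_of_int (D * d') = n * m * (real f)\<^sup>2" unfolding Em by (simp add: n_def m_def)
  have sq: "sqrt (real_of_int (D * d')) = sqrt (n * m) * real f" unfolding Er using f0 by (simp add: real_sqrt_mult)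
  obtain j where j: "k = Suc j" using k by (cases k) auto
  \<comment> \<open>Since the full discriminant is \<open>n m f^2\<close>, the prefactor of the
    integral supplies exactly the power \<open>f^(2k-1)\<close> by which Cohen's finite sum was
    rescaled.\<close>
  have pw: "real f * ((real f)\<^sup>2) ^ (k - 1) = real f ^ (2 * k - 1)" by (simp add: j power_mult)
  have int: "integral {0..1} (F k D (\<Prod>S)) = (-1) ^ k * sqrt (n * m) * (n * m) ^ (k - 1) *
      ((fact (k - 1))\<^sup>2 / fact (2 * k - 1)) * (W * real f ^ (2 * k - 1))"
  proof -
    have "integral {0..1} (F k D (\<Prod>S)) = of_int (sgn d') * sqrt (of_int (D * d')) * of_int (D * d') ^ (k - 1) *
       ((fact (k - 1))\<^sup>2 / fact (2 * k - 1)) * W"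
      using integral_F[OF S g(1) _ _ dD(1) _ k, of g] g pos unfolding d'_def W_def by simp
    also have "of_int (sgn d') = ((-1) ^ k :: real)" using d(2) by (simp add: d'_def)
    finally show ?thesis unfolding sq unfolding Er power_mult_distrib[of "n * m" "(real f)\<^sup>2"] pw[symmetric] by (simp only: mult_ac)
  qed
  have tt: "tau d' * tau D0 = of_real ((-1) ^ k * sqrt (n * m))"
  proof (cases "even k")
    case True
    hence "d' > 0" "D0 > 0" using d(2) sg0 by (auto simp: d'_def sgn_if split: if_splits)
    thus ?thesis using True by (simp add: tau_def n_def m_def real_sqrt_mult)
  next
    case False
    hence "d' < 0" "D0 < 0" using d(2) sg0 by (auto simp: d'_def sgn_if split: if_splits)
    hence "tau d' = \<i> * of_real (sqrt n)" "tau D0 = \<i> * of_real (sqrt m)" by (simp_all add: tau_def n_def m_def)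
    thus ?thesis using False by (simp add: real_sqrt_mult complex_eq_iff)
  qed
  have Hd: "cohen_H k (nat \<bar>d'\<bar>) = 2 * fact (k - 1) * of_real n ^ (k - 1) * tau d' / w * of_real (Lreal d' k)"
  proof -
    have "cohen_sum d' k 1 = 1"
    proof -
      have "{r::nat. r dvd 1} = {1}" by auto
      thus ?thesis by (simp add: cohen_sum_def moebius_mu_def divisor_sigma_def d'_def kronecker_fund_one[OF S])
    qed
    hence "cohen_H k (nat \<bar>d'\<bar>) = dirichlet_L d' (1 - of_nat k)"
      using cohen_H_eq[OF d(1) _ d(2), of 1] by (simp add: d'_def)
    moreover have "of_real n = (of_nat (nat \<bar>d'\<bar>) :: complex)" unfolding n_def by (rule of_real_of_nat_eq)
    ultimately show ?thesis using dirichlet_L_fundamental[OF S d(1) k d(2)] unfolding d'_def[symmetric] w_def by simp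
  qed
  have HD: "cohen_H k (nat \<bar>D\<bar>) = 2 * fact (k - 1) * of_real m ^ (k - 1) * tau D0 / w * of_real (Lreal D0 k) * of_real cs"
  proof -
    have "of_real m = (of_nat (nat \<bar>D0\<bar>) :: complex)" unfolding m_def by (rule of_real_of_nat_eq)
    thus ?thesis
      using cohen_H_eq[OF f(1,2) sg0] dirichlet_L_fundamental[OF S0(1) _ k, unfolded S0(2), OF f(1) sg0]
      unfolding f(3)[symmetric] cs_def w_def by simp
  qed
  have Z: "zeta (1 - 2 * of_nat k) = 2 * fact (2 * k - 1) / w\<^sup>2 * of_real (Lreal 1 (2 * k))"
  proof -
    have "lval (\<lambda>_. 1) (2 * k) = of_real (Lreal 1 (2 * k))"
      using lval_kronecker[OF disc_set_empty, of "2 * k"] k by (simp add: kronecker_1)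
    thus ?thesis using zeta_functional[of "2 * k"] k by (simp add: w_def power_mult mult.commute)
  qed
  have "cohen_H k (nat \<bar>d'\<bar>) * cohen_H k (nat \<bar>D\<bar>) =
     4 * (fact (k - 1))\<^sup>2 * of_real (n * m) ^ (k - 1) * (tau d' * tau D0) / w\<^sup>2 * of_real (Lreal d' k * Lreal D0 k * cs)"
    unfolding Hd HD by (simp add: power_mult_distrib power2_eq_square)
  also have "\<dots> = 2 * (2 * fact (2 * k - 1) / w\<^sup>2 * of_real (Lreal 1 (2 * k))) *
     of_real ((-1) ^ k * sqrt (n * m) * (n * m) ^ (k - 1) * ((fact (k - 1))\<^sup>2 / fact (2 * k - 1)) * (W * real f ^ (2 * k - 1)))"
    unfolding ident[symmetric] tt by (simp add: power2_eq_square)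
  finally show ?thesis unfolding Z int d'_def .
qed

lemma cohen_H_fundamental_nz:
  assumes S: "disc_set S" and d: "min_disc (\<Prod>S)" "sgn (\<Prod>S) = (- 1) ^ k" and k: "k \<ge> 2"
  shows "cohen_H k (nat \<bar>\<Prod>S\<bar>) \<noteq> 0"
proof -
  have d0: "\<Prod>S \<noteq> 0" using d(1) by (simp add: min_disc_def)
  have "{r::nat. r dvd 1} = {1}" by auto
  hence "cohen_sum (\<Prod>S) k 1 = 1" by (simp add: cohen_sum_def moebius_mu_def divisor_sigma_def kronecker_fund_one[OF S])
  hence "cohen_H k (nat \<bar>\<Prod>S\<bar>) = dirichlet_L (\<Prod>S) (1 - of_nat k)" using cohen_H_eq[OF d(1) _ d(2), of 1] by simp
  also have "\<dots> \<noteq> 0" unfolding dirichlet_L_fundamental[OF S d(1) k d(2)]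
  proof -
    have "tau (\<Prod>S) \<noteq> 0" using tau_square[OF d0] d0 by (metis mult_zero_left of_int_eq_0_iff)
    moreover have "nat \<bar>\<Prod>S\<bar> \<noteq> 0" using d0 by linarith
    ultimately show "2 * fact (k - 1) * of_nat (nat \<bar>\<Prod>S\<bar>) ^ (k - 1) * tau (\<Prod>S) / (2 * of_real pi * \<i>) ^ k *
        of_real (Lreal (\<Prod>S) k) \<noteq> (0 :: complex)"
      using Lreal_nz[OF S k] by simp
  qed
  finally show ?thesis .
qed

lemma zeta_nz: "k \<ge> 2 \<Longrightarrow> zeta (1 - 2 * of_nat k) \<noteq> 0"
proof -
  assume k: "k \<ge> 2"
  have "lval (\<lambda>_. 1) (2 * k) = of_real (Lreal (\<Prod>{}) (2 * k))"
    using lval_kronecker[OF disc_set_empty, of "2 * k"] k by (simp add: kronecker_1)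
  moreover have "Lreal (\<Prod>{}) (2 * k) \<noteq> 0" by (rule Lreal_nz[OF disc_set_empty]) (use k in simp)
  ultimately show ?thesis using zeta_functional[of "2 * k"] k by simp
qed

text \<open>Crude: at most \<open>f\<close> divisors, each contributing at most
  \<open>f^(k-1)\<close> times \<open>f^(2k)\<close>.\<close>

lemma cohen_sum_abs_le:
  assumes S: "disc_set S" and f: "f \<ge> 1" and k: "k \<ge> 2"
  shows "\<bar>cohen_sum (\<Prod>S) k f\<bar> \<le> real f ^ (3 * k)"
proof -
  have sig: "real (divisor_sigma M m) \<le> real f ^ Suc M" if "m dvd f" for m M
  proof -
    have m: "m \<le> f" "m > 0" using that f by (auto intro: dvd_imp_le Nat.gr0I)
    have "divisor_sigma M m \<le> (\<Sum>t | t dvd m. f ^ M)" unfolding divisor_sigma_def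
      using m by (intro sum_mono power_mono) (auto dest: dvd_imp_le)
    also have "\<dots> = card {t. t dvd m} * f ^ M" by simp
    also have "card {t. t dvd m} \<le> card {1..m}"
      using m by (intro card_mono) (auto dest: dvd_imp_le intro: Suc_leI Nat.gr0I)
    hence "card {t. t dvd m} * f ^ M \<le> f * f ^ M" using m by (intro mult_right_mono) auto
    finally have "real (divisor_sigma M m) \<le> real (f ^ Suc M)" by (simp only: power_Suc of_nat_le_iff)
    thus ?thesis by simp
  qed
  have "\<bar>cohen_sum (\<Prod>S) k f\<bar> \<le> (\<Sum>r | r dvd f. real f ^ (k - 1) * real f ^ (2 * k))"
    unfolding cohen_sum_def
  proof (rule order.trans[OF sum_abs sum_mono])
    fix r assume "r \<in> {r. r dvd f}"
    hence r: "r dvd f" by simp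
    have 1: "real_of_int \<bar>moebius_mu r * kronecker (\<Prod>S) (int r)\<bar> \<le> 1"
    proof -
      have "\<bar>moebius_mu r\<bar> \<le> 1" by (simp add: moebius_mu_def power_abs)
      hence "\<bar>moebius_mu r\<bar> * \<bar>kronecker (\<Prod>S) (int r)\<bar> \<le> 1 * 1"
        by (intro mult_mono kronecker_abs_le[OF S]) auto
      thus ?thesis unfolding abs_mult by linarith
    qed
    have 2: "real (r ^ (k - 1)) \<le> real f ^ (k - 1)"
      using r f by (simp add: power_mono dvd_imp_le)
    have 3: "real (divisor_sigma (2 * k - 1) (f div r)) \<le> real f ^ (2 * k)"
    proof -
      have "f div r dvd f" using r by (metis dvd_div_mult_self dvd_triv_left)
      thus ?thesis using sig[of "f div r" "2 * k - 1"] k by simp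
    qed
    have "\<bar>of_int (moebius_mu r * kronecker (\<Prod>S) (int r)) * real (r ^ (k - 1)) * real (divisor_sigma (2 * k - 1) (f div r))\<bar>
      = real_of_int \<bar>moebius_mu r * kronecker (\<Prod>S) (int r)\<bar> * real (r ^ (k - 1)) * real (divisor_sigma (2 * k - 1) (f div r))"
      by (simp add: abs_mult)
    also have "\<dots> \<le> 1 * real f ^ (k - 1) * real f ^ (2 * k)" by (intro mult_mono 1 2 3) auto
    finally show "\<bar>of_int (moebius_mu r * kronecker (\<Prod>S) (int r)) * real (r ^ (k - 1)) * real (divisor_sigma (2 * k - 1) (f div r))\<bar>
      \<le> real f ^ (k - 1) * real f ^ (2 * k)" by simp
  qed
  also have "\<dots> = real (card {r. r dvd f}) * (real f ^ (k - 1) * real f ^ (2 * k))" by simp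
  also have "card {r. r dvd f} \<le> card {1..f}"
    using f by (intro card_mono) (auto dest: dvd_imp_le intro: Suc_leI Nat.gr0I)
  hence "real (card {r. r dvd f}) * (real f ^ (k - 1) * real f ^ (2 * k)) \<le> real f * (real f ^ (k - 1) * real f ^ (2 * k))"
    by (intro mult_right_mono) auto
  also have "\<dots> = real f ^ (Suc (k - 1) + 2 * k)" by (simp add: power_add)
  also have "Suc (k - 1) + 2 * k = 3 * k" using k by simp
  finally show ?thesis .
qed

text \<open>Only polynomial growth in \<open>|D|\<close> matters, for the convergence of the
  \<open>q\<close>-series; the powers of \<open>|D0|\<close> and \<open>f\<close> are raised to a
  common exponent to be merged.\<close>

lemma cohen_H_bound:
  assumes k: "k \<ge> 2" and D: "is_discriminant D" "sgn D = (- 1) ^ k"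
  shows "norm (cohen_H k (nat \<bar>D\<bar>)) \<le> 4 * fact (k - 1) * real (nat \<bar>D\<bar>) ^ (3 * k)"
proof -
  have dD: "disc4 D" "D \<noteq> 0" using D by (auto simp: is_discriminant_def disc4_def)
  obtain D0 f where f: "min_disc D0" "1 \<le> f" "D = D0 * (int f)\<^sup>2" using min_disc_decomp_exists[OF dD] by blast
  obtain S0 where S0: "disc_set S0" "\<Prod>S0 = D0" using min_disc_disc_set[OF f(1)] by blast
  have D00: "D0 \<noteq> 0" using f(1) by (simp add: min_disc_def)
  have sg0: "sgn D0 = (- 1) ^ k" using D(2) f by (simp add: sgn_mult)
  define m where "m = real (nat \<bar>D0\<bar>)"
  have m1: "m \<ge> 1" using D00 by (simp add: m_def)
  have tau: "norm (tau D0) \<le> m"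
  proof -
    have "norm (tau D0) = sqrt m" by (simp add: tau_def m_def norm_mult)
    also have "\<dots> \<le> m" using m1 by (intro real_le_lsqrt) (auto simp: power2_eq_square)
    finally show ?thesis .
  qed
  have L: "\<bar>Lreal D0 k\<bar> \<le> 2" using Lreal_bounds[OF S0(1) k] unfolding S0(2) by linarith
  have "norm ((2 * of_real pi * \<i>) ^ k :: complex) = (2 * pi) ^ k" by (simp add: norm_power norm_mult)
  also have "\<dots> \<ge> 1" using pi_gt3 by (intro one_le_power) simp
  finally have w: "norm ((2 * of_real pi * \<i>) ^ k :: complex) \<ge> 1" .
  obtain j where j: "k = Suc j" using k by (cases k) auto
  have "norm (dirichlet_L D0 (1 - of_nat k)) = 2 * fact (k - 1) * m ^ (k - 1) * norm (tau D0) / norm ((2 * of_real pi * \<i>) ^ k :: complex) * \<bar>Lreal D0 k\<bar>"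
    using dirichlet_L_fundamental[OF S0(1) _ k, unfolded S0(2), OF f(1) sg0]
    by (simp add: norm_mult norm_divide norm_power m_def)
  also have "\<dots> \<le> 2 * fact (k - 1) * m ^ (k - 1) * m / 1 * 2"
    using w tau L m1 by (intro mult_mono frac_le) auto
  also have "\<dots> = 4 * fact (k - 1) * m ^ k" by (simp add: j)
  also have "\<dots> \<le> 4 * fact (k - 1) * m ^ (3 * k)"
    using m1 by (intro mult_left_mono power_increasing) auto
  finally have A: "norm (dirichlet_L D0 (1 - of_nat k)) \<le> 4 * fact (k - 1) * m ^ (3 * k)" .
  have "norm (cohen_H k (nat \<bar>D\<bar>)) = norm (dirichlet_L D0 (1 - of_nat k)) * \<bar>cohen_sum D0 k f\<bar>"
    using cohen_H_eq[OF f(1,2) sg0] by (simp add: f(3) norm_mult)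
  also have "\<dots> \<le> (4 * fact (k - 1) * m ^ (3 * k)) * real f ^ (3 * k)"
    using A cohen_sum_abs_le[OF S0(1) f(2) k] m1 unfolding S0(2) by (intro mult_mono) auto
  also have "\<dots> = 4 * fact (k - 1) * (m * real f) ^ (3 * k)" by (simp add: power_mult_distrib)
  also have "\<dots> \<le> 4 * fact (k - 1) * real (nat \<bar>D\<bar>) ^ (3 * k)"
  proof (intro mult_left_mono power_mono)
    have "m * real f * 1 \<le> m * real f * real f" using f(2) m1 by (intro mult_left_mono) auto
    also have "\<dots> = real (nat \<bar>D\<bar>)" by (simp add: m_def f(3) abs_mult power2_eq_square)
    finally show "m * real f \<le> real (nat \<bar>D\<bar>)" by simp
  qed (use m1 in auto)
  finally show ?thesis .
qed

lemma summable_power_times_geometric: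
  fixes r :: real assumes "0 \<le> r" "r < 1" shows "summable (\<lambda>n. real n ^ m * r ^ n)"
  using assms
proof (induction m arbitrary: r)
  case 0 thus ?case by (simp add: summable_geometric)
next
  case (Suc m)
  define s where "s = (1 + r) / 2"
  have s: "0 \<le> s" "s < 1" "r < s" using Suc.prems by (auto simp: s_def)
  have "summable (\<lambda>n. diffs (\<lambda>n. real n ^ m) n * r ^ n)"
  proof (rule termdiff_converges[of _ s])
    show "norm r < s" using s Suc.prems by simp
    fix x :: real assume x: "norm x < s"
    have "summable (\<lambda>n. real n ^ m * \<bar>x\<bar> ^ n)" by (rule Suc.IH) (use x s in auto)
    thus "summable (\<lambda>n. real n ^ m * x ^ n)" by - (rule summable_norm_cancel, simp add: abs_mult power_abs)
  qed
  hence "summable (\<lambda>n. r * (diffs (\<lambda>n. real n ^ m) n * r ^ n))" by (rule summable_mult)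
  hence "summable (\<lambda>n. real (Suc n) ^ Suc m * r ^ Suc n)" by (simp add: diffs_def mult_ac)
  thus ?case by (subst (asm) summable_Suc_iff)
qed

lemma norm_nome: "norm (nome \<tau>) = exp (- 2 * pi * Im \<tau>)"
  by (simp add: nome_def norm_exp_eq_Re)

lemma sgn_disc: "D \<in> discs_of_sign k \<longleftrightarrow> is_discriminant D \<and> sgn D = (- 1) ^ k"
  by (cases "even k") (auto simp: discs_of_sign_def sgn_if is_discriminant_def)

lemma cohen_series_summable:
  assumes k: "k \<ge> 2" and \<tau>: "Im \<tau> > 0"
  shows "(\<lambda>D. cohen_H k (nat \<bar>D\<bar>) * nome \<tau> ^ nat \<bar>D\<bar>) summable_on discs_of_sign k"
proof (rule abs_summable_summable, rule summable_on_comparison_test)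
  define r where "r = norm (nome \<tau>)"
  have r: "0 \<le> r" "r < 1" using \<tau> by (auto simp: r_def norm_nome)
  have inj: "inj_on (\<lambda>D. nat \<bar>D\<bar>) (discs_of_sign k)"
  proof (rule inj_onI)
    fix D E assume a: "D \<in> discs_of_sign k" "E \<in> discs_of_sign k" "nat \<bar>D\<bar> = nat \<bar>E\<bar>"
    have h: "\<bar>D\<bar> = \<bar>E\<bar>" "sgn D = sgn E" using a by (simp_all add: sgn_disc)
    have "D = sgn D * \<bar>D\<bar>" by (rule sgn_mult_abs[symmetric])
    also have "\<dots> = sgn E * \<bar>E\<bar>" by (simp only: h)
    also have "\<dots> = E" by (rule sgn_mult_abs)
    finally show "D = E" .
  qed
  have "(\<lambda>n. real n ^ (3 * k) * r ^ n) summable_on UNIV"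
    using summable_power_times_geometric[OF r, of "3 * k"] r by (intro norm_summable_imp_summable_on) simp
  hence "(\<lambda>n. real n ^ (3 * k) * r ^ n) summable_on (\<lambda>D. nat \<bar>D\<bar>) ` discs_of_sign k"
    by (rule summable_on_subset_banach) simp
  hence "(\<lambda>D. real (nat \<bar>D\<bar>) ^ (3 * k) * r ^ nat \<bar>D\<bar>) summable_on discs_of_sign k"
    by (subst (asm) summable_on_reindex[OF inj]) (simp add: o_def)
  thus "(\<lambda>D. 4 * fact (k - 1) * (real (nat \<bar>D\<bar>) ^ (3 * k) * r ^ nat \<bar>D\<bar>)) summable_on discs_of_sign k"
    by (rule summable_on_cmult_right)
  show "norm (cohen_H k (nat \<bar>D\<bar>) * nome \<tau> ^ nat \<bar>D\<bar>) \<le> 4 * fact (k - 1) * (real (nat \<bar>D\<bar>) ^ (3 * k) * r ^ nat \<bar>D\<bar>)"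
    if "D \<in> discs_of_sign k" for D
    using mult_right_mono[OF cohen_H_bound[OF k, of D], of "r ^ nat \<bar>D\<bar>"] that r
    by (simp add: sgn_disc norm_mult norm_power r_def mult_ac)
qed auto

theorem theorem1:
  fixes k :: nat and d :: int and \<tau> :: complex
  assumes "k > 1"
    and "fundamental_discriminant d"
    and "sgn d = (- 1) ^ k"
    and "Im \<tau> > 0"
  shows "(\<lambda>D. of_real (integral {0..1} (F k D d)) * nome \<tau> ^ nat \<bar>D\<bar>) summable_on discs_of_sign k \<and>
         (\<lambda>D. cohen_H k (nat \<bar>D\<bar>) * nome \<tau> ^ nat \<bar>D\<bar>) summable_on discs_of_sign k \<and>
         zeta (1 - 2 * of_nat k) / cohen_H k (nat \<bar>d\<bar>) *
           (1 / 2 * cohen_H k (nat \<bar>d\<bar>) +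
            (\<Sum>\<^sub>\<infinity>D\<in>discs_of_sign k.
               of_real (integral {0..1} (F k D d)) * nome \<tau> ^ nat \<bar>D\<bar>))
         = 1 / 2 * cohen_eisenstein k \<tau>"
proof -
  have k: "k \<ge> 2" using assms(1) by simp
  have d: "min_disc d" using assms(2) by (simp add: fundamental_iff)
  then obtain S where S: "disc_set S" "\<Prod>S = d" using min_disc_disc_set by blast
  define Z H where "Z = zeta (1 - 2 * of_nat k)" and "H = cohen_H k (nat \<bar>d\<bar>)"
  have Z0: "Z \<noteq> 0" unfolding Z_def by (rule zeta_nz[OF k])
  have H0: "H \<noteq> 0" unfolding H_def
    using cohen_H_fundamental_nz[OF S(1), unfolded S(2), OF d assms(3) k] .
  note sm = cohen_series_summable[OF k assms(4)]
  \<comment> \<open>The integrals are Cohen's numbers times the constant \<open>H / (2 Z)\<close>,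
    so both series converge together and the claim becomes a rescaling of one series.\<close>
  have int: "of_real (integral {0..1} (F k D d)) = H / (2 * Z) * cohen_H k (nat \<bar>D\<bar>)" if "D \<in> discs_of_sign k" for D
  proof -
    have "H * cohen_H k (nat \<bar>D\<bar>) = 2 * Z * of_real (integral {0..1} (F k D d))"
      using cohen_H_product[OF S(1), unfolded S(2), OF d assms(3) k] that by (simp add: sgn_disc H_def Z_def)
    thus ?thesis using Z0 by (simp add: field_simps)
  qed
  have "(\<lambda>D. H / (2 * Z) * (cohen_H k (nat \<bar>D\<bar>) * nome \<tau> ^ nat \<bar>D\<bar>)) summable_on discs_of_sign k"
    by (rule summable_on_cmult_right[OF sm])
  also have "?this \<longleftrightarrow> (\<lambda>D. of_real (integral {0..1} (F k D d)) * nome \<tau> ^ nat \<bar>D\<bar>) summable_on discs_of_sign k"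
    by (intro summable_on_cong) (simp add: int)
  finally have sF: "(\<lambda>D. of_real (integral {0..1} (F k D d)) * nome \<tau> ^ nat \<bar>D\<bar>) summable_on discs_of_sign k" .
  define A where "A = (\<Sum>\<^sub>\<infinity>D\<in>discs_of_sign k. cohen_H k (nat \<bar>D\<bar>) * nome \<tau> ^ nat \<bar>D\<bar>)"
  have "(\<Sum>\<^sub>\<infinity>D\<in>discs_of_sign k. of_real (integral {0..1} (F k D d)) * nome \<tau> ^ nat \<bar>D\<bar>) =
      (\<Sum>\<^sub>\<infinity>D\<in>discs_of_sign k. H / (2 * Z) * (cohen_H k (nat \<bar>D\<bar>) * nome \<tau> ^ nat \<bar>D\<bar>))"
    by (intro infsum_cong) (simp add: int)
  also have "\<dots> = H / (2 * Z) * A" unfolding A_def by (rule infsum_cmult_right')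
  finally have e: "(\<Sum>\<^sub>\<infinity>D\<in>discs_of_sign k. of_real (integral {0..1} (F k D d)) * nome \<tau> ^ nat \<bar>D\<bar>) = H / (2 * Z) * A" .
  have "Z / H * (1 / 2 * H + H / (2 * Z) * A) = 1 / 2 * (Z + A)"
    using Z0 H0 by (simp add: field_simps)
  thus ?thesis using sF sm unfolding e cohen_eisenstein_def A_def[symmetric] Z_def[symmetric] H_def[symmetric] by blast
qed

end
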